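(* Assume the $H^2$ regularity property holds for the model problem and that $a_{ij}$ ($i,j=1,2$) and $c$ are uniformly piecewise continuous in $\Omega$ with respect to $\mathcal T_h$. Then there is a fixed $h_0>0$ such that for meshsize $h<h_0$ the primal-dual discontinuous Galerkin scheme: find $(u_h;\lambda_h)\in X_h\times M_h$ with $$s_h(u_h,v)+b_h(v,\lambda_h)=0\ \ \forall v\in X_h,\qquad b_h(u_h,q)=(f,q)\ \ \forall q\in M_h,$$ has a unique solution, and there is a constant $C$ such that $\|u_h\|_*+\|\lambda_h\|\le C\|f\|$, where $\|\cdot\|$ is the $L^2(\Omega)$ norm.
   Context: Let $\Omega\subset\mathbb R^2$ be an open bounded domain with Lipschitz boundary. The tensor $a=\{a_{ij}\}_{2\times2}$ is symmetric positive definite and uniformly bounded on $\Omega$; $c$ is non-positive and uniformly bounded; $f\in L^2(\Omega)$. Model problem: $\sum_{i,j=1}^2 a_{ij}\partial^2_{ij}u+cu=f$ in $\Omega$, $u=0$ on $\partial\Omega$. $H^2$ regularity property: for every right-hand side in $L^2(\Omega)$ there is a unique strong solution $u\in H^2(\Omega)\cap H^1_0(\Omega)$ with $\|u\|_{H^2}\le C\|f\|_{L^2}$. $\mathcal T_h$ is a shape-regular polygonal partition of $\Omega$, $h_T=\operatorname{diam}T$, $h=\max_Th_T$, $\mathcal E_h$ all edges, $\mathcal E_h^0$ interior edges. Uniform piecewise continuity w.r.t. $\mathcal T_h$: for every $\varepsilon>0$ there is $h_0$ with $\|a_{ij}-\bar a_{ij}\|_{L^\infty}\le\varepsilon$, $\|c-\bar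 c\|_{L^\infty}\le\varepsilon$ for $h\le h_0$, bars denoting elementwise averages. For an integer $k\ge2$, $X_h$ (resp. $M_h$) consists of functions that are polynomials of degree $\le k$ (resp. $\le k-2$) on each $T$. $Q_{k-2}$ is the $L^2$ projection onto $M_h$. Jumps: $[\![v]\!]=v|_{T_1}-v|_{T_2}$ on an interior edge $e=\partial T_1\cap\partial T_2$, $[\![v]\!]=v$ on a boundary edge; $[\![\nabla v]\!]$ analogously on interior edges. $s_h(u,v)=\sum_{e\in\mathcal E_h}h_T^{-3}\langle[\![u]\!],[\![v]\!]\rangle_e+\sum_{e\in\mathcal E_h^0}h_T^{-1}\langle[\![\nabla u]\!],[\![\nabla v]\!]\rangle_e$ ($h_T$ the diameter of an element containing $e$). $b_h(v,q)=\sum_{T}\big(\sum_{i,j}a_{ij}\partial^2_{ij}v+cv,q\big)_T$. $\|v\|_*=\big(\sum_{T}\|Q_{k-2}(\sum_{i,j}a_{ij}\partial^2_{ij}v+cv)\|_T^2+s_h(v,v)\big)^{1/2}$. *)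

theory Defs
  imports "HOL-Analysis.Analysis"
begin

type_synonym pt = "real^2"

definition pd :: "2 \<Rightarrow> (pt \<Rightarrow> real) \<Rightarrow> pt \<Rightarrow> real" where
  "pd i u x = deriv (\<lambda>t. u (x + t *\<^sub>R axis i 1)) 0"

fun iter_pd :: "2 list \<Rightarrow> (pt \<Rightarrow> real) \<Rightarrow> pt \<Rightarrow> real" where
  "iter_pd [] u = u"
| "iter_pd (i # is) u = pd i (iter_pd is u)"

definition smooth2 :: "(pt \<Rightarrow> real) \<Rightarrow> bool" where
  "smooth2 \<phi> \<longleftrightarrow> (\<forall>is. continuous_on UNIV (iter_pd is \<phi>) \<and>
      (\<forall>i x. (\<lambda>t. iter_pd is \<phi> (x + t *\<^sub>R axis i 1)) differentiable (at 0)))"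

definition test_fun :: "pt set \<Rightarrow> (pt \<Rightarrow> real) \<Rightarrow> bool" where
  "test_fun \<Omega> \<phi> \<longleftrightarrow> smooth2 \<phi> \<and> compact (closure {x. \<phi> x \<noteq> 0})
      \<and> closure {x. \<phi> x \<noteq> 0} \<subseteq> \<Omega>"

definition L2_on :: "pt set \<Rightarrow> (pt \<Rightarrow> real) \<Rightarrow> bool" where
  "L2_on \<Omega> u \<longleftrightarrow> set_borel_measurable lborel \<Omega> u \<and> set_integrable lborel \<Omega> (\<lambda>x. (u x)\<^sup>2)"

definition L2_norm_on :: "pt set \<Rightarrow> (pt \<Rightarrow> real) \<Rightarrow> real" where
  "L2_norm_on \<Omega> u = sqrt (LINT x:\<Omega>|lborel. (u x)\<^sup>2)"

definition weak_pd :: "pt set \<Rightarrow> 2 \<Rightarrow> (pt \<Rightarrow> real) \<Rightarrow> (pt \<Rightarrow> real) \<Rightarrow> bool" where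
  "weak_pd \<Omega> i u g \<longleftrightarrow> (\<forall>\<phi>. test_fun \<Omega> \<phi> \<longrightarrow>
      (LINT x:\<Omega>|lborel. u x * pd i \<phi> x) = - (LINT x:\<Omega>|lborel. g x * \<phi> x))"

definition H2_with :: "pt set \<Rightarrow> (pt \<Rightarrow> real) \<Rightarrow> (2 \<Rightarrow> pt \<Rightarrow> real)
      \<Rightarrow> (2 \<Rightarrow> 2 \<Rightarrow> pt \<Rightarrow> real) \<Rightarrow> bool" where
  "H2_with \<Omega> u D1 D2 \<longleftrightarrow> L2_on \<Omega> u \<and>
     (\<forall>i. L2_on \<Omega> (D1 i) \<and> weak_pd \<Omega> i u (D1 i)) \<and>
     (\<forall>i j. L2_on \<Omega> (D2 i j) \<and> weak_pd \<Omega> i (D1 j) (D2 i j))"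

definition H2_norm :: "pt set \<Rightarrow> (pt \<Rightarrow> real) \<Rightarrow> (2 \<Rightarrow> pt \<Rightarrow> real)
      \<Rightarrow> (2 \<Rightarrow> 2 \<Rightarrow> pt \<Rightarrow> real) \<Rightarrow> real" where
  "H2_norm \<Omega> u D1 D2 = sqrt ((LINT x:\<Omega>|lborel. (u x)\<^sup>2)
      + (\<Sum>i\<in>UNIV. LINT x:\<Omega>|lborel. (D1 i x)\<^sup>2)
      + (\<Sum>i\<in>UNIV. \<Sum>j\<in>UNIV. LINT x:\<Omega>|lborel. (D2 i j x)\<^sup>2))"

definition H10_with :: "pt set \<Rightarrow> (pt \<Rightarrow> real) \<Rightarrow> (2 \<Rightarrow> pt \<Rightarrow> real) \<Rightarrow> bool" where
  "H10_with \<Omega> u D1 \<longleftrightarrow> (\<exists>\<phi> :: nat \<Rightarrow> pt \<Rightarrow> real. (\<forall>n. test_fun \<Omega> (\<phi> n)) \<and>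
      (\<lambda>n. LINT x:\<Omega>|lborel. (\<phi> n x - u x)\<^sup>2) \<longlonglongrightarrow> 0 \<and>
      (\<forall>i. (\<lambda>n. LINT x:\<Omega>|lborel. (pd i (\<phi> n) x - D1 i x)\<^sup>2) \<longlonglongrightarrow> 0))"

definition strong_sol :: "pt set \<Rightarrow> (pt \<Rightarrow> real^2^2) \<Rightarrow> (pt \<Rightarrow> real) \<Rightarrow> (pt \<Rightarrow> real)
      \<Rightarrow> (pt \<Rightarrow> real) \<Rightarrow> (2 \<Rightarrow> pt \<Rightarrow> real) \<Rightarrow> (2 \<Rightarrow> 2 \<Rightarrow> pt \<Rightarrow> real) \<Rightarrow> bool" where
  "strong_sol \<Omega> a c g u D1 D2 \<longleftrightarrow> H2_with \<Omega> u D1 D2 \<and> H10_with \<Omega> u D1 \<and>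
     (AE x in lborel. x \<in> \<Omega> \<longrightarrow>
        (\<Sum>i\<in>UNIV. \<Sum>j\<in>UNIV. a x $ i $ j * D2 i j x) + c x * u x = g x)"

definition H2_regularity :: "pt set \<Rightarrow> (pt \<Rightarrow> real^2^2) \<Rightarrow> (pt \<Rightarrow> real) \<Rightarrow> bool" where
  "H2_regularity \<Omega> a c \<longleftrightarrow> (\<exists>C. \<forall>g. L2_on \<Omega> g \<longrightarrow>
      (\<exists>u D1 D2. strong_sol \<Omega> a c g u D1 D2 \<and> H2_norm \<Omega> u D1 D2 \<le> C * L2_norm_on \<Omega> g) \<and>
      (\<forall>u D1 D2 v E1 E2. strong_sol \<Omega> a c g u D1 D2 \<longrightarrow> strong_sol \<Omega> a c g v E1 E2 \<longrightarrow>
          (AE x in lborel. x \<in> \<Omega> \<longrightarrow> u x = v x)))"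

definition lipschitz_domain :: "pt set \<Rightarrow> bool" where
  "lipschitz_domain \<Omega> \<longleftrightarrow> open \<Omega> \<and> bounded \<Omega> \<and> \<Omega> \<noteq> {} \<and>
    (\<forall>p\<in>frontier \<Omega>. \<exists>r>0. \<exists>Q :: pt \<Rightarrow> pt. orthogonal_transformation Q \<and>
       (\<exists>g :: real \<Rightarrow> real. (\<exists>L. \<forall>s t. \<bar>g s - g t\<bar> \<le> L * \<bar>s - t\<bar>) \<and>
          \<Omega> \<inter> ball p r = {x \<in> ball p r. Q (x - p) $ 2 < g (Q (x - p) $ 1)}))"

text \<open>A mesh is a pair (elements, edges); an edge is given by its two endpoints.\<close>
type_synonym mesh = "pt set set \<times> (pt \<times> pt) set"

definition eseg :: "pt \<times> pt \<Rightarrow> pt set" where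
  "eseg e = closed_segment (fst e) (snd e)"

definition adj :: "mesh \<Rightarrow> pt \<times> pt \<Rightarrow> pt set set" where
  "adj M e = {T \<in> fst M. eseg e \<subseteq> frontier T}"

definition bdry_edge :: "pt set \<Rightarrow> pt \<times> pt \<Rightarrow> bool" where
  "bdry_edge \<Omega> e \<longleftrightarrow> eseg e \<subseteq> frontier \<Omega>"

definition int_edges :: "pt set \<Rightarrow> mesh \<Rightarrow> (pt \<times> pt) set" where
  "int_edges \<Omega> M = {e \<in> snd M. \<not> bdry_edge \<Omega> e}"

definition poly_mesh :: "pt set \<Rightarrow> mesh \<Rightarrow> bool" where
  "poly_mesh \<Omega> M \<longleftrightarrow> finite (fst M) \<and> finite (snd M) \<and> fst M \<noteq> {} \<and>
    (\<forall>T\<in>fst M. open T \<and> bounded T \<and> T \<noteq> {} \<and> T \<subseteq> \<Omega> \<and>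
        frontier T = \<Union>{eseg e | e. e \<in> snd M \<and> eseg e \<subseteq> frontier T}) \<and>
    (\<forall>T1\<in>fst M. \<forall>T2\<in>fst M. T1 \<noteq> T2 \<longrightarrow> T1 \<inter> T2 = {}) \<and>
    \<Omega> \<subseteq> \<Union>(closure ` fst M) \<and>
    (\<forall>e\<in>snd M. fst e \<noteq> snd e \<and>
        ((bdry_edge \<Omega> e \<and> card (adj M e) = 1) \<or>
         (open_segment (fst e) (snd e) \<subseteq> \<Omega> \<and> card (adj M e) = 2))) \<and>
    (\<forall>e1\<in>snd M. \<forall>e2\<in>snd M. e1 \<noteq> e2 \<longrightarrow> eseg e1 \<inter> eseg e2 \<subseteq> {fst e1, snd e1})"

definition meshsize :: "mesh \<Rightarrow> real" where
  "meshsize M = Max (diameter ` fst M)"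

definition shape_regular :: "real \<Rightarrow> mesh \<Rightarrow> bool" where
  "shape_regular \<rho> M \<longleftrightarrow> (\<forall>T\<in>fst M.
      (\<exists>x0. ball x0 (\<rho> * diameter T) \<subseteq> T \<and>
          (\<forall>y\<in>ball x0 (\<rho> * diameter T). \<forall>z\<in>T. closed_segment y z \<subseteq> T)) \<and>
      (\<forall>e\<in>snd M. eseg e \<subseteq> frontier T \<longrightarrow> dist (fst e) (snd e) \<ge> \<rho> * diameter T))"

definition pw_avg :: "mesh \<Rightarrow> (pt \<Rightarrow> real) \<Rightarrow> pt \<Rightarrow> real" where
  "pw_avg M g x = (\<Sum>T\<in>fst M. indicator T x * ((LINT y:T|lborel. g y) / measure lborel T))"

definition unif_pw_continuous :: "pt set \<Rightarrow> mesh set \<Rightarrow> (pt \<Rightarrow> real) \<Rightarrow> bool" where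
  "unif_pw_continuous \<Omega> \<M> g \<longleftrightarrow> (\<forall>\<epsilon>>0. \<exists>h0>0. \<forall>M\<in>\<M>. meshsize M \<le> h0 \<longrightarrow>
      (AE x in lborel. x \<in> \<Omega> \<longrightarrow> \<bar>g x - pw_avg M g x\<bar> \<le> \<epsilon>))"

definition poly_deg_le :: "nat \<Rightarrow> (pt \<Rightarrow> real) \<Rightarrow> bool" where
  "poly_deg_le k p \<longleftrightarrow> (\<exists>co :: nat \<Rightarrow> nat \<Rightarrow> real.
      p = (\<lambda>x. \<Sum>i\<le>k. \<Sum>j\<le>k - i. co i j * x $ 1 ^ i * x $ 2 ^ j))"

text \<open>Piecewise polynomials: a function v assigns to each element T its polynomial v T
  (defined on all of R^2, so traces from T are its restriction); v T = 0 off the mesh.\<close>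
definition pw_poly :: "mesh \<Rightarrow> nat \<Rightarrow> (pt set \<Rightarrow> pt \<Rightarrow> real) set" where
  "pw_poly M k = {v. (\<forall>T\<in>fst M. poly_deg_le k (v T)) \<and> (\<forall>T. T \<notin> fst M \<longrightarrow> v T = (\<lambda>_. 0))}"

abbreviation Xh :: "mesh \<Rightarrow> nat \<Rightarrow> (pt set \<Rightarrow> pt \<Rightarrow> real) set" where
  "Xh M k \<equiv> pw_poly M k"

abbreviation Mh :: "mesh \<Rightarrow> nat \<Rightarrow> (pt set \<Rightarrow> pt \<Rightarrow> real) set" where
  "Mh M k \<equiv> pw_poly M (k - 2)"

definition Lop :: "(pt \<Rightarrow> real^2^2) \<Rightarrow> (pt \<Rightarrow> real) \<Rightarrow> (pt \<Rightarrow> real) \<Rightarrow> pt \<Rightarrow> real" where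
  "Lop a c p x = (\<Sum>i\<in>UNIV. \<Sum>j\<in>UNIV. a x $ i $ j * pd i (pd j p) x) + c x * p x"

definition pw_inner :: "mesh \<Rightarrow> (pt set \<Rightarrow> pt \<Rightarrow> real) \<Rightarrow> (pt set \<Rightarrow> pt \<Rightarrow> real) \<Rightarrow> real" where
  "pw_inner M w q = (\<Sum>T\<in>fst M. LINT x:T|lborel. w T x * q T x)"

definition bh :: "mesh \<Rightarrow> (pt \<Rightarrow> real^2^2) \<Rightarrow> (pt \<Rightarrow> real)
      \<Rightarrow> (pt set \<Rightarrow> pt \<Rightarrow> real) \<Rightarrow> (pt set \<Rightarrow> pt \<Rightarrow> real) \<Rightarrow> real" where
  "bh M a c v q = pw_inner M (\<lambda>T. Lop a c (v T)) q"

definition l2proj :: "mesh \<Rightarrow> nat \<Rightarrow> (pt set \<Rightarrow> pt \<Rightarrow> real) \<Rightarrow> (pt set \<Rightarrow> pt \<Rightarrow> real)" where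
  "l2proj M m w = (THE q. q \<in> pw_poly M m \<and>
      (\<forall>p\<in>pw_poly M m. pw_inner M (\<lambda>T x. w T x - q T x) p = 0))"

definition edge_int :: "pt \<times> pt \<Rightarrow> (pt \<Rightarrow> real) \<Rightarrow> real" where
  "edge_int e g = dist (fst e) (snd e) *
      integral {0..1} (\<lambda>t. g (fst e + t *\<^sub>R (snd e - fst e)))"

definition elt1 :: "mesh \<Rightarrow> pt \<times> pt \<Rightarrow> pt set" where
  "elt1 M e = (SOME T. T \<in> adj M e)"

definition elt2 :: "mesh \<Rightarrow> pt \<times> pt \<Rightarrow> pt set" where
  "elt2 M e = (SOME T. T \<in> adj M e - {elt1 M e})"

definition jump :: "pt set \<Rightarrow> mesh \<Rightarrow> (pt set \<Rightarrow> pt \<Rightarrow> real) \<Rightarrow> pt \<times> pt \<Rightarrow> pt \<Rightarrow> real" where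
  "jump \<Omega> M v e x = (if bdry_edge \<Omega> e then v (elt1 M e) x
                      else v (elt1 M e) x - v (elt2 M e) x)"

text \<open>h_T for an edge: diameter of an adjacent element (the largest one).\<close>
definition h_edge :: "mesh \<Rightarrow> pt \<times> pt \<Rightarrow> real" where
  "h_edge M e = Max (diameter ` adj M e)"

definition sh :: "pt set \<Rightarrow> mesh \<Rightarrow> (pt set \<Rightarrow> pt \<Rightarrow> real) \<Rightarrow> (pt set \<Rightarrow> pt \<Rightarrow> real) \<Rightarrow> real" where
  "sh \<Omega> M u v =
     (\<Sum>e\<in>snd M. (1 / h_edge M e ^ 3) * edge_int e (\<lambda>x. jump \<Omega> M u e x * jump \<Omega> M v e x))
   + (\<Sum>e\<in>int_edges \<Omega> M. (1 / h_edge M e) *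
        (\<Sum>i\<in>UNIV. edge_int e (\<lambda>x. jump \<Omega> M (\<lambda>T. pd i (u T)) e x
                                  * jump \<Omega> M (\<lambda>T. pd i (v T)) e x)))"

definition star_norm :: "pt set \<Rightarrow> mesh \<Rightarrow> nat \<Rightarrow> (pt \<Rightarrow> real^2^2) \<Rightarrow> (pt \<Rightarrow> real)
      \<Rightarrow> (pt set \<Rightarrow> pt \<Rightarrow> real) \<Rightarrow> real" where
  "star_norm \<Omega> M k a c v =
     sqrt ((\<Sum>T\<in>fst M. LINT x:T|lborel. (l2proj M (k - 2) (\<lambda>T. Lop a c (v T)) T x)\<^sup>2)
           + sh \<Omega> M v v)"

definition pw_L2_norm :: "mesh \<Rightarrow> (pt set \<Rightarrow> pt \<Rightarrow> real) \<Rightarrow> real" where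
  "pw_L2_norm M q = sqrt (\<Sum>T\<in>fst M. LINT x:T|lborel. (q T x)\<^sup>2)"

definition pd_dg_solution :: "pt set \<Rightarrow> mesh \<Rightarrow> nat \<Rightarrow> (pt \<Rightarrow> real^2^2) \<Rightarrow> (pt \<Rightarrow> real)
      \<Rightarrow> (pt \<Rightarrow> real) \<Rightarrow> (pt set \<Rightarrow> pt \<Rightarrow> real) \<Rightarrow> (pt set \<Rightarrow> pt \<Rightarrow> real) \<Rightarrow> bool" where
  "pd_dg_solution \<Omega> M k a c f uh lh \<longleftrightarrow> uh \<in> Xh M k \<and> lh \<in> Mh M k \<and>
     (\<forall>v\<in>Xh M k. sh \<Omega> M uh v + bh M a c v lh = 0) \<and>
     (\<forall>q\<in>Mh M k. bh M a c uh q = pw_inner M (\<lambda>T. f) q)"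

end

theory Submission
  imports Defs
begin

text \<open>The inf-sup condition is local. On an element \<open>T\<close> with averaged coefficients \<open>A\<close>, every
  polynomial \<open>q\<close> of degree \<open>k - 2\<close> equals \<open>A : D\<^sup>2 z\<close> for a polynomial \<open>z\<close> of degree \<open>k\<close> whose size on \<open>T\<close> is
  \<open>h\<^sub>T \<parallel>q\<parallel>\<close>, and its \<open>j\<close>-th derivatives lose a factor \<open>h\<^sub>T\<^sup>j\<close>. Hence \<open>s\<^sub>h(z, z)\<close> is bounded by a multiple of \<open>\<parallel>q\<parallel>\<^sup>2\<close>,
  and \<open>b\<^sub>h(z, q)\<close> is at least \<open>\<parallel>q\<parallel>\<^sup>2 / 2\<close> when the oscillation of the coefficients is small. Since \<open>a\<close> is
  not assumed uniformly elliptic, the lower bound on a diagonal entry of \<open>A\<close> that this needs is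
  extracted from the regularity hypothesis, tested with a bump function on \<open>T\<close>.

  A piecewise polynomial \<open>v\<close> with \<open>s\<^sub>h(v, v) = 0\<close> has no jumps, so it lies in \<open>H\<^sup>2 \<inter> H\<^sup>1\<^sub>0\<close> and is controlled
  by \<open>\<parallel>L v\<parallel>\<close>. On fine meshes \<open>L v\<close> is within a small multiple of \<open>\<parallel>L v\<parallel>\<close> of \<open>M\<^sub>h\<close>, so \<open>b\<^sub>h(v, \<cdot>) = 0\<close> forces
  \<open>v = 0\<close>. Both facts together make the finite-dimensional saddle point problem uniquely solvable,
  and the inf-sup constant alone enters the stability bound.\<close>

section \<open>Smooth functions\<close>

text \<open>The threshold and the bound must serve every mesh of the family, so the constants of all
  estimates are fixed before a mesh is chosen; apart from the coefficients and the domain they may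
  depend only on \<open>k\<close> and \<open>\<rho>\<close>. Scaling achieves this: shape regularity
  puts a ball of radius \<open>\<rho> * diameter T\<close> inside \<open>T\<close>, and the ball of
  radius \<open>diameter T\<close> about the same centre contains \<open>T\<close>, so polynomials
  need to be compared on these two balls only. The number of edges of an element is bounded
  separately, by area. Two obstacles shape the rest. The regularity hypothesis speaks about weak
  derivatives and limits of test functions, so a function without jumps has to be tested and
  approximated in exactly that sense; the mollification part serves this purpose. And vanishing
  jumps compare only elements that share an edge, while elements may also touch in a single vertex;
  equality there is propagated around the vertex, using that a punctured ball in the plane is
  connected.\<close>

lemma axis_DERIV:
  assumes "\<And>x. (\<lambda>t. f (x + t *\<^sub>R axis i 1)) differentiable (at 0)"
  shows "((\<lambda>t. f (x + t *\<^sub>R axis i 1)) has_real_derivative pd i f (x + s *\<^sub>R axis i 1)) (at s)"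
proof -
  let ?g = "\<lambda>t. f (x + t *\<^sub>R axis i 1)"
  have eq: "(\<lambda>t. ?g (t + s)) = (\<lambda>t. f ((x + s *\<^sub>R axis i 1) + t *\<^sub>R axis i 1))"
    by (simp add: algebra_simps)
  have "(\<lambda>t. f ((x + s *\<^sub>R axis i 1) + t *\<^sub>R axis i 1)) differentiable (at 0)"
    by (rule assms)
  then obtain D where D: "((\<lambda>t. f ((x + s *\<^sub>R axis i 1) + t *\<^sub>R axis i 1)) has_real_derivative D) (at 0)"
    using real_differentiable_def by blast
  have "pd i f (x + s *\<^sub>R axis i 1) = D"
    unfolding pd_def by (rule DERIV_imp_deriv[OF D])
  moreover have "(?g has_real_derivative D) (at (0 + s))"
    unfolding DERIV_shift eq by (rule D)
  ultimately show ?thesis by simp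
qed

lemma pd_eqI: "((\<lambda>t. f (x + t *\<^sub>R axis i 1)) has_real_derivative D) (at 0) \<Longrightarrow> pd i f x = D"
  unfolding pd_def by (rule DERIV_imp_deriv)

text \<open>\<open>smooth2\<close> quantifies over all lists of directions. A class that contains
  \<open>f\<close>, is stable under \<open>pd\<close> and consists of continuous, partially
  differentiable functions replaces the induction on lists by a single closure check.\<close>

lemma smooth2_coinduct:
  assumes "P f" and "\<And>f. P f \<Longrightarrow> continuous_on UNIV f"
    and "\<And>f i x. P f \<Longrightarrow> (\<lambda>t. f (x + t *\<^sub>R axis i 1)) differentiable (at 0)"
    and "\<And>f i. P f \<Longrightarrow> P (pd i f)"
  shows "smooth2 f"
proof -
  have "P (iter_pd is f)" for "is"
    by (induction "is") (use assms in auto)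
  then show ?thesis unfolding smooth2_def using assms by blast
qed

text \<open>\<open>iter_pd\<close> applies the head of its list last. Appending at the end changes
  the function that is differentiated, which is the form needed for
  \<open>smooth2 (pd i f)\<close>.\<close>

lemma iter_pd_snoc: "iter_pd (is @ [i]) f = iter_pd is (pd i f)"
  by (induction "is") auto

lemma smooth2_pd: "smooth2 f \<Longrightarrow> smooth2 (pd i f)"
  unfolding smooth2_def iter_pd_snoc[symmetric] by blast

lemma smooth2_cont: "smooth2 f \<Longrightarrow> continuous_on UNIV f"
  unfolding smooth2_def using iter_pd.simps(1) by metis

lemma smooth2_differentiable: "smooth2 f \<Longrightarrow> (\<lambda>t. f (x + t *\<^sub>R axis i 1)) differentiable (at 0)"
  unfolding smooth2_def using iter_pd.simps(1) by metis

lemma smooth2_DERIV: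
  "smooth2 f \<Longrightarrow> ((\<lambda>t. f (x + t *\<^sub>R axis i 1)) has_real_derivative pd i f (x + s *\<^sub>R axis i 1)) (at s)"
  by (rule axis_DERIV) (rule smooth2_differentiable)

lemma smooth2_DERIV0:
  "smooth2 f \<Longrightarrow> ((\<lambda>t. f (x + t *\<^sub>R axis i 1)) has_real_derivative pd i f x) (at 0)"
  using smooth2_DERIV[of f x i 0] by simp

section \<open>Algebras of functions stable under partial differentiation\<close>

inductive falg :: "(pt \<Rightarrow> real) set \<Rightarrow> (pt \<Rightarrow> real) \<Rightarrow> bool" for G where
  falg_base: "g \<in> G \<Longrightarrow> falg G g"
| falg_const: "falg G (\<lambda>_. b)"
| falg_add: "falg G f \<Longrightarrow> falg G g \<Longrightarrow> falg G (\<lambda>x. f x + g x)"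
| falg_mult: "falg G f \<Longrightarrow> falg G g \<Longrightarrow> falg G (\<lambda>x. f x * g x)"

lemma pd_const: "pd i (\<lambda>_. b) = (\<lambda>_. 0)"
  by (rule ext, rule pd_eqI) simp

text \<open>By the sum and product rules, stability of the generated algebra under \<open>pd\<close>
  reduces to its generators. Applied to the coordinates, to the flat exponentials and to all smooth
  functions, this yields the closure properties of \<open>smooth2\<close>.\<close>

lemma falg_smooth2:
  assumes cont: "\<And>g. g \<in> G \<Longrightarrow> continuous_on UNIV g"
    and diff: "\<And>g i x. g \<in> G \<Longrightarrow> (\<lambda>t. g (x + t *\<^sub>R axis i 1)) differentiable (at 0)"
    and pdG: "\<And>g i. g \<in> G \<Longrightarrow> falg G (pd i g)"
    and f: "falg G f"
  shows "smooth2 f"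
proof (rule smooth2_coinduct[where P = "falg G", OF f])
  fix f assume "falg G f"
  then show "continuous_on UNIV f"
    by induction (auto intro: cont continuous_on_const continuous_on_add continuous_on_mult)
next
  fix f i x assume "falg G f"
  then show "(\<lambda>t. f (x + t *\<^sub>R axis i 1)) differentiable (at 0)"
    by induction (auto intro!: derivative_intros diff)
next
  fix f i assume "falg G f"
  moreover have D: "((\<lambda>t. f (x + t *\<^sub>R axis i 1)) has_real_derivative pd i f x) (at 0)"
    if "falg G f" for f x
  proof -
    have "(\<lambda>t. f (y + t *\<^sub>R axis i 1)) differentiable (at 0)" for y
      using that by induction (auto intro!: derivative_intros diff)
    then show ?thesis using axis_DERIV[of f i x 0] by simp
  qed
  ultimately show "falg G (pd i f)"
  proof induction
    case (falg_base g) then show ?case by (simp add: pdG)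
  next
    case (falg_const b) then show ?case by (simp add: pd_const falg.falg_const)
  next
    case (falg_add f g)
    have "pd i (\<lambda>x. f x + g x) = (\<lambda>x. pd i f x + pd i g x)"
      by (rule ext, rule pd_eqI, rule DERIV_add[OF D D]) (use falg_add in auto)
    then show ?case using falg_add falg.falg_add D by metis
  next
    case (falg_mult f g)
    have "pd i (\<lambda>x. f x * g x) = (\<lambda>x. pd i f x * g x + pd i g x * f x)"
      by (rule ext, rule pd_eqI)
        (use DERIV_mult[OF D[of f] D[of g]] falg_mult in auto)
    then show ?case using falg_mult D by (simp add: falg.falg_add falg.falg_mult)
  qed
qed

lemma smooth2_falg: "falg (Collect smooth2) f \<Longrightarrow> smooth2 f"
  by (rule falg_smooth2)
    (auto intro: smooth2_cont smooth2_differentiable falg_base smooth2_pd)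

lemma smooth2_const [intro]: "smooth2 (\<lambda>_. b)"
  by (rule smooth2_falg) (rule falg_const)

lemma smooth2_add [intro]: "smooth2 f \<Longrightarrow> smooth2 g \<Longrightarrow> smooth2 (\<lambda>x. f x + g x)"
  by (rule smooth2_falg) (auto intro: falg.intros)

lemma smooth2_mult [intro]: "smooth2 f \<Longrightarrow> smooth2 g \<Longrightarrow> smooth2 (\<lambda>x. f x * g x)"
  by (rule smooth2_falg) (auto intro: falg.intros)

lemma smooth2_diff [intro]: "smooth2 f \<Longrightarrow> smooth2 g \<Longrightarrow> smooth2 (\<lambda>x. f x - g x)"
  using smooth2_add[of f "\<lambda>x. -1 * g x"] smooth2_mult[OF smooth2_const[of "-1"], of g] by simp

lemma smooth2_sum [intro]: "(\<And>i. i \<in> I \<Longrightarrow> smooth2 (f i)) \<Longrightarrow> smooth2 (\<lambda>x. \<Sum>i\<in>I. f i x)"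
  by (induction I rule: infinite_finite_induct) auto

lemma smooth2_power [intro]: "smooth2 f \<Longrightarrow> smooth2 (\<lambda>x. f x ^ n)"
  by (induction n) auto

lemma pd_add: "smooth2 f \<Longrightarrow> smooth2 g \<Longrightarrow> pd i (\<lambda>x. f x + g x) = (\<lambda>x. pd i f x + pd i g x)"
  by (rule ext, rule pd_eqI, rule DERIV_add) (auto intro: smooth2_DERIV0)

lemma pd_diff: "smooth2 f \<Longrightarrow> smooth2 g \<Longrightarrow> pd i (\<lambda>x. f x - g x) = (\<lambda>x. pd i f x - pd i g x)"
  by (rule ext, rule pd_eqI, rule DERIV_diff) (auto intro: smooth2_DERIV0)

lemma pd_mult: "smooth2 f \<Longrightarrow> smooth2 g \<Longrightarrow>
    pd i (\<lambda>x. f x * g x) = (\<lambda>x. pd i f x * g x + f x * pd i g x)"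
  using DERIV_mult[OF smooth2_DERIV0[of f _ i] smooth2_DERIV0[of g _ i]]
  by (intro ext pd_eqI) (auto simp: algebra_simps)

lemma pd_cmult: "smooth2 f \<Longrightarrow> pd i (\<lambda>x. b * f x) = (\<lambda>x. b * pd i f x)"
  by (rule ext, rule pd_eqI, rule DERIV_cmult) (auto intro: smooth2_DERIV0)

lemma pd_sum: "(\<And>i. i \<in> I \<Longrightarrow> smooth2 (f i)) \<Longrightarrow>
    pd j (\<lambda>x. \<Sum>i\<in>I. f i x) = (\<lambda>x. \<Sum>i\<in>I. pd j (f i) x)"
  by (rule ext, rule pd_eqI, rule DERIV_sum) (auto intro: smooth2_DERIV0)

lemma nth_plus_axis: "(x + t *\<^sub>R axis j 1) $ i = x $ i + (if i = j then t else 0)" for x :: pt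
  by (simp add: axis_def)

lemma pd_coord: "pd j (\<lambda>x. x $ i) = (\<lambda>_. if i = j then 1 else 0)"
  by (rule ext, rule pd_eqI) (auto simp: axis_def intro!: derivative_eq_intros)

lemma smooth2_coord [intro]: "smooth2 (\<lambda>x. x $ i)"
proof (rule falg_smooth2[where G = "range (\<lambda>i x. x $ i)"])
  fix g j assume "g \<in> range (\<lambda>i (x::pt). x $ i)"
  then show "falg (range (\<lambda>i x. x $ i)) (pd j g)"
    by (auto simp: pd_coord falg_const)
next
  fix g j x assume "g \<in> range (\<lambda>i (x::pt). x $ i)"
  then obtain i where "g = (\<lambda>x. x $ i)" by auto
  then show "(\<lambda>t. g (x + t *\<^sub>R axis j 1)) differentiable at 0"
    by (auto simp: nth_plus_axis intro!: derivative_intros)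
qed (auto intro!: falg_base continuous_intros)

lemma axis_mvt:
  assumes f: "smooth2 f" and K: "\<And>s. \<bar>s\<bar> \<le> \<bar>t\<bar> \<Longrightarrow> \<bar>pd i f (x + s *\<^sub>R axis i 1)\<bar> \<le> K"
  shows "\<bar>f (x + t *\<^sub>R axis i 1) - f x\<bar> \<le> K * \<bar>t\<bar>"
proof -
  have "norm ((\<lambda>s. f (x + s *\<^sub>R axis i 1)) t - (\<lambda>s. f (x + s *\<^sub>R axis i 1)) 0) \<le> K * norm (t - 0)"
  proof (rule field_differentiable_bound[of "closed_segment 0 t"])
    fix z assume "z \<in> closed_segment 0 t"
    then have "\<bar>z\<bar> \<le> \<bar>t\<bar>" by (auto simp: closed_segment_eq_real_ivl split: if_splits)
    then show "norm (pd i f (x + z *\<^sub>R axis i 1)) \<le> K" using K by simp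
  qed (auto intro: DERIV_subset[OF smooth2_DERIV[OF f]])
  then show ?thesis by simp
qed

text \<open>Only partial derivatives are at hand, so two points are joined by two axis-parallel
  legs, each handled by the one-dimensional mean value bound. The corner may leave the ball of
  radius \<open>R\<close>, but both legs stay within radius \<open>3 * R\<close>, where the partial
  derivatives are bounded.\<close>

lemma smooth2_Lipschitz:
  assumes f: "smooth2 f"
  shows "\<exists>L\<ge>0. L-lipschitz_on (cball 0 R) f"
proof (cases "R \<ge> 0")
  case False
  then show ?thesis by (auto intro!: exI[of _ 0] simp: lipschitz_on_def)
next
  case True
  have "\<exists>B. \<forall>x\<in>cball 0 (3 * R). \<bar>pd i f x\<bar> \<le> B" for i
  proof -
    have "compact (pd i f ` cball 0 (3 * R))"
      by (intro compact_continuous_image compact_cball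
          continuous_on_subset[OF smooth2_cont[OF smooth2_pd[OF f]]]) auto
    then show ?thesis
      using compact_imp_bounded bounded_iff by (metis imageI real_norm_def)
  qed
  then obtain B where B: "\<And>i x. x \<in> cball 0 (3 * R) \<Longrightarrow> \<bar>pd i f x\<bar> \<le> B i" by metis
  define K where "K = \<bar>B 1\<bar> + \<bar>B 2\<bar>"
  have K: "\<bar>pd i f x\<bar> \<le> K" if "norm x \<le> 3 * R" for i x
  proof -
    have "\<bar>pd 1 f x\<bar> \<le> K" "\<bar>pd 2 f x\<bar> \<le> K"
      using B[of x 1] B[of x 2] that unfolding K_def by auto
    then show ?thesis using exhaust_2[of i] by auto
  qed
  have K0: "K \<ge> 0" unfolding K_def by simp
  have "\<bar>f x - f y\<bar> \<le> (2 * K) * dist x y" if x: "norm x \<le> R" and y: "norm y \<le> R" for x y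
  proof -
    define z where "z = x + (y $ 1 - x $ 1) *\<^sub>R axis 1 1"
    have yz: "y = z + (y $ 2 - x $ 2) *\<^sub>R axis 2 1"
      unfolding z_def by (simp add: vec_eq_iff forall_2 axis_def)
    have c: "\<bar>y $ i - x $ i\<bar> \<le> dist x y" for i
      using component_le_norm_cart[of "y - x" i] by (simp add: dist_norm norm_minus_commute)
    have d: "dist x y \<le> 2 * R" using norm_triangle_ineq4[of x y] x y by (simp add: dist_norm)
    have "\<bar>f z - f x\<bar> \<le> K * \<bar>y $ 1 - x $ 1\<bar>"
      unfolding z_def
    proof (rule axis_mvt[OF f], rule K)
      fix s assume "\<bar>s\<bar> \<le> \<bar>y $ 1 - x $ 1\<bar>"
      then have "norm (s *\<^sub>R axis 1 1 :: pt) \<le> 2 * R" using c[of 1] d by (simp add: norm_axis_1)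
      then show "norm (x + s *\<^sub>R axis 1 1) \<le> 3 * R" using norm_triangle_ineq[of x "s *\<^sub>R axis 1 1"] x by simp
    qed
    moreover have "\<bar>f (y + (x $ 2 - y $ 2) *\<^sub>R axis 2 1) - f y\<bar> \<le> K * \<bar>x $ 2 - y $ 2\<bar>"
    proof (rule axis_mvt[OF f], rule K)
      fix s assume "\<bar>s\<bar> \<le> \<bar>x $ 2 - y $ 2\<bar>"
      then have "norm (s *\<^sub>R axis 2 1 :: pt) \<le> 2 * R" using c[of 2] d by (simp add: norm_axis_1)
      then show "norm (y + s *\<^sub>R axis 2 1) \<le> 3 * R" using norm_triangle_ineq[of y "s *\<^sub>R axis 2 1"] y by simp
    qed
    moreover have "y + (x $ 2 - y $ 2) *\<^sub>R axis 2 1 = z"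
      using yz by (simp add: algebra_simps)
    moreover have "K * \<bar>y $ 1 - x $ 1\<bar> \<le> K * dist x y" "K * \<bar>x $ 2 - y $ 2\<bar> \<le> K * dist x y"
      using c[of 1] c[of 2] K0 by (auto intro!: mult_left_mono)
    ultimately show ?thesis by simp
  qed
  then have "(2 * K)-lipschitz_on (cball 0 R) f"
    using K0 by (auto simp: lipschitz_on_def dist_real_def)
  then show ?thesis using K0 by (intro exI[of _ "2 * K"]) auto
qed

section \<open>Bump functions\<close>

definition flat_exp :: "nat \<Rightarrow> real \<Rightarrow> real" where
  "flat_exp n t = (if t > 0 then (1 / t) ^ n * exp (- (1 / t)) else 0)"

lemma flat_exp_tendsto_0: "(flat_exp n \<longlongrightarrow> 0) (at 0)"
proof -
  have "((\<lambda>t. (inverse t) ^ n / exp (inverse t)) \<longlongrightarrow> (0::real)) (at_right 0)"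
    by (rule filterlim_compose[OF tendsto_power_div_exp_0 filterlim_inverse_at_top_right])
  then have "(flat_exp n \<longlongrightarrow> 0) (at_right 0)"
    by (rule Lim_transform_eventually)
      (auto simp: flat_exp_def eventually_at_filter exp_minus field_simps)
  moreover have "(flat_exp n \<longlongrightarrow> 0) (at_left 0)"
    by (rule Lim_transform_eventually[OF tendsto_const])
      (auto simp: flat_exp_def eventually_at_filter)
  ultimately show ?thesis using filterlim_split_at by blast
qed

text \<open>The family \<open>flat_exp n\<close> is closed under differentiation up to linear
  combinations. This is why a power of \<open>1 / t\<close> is carried along with the classical
  \<open>exp (- (1 / t))\<close>, the case \<open>n = 0\<close>.\<close>

lemma flat_exp_DERIV:
  "(flat_exp n has_real_derivative flat_exp (n + 2) t - real n * flat_exp (n + 1) t) (at t)"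
proof -
  consider "t > 0" | "t = 0" | "t < 0" by linarith
  then show ?thesis
  proof cases
    case 1
    have "((\<lambda>t. (1 / t) ^ n * exp (- (1 / t))) has_real_derivative
        flat_exp (n + 2) t - real n * flat_exp (n + 1) t) (at t)"
    proof (cases n)
      case 0
      then show ?thesis using 1
        by (auto intro!: derivative_eq_intros simp: flat_exp_def field_simps power2_eq_square)
    next
      case (Suc m)
      show ?thesis unfolding Suc using 1
        by (auto intro!: derivative_eq_intros simp: flat_exp_def power_divide)
          (cases m; simp add: field_simps power2_eq_square)
    qed
    then show ?thesis
      by (rule has_field_derivative_transform_within_open[of _ _ _ "{0<..}"])
        (use 1 in \<open>auto simp: flat_exp_def\<close>)
  next
    case 2
    \<comment> \<open>The difference quotient of \<open>flat_exp n\<close> at 0 is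
      \<open>flat_exp (Suc n)\<close>, whose limit at 0 is known.\<close>
    have "((\<lambda>h. (flat_exp n (0 + h) - flat_exp n 0) / h) \<longlongrightarrow> 0) (at 0)"
      by (rule Lim_transform_eventually[OF flat_exp_tendsto_0[of "Suc n"]])
        (auto simp: flat_exp_def eventually_at_filter)
    then show ?thesis using 2 by (simp add: DERIV_def flat_exp_def)
  next
    case 3
    have "((\<lambda>t. 0) has_real_derivative flat_exp (n + 2) t - real n * flat_exp (n + 1) t) (at t)"
      using 3 by (simp add: flat_exp_def)
    then show ?thesis
      by (rule has_field_derivative_transform_within_open[of _ _ _ "{..<0}"])
        (use 3 in \<open>auto simp: flat_exp_def\<close>)
  qed
qed

lemma smooth2_flat_exp: "smooth2 (\<lambda>x. flat_exp n (\<alpha> + \<beta> * x $ i))"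
proof -
  let ?G = "{\<lambda>x::pt. flat_exp n (\<alpha> + \<beta> * x $ i) | n \<alpha> \<beta> i. True}"
  have D: "((\<lambda>t. flat_exp n (\<alpha> + \<beta> * (x + t *\<^sub>R axis j 1) $ i)) has_real_derivative
        (if i = j then \<beta> else 0) *
          (flat_exp (n + 2) (\<alpha> + \<beta> * x $ i) + (- real n) * flat_exp (n + 1) (\<alpha> + \<beta> * x $ i))) (at 0)"
    for n \<alpha> \<beta> i j and x :: pt
  proof -
    have "((\<lambda>t. flat_exp n (\<alpha> + \<beta> * (x $ i + (if i = j then t else 0)))) has_real_derivative
        (flat_exp (n + 2) (\<alpha> + \<beta> * x $ i) - real n * flat_exp (n + 1) (\<alpha> + \<beta> * x $ i))
         * (if i = j then \<beta> else 0)) (at 0)"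
      by (rule DERIV_chain2[of "flat_exp n"])
        (auto intro!: flat_exp_DERIV[THEN DERIV_cong] derivative_eq_intros)
    then show ?thesis unfolding nth_plus_axis by (simp add: mult.commute)
  qed
  have cont: "continuous_on UNIV (flat_exp n)" for n
    using flat_exp_DERIV DERIV_isCont continuous_at_imp_continuous_on by blast
  show ?thesis
  proof (rule falg_smooth2[where G = ?G])
    fix g assume "g \<in> ?G"
    then obtain n \<alpha> \<beta> i where g: "g = (\<lambda>x. flat_exp n (\<alpha> + \<beta> * x $ i))" by auto
    show "continuous_on UNIV g"
      unfolding g by (rule continuous_on_compose2[OF cont]) (auto intro!: continuous_intros)
    show "(\<lambda>t. g (x + t *\<^sub>R axis j 1)) differentiable at 0" for j x
      unfolding g using D real_differentiable_def by blast
    have "pd j g = (\<lambda>x. (if i = j then \<beta> else 0) *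
          (flat_exp (n + 2) (\<alpha> + \<beta> * x $ i) + (- real n) * flat_exp (n + 1) (\<alpha> + \<beta> * x $ i)))" for j
      unfolding g by (rule ext, rule pd_eqI, rule D)
    then show "falg ?G (pd j g)" for j
      by (simp only:) (intro falg_mult falg_const falg_add falg_base; blast)
  qed (auto intro!: falg_base)
qed

text \<open>A product of one-dimensional bumps supported in
  \<open>\<bar>x $ i\<bar> \<le> r / 2\<close>. The resulting open square lies in the ball of radius
  \<open>r\<close> because the norm is at most the sum of the absolute values of the
  coordinates.\<close>

lemma exists_bump:
  assumes r: "r > 0"
  obtains \<eta> where "smooth2 \<eta>" "\<And>x. \<eta> x \<ge> 0" "\<And>x. norm x \<ge> r \<Longrightarrow> \<eta> x = 0" "\<eta> 0 > 0"
proof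
  define e where "e i x = flat_exp 0 (r / 2 + 1 * x $ i) * flat_exp 0 (r / 2 + (-1) * x $ i)" for i and x :: pt
  let ?\<eta> = "\<lambda>x. e 1 x * e 2 x"
  show "smooth2 ?\<eta>" unfolding e_def by (intro smooth2_mult smooth2_flat_exp)
  show "?\<eta> x \<ge> 0" for x by (simp add: e_def flat_exp_def)
  show "?\<eta> 0 > 0" using r by (simp add: e_def flat_exp_def)
  show "?\<eta> x = 0" if "norm x \<ge> r" for x
  proof (rule ccontr)
    assume "?\<eta> x \<noteq> 0"
    then have "\<bar>x $ 1\<bar> < r / 2" "\<bar>x $ 2\<bar> < r / 2"
      by (auto simp: e_def flat_exp_def split: if_splits)
    moreover have "norm x \<le> \<bar>x $ 1\<bar> + \<bar>x $ 2\<bar>"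
      using norm_le_l1_cart[of x] by (simp add: sum_2)
    ultimately show False using that by linarith
  qed
qed

section \<open>Linear systems\<close>

text \<open>Gaussian elimination by induction on the equations: a pivot \<open>j0\<close> of the new
  equation is eliminated from the others, and its value is recovered afterwards by back
  substitution.\<close>

lemma underdetermined_system:
  fixes A :: "'i \<Rightarrow> 'j \<Rightarrow> real"
  assumes "finite I" "finite J" "card I < card J"
  shows "\<exists>x. (\<exists>j\<in>J. x j \<noteq> 0) \<and> (\<forall>i\<in>I. (\<Sum>j\<in>J. A i j * x j) = 0)"
  using assms
proof (induction I arbitrary: J A rule: finite_induct)
  case empty
  then have "J \<noteq> {}" by auto
  then show ?case by (intro exI[of _ "\<lambda>_. 1"]) auto
next
  case (insert i0 I)
  show ?case
  proof (cases "\<forall>j\<in>J. A i0 j = 0")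
    case True
    from insert.IH[OF insert.prems(1), of A] insert.prems insert.hyps
    obtain x where "\<exists>j\<in>J. x j \<noteq> 0" "\<forall>i\<in>I. (\<Sum>j\<in>J. A i j * x j) = 0" by auto
    then show ?thesis using True by (intro exI[of _ x]) auto
  next
    case False
    then obtain j0 where j0: "j0 \<in> J" "A i0 j0 \<noteq> 0" by auto
    let ?J = "J - {j0}"
    have "card I < card ?J" using insert.prems insert.hyps j0 by simp
    from insert.IH[of ?J "\<lambda>i j. A i j - A i j0 * A i0 j / A i0 j0"] this insert.prems
    obtain x where x: "\<exists>j\<in>?J. x j \<noteq> 0"
      "\<forall>i\<in>I. (\<Sum>j\<in>?J. (A i j - A i j0 * A i0 j / A i0 j0) * x j) = 0" by auto
    define y where "y = x(j0 := - (\<Sum>j\<in>?J. A i0 j * x j) / A i0 j0)"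
    have split: "(\<Sum>j\<in>J. A i j * y j) = A i j0 * y j0 + (\<Sum>j\<in>?J. A i j * x j)" for i
    proof -
      have "(\<Sum>j\<in>J. A i j * y j) = A i j0 * y j0 + (\<Sum>j\<in>?J. A i j * y j)"
        using insert.prems j0 by (simp add: sum.remove)
      also have "(\<Sum>j\<in>?J. A i j * y j) = (\<Sum>j\<in>?J. A i j * x j)"
        by (rule sum.cong) (auto simp: y_def)
      finally show ?thesis .
    qed
    have "(\<Sum>j\<in>J. A i0 j * y j) = 0"
      unfolding split using j0 by (simp add: y_def)
    moreover have "(\<Sum>j\<in>J. A i j * y j) = 0" if "i \<in> I" for i
    proof -
      have "0 = (\<Sum>j\<in>?J. A i j * x j - A i j0 / A i0 j0 * (A i0 j * x j))"
        using x(2) that by (simp add: left_diff_distrib mult.assoc)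
      also have "\<dots> = (\<Sum>j\<in>?J. A i j * x j) - A i j0 / A i0 j0 * (\<Sum>j\<in>?J. A i0 j * x j)"
        by (simp add: sum_subtractf sum_distrib_left)
      finally show ?thesis unfolding split by (simp add: y_def algebra_simps)
    qed
    moreover have "\<exists>j\<in>J. y j \<noteq> 0" using x(1) by (auto simp: y_def)
    ultimately show ?thesis by auto
  qed
qed

text \<open>The column \<open>- b i\<close> is appended under the index \<open>None\<close>. The
  enlarged system has more unknowns than equations, hence a nonzero solution; injectivity forces its
  \<open>None\<close> component to be nonzero, and dividing by that component gives the required
  vector.\<close>

lemma square_system_solvable:
  fixes A :: "'j \<Rightarrow> 'j \<Rightarrow> real"
  assumes J: "finite J"
    and inj: "\<And>x. (\<forall>i\<in>J. (\<Sum>j\<in>J. A i j * x j) = 0) \<Longrightarrow> \<forall>j\<in>J. x j = 0"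
  shows "\<exists>x. \<forall>i\<in>J. (\<Sum>j\<in>J. A i j * x j) = b i"
proof -
  let ?K = "insert None (Some ` J)"
  have "card J < card ?K" using J by (simp add: card_image)
  from underdetermined_system[OF J _ this, of "\<lambda>i. case_option (- b i) (A i)"] J
  obtain x where x: "\<exists>j\<in>?K. x j \<noteq> 0"
    "\<And>i. i \<in> J \<Longrightarrow> (\<Sum>j\<in>?K. case_option (- b i) (A i) j * x j) = 0" by auto
  have e: "(\<Sum>j\<in>J. A i j * x (Some j)) = b i * x None" if "i \<in> J" for i
    using x(2)[OF that] J by (simp add: sum.reindex)
  have "x None \<noteq> 0"
  proof
    assume 0: "x None = 0"
    then have "\<forall>j\<in>J. x (Some j) = 0" using e inj[of "\<lambda>j. x (Some j)"] by simp
    then show False using x(1) 0 by auto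
  qed
  then show ?thesis using e
    by (intro exI[of _ "\<lambda>j. x (Some j) / x None"]) (auto simp: sum_divide_distrib[symmetric])
qed

section \<open>Square integrable functions\<close>

lemma L2_on_mult_integrable:
  assumes "L2_on S f" "L2_on S g"
  shows "set_integrable lborel S (\<lambda>x. f x * g x)"
proof -
  have "set_integrable lborel S (\<lambda>x. (f x)\<^sup>2 + (g x)\<^sup>2)"
    using assms by (auto simp: L2_on_def intro: set_integral_add)
  moreover have "set_borel_measurable lborel S (\<lambda>x. f x * g x)"
  proof -
    have "(\<lambda>x. (indicat_real S x *\<^sub>R f x) * (indicat_real S x *\<^sub>R g x)) \<in> borel_measurable lborel"
      using assms by (auto simp: L2_on_def set_borel_measurable_def intro!: borel_measurable_times)
    then show ?thesis unfolding set_borel_measurable_def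
      by (rule back_subst[where P = "\<lambda>f. f \<in> borel_measurable lborel"]) (auto simp: indicator_def)
  qed
  moreover have "\<bar>f x * g x\<bar> \<le> (f x)\<^sup>2 + (g x)\<^sup>2" for x
  proof -
    have "2 * (\<bar>f x\<bar> * \<bar>g x\<bar>) \<le> (f x)\<^sup>2 + (g x)\<^sup>2"
      using sum_squares_bound[of "\<bar>f x\<bar>" "\<bar>g x\<bar>"] by simp
    moreover have "0 \<le> \<bar>f x\<bar> * \<bar>g x\<bar>" by simp
    ultimately show ?thesis unfolding abs_mult by linarith
  qed
  ultimately show ?thesis
    unfolding set_integrable_def set_borel_measurable_def
    by (elim Bochner_Integration.integrable_bound) (auto simp: indicator_def)
qed

lemma L2_on_add [intro]:
  assumes "L2_on S f" "L2_on S g" shows "L2_on S (\<lambda>x. f x + g x)"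
proof -
  have "set_borel_measurable lborel S (\<lambda>x. f x + g x)"
    using assms by (auto simp: L2_on_def set_borel_measurable_def algebra_simps)
  moreover have "set_integrable lborel S (\<lambda>x. (f x + g x)\<^sup>2)"
  proof -
    have "set_integrable lborel S (\<lambda>x. (f x)\<^sup>2 + (g x)\<^sup>2 + 2 * (f x * g x))"
      using assms L2_on_mult_integrable[OF assms]
      by (auto simp: L2_on_def intro!: set_integral_add set_integrable_mult_right)
    then show ?thesis by (simp add: power2_sum algebra_simps)
  qed
  ultimately show ?thesis by (simp add: L2_on_def)
qed

lemma L2_on_cmult [intro]: "L2_on S f \<Longrightarrow> L2_on S (\<lambda>x. b * f x)"
proof -
  assume f: "L2_on S f"
  have "set_borel_measurable lborel S (\<lambda>x. b * f x)"
    using f by (auto simp: L2_on_def set_borel_measurable_def algebra_simps)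
  moreover have "set_integrable lborel S (\<lambda>x. (b * f x)\<^sup>2)"
    using f by (auto simp: L2_on_def power_mult_distrib)
  ultimately show ?thesis by (simp add: L2_on_def)
qed

lemma L2_on_diff [intro]: "L2_on S f \<Longrightarrow> L2_on S g \<Longrightarrow> L2_on S (\<lambda>x. f x - g x)"
  using L2_on_add[of S f "\<lambda>x. -1 * g x"] L2_on_cmult[of S g "-1"] by simp

lemma L2_on_sum [intro]: "(\<And>i. i \<in> I \<Longrightarrow> L2_on S (f i)) \<Longrightarrow> L2_on S (\<lambda>x. \<Sum>i\<in>I. f i x)"
proof (induction I rule: infinite_finite_induct)
  case (insert x F)
  then show ?case using L2_on_add[of S "f x" "\<lambda>y. \<Sum>i\<in>F. f i y"] by simp
qed (auto simp: L2_on_def set_borel_measurable_def set_integrable_def)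

lemma L2_norm_nonneg [simp]: "L2_norm_on S f \<ge> 0"
  by (auto simp: L2_norm_on_def set_lebesgue_integral_def intro!: integral_nonneg_AE)

lemma L2_norm_sq: "(L2_norm_on S f)\<^sup>2 = (LINT x:S|lborel. (f x)\<^sup>2)"
  by (auto simp: L2_norm_on_def set_lebesgue_integral_def intro!: real_sqrt_pow2 integral_nonneg_AE)

lemma L2_Cauchy_Schwarz:
  assumes "L2_on S f" "L2_on S g"
  shows "\<bar>LINT x:S|lborel. f x * g x\<bar> \<le> L2_norm_on S f * L2_norm_on S g"
proof -
  let ?a = "LINT x:S|lborel. (f x)\<^sup>2" and ?b = "LINT x:S|lborel. f x * g x" and ?c = "LINT x:S|lborel. (g x)\<^sup>2"
  have q: "0 \<le> ?a * t\<^sup>2 + 2 * ?b * t + ?c" for t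
  proof -
    have i: "set_integrable lborel S (\<lambda>x. (f x)\<^sup>2)" "set_integrable lborel S (\<lambda>x. (g x)\<^sup>2)"
      "set_integrable lborel S (\<lambda>x. f x * g x)"
      using assms L2_on_mult_integrable[OF assms] by (auto simp: L2_on_def)
    have "(LINT x:S|lborel. (t * f x + g x)\<^sup>2) =
        (LINT x:S|lborel. t\<^sup>2 * (f x)\<^sup>2 + 2 * t * (f x * g x) + (g x)\<^sup>2)"
      by (rule arg_cong[of _ _ "set_lebesgue_integral lborel S"]) (auto simp: power2_eq_square algebra_simps)
    also have "\<dots> = t\<^sup>2 * ?a + 2 * t * ?b + ?c"
      using i by (simp add: set_integral_add set_integrable_mult_right set_integral_mult_right)
    finally have "t\<^sup>2 * ?a + 2 * t * ?b + ?c = (L2_norm_on S (\<lambda>x. t * f x + g x))\<^sup>2"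
      by (simp add: L2_norm_sq)
    then show ?thesis by (simp add: algebra_simps)
  qed
  have "?b\<^sup>2 \<le> ?a * ?c"
  proof (cases "?a = 0")
    case True
    have "?b = 0"
    proof (rule ccontr)
      assume "?b \<noteq> 0"
      \<comment> \<open>With \<open>?a = 0\<close> the quadratic is affine in \<open>t\<close>; a
        nonzero slope makes it equal to \<open>-1\<close> at this \<open>t\<close>.\<close>
      then show False using q[of "- (?c + 1) / (2 * ?b)"] True by simp
    qed
    then show ?thesis using True by simp
  next
    case False
    then have "?a > 0" using L2_norm_sq[of S f] zero_le_power2[of "L2_norm_on S f"] by linarith
    then show ?thesis using q[of "- ?b / ?a"]
      by (simp add: power2_eq_square field_simps)
  qed
  then have "?b\<^sup>2 \<le> (L2_norm_on S f * L2_norm_on S g)\<^sup>2"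
    by (simp add: power_mult_distrib L2_norm_sq)
  then show ?thesis by (rule abs_le_square_iff[THEN iffD2, THEN order_trans]) simp
qed

lemma L2_norm_cmult: "L2_norm_on S (\<lambda>x. b * f x) = \<bar>b\<bar> * L2_norm_on S f"
  by (simp add: L2_norm_on_def power_mult_distrib real_sqrt_mult)

lemma L2_norm_triangle:
  assumes "L2_on S f" "L2_on S g"
  shows "L2_norm_on S (\<lambda>x. f x + g x) \<le> L2_norm_on S f + L2_norm_on S g"
proof (rule power2_le_imp_le)
  have i: "set_integrable lborel S (\<lambda>x. (f x)\<^sup>2)" "set_integrable lborel S (\<lambda>x. (g x)\<^sup>2)"
    "set_integrable lborel S (\<lambda>x. f x * g x)"
    using assms L2_on_mult_integrable[OF assms] by (auto simp: L2_on_def)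
  have "(LINT x:S|lborel. (f x + g x)\<^sup>2) = (LINT x:S|lborel. (f x)\<^sup>2 + 2 * (f x * g x) + (g x)\<^sup>2)"
    by (rule arg_cong[of _ _ "set_lebesgue_integral lborel S"]) (auto simp: power2_eq_square algebra_simps)
  also have "\<dots> = (L2_norm_on S f)\<^sup>2 + 2 * (LINT x:S|lborel. f x * g x) + (L2_norm_on S g)\<^sup>2"
    using i by (simp add: set_integral_add set_integrable_mult_right set_integral_mult_right L2_norm_sq)
  finally have "(L2_norm_on S (\<lambda>x. f x + g x))\<^sup>2 =
      (L2_norm_on S f)\<^sup>2 + 2 * (LINT x:S|lborel. f x * g x) + (L2_norm_on S g)\<^sup>2"
    by (simp only: L2_norm_sq)
  then show "(L2_norm_on S (\<lambda>x. f x + g x))\<^sup>2 \<le> (L2_norm_on S f + L2_norm_on S g)\<^sup>2"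
    using L2_Cauchy_Schwarz[OF assms] unfolding power2_sum by linarith
qed simp

lemma bounded_measurable_set_integrable:
  fixes f :: "pt \<Rightarrow> real"
  assumes "S \<in> sets borel" "bounded S" "set_borel_measurable lborel S f" "\<And>x. x \<in> S \<Longrightarrow> \<bar>f x\<bar> \<le> K"
  shows "set_integrable lborel S f"
proof -
  have "integrable lborel (\<lambda>x. indicat_real S x *\<^sub>R f x)"
  proof (rule Bochner_Integration.integrable_bound)
    show "integrable lborel (\<lambda>x. indicat_real S x * \<bar>K\<bar>)"
      using assms emeasure_bounded_finite[of S] by (auto simp: less_top)
    show "(\<lambda>x. indicat_real S x *\<^sub>R f x) \<in> borel_measurable lborel"
      using assms by (simp add: set_borel_measurable_def)
    show "AE x in lborel. norm (indicat_real S x *\<^sub>R f x) \<le> norm (indicat_real S x * \<bar>K\<bar>)"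
    proof (rule AE_I2)
      fix x show "norm (indicat_real S x *\<^sub>R f x) \<le> norm (indicat_real S x * \<bar>K\<bar>)"
        using assms(4)[of x] by (cases "x \<in> S") auto
    qed
  qed
  then show ?thesis by (simp add: set_integrable_def)
qed

lemma set_borel_measurable_power2:
  fixes f :: "pt \<Rightarrow> real"
  shows "set_borel_measurable lborel S f \<Longrightarrow> set_borel_measurable lborel S (\<lambda>x. (f x)\<^sup>2)"
proof -
  assume "set_borel_measurable lborel S f"
  then have "(\<lambda>x. (indicat_real S x *\<^sub>R f x)\<^sup>2) \<in> borel_measurable lborel"
    by (simp add: set_borel_measurable_def)
  then show ?thesis unfolding set_borel_measurable_def
    by (rule back_subst[where P = "\<lambda>f. f \<in> borel_measurable lborel"]) (auto simp: indicator_def)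
qed

lemma bounded_measurable_L2_on:
  assumes "S \<in> sets borel" "bounded S" "set_borel_measurable lborel S f" "\<And>x. x \<in> S \<Longrightarrow> \<bar>f x\<bar> \<le> K"
  shows "L2_on S f"
proof -
  have "(f x)\<^sup>2 \<le> K\<^sup>2" if "x \<in> S" for x
    using assms(4)[OF that] by (metis abs_ge_zero power2_abs power_mono)
  then have "set_integrable lborel S (\<lambda>x. (f x)\<^sup>2)"
    using assms set_borel_measurable_power2[OF assms(3)]
    by (intro bounded_measurable_set_integrable[where K = "K\<^sup>2"]) auto
  then show ?thesis using assms by (simp add: L2_on_def)
qed

lemma continuous_set_borel_measurable:
  fixes f :: "pt \<Rightarrow> real"
  assumes "S \<in> sets borel" "continuous_on UNIV f"
  shows "set_borel_measurable lborel S f"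
  using assms borel_measurable_continuous_onI[OF assms(2)]
  by (auto simp: set_borel_measurable_def)

lemma continuous_bounded_on:
  fixes f :: "pt \<Rightarrow> real"
  assumes "bounded S" "continuous_on UNIV f"
  obtains K where "\<And>x. x \<in> S \<Longrightarrow> \<bar>f x\<bar> \<le> K"
proof -
  have "compact (f ` closure S)"
    using assms by (intro compact_continuous_image) (auto intro: continuous_on_subset simp: compact_closure)
  then obtain K where "\<forall>y\<in>f ` closure S. norm y \<le> K"
    using compact_imp_bounded bounded_iff by metis
  then show ?thesis using closure_subset that by fastforce
qed

lemma continuous_L2_on:
  assumes "S \<in> sets borel" "bounded S" "continuous_on UNIV f"
  shows "L2_on S f"
  by (metis assms bounded_measurable_L2_on continuous_bounded_on continuous_set_borel_measurable)

lemma continuous_set_integrable: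
  fixes f :: "pt \<Rightarrow> real"
  assumes "S \<in> sets borel" "bounded S" "continuous_on UNIV f"
  shows "set_integrable lborel S f"
  by (metis assms bounded_measurable_set_integrable continuous_bounded_on continuous_set_borel_measurable)

lemma L2_norm_mono:
  assumes "L2_on S f" "T \<subseteq> S" "T \<in> sets borel"
  shows "L2_norm_on T f \<le> L2_norm_on S f"
  unfolding L2_norm_on_def set_lebesgue_integral_def
proof (intro real_sqrt_le_mono integral_mono)
  have i: "set_integrable lborel S (\<lambda>x. (f x)\<^sup>2)" using assms by (simp add: L2_on_def)
  then show "integrable lborel (\<lambda>x. indicat_real S x *\<^sub>R (f x)\<^sup>2)" by (simp add: set_integrable_def)
  show "integrable lborel (\<lambda>x. indicat_real T x *\<^sub>R (f x)\<^sup>2)"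
    using set_integrable_subset[OF i, of T] assms by (simp add: set_integrable_def)
qed (use assms in \<open>auto simp: indicator_def\<close>)

lemma L2_norm_le_sup:
  assumes "S \<in> sets borel" "bounded S" "set_borel_measurable lborel S f" "\<And>x. x \<in> S \<Longrightarrow> \<bar>f x\<bar> \<le> K" "K \<ge> 0"
  shows "L2_norm_on S f \<le> K * sqrt (measure lborel S)"
proof -
  have "(LINT x:S|lborel. (f x)\<^sup>2) \<le> (LINT x:S|lborel. K\<^sup>2)"
  proof (rule set_integral_mono)
    show "set_integrable lborel S (\<lambda>x. (f x)\<^sup>2)"
      using bounded_measurable_L2_on[OF assms(1-4)] by (simp add: L2_on_def)
    show "set_integrable lborel S (\<lambda>x. K\<^sup>2)"
      using assms by (intro continuous_set_integrable) auto
    show "(f x)\<^sup>2 \<le> K\<^sup>2" if "x \<in> S" for x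
      using assms(4)[OF that] by (metis abs_ge_zero power2_abs power_mono)
  qed
  also have "\<dots> = K\<^sup>2 * measure lborel S"
    using assms emeasure_bounded_finite[of S] by (simp add: set_integral_const less_top)
  finally show ?thesis using assms(5)
    unfolding L2_norm_on_def by (metis real_sqrt_le_mono real_sqrt_mult real_sqrt_abs abs_of_nonneg)
qed

text \<open>The part of \<open>S\<close> where the continuous \<open>f\<close> does not vanish is
  open and, by the vanishing integral, null; an open null set is empty.\<close>

lemma continuous_L2_zero:
  fixes f :: "pt \<Rightarrow> real"
  assumes "open S" "bounded S" "continuous_on UNIV f" "L2_norm_on S f = 0" "x \<in> S"
  shows "f x = 0"
proof (rule ccontr)
  assume fx: "f x \<noteq> 0"
  have i: "integrable lborel (\<lambda>x. indicat_real S x *\<^sub>R (f x)\<^sup>2)"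
    using continuous_L2_on[of S f] assms by (auto simp: L2_on_def set_integrable_def)
  have "(LINT x:S|lborel. (f x)\<^sup>2) = 0"
    using assms(4) L2_norm_sq[of S f] by simp
  then have "AE x in lborel. indicat_real S x *\<^sub>R (f x)\<^sup>2 = 0"
    unfolding set_lebesgue_integral_def
    by (subst (asm) integral_nonneg_eq_0_iff_AE) (use i in auto)
  then have ae: "AE x in lborel. x \<notin> S \<inter> f -` (- {0})"
    by eventually_elim (auto simp: indicator_def)
  have op: "open (S \<inter> f -` (- {0}))"
    using assms by (intro open_Int open_vimage) auto
  have "S \<inter> f -` (- {0}) \<in> null_sets lborel"
    using op ae by (subst AE_iff_null_sets) auto
  then have "negligible (S \<inter> f -` (- {0}))"
    by (simp add: negligible_iff_null_sets null_sets_completionI)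
  then show False using open_not_negligible[OF op] fx assms(5) by auto
qed

lemma lborel_integral_affine:
  fixes f :: "pt \<Rightarrow> real"
  assumes "h > 0" "f \<in> borel_measurable borel"
  shows "integral\<^sup>L lborel f = h\<^sup>2 * (LINT y|lborel. f (u + h *\<^sub>R y))"
proof -
  have "integral\<^sup>L lborel f
      = integral\<^sup>L (density (distr lborel borel (\<lambda>x. u + h *\<^sub>R x)) (\<lambda>x. ennreal (\<bar>h\<bar> ^ DIM(pt)))) f"
    using lborel_affine[of h u] assms by simp
  also have "\<dots> = (LINT x|distr lborel borel (\<lambda>x. u + h *\<^sub>R x). h\<^sup>2 *\<^sub>R f x)"
    using assms by (subst integral_density) (auto simp: DIM_cart)
  also have "\<dots> = (LINT y|lborel. h\<^sup>2 *\<^sub>R f (u + h *\<^sub>R y))"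
    using assms by (subst integral_distr) auto
  finally show ?thesis by simp
qed

text \<open>The Jacobian in two dimensions is \<open>h\<^sup>2\<close>, hence a single factor
  \<open>h\<close> after the square root. Together with the chain rule this accounts for the powers
  of \<open>h\<close> in the local estimates.\<close>

lemma L2_norm_affine:
  fixes f :: "pt \<Rightarrow> real"
  assumes h: "h > 0" and f: "continuous_on UNIV f"
  shows "L2_norm_on (ball u (r * h)) f = h * L2_norm_on (ball 0 r) (\<lambda>y. f (u + h *\<^sub>R y))"
proof -
  have fm [measurable]: "f \<in> borel_measurable borel"
    by (rule borel_measurable_continuous_onI[OF f])
  have [measurable]: "ball u (r * h) \<in> sets borel" by simp
  have "(LINT x:ball u (r * h)|lborel. (f x)\<^sup>2) =
     h\<^sup>2 * (LINT y|lborel. indicat_real (ball u (r * h)) (u + h *\<^sub>R y) *\<^sub>R (f (u + h *\<^sub>R y))\<^sup>2)"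
    unfolding set_lebesgue_integral_def
    by (rule lborel_integral_affine[OF h]) measurable
  also have "(\<lambda>y. indicat_real (ball u (r * h)) (u + h *\<^sub>R y)) = indicat_real (ball 0 r)"
    using h by (auto simp: fun_eq_iff indicator_def dist_norm mult.commute)
  finally show ?thesis
    unfolding L2_norm_on_def set_lebesgue_integral_def using h by (simp add: real_sqrt_mult fun_eq_iff)
qed

section \<open>Polynomials in two variables\<close>

definition pidx :: "nat \<Rightarrow> (nat \<times> nat) set" where
  "pidx k = (SIGMA i:{..k}. {..k - i})"

definition mon :: "nat \<times> nat \<Rightarrow> pt \<Rightarrow> real" where
  "mon m x = x $ 1 ^ fst m * x $ 2 ^ snd m"

lemma finite_pidx [simp]: "finite (pidx k)"
  by (simp add: pidx_def)

lemma pidx_iff: "m \<in> pidx k \<longleftrightarrow> fst m + snd m \<le> k"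
  by (cases m) (auto simp: pidx_def)

lemma poly_deg_le_iff: "poly_deg_le k p \<longleftrightarrow> (\<exists>co. p = (\<lambda>x. \<Sum>m\<in>pidx k. co m * mon m x))"
proof -
  have e: "(\<Sum>i\<le>k. \<Sum>j\<le>k - i. co i j * x $ 1 ^ i * x $ 2 ^ j) = (\<Sum>m\<in>pidx k. co (fst m) (snd m) * mon m x)"
    for co and x :: pt
    unfolding pidx_def by (subst sum.Sigma) (auto simp: mon_def mult.assoc intro!: sum.cong)
  show ?thesis
  proof
    assume "poly_deg_le k p"
    then obtain co where "p = (\<lambda>x. \<Sum>m\<in>pidx k. co (fst m) (snd m) * mon m x)"
      unfolding poly_deg_le_def e by auto
    then show "\<exists>co. p = (\<lambda>x. \<Sum>m\<in>pidx k. co m * mon m x)"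
      by (intro exI[of _ "\<lambda>m. co (fst m) (snd m)"])
  next
    assume "\<exists>co. p = (\<lambda>x. \<Sum>m\<in>pidx k. co m * mon m x)"
    then obtain co where p: "p = (\<lambda>x. \<Sum>m\<in>pidx k. co m * mon m x)" by auto
    show "poly_deg_le k p"
      unfolding poly_deg_le_def e by (rule exI[of _ "\<lambda>i j. co (i, j)"]) (simp add: p)
  qed
qed

lemma poly_deg_le_add [intro]:
  "poly_deg_le k p \<Longrightarrow> poly_deg_le k q \<Longrightarrow> poly_deg_le k (\<lambda>x. p x + q x)"
  unfolding poly_deg_le_iff
proof (elim exE)
  fix co co'
  assume "p = (\<lambda>x. \<Sum>m\<in>pidx k. co m * mon m x)" "q = (\<lambda>x. \<Sum>m\<in>pidx k. co' m * mon m x)"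
  then show "\<exists>co. (\<lambda>x. p x + q x) = (\<lambda>x. \<Sum>m\<in>pidx k. co m * mon m x)"
    by (intro exI[of _ "\<lambda>m. co m + co' m"]) (auto simp: algebra_simps sum.distrib)
qed

lemma poly_deg_le_cmult [intro]: "poly_deg_le k p \<Longrightarrow> poly_deg_le k (\<lambda>x. b * p x)"
  unfolding poly_deg_le_iff
proof (elim exE)
  fix co assume "p = (\<lambda>x. \<Sum>m\<in>pidx k. co m * mon m x)"
  then show "\<exists>co. (\<lambda>x. b * p x) = (\<lambda>x. \<Sum>m\<in>pidx k. co m * mon m x)"
    by (intro exI[of _ "\<lambda>m. b * co m"]) (auto simp: algebra_simps sum_distrib_left)
qed

lemma poly_deg_le_mon: "fst m + snd m \<le> k \<Longrightarrow> poly_deg_le k (mon m)"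
proof -
  assume "fst m + snd m \<le> k"
  then have "mon m = (\<lambda>x. \<Sum>l\<in>pidx k. (if l = m then 1 else 0) * mon l x)"
    by (auto simp: fun_eq_iff pidx_iff if_distrib[of "\<lambda>b. b * _"] cong: if_cong)
  then show ?thesis unfolding poly_deg_le_iff by (intro exI[of _ "\<lambda>l. if l = m then 1 else 0"])
qed

lemma poly_deg_le_const [intro, simp]: "poly_deg_le k (\<lambda>_. b)"
  using poly_deg_le_cmult[OF poly_deg_le_mon[of "(0, 0)" k], of b] by (simp add: mon_def)

lemma poly_deg_le_coord: "poly_deg_le (Suc 0) (\<lambda>x. x $ i)"
  using poly_deg_le_mon[of "(1, 0)" 1] poly_deg_le_mon[of "(0, 1)" 1] exhaust_2[of i]
  by (auto simp: mon_def[abs_def])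

lemma poly_deg_le_sum [intro]:
  "(\<And>i. i \<in> I \<Longrightarrow> poly_deg_le k (f i)) \<Longrightarrow> poly_deg_le k (\<lambda>x. \<Sum>i\<in>I. f i x)"
  by (induction I rule: infinite_finite_induct) auto

lemma poly_deg_le_mono: "poly_deg_le k p \<Longrightarrow> k \<le> l \<Longrightarrow> poly_deg_le l p"
proof -
  assume "poly_deg_le k p" "k \<le> l"
  then obtain co where "p = (\<lambda>x. \<Sum>m\<in>pidx k. co m * mon m x)" by (auto simp: poly_deg_le_iff)
  then show ?thesis using \<open>k \<le> l\<close>
    by (auto intro!: poly_deg_le_sum poly_deg_le_cmult poly_deg_le_mon simp: pidx_iff)
qed

lemma poly_deg_le_mult [intro]:
  assumes "poly_deg_le k p" "poly_deg_le l q"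
  shows "poly_deg_le (k + l) (\<lambda>x. p x * q x)"
proof -
  obtain c d where "p = (\<lambda>x. \<Sum>m\<in>pidx k. c m * mon m x)" "q = (\<lambda>x. \<Sum>m\<in>pidx l. d m * mon m x)"
    using assms by (auto simp: poly_deg_le_iff)
  then have "(\<lambda>x. p x * q x) = (\<lambda>x. \<Sum>m\<in>pidx k. \<Sum>n\<in>pidx l. (c m * d n) * mon (fst m + fst n, snd m + snd n) x)"
    by (auto simp: fun_eq_iff sum_product mon_def power_add algebra_simps)
  moreover have "poly_deg_le (k + l) (mon (fst m + fst n, snd m + snd n))" if "m \<in> pidx k" "n \<in> pidx l" for m n
    using that by (intro poly_deg_le_mon) (simp add: pidx_iff)
  ultimately show ?thesis by (auto intro!: poly_deg_le_sum poly_deg_le_cmult)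
qed

lemma poly_deg_le_power: "poly_deg_le k p \<Longrightarrow> poly_deg_le (n * k) (\<lambda>x. p x ^ n)"
  by (induction n) auto

lemma poly_deg_le_affine:
  assumes "poly_deg_le k p" shows "poly_deg_le k (\<lambda>x. p (u + r *\<^sub>R x))"
proof -
  obtain c where p: "p = (\<lambda>x. \<Sum>m\<in>pidx k. c m * mon m x)"
    using assms by (auto simp: poly_deg_le_iff)
  have 1: "poly_deg_le (Suc 0) (\<lambda>x. u $ i + r * x $ i)" for i
    by (intro poly_deg_le_add poly_deg_le_cmult poly_deg_le_coord) auto
  have "poly_deg_le k (\<lambda>x. mon m (u + r *\<^sub>R x))" if "m \<in> pidx k" for m
  proof (rule poly_deg_le_mono)
    show "poly_deg_le (fst m * Suc 0 + snd m * Suc 0) (\<lambda>x. mon m (u + r *\<^sub>R x))"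
      unfolding mon_def vector_add_component vector_scaleR_component real_scaleR_def
      by (intro poly_deg_le_mult poly_deg_le_power 1)
  qed (use that in \<open>simp add: pidx_iff\<close>)
  then show ?thesis unfolding p by (intro poly_deg_le_sum poly_deg_le_cmult)
qed

lemma smooth2_mon: "smooth2 (mon m)"
  unfolding mon_def[abs_def] by (intro smooth2_mult smooth2_power smooth2_coord)

lemma smooth2_poly: "poly_deg_le k p \<Longrightarrow> smooth2 p"
  unfolding poly_deg_le_iff by (auto intro!: smooth2_sum smooth2_mult smooth2_mon)

lemma pd_coord_power: "pd j (\<lambda>x. x $ i ^ n) = (\<lambda>x. if i = j then real n * x $ i ^ (n - 1) else 0)"
  by (rule ext, rule pd_eqI) (auto simp: axis_def intro!: derivative_eq_intros)

lemma pd_mon: "pd j (mon m) = (\<lambda>x. if j = 1 then real (fst m) * mon (fst m - 1, snd m) x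
    else real (snd m) * mon (fst m, snd m - 1) x)"
proof -
  have "pd j (mon m) = (\<lambda>x. pd j (\<lambda>x. x $ 1 ^ fst m) x * x $ 2 ^ snd m + x $ 1 ^ fst m * pd j (\<lambda>x. x $ 2 ^ snd m) x)"
    unfolding mon_def[abs_def] by (rule pd_mult) auto
  then show ?thesis using exhaust_2[of j] by (auto simp: pd_coord_power mon_def fun_eq_iff)
qed

lemma poly_deg_le_pd: "poly_deg_le k p \<Longrightarrow> poly_deg_le (k - 1) (pd i p)"
proof -
  assume "poly_deg_le k p"
  then obtain co where p: "p = (\<lambda>x. \<Sum>m\<in>pidx k. co m * mon m x)" by (auto simp: poly_deg_le_iff)
  have "pd i p = (\<lambda>x. \<Sum>m\<in>pidx k. pd i (\<lambda>x. co m * mon m x) x)"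
    unfolding p by (rule pd_sum) (auto intro: smooth2_mult smooth2_mon)
  also have "\<dots> = (\<lambda>x. \<Sum>m\<in>pidx k. co m * pd i (mon m) x)"
    by (simp add: pd_cmult smooth2_mon)
  finally have e: "pd i p = (\<lambda>x. \<Sum>m\<in>pidx k. co m * pd i (mon m) x)" .
  have "poly_deg_le (k - 1) (pd i (mon m))" if m: "m \<in> pidx k" for m
  proof (cases "i = 1")
    case True
    show ?thesis
    proof (cases "fst m")
      case (Suc n)
      then show ?thesis using m True
        by (auto simp: pd_mon pidx_iff intro!: poly_deg_le_cmult poly_deg_le_mon)
    qed (simp add: pd_mon True)
  next
    case False
    show ?thesis
    proof (cases "snd m")
      case (Suc n)
      then show ?thesis using m False
        by (auto simp: pd_mon pidx_iff intro!: poly_deg_le_cmult poly_deg_le_mon)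
    qed (simp add: pd_mon False)
  qed
  then show ?thesis unfolding e by (intro poly_deg_le_sum poly_deg_le_cmult)
qed

lemma pd_affine: "smooth2 f \<Longrightarrow> pd i (\<lambda>x. f (u + r *\<^sub>R x)) = (\<lambda>x. r * pd i f (u + r *\<^sub>R x))"
proof (rule ext, rule pd_eqI)
  fix x assume f: "smooth2 f"
  have "((\<lambda>t. f ((u + r *\<^sub>R x) + (r * t) *\<^sub>R axis i 1)) has_real_derivative pd i f (u + r *\<^sub>R x) * r) (at 0)"
    by (rule DERIV_chain2[of "\<lambda>t. f ((u + r *\<^sub>R x) + t *\<^sub>R axis i 1)"])
      (auto intro!: derivative_eq_intros smooth2_DERIV0[OF f])
  then show "((\<lambda>t. f (u + r *\<^sub>R (x + t *\<^sub>R axis i 1))) has_real_derivative r * pd i f (u + r *\<^sub>R x)) (at 0)"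
    by (simp add: algebra_simps)
qed

text \<open>A univariate polynomial with infinitely many roots is zero. This is used twice: in the
  first variable with the second one frozen, and then in the second. The open square of side
  \<open>s / 2\<close> in the positive quadrant lies in the ball.\<close>

lemma poly_coeffs_zero:
  assumes s: "s > 0" and z: "\<And>x. x \<in> ball 0 s \<Longrightarrow> (\<Sum>m\<in>pidx k. co m * mon m x) = 0" and m: "m \<in> pidx k"
  shows "co m = 0"
proof -
  obtain i j where ij: "m = (i, j)" "i \<le> k" "j \<le> k - i" using m by (auto simp: pidx_def)
  have van: "\<forall>i\<le>n. c i = 0" if "\<And>x. x \<in> {0<..<s/2} \<Longrightarrow> (\<Sum>i\<le>n. c i * x ^ i) = (0::real)" for c n
  proof (rule ccontr)
    assume "\<not> (\<forall>i\<le>n. c i = 0)"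
    then have "finite {x. (\<Sum>i\<le>n. c i * x ^ i) = 0}"
      by (simp add: polyfun_finite_roots)
    then have "finite {0<..<s/2}"
      by (rule finite_subset[rotated]) (use that in auto)
    then show False using s infinite_Ioo[of 0 "s/2"] by simp
  qed
  have "(\<Sum>j\<le>k - i. co (i, j) * x2 ^ j) = 0" if "x2 \<in> {0<..<s/2}" for x2
  proof -
    have "\<forall>i\<le>k. (\<Sum>j\<le>k - i. co (i, j) * x2 ^ j) = 0"
    proof (rule van)
      fix x1 assume x1: "x1 \<in> {0<..<s/2}"
      define x :: pt where "x = vector [x1, x2]"
      have x: "x $ 1 = x1" "x $ 2 = x2" by (auto simp: x_def)
      have "norm x \<le> \<bar>x $ 1\<bar> + \<bar>x $ 2\<bar>"
        using norm_le_l1_cart[of x] by (simp add: sum_2)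
      then have "x \<in> ball 0 s" using x x1 that by auto
      then have "0 = (\<Sum>m\<in>pidx k. co m * mon m x)" using z by simp
      also have "\<dots> = (\<Sum>i\<le>k. \<Sum>j\<le>k - i. co (i, j) * (x1 ^ i * x2 ^ j))"
        unfolding pidx_def by (subst sum.Sigma) (auto simp: mon_def x intro!: sum.cong)
      finally show "(\<Sum>i\<le>k. (\<Sum>j\<le>k - i. co (i, j) * x2 ^ j) * x1 ^ i) = 0"
        by (simp add: sum_distrib_left sum_distrib_right mult_ac)
    qed
    then show ?thesis using ij by simp
  qed
  then show ?thesis using van[of "\<lambda>j. co (i, j)" "k - i"] ij by auto
qed

lemma poly_zero_if_L2_zero:
  assumes "open S" "bounded S" "S \<noteq> {}" "poly_deg_le k p" "L2_norm_on S p = 0"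
  shows "p = (\<lambda>_. 0)"
proof -
  obtain u where "u \<in> S" using assms(3) by auto
  then obtain s where us: "s > 0" "ball u s \<subseteq> S" using assms(1) open_contains_ball by blast
  have p0: "p x = 0" if "x \<in> ball u s" for x
    using continuous_L2_zero[OF assms(1,2) smooth2_cont[OF smooth2_poly[OF assms(4)]] assms(5)] that us by auto
  have "poly_deg_le k (\<lambda>x. p (u + 1 *\<^sub>R x))" using assms(4) by (rule poly_deg_le_affine)
  then obtain co where co: "(\<lambda>x. p (u + x)) = (\<lambda>x. \<Sum>m\<in>pidx k. co m * mon m x)"
    by (auto simp: poly_deg_le_iff)
  have "co m = 0" if "m \<in> pidx k" for m
  proof (rule poly_coeffs_zero[OF us(1) _ that])
    fix x :: pt assume "x \<in> ball 0 s"
    then show "(\<Sum>m\<in>pidx k. co m * mon m x) = 0"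
      using p0[of "u + x"] fun_cong[OF co, of x] by (simp add: dist_norm)
  qed
  then have "p (u + x) = 0" for x using fun_cong[OF co, of x] by simp
  then have "p x = 0" for x by (metis add_diff_cancel_left' diff_add_cancel add.commute)
  then show ?thesis by auto
qed

lemma set_integral_sum_fun:
  assumes "finite I" "\<And>i. i \<in> I \<Longrightarrow> set_integrable lborel S (f i)"
  shows "(LINT x:S|lborel. (\<Sum>i\<in>I. f i x)) = (\<Sum>i\<in>I. LINT x:S|lborel. f i x)"
  using assms unfolding set_integrable_def set_lebesgue_integral_def scaleR_sum_right
  by (intro Bochner_Integration.integral_sum) auto

text \<open>The Gram matrix of the monomials on the ball is injective, so there is a dual polynomial
  \<open>?\<kappa>\<close> whose inner product with any polynomial of the family is the
  \<open>m\<close>-th coefficient of the latter. Cauchy-Schwarz gives the bound, with the norm of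
  \<open>?\<kappa>\<close> as a constant independent of \<open>co\<close>.\<close>

lemma coeff_bound:
  assumes s: "s > 0" and m: "m \<in> pidx k"
  shows "\<exists>C\<ge>0. \<forall>co. \<bar>co m\<bar> \<le> C * L2_norm_on (ball 0 s) (\<lambda>x. \<Sum>l\<in>pidx k. co l * mon l x)"
proof -
  let ?J = "pidx k" and ?B = "ball 0 s :: pt set"
  define A where "A i j = (LINT x:?B|lborel. mon i x * mon j x)" for i j
  have cm: "continuous_on UNIV (mon i)" for i by (rule smooth2_cont[OF smooth2_mon])
  have int: "set_integrable lborel ?B (\<lambda>x. mon i x * mon j x)" for i j
    by (rule continuous_set_integrable) (auto intro!: continuous_intros cm)
  have inner: "(LINT x:?B|lborel. (\<Sum>i\<in>?J. y i * mon i x) * (\<Sum>j\<in>?J. x' j * mon j x))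
      = (\<Sum>i\<in>?J. y i * (\<Sum>j\<in>?J. A i j * x' j))" for y x'
  proof -
    have "(LINT x:?B|lborel. (\<Sum>i\<in>?J. y i * mon i x) * (\<Sum>j\<in>?J. x' j * mon j x)) =
       (LINT x:?B|lborel. (\<Sum>i\<in>?J. \<Sum>j\<in>?J. (y i * x' j) * (mon i x * mon j x)))"
      unfolding sum_product
      by (rule arg_cong[of _ _ "set_lebesgue_integral lborel ?B"], intro ext sum.cong refl) simp
    also have "\<dots> = (\<Sum>i\<in>?J. LINT x:?B|lborel. (\<Sum>j\<in>?J. (y i * x' j) * (mon i x * mon j x)))"
      by (intro set_integral_sum_fun continuous_set_integrable continuous_intros cm) auto
    also have "\<dots> = (\<Sum>i\<in>?J. \<Sum>j\<in>?J. (y i * x' j) * A i j)"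
    proof (intro sum.cong refl)
      fix i
      have "(LINT x:?B|lborel. (\<Sum>j\<in>?J. (y i * x' j) * (mon i x * mon j x)))
          = (\<Sum>j\<in>?J. LINT x:?B|lborel. (y i * x' j) * (mon i x * mon j x))"
        by (intro set_integral_sum_fun set_integrable_mult_right int) auto
      then show "(LINT x:?B|lborel. (\<Sum>j\<in>?J. (y i * x' j) * (mon i x * mon j x)))
          = (\<Sum>j\<in>?J. (y i * x' j) * A i j)"
        by (simp add: A_def)
    qed
    finally show ?thesis by (simp add: sum_distrib_left mult_ac)
  qed
  have "\<exists>x. \<forall>i\<in>?J. (\<Sum>j\<in>?J. A i j * x j) = (if i = m then 1 else 0)"
  proof (rule square_system_solvable)
    fix x assume x: "\<forall>i\<in>?J. (\<Sum>j\<in>?J. A i j * x j) = 0"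
    let ?p = "\<lambda>y. \<Sum>j\<in>?J. x j * mon j y"
    have "(L2_norm_on ?B ?p)\<^sup>2 = 0"
      unfolding L2_norm_sq unfolding power2_eq_square using inner[of x x] x by simp
    moreover have "continuous_on UNIV ?p" by (intro continuous_intros cm)
    ultimately have "?p y = 0" if "y \<in> ?B" for y
      by (intro continuous_L2_zero[of ?B ?p y] that) (simp_all only: open_ball bounded_ball power_eq_0_iff)
    then show "\<forall>j\<in>?J. x j = 0" using poly_coeffs_zero[OF s] by blast
  qed simp
  then obtain x where x: "\<And>i. i \<in> ?J \<Longrightarrow> (\<Sum>j\<in>?J. A i j * x j) = (if i = m then 1 else 0)" by auto
  let ?\<kappa> = "\<lambda>y. \<Sum>j\<in>?J. x j * mon j y"
  have L2: "L2_on ?B (\<lambda>y. \<Sum>j\<in>?J. co j * mon j y)" for co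
    by (rule continuous_L2_on) (auto intro!: continuous_intros cm)
  have "\<bar>co m\<bar> \<le> L2_norm_on ?B ?\<kappa> * L2_norm_on ?B (\<lambda>y. \<Sum>j\<in>?J. co j * mon j y)" for co
  proof -
    have "co m = (\<Sum>i\<in>?J. co i * (\<Sum>j\<in>?J. A i j * x j))"
      using m by (simp add: x if_distrib[of "\<lambda>b. _ * b"] cong: if_cong)
    then show ?thesis
      using L2_Cauchy_Schwarz[OF L2[of co] L2[of x]] by (simp add: inner mult.commute)
  qed
  then show ?thesis by (intro exI[of _ "L2_norm_on ?B ?\<kappa>"]) auto
qed

lemma coeffs_bound:
  assumes s: "s > 0"
  shows "\<exists>C\<ge>0. \<forall>co. (\<Sum>m\<in>pidx k. \<bar>co m\<bar>) \<le> C * L2_norm_on (ball 0 s) (\<lambda>x. \<Sum>l\<in>pidx k. co l * mon l x)"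
proof -
  have "\<forall>m\<in>pidx k. \<exists>C\<ge>0. \<forall>co. \<bar>co m\<bar> \<le> C * L2_norm_on (ball 0 s) (\<lambda>x. \<Sum>l\<in>pidx k. co l * mon l x)"
    using coeff_bound[OF s] by blast
  from bchoice[OF this] obtain C where C: "\<And>m. m \<in> pidx k \<Longrightarrow> C m \<ge> 0"
    "\<And>m co. m \<in> pidx k \<Longrightarrow> \<bar>co m\<bar> \<le> C m * L2_norm_on (ball 0 s) (\<lambda>x. \<Sum>l\<in>pidx k. co l * mon l x)"
    by blast
  show ?thesis
  proof (intro exI[of _ "sum C (pidx k)"] conjI allI)
    show "sum C (pidx k) \<ge> 0" by (intro sum_nonneg C(1))
    show "(\<Sum>m\<in>pidx k. \<bar>co m\<bar>) \<le> sum C (pidx k) * L2_norm_on (ball 0 s) (\<lambda>x. \<Sum>l\<in>pidx k. co l * mon l x)" for co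
      unfolding sum_distrib_right by (intro sum_mono C(2))
  qed
qed

section \<open>Local solvability with bounds\<close>

text \<open>The principal part with coefficients frozen at a matrix. The zero-order term is left out
  on purpose: it is a perturbation of higher order in the element diameter.\<close>

definition cop :: "real^2^2 \<Rightarrow> (pt \<Rightarrow> real) \<Rightarrow> pt \<Rightarrow> real" where
  "cop A z x = (\<Sum>i\<in>UNIV. \<Sum>j\<in>UNIV. A $ i $ j * pd i (pd j z) x)"

definition C2_bounded :: "real \<Rightarrow> (pt \<Rightarrow> real) \<Rightarrow> bool" where
  "C2_bounded C z \<longleftrightarrow> (\<forall>x\<in>cball 0 1. \<bar>z x\<bar> \<le> C \<and> (\<forall>i. \<bar>pd i z x\<bar> \<le> C) \<and> (\<forall>i j. \<bar>pd i (pd j z) x\<bar> \<le> C))"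

lemma cop_add: "smooth2 z \<Longrightarrow> smooth2 w \<Longrightarrow> cop A (\<lambda>x. z x + w x) = (\<lambda>x. cop A z x + cop A w x)"
  by (simp add: cop_def[abs_def] pd_add smooth2_pd sum.distrib algebra_simps)

lemma cop_cmult: "smooth2 z \<Longrightarrow> cop A (\<lambda>x. b * z x) = (\<lambda>x. b * cop A z x)"
  by (simp add: cop_def[abs_def] pd_cmult smooth2_pd sum_distrib_left mult_ac)

lemma C2_bounded_add: "smooth2 z \<Longrightarrow> smooth2 w \<Longrightarrow> C2_bounded C z \<Longrightarrow> C2_bounded D w \<Longrightarrow>
    C2_bounded (C + D) (\<lambda>x. z x + w x)"
  unfolding C2_bounded_def
  by (simp add: pd_add smooth2_pd) (smt (verit, ccfv_SIG) abs_triangle_ineq)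

lemma C2_bounded_cmult: "smooth2 z \<Longrightarrow> C2_bounded C z \<Longrightarrow> C2_bounded (\<bar>b\<bar> * C) (\<lambda>x. b * z x)"
  unfolding C2_bounded_def by (simp add: pd_cmult smooth2_pd abs_mult mult_left_mono)

lemma C2_bounded_mono: "C2_bounded C z \<Longrightarrow> C \<le> D \<Longrightarrow> C2_bounded D z"
  unfolding C2_bounded_def by (meson order_trans)

lemma C2_bounded_exists:
  assumes "smooth2 z" shows "\<exists>C\<ge>0. C2_bounded C z"
proof -
  have "\<exists>K. \<forall>x\<in>cball 0 1. \<bar>f x\<bar> \<le> K" if sf: "smooth2 f" for f
  proof -
    obtain K where "\<And>x. x \<in> cball 0 1 \<Longrightarrow> \<bar>f x\<bar> \<le> K"
      by (rule continuous_bounded_on[OF bounded_cball smooth2_cont[OF sf]]) blast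
    then show ?thesis by blast
  qed
  note bd = this
  obtain K0 where K0: "\<And>x. x \<in> cball 0 1 \<Longrightarrow> \<bar>z x\<bar> \<le> K0" using bd[OF assms] by blast
  have "\<forall>i. \<exists>K. \<forall>x\<in>cball 0 1. \<bar>pd i z x\<bar> \<le> K" using bd[OF smooth2_pd[OF assms]] by blast
  from choice[OF this] obtain K1 where K1: "\<And>i x. x \<in> cball 0 1 \<Longrightarrow> \<bar>pd i z x\<bar> \<le> K1 i" by blast
  have "\<forall>p. \<exists>K. \<forall>x\<in>cball 0 1. \<bar>pd (fst p) (pd (snd p) z) x\<bar> \<le> K"
    using bd[OF smooth2_pd[OF smooth2_pd[OF assms]]] by blast
  from choice[OF this] obtain K where K': "\<And>p x. x \<in> cball 0 1 \<Longrightarrow> \<bar>pd (fst p) (pd (snd p) z) x\<bar> \<le> K p" by blast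
  define K2 where "K2 i j = K (i, j)" for i j
  have K2: "\<bar>pd i (pd j z) x\<bar> \<le> K2 i j" if "x \<in> cball 0 1" for i j x
    using K'[OF that, of "(i, j)"] by (simp add: K2_def)
  note K = K0 K1 K2
  define C where "C = \<bar>K0\<bar> + (\<Sum>i\<in>UNIV. \<bar>K1 i\<bar>) + (\<Sum>i\<in>UNIV. \<Sum>j\<in>UNIV. \<bar>K2 i j\<bar>)"
  have s1: "\<bar>K1 i\<bar> \<le> (\<Sum>i\<in>UNIV. \<bar>K1 i\<bar>)" for i by (rule member_le_sum) auto
  have s2: "\<bar>K2 i j\<bar> \<le> (\<Sum>i\<in>UNIV. \<Sum>j\<in>UNIV. \<bar>K2 i j\<bar>)" for i j
    using member_le_sum[of i UNIV "\<lambda>i. \<Sum>j\<in>UNIV. \<bar>K2 i j\<bar>"] member_le_sum[of j UNIV "\<lambda>j. \<bar>K2 i j\<bar>"]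
    by (simp add: sum_nonneg) 
  have n: "0 \<le> (\<Sum>i\<in>UNIV. \<bar>K1 i\<bar>)" "0 \<le> (\<Sum>i\<in>UNIV. \<Sum>j\<in>UNIV. \<bar>K2 i j\<bar>)"
    by (auto intro!: sum_nonneg)
  have "C2_bounded C z" unfolding C2_bounded_def
  proof (intro ballI conjI allI)
    fix x :: pt assume x: "x \<in> cball 0 1"
    show "\<bar>z x\<bar> \<le> C" using K(1)[OF x] n unfolding C_def by linarith
    show "\<bar>pd i z x\<bar> \<le> C" for i using K(2)[OF x, of i] s1[of i] n unfolding C_def by linarith
    show "\<bar>pd i (pd j z) x\<bar> \<le> C" for i j using K(3)[OF x, of i j] s2[of i j] n unfolding C_def by linarith
  qed
  then show ?thesis using n by (intro exI[of _ C]) (auto simp: C_def)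
qed

section \<open>Polynomial solutions of constant-coefficient equations\<close>

definition bmon :: "2 \<Rightarrow> 2 \<Rightarrow> nat \<Rightarrow> nat \<Rightarrow> pt \<Rightarrow> real" where
  "bmon a b m n x = x $ a ^ m * x $ b ^ n"

lemma smooth2_bmon: "smooth2 (bmon a b m n)"
  unfolding bmon_def[abs_def] by (intro smooth2_mult smooth2_power smooth2_coord)

lemma poly_deg_le_bmon: "poly_deg_le (m + n) (bmon a b m n)"
proof -
  have "poly_deg_le (m * Suc 0 + n * Suc 0) (\<lambda>x. x $ a ^ m * x $ b ^ n)"
    by (intro poly_deg_le_mult poly_deg_le_power poly_deg_le_coord)
  then show ?thesis by (simp add: bmon_def[abs_def])
qed

lemma pd_bmon:
  assumes "a \<noteq> b"
  shows "pd a (bmon a b m n) = (\<lambda>x. real m * bmon a b (m - 1) n x)"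
    "pd b (bmon a b m n) = (\<lambda>x. real n * bmon a b m (n - 1) x)"
proof -
  have e: "pd j (bmon a b m n) = (\<lambda>x. pd j (\<lambda>x. x $ a ^ m) x * x $ b ^ n + x $ a ^ m * pd j (\<lambda>x. x $ b ^ n) x)" for j
    unfolding bmon_def[abs_def] by (rule pd_mult) auto
  show "pd a (bmon a b m n) = (\<lambda>x. real m * bmon a b (m - 1) n x)"
    "pd b (bmon a b m n) = (\<lambda>x. real n * bmon a b m (n - 1) x)"
    unfolding e pd_coord_power using assms by (auto simp: bmon_def fun_eq_iff)
qed

lemma UNIV_two: "a \<noteq> b \<Longrightarrow> (UNIV :: 2 set) = {a, b}"
proof -
  assume "a \<noteq> b"
  then have "x = a \<or> x = b" for x
    using exhaust_2[of a] exhaust_2[of b] exhaust_2[of x] by auto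
  then show ?thesis by auto
qed

text \<open>Writing the exponent as \<open>m + 2\<close> keeps the leading term free of truncated
  subtraction. The truncated \<open>n - 1\<close> and \<open>n - 2\<close> do no harm, since the
  factors in front of them vanish where truncation occurs.\<close>

lemma cop_bmon:
  assumes "a \<noteq> b"
  shows "cop A (bmon a b (m + 2) n) x = A $ a $ a * real (m + 2) * real (m + 1) * bmon a b m n x
    + ((A $ a $ b + A $ b $ a) * real (m + 2)) * (real n * bmon a b (m + 1) (n - 1) x)
    + A $ b $ b * (real n * real (n - 1) * bmon a b (m + 2) (n - 2) x)"
proof -
  have "pd i (\<lambda>x. c * bmon a b m n x) = (\<lambda>x. c * pd i (bmon a b m n) x)" for i c m n
    by (rule pd_cmult) (rule smooth2_bmon)
  note pd2 = pd_bmon[OF assms] this pd_bmon[OF assms]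
  have ar: "m + 2 - 1 = m + 1" "m + 1 - 1 = m" "n - 1 - 1 = n - 2" by simp_all
  have "pd a (pd a (bmon a b (m + 2) n)) x = real (m + 2) * (real (m + 1) * bmon a b m n x)"
    "pd a (pd b (bmon a b (m + 2) n)) x = real n * (real (m + 2) * bmon a b (m + 1) (n - 1) x)"
    "pd b (pd a (bmon a b (m + 2) n)) x = real (m + 2) * (real n * bmon a b (m + 1) (n - 1) x)"
    "pd b (pd b (bmon a b (m + 2) n)) x = real n * (real (n - 1) * bmon a b (m + 2) (n - 2) x)"
    unfolding pd2 ar by (rule refl)+
  then show ?thesis
    unfolding cop_def UNIV_two[OF assms] using assms by (simp add: algebra_simps)
qed

text \<open>Only the coefficient of \<^term>\<open>pd a (pd a z)\<close> has to be bounded away from zero: correcting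
  \<^term>\<open>bmon a b (m + 2) n\<close> produces residuals of smaller degree in the other variable, so the
  correction terminates and needs no ellipticity.\<close>

lemma solve_bmon:
  assumes ab: "a \<noteq> b" and \<eta>: "\<eta> > 0" and B: "B \<ge> 0"
  shows "\<exists>C\<ge>0. \<forall>A. (\<forall>i j. \<bar>A $ i $ j\<bar> \<le> B) \<longrightarrow> \<bar>A $ a $ a\<bar> \<ge> \<eta> \<longrightarrow>
    (\<exists>z. poly_deg_le (m + n + 2) z \<and> C2_bounded C z \<and> cop A z = bmon a b m n)"
proof (induction n arbitrary: m rule: less_induct)
  case (less n)
  let ?P = "\<lambda>A::real^2^2. (\<forall>i j. \<bar>A $ i $ j\<bar> \<le> B) \<and> \<bar>A $ a $ a\<bar> \<ge> \<eta>"
  have zero: "poly_deg_le l (\<lambda>_. 0) \<and> C2_bounded 0 (\<lambda>_. 0) \<and> cop A (\<lambda>_. 0) = (\<lambda>_. 0)" for l A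
    by (auto simp: C2_bounded_def cop_def[abs_def] pd_const)
  \<comment> \<open>For \<open>c = 0\<close> the zero function is a solution. This alternative
    covers the small \<open>n\<close> for which truncated subtraction violates the other
    one.\<close>
  have scale: "\<exists>C\<ge>0. \<forall>A. ?P A \<longrightarrow> (\<exists>z. poly_deg_le (m + n + 2) z \<and> C2_bounded C z \<and> cop A z = (\<lambda>x. c * bmon a b m' n' x))"
    if "c = 0 \<or> n' < n \<and> m' + n' + 2 \<le> m + n + 2" for c m' n'
  proof (cases "c = 0")
    case True
    then show ?thesis using zero by (intro exI[of _ 0]) auto
  next
    case False
    with that have n': "n' < n" "m' + n' + 2 \<le> m + n + 2" by auto
    obtain C where C: "C \<ge> 0" "\<And>A. ?P A \<Longrightarrow> \<exists>z. poly_deg_le (m' + n' + 2) z \<and> C2_bounded C z \<and> cop A z = bmon a b m' n'"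
      using less[OF n'(1), of m'] by auto
    show ?thesis
    proof (intro exI[of _ "\<bar>c\<bar> * C"] conjI allI impI)
      show "0 \<le> \<bar>c\<bar> * C" using C by simp
      fix A :: "real^2^2" assume "?P A"
      then obtain z where z: "poly_deg_le (m' + n' + 2) z" "C2_bounded C z" "cop A z = bmon a b m' n'"
        using C(2) by blast
      have "smooth2 z" using z(1) by (rule smooth2_poly)
      then have "C2_bounded (\<bar>c\<bar> * C) (\<lambda>x. c * z x)" "cop A (\<lambda>x. c * z x) = (\<lambda>x. c * bmon a b m' n' x)"
        using z by (auto simp: C2_bounded_cmult cop_cmult)
      moreover have "poly_deg_le (m + n + 2) (\<lambda>x. c * z x)"
        using poly_deg_le_mono[OF z(1) n'(2)] by auto
      ultimately show "\<exists>z. poly_deg_le (m + n + 2) z \<and> C2_bounded (\<bar>c\<bar> * C) z \<and> cop A z = (\<lambda>x. c * bmon a b m' n' x)"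
        by blast
    qed
  qed
  obtain C1 where C1: "C1 \<ge> 0" "\<And>A. ?P A \<Longrightarrow> \<exists>z. poly_deg_le (m + n + 2) z \<and> C2_bounded C1 z \<and>
      cop A z = (\<lambda>x. real n * bmon a b (m + 1) (n - 1) x)"
    using scale[of "real n" "n - 1" "m + 1"] by fastforce
  obtain C2 where C2: "C2 \<ge> 0" "\<And>A. ?P A \<Longrightarrow> \<exists>z. poly_deg_le (m + n + 2) z \<and> C2_bounded C2 z \<and>
      cop A z = (\<lambda>x. (real n * real (n - 1)) * bmon a b (m + 2) (n - 2) x)"
  proof -
    have "real n * real (n - 1) = 0 \<or> n - 2 < n \<and> (m + 2) + (n - 2) + 2 \<le> m + n + 2"
      by (cases "n \<le> 1") auto
    then show ?thesis using scale[of "real n * real (n - 1)" "n - 2" "m + 2"] that by meson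
  qed
  obtain C0 where C0: "C0 \<ge> 0" "C2_bounded C0 (bmon a b (m + 2) n)"
    using C2_bounded_exists[OF smooth2_bmon] by blast
  define N where "N = real (m + 2)"
  \<comment> \<open>\<open>C0\<close>, \<open>C1\<close> and \<open>C2\<close> bound the monomial
    and its two corrections, \<open>2 * B * N\<close> and \<open>B\<close> the coefficients of the
    corrections, and \<open>1 / \<eta>\<close> the final division by the leading
    coefficient.\<close>
  define C where "C = (1 / \<eta>) * (C0 + (2 * B * N) * C1 + B * C2)"
  have N: "N \<ge> 1" by (simp add: N_def)
  show ?case
  proof (intro exI[of _ C] conjI allI impI)
    show "C \<ge> 0" using C0 C1 C2 B \<eta> N by (simp add: C_def)
    fix A :: "real^2^2" assume A: "\<forall>i j. \<bar>A $ i $ j\<bar> \<le> B" "\<bar>A $ a $ a\<bar> \<ge> \<eta>"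
    obtain z1 where z1: "poly_deg_le (m + n + 2) z1" "C2_bounded C1 z1"
      "cop A z1 = (\<lambda>x. real n * bmon a b (m + 1) (n - 1) x)" using C1(2)[of A] A by auto
    obtain z2 where z2: "poly_deg_le (m + n + 2) z2" "C2_bounded C2 z2"
      "cop A z2 = (\<lambda>x. (real n * real (n - 1)) * bmon a b (m + 2) (n - 2) x)" using C2(2)[of A] A by auto
    \<comment> \<open>\<open>?\<alpha>\<close> and \<open>?\<beta>\<close> cancel the mixed
      derivatives and the pure second derivative in direction \<open>b\<close>. What remains is a
      multiple of \<open>bmon a b m n\<close>, which \<open>?\<gamma>\<close> normalizes.\<close>
    let ?\<alpha> = "- ((A $ a $ b + A $ b $ a) * N)" and ?\<beta> = "- A $ b $ b"
    let ?\<gamma> = "1 / (A $ a $ a * N * real (m + 1))"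
    define w where "w = (\<lambda>x. (bmon a b (m + 2) n x + ?\<alpha> * z1 x) + ?\<beta> * z2 x)"
    have s3: "smooth2 z1" "smooth2 z2" "smooth2 (bmon a b (m + 2) n)"
      by (rule smooth2_poly[OF z1(1)], rule smooth2_poly[OF z2(1)], rule smooth2_bmon)
    have s5: "smooth2 (\<lambda>x. ?\<alpha> * z1 x)" "smooth2 (\<lambda>x. ?\<beta> * z2 x)"
      by (rule smooth2_mult[OF smooth2_const s3(1)], rule smooth2_mult[OF smooth2_const s3(2)])
    note sm = s3 s5 smooth2_add[OF s3(3) s5(1)]
    have sw: "smooth2 w" unfolding w_def by (rule smooth2_add[OF sm(6,5)])
    have nz: "A $ a $ a \<noteq> 0" using A \<eta> by auto
    have "cop A w x = (A $ a $ a * N * real (m + 1)) * bmon a b m n x" for x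
    proof -
      have "cop A w x = (cop A (bmon a b (m + 2) n) x + ?\<alpha> * cop A z1 x) + ?\<beta> * cop A z2 x"
        unfolding w_def cop_add[OF sm(6,5)] cop_add[OF sm(3,4)] cop_cmult[OF sm(1)] cop_cmult[OF sm(2)] ..
      then show ?thesis
        unfolding z1(3) z2(3) cop_bmon[OF ab] N_def by (simp add: algebra_simps)
    qed
    then have "cop A (\<lambda>x. ?\<gamma> * w x) = bmon a b m n"
      unfolding cop_cmult[OF sw] using nz N by (auto simp: fun_eq_iff)
    moreover have "poly_deg_le (m + n + 2) (\<lambda>x. ?\<gamma> * w x)"
      unfolding w_def using z1(1) z2(1) poly_deg_le_bmon[of "m + 2" n a b]
      by (intro poly_deg_le_cmult poly_deg_le_add) (auto simp: add_ac)
    moreover have "C2_bounded C (\<lambda>x. ?\<gamma> * w x)"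
    proof -
      have bw: "C2_bounded (C0 + \<bar>?\<alpha>\<bar> * C1 + \<bar>?\<beta>\<bar> * C2) w"
        unfolding w_def using sm C0(2) z1(2) z2(2) by (intro C2_bounded_add C2_bounded_cmult)
      have "\<bar>?\<alpha>\<bar> \<le> 2 * B * N"
      proof -
        have "\<bar>A $ a $ b + A $ b $ a\<bar> \<le> 2 * B" using A(1) by (smt (verit) abs_triangle_ineq)
        then show ?thesis using N by (simp add: abs_mult mult_right_mono)
      qed
      moreover have "\<bar>?\<beta>\<bar> \<le> B" using A(1) by simp
      ultimately have b1: "C0 + \<bar>?\<alpha>\<bar> * C1 + \<bar>?\<beta>\<bar> * C2 \<le> C0 + (2 * B * N) * C1 + B * C2"
        using C1(1) C2(1) by (intro add_mono mult_right_mono) auto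
      have "\<eta> * (1 * 1) \<le> \<bar>A $ a $ a\<bar> * (N * real (m + 1))"
        using A(2) N \<eta> by (intro mult_mono) auto
      then have "\<bar>?\<gamma>\<bar> \<le> 1 / \<eta>" using \<eta> N by (simp add: abs_mult frac_le mult.assoc)
      then have "\<bar>?\<gamma>\<bar> * (C0 + \<bar>?\<alpha>\<bar> * C1 + \<bar>?\<beta>\<bar> * C2) \<le> C"
        unfolding C_def using b1 \<eta> C0 C1 C2 by (intro mult_mono) auto
      then show ?thesis by (rule C2_bounded_mono[OF C2_bounded_cmult[OF sw bw]])
    qed
    ultimately show "\<exists>z. poly_deg_le (m + n + 2) z \<and> C2_bounded C z \<and> cop A z = bmon a b m n" by blast
  qed
qed

text \<open>Which diagonal entry is bounded below may vary from element to element, so one constant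
  has to serve both choices; the monomial is read with the coordinates in either order.\<close>

lemma solve_mon:
  assumes \<eta>: "\<eta> > 0" and B: "B \<ge> 0"
  shows "\<exists>C\<ge>0. \<forall>(A :: real^2^2) a. (\<forall>i j. \<bar>A $ i $ j\<bar> \<le> B) \<longrightarrow> \<bar>A $ a $ a\<bar> \<ge> \<eta> \<longrightarrow>
    (\<exists>z. poly_deg_le (fst m + snd m + 2) z \<and> C2_bounded C z \<and> cop A z = mon m)"
proof -
  have e: "mon m = bmon 1 2 (fst m) (snd m)" "mon m = bmon 2 1 (snd m) (fst m)"
    by (auto simp: mon_def bmon_def fun_eq_iff)
  obtain C where C: "C \<ge> 0" "\<And>A. (\<forall>i j. \<bar>A $ i $ j\<bar> \<le> B) \<Longrightarrow> \<bar>A $ 1 $ 1\<bar> \<ge> \<eta> \<Longrightarrow>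
    (\<exists>z. poly_deg_le (fst m + snd m + 2) z \<and> C2_bounded C z \<and> cop A z = mon m)"
    using solve_bmon[OF _ \<eta> B, of 1 2 "fst m" "snd m"] unfolding e(1)[symmetric] by auto
  obtain D where D: "D \<ge> 0" "\<And>A. (\<forall>i j. \<bar>A $ i $ j\<bar> \<le> B) \<Longrightarrow> \<bar>A $ 2 $ 2\<bar> \<ge> \<eta> \<Longrightarrow>
    (\<exists>z. poly_deg_le (snd m + fst m + 2) z \<and> C2_bounded D z \<and> cop A z = mon m)"
    using solve_bmon[OF _ \<eta> B, of 2 1 "snd m" "fst m"] unfolding e(2)[symmetric] by auto
  show ?thesis
  proof (intro exI[of _ "max C D"] conjI allI impI)
    show "max C D \<ge> 0" using C by simp
    fix A :: "real^2^2" and a assume A: "\<forall>i j. \<bar>A $ i $ j\<bar> \<le> B" "\<eta> \<le> \<bar>A $ a $ a\<bar>"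
    have "a = 1 \<or> a = 2" using exhaust_2 by blast
    then show "\<exists>z. poly_deg_le (fst m + snd m + 2) z \<and> C2_bounded (max C D) z \<and> cop A z = mon m"
    proof
      assume "a = 1"
      then obtain z where "poly_deg_le (fst m + snd m + 2) z" "C2_bounded C z" "cop A z = mon m"
        using C(2)[OF A(1)] A(2) by auto
      then show ?thesis using C2_bounded_mono[of C z "max C D"] by auto
    next
      assume "a = 2"
      then obtain z where "poly_deg_le (snd m + fst m + 2) z" "C2_bounded D z" "cop A z = mon m"
        using D(2)[OF A(1)] A(2) by auto
      then show ?thesis using C2_bounded_mono[of D z "max C D"] by (auto simp: add.commute)
    qed
  qed
qed

lemma cop_sum:
  assumes "finite I" "\<And>i. i \<in> I \<Longrightarrow> smooth2 (z i)"
  shows "cop A (\<lambda>x. \<Sum>i\<in>I. z i x) = (\<lambda>x. \<Sum>i\<in>I. cop A (z i) x)"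
  using assms
proof (induction I rule: finite_induct)
  case empty
  then show ?case by (auto simp: cop_def[abs_def] pd_const)
next
  case (insert i I)
  then show ?case using cop_add[of "z i" "\<lambda>x. \<Sum>i\<in>I. z i x" A] smooth2_sum[of I z] by simp
qed

lemma C2_bounded_sum:
  assumes "finite I" "\<And>i. i \<in> I \<Longrightarrow> smooth2 (z i)" "\<And>i. i \<in> I \<Longrightarrow> C2_bounded (C i) (z i)"
  shows "C2_bounded (sum C I) (\<lambda>x. \<Sum>i\<in>I. z i x)"
  using assms
proof (induction I rule: finite_induct)
  case empty
  then show ?case by (auto simp: C2_bounded_def pd_const)
next
  case (insert i I)
  have "smooth2 (z i)" "smooth2 (\<lambda>x. \<Sum>i\<in>I. z i x)" "C2_bounded (C i) (z i)"
    "C2_bounded (sum C I) (\<lambda>x. \<Sum>i\<in>I. z i x)"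
    using insert smooth2_sum[of I z] by auto
  from C2_bounded_add[OF this] show ?case using insert.hyps by simp
qed

lemma solve_poly_unit:
  assumes \<eta>: "\<eta> > 0" and B: "B \<ge> 0"
  shows "\<exists>C\<ge>0. \<forall>(A :: real^2^2) a co. (\<forall>i j. \<bar>A $ i $ j\<bar> \<le> B) \<longrightarrow> \<bar>A $ a $ a\<bar> \<ge> \<eta> \<longrightarrow>
    (\<exists>z. poly_deg_le (n + 2) z \<and> C2_bounded (C * (\<Sum>m\<in>pidx n. \<bar>co m\<bar>)) z \<and>
       cop A z = (\<lambda>x. \<Sum>m\<in>pidx n. co m * mon m x))"
proof -
  define Q where "Q m C \<longleftrightarrow> 0 \<le> C \<and> (\<forall>(A :: real^2^2) a. (\<forall>i j. \<bar>A $ i $ j\<bar> \<le> B) \<longrightarrow> \<bar>A $ a $ a\<bar> \<ge> \<eta> \<longrightarrow>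
    (\<exists>z. poly_deg_le (fst m + snd m + 2) z \<and> C2_bounded C z \<and> cop A z = mon m))" for m C
  have "\<forall>m. \<exists>C. Q m C" using solve_mon[OF \<eta> B] unfolding Q_def by (intro allI)
  then obtain C where Q: "\<And>m. Q m (C m)" by metis
  have C1: "C m \<ge> 0" for m by (rule conjunct1[OF Q[unfolded Q_def]])
  have C2: "\<exists>z. poly_deg_le (fst m + snd m + 2) z \<and> C2_bounded (C m) z \<and> cop A z = mon m"
    if "\<forall>i j. \<bar>A $ i $ j\<bar> \<le> B" "\<bar>A $ a $ a\<bar> \<ge> \<eta>" for m and A :: "real^2^2" and a
    by (rule conjunct2[OF Q[unfolded Q_def], THEN spec, THEN spec, THEN mp, THEN mp, OF that])
  note C = C1 C2
  define K where "K = sum C (pidx n)"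
  have CK: "C m \<le> K" if "m \<in> pidx n" for m
    unfolding K_def using that C(1) by (intro member_le_sum) auto
  show ?thesis
  proof (intro exI[of _ K] conjI allI impI)
    show "K \<ge> 0" unfolding K_def by (intro sum_nonneg C(1))
    fix A :: "real^2^2" and a co assume A: "\<forall>i j. \<bar>A $ i $ j\<bar> \<le> B" "\<eta> \<le> \<bar>A $ a $ a\<bar>"
    define R where "R m z \<longleftrightarrow> poly_deg_le (fst m + snd m + 2) z \<and> C2_bounded (C m) z \<and> cop A z = mon m" for m z
    have "\<forall>m. \<exists>z. R m z" unfolding R_def by (intro allI C(2)[OF A])
    then obtain z where R: "\<And>m. R m (z m)" by metis
    then have z: "\<And>m. poly_deg_le (fst m + snd m + 2) (z m)" "\<And>m. C2_bounded (C m) (z m)" "\<And>m. cop A (z m) = mon m"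
      unfolding R_def by simp_all
    have sz: "smooth2 (z m)" for m using z(1) by (rule smooth2_poly)
    let ?w = "\<lambda>x. \<Sum>m\<in>pidx n. co m * z m x"
    have "poly_deg_le (n + 2) ?w"
    proof (intro poly_deg_le_sum poly_deg_le_cmult)
      fix m assume "m \<in> pidx n"
      then show "poly_deg_le (n + 2) (z m)" using poly_deg_le_mono[OF z(1)[of m]] by (simp add: pidx_iff)
    qed
    moreover have "C2_bounded (\<Sum>m\<in>pidx n. \<bar>co m\<bar> * C m) ?w"
      by (intro C2_bounded_sum C2_bounded_cmult z(2) sz smooth2_mult smooth2_const) simp
    moreover have "(\<Sum>m\<in>pidx n. \<bar>co m\<bar> * C m) \<le> K * (\<Sum>m\<in>pidx n. \<bar>co m\<bar>)"
      unfolding sum_distrib_left by (intro sum_mono) (use CK in \<open>simp add: mult.commute[of "\<bar>_\<bar>"] mult_right_mono\<close>)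
    moreover have "cop A ?w = (\<lambda>x. \<Sum>m\<in>pidx n. co m * mon m x)"
      by (subst cop_sum) (auto simp: cop_cmult sz z(3))
    ultimately show "\<exists>z. poly_deg_le (n + 2) z \<and> C2_bounded (K * (\<Sum>m\<in>pidx n. \<bar>co m\<bar>)) z \<and>
       cop A z = (\<lambda>x. \<Sum>m\<in>pidx n. co m * mon m x)"
      using C2_bounded_mono by blast
  qed
qed

section \<open>Scaling of the local estimates\<close>

definition lift_bound :: "nat \<Rightarrow> real \<Rightarrow> real \<Rightarrow> real \<Rightarrow> real \<Rightarrow> bool" where
  "lift_bound n \<eta> B \<rho> C \<longleftrightarrow> (\<forall>(A :: real^2^2) a (u :: pt) (h :: real) q.
    (\<forall>i j. \<bar>A $ i $ j\<bar> \<le> B) \<longrightarrow> \<bar>A $ a $ a\<bar> \<ge> \<eta> \<longrightarrow> h > 0 \<longrightarrow> poly_deg_le n q \<longrightarrow>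
    (\<exists>z. poly_deg_le (n + 2) z \<and> cop A z = q \<and> (\<forall>x\<in>cball u h.
        \<bar>z x\<bar> \<le> C * h * L2_norm_on (ball u (\<rho> * h)) q \<and>
        (\<forall>i. \<bar>pd i z x\<bar> \<le> C * L2_norm_on (ball u (\<rho> * h)) q) \<and>
        (\<forall>i j. \<bar>pd i (pd j z) x\<bar> \<le> C / h * L2_norm_on (ball u (\<rho> * h)) q))))"

text \<open>The equation is transported to the unit ball by \<open>x = u + h *\<^sub>R y\<close>,
  solved there, and carried back with the factor \<open>h\<^sup>2\<close>, which undoes the two
  chain-rule factors \<open>1 / h\<close>. The norm of the transported datum brings another
  \<open>1 / h\<close>, so values, first and second derivatives have sizes \<open>h\<close>,
  \<open>1\<close> and \<open>1 / h\<close>. The datum is measured on the ball of radius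
  \<open>\<rho> * h\<close>, which fits inside an element; the bounds hold on the ball of radius
  \<open>h\<close>, which covers it.\<close>

lemma local_lift:
  assumes \<eta>: "\<eta> > 0" and B: "B \<ge> 0" and \<rho>: "\<rho> > 0"
  shows "\<exists>C\<ge>0. lift_bound n \<eta> B \<rho> C"
proof -
  obtain C1 where C1: "C1 \<ge> 0" "\<And>A a co. (\<forall>i j. \<bar>A $ i $ j\<bar> \<le> B) \<Longrightarrow> \<bar>A $ a $ a\<bar> \<ge> \<eta> \<Longrightarrow>
    (\<exists>z. poly_deg_le (n + 2) z \<and> C2_bounded (C1 * (\<Sum>m\<in>pidx n. \<bar>co m\<bar>)) z \<and>
       cop A z = (\<lambda>x. \<Sum>m\<in>pidx n. co m * mon m x))"
    using solve_poly_unit[OF \<eta> B, of n] by blast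
  obtain C2 where C2: "C2 \<ge> 0" "\<And>co. (\<Sum>m\<in>pidx n. \<bar>co m\<bar>) \<le> C2 * L2_norm_on (ball 0 \<rho>) (\<lambda>x. \<Sum>l\<in>pidx n. co l * mon l x)"
    using coeffs_bound[OF \<rho>, of n] by blast
  show ?thesis
    unfolding lift_bound_def
  proof (intro exI[of _ "C1 * C2"] conjI allI impI)
    show "C1 * C2 \<ge> 0" using C1 C2 by simp
    fix A :: "real^2^2" and a and u :: pt and h :: real and q assume A: "\<forall>i j. \<bar>A $ i $ j\<bar> \<le> B" "\<eta> \<le> \<bar>A $ a $ a\<bar>" and h: "h > 0" and q: "poly_deg_le n q"
    let ?N = "L2_norm_on (ball u (\<rho> * h)) q"
    obtain co where co: "(\<lambda>y. q (u + h *\<^sub>R y)) = (\<lambda>x. \<Sum>m\<in>pidx n. co m * mon m x)"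
      using poly_deg_le_affine[OF q, of u h] by (auto simp: poly_deg_le_iff)
    obtain z where z: "poly_deg_le (n + 2) z" "C2_bounded (C1 * (\<Sum>m\<in>pidx n. \<bar>co m\<bar>)) z" "cop A z = (\<lambda>y. q (u + h *\<^sub>R y))"
      using C1(2)[OF A, of co] co by auto
    have "L2_norm_on (ball 0 \<rho>) (\<lambda>y. q (u + h *\<^sub>R y)) = ?N / h"
      using L2_norm_affine[OF h smooth2_cont[OF smooth2_poly[OF q]], of u \<rho>] h by simp
    then have "C1 * (\<Sum>m\<in>pidx n. \<bar>co m\<bar>) \<le> C1 * (C2 * (?N / h))"
      using C2(2)[of co] C1(1) co by (intro mult_left_mono) auto
    then have zb: "C2_bounded (C1 * C2 / h * ?N) z"
      using C2_bounded_mono[OF z(2)] by simp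
    have sz: "smooth2 z" using z(1) by (rule smooth2_poly)
    define y where "y x = - (1/h) *\<^sub>R u + (1/h) *\<^sub>R x" for x :: pt
    define w where "w = (\<lambda>x. h\<^sup>2 * z (y x))"
    have sy: "smooth2 (\<lambda>x. f (y x)) \<and> pd i (\<lambda>x. f (y x)) = (\<lambda>x. 1/h * pd i f (y x))" if "poly_deg_le k f" for f i k
      unfolding y_def using poly_deg_le_affine[OF that] smooth2_poly pd_affine[OF smooth2_poly[OF that]] by blast
    have w1: "pd i w = (\<lambda>x. h * pd i z (y x))" for i
      unfolding w_def using sy[OF z(1), of i] h by (simp add: pd_cmult power2_eq_square)
    have w2: "pd i (pd j w) = (\<lambda>x. pd i (pd j z) (y x))" for i j
      unfolding w1 using sy[OF poly_deg_le_pd[OF z(1), of j], of i] h by (simp add: pd_cmult)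
    have yu: "u + h *\<^sub>R y x = x" for x using h by (simp add: y_def algebra_simps)
    have "cop A w x = q x" for x
    proof -
      have "cop A w x = cop A z (y x)" by (simp add: cop_def w2)
      then show ?thesis by (simp add: z(3) yu)
    qed
    moreover have "poly_deg_le (n + 2) w"
      unfolding w_def y_def by (intro poly_deg_le_cmult poly_deg_le_affine z(1))
    moreover have "\<bar>w x\<bar> \<le> C1 * C2 * h * ?N \<and> (\<forall>i. \<bar>pd i w x\<bar> \<le> C1 * C2 * ?N) \<and> (\<forall>i j. \<bar>pd i (pd j w) x\<bar> \<le> C1 * C2 / h * ?N)"
      if "x \<in> cball u h" for x
    proof -
      have "y x = (1/h) *\<^sub>R (x - u)" by (simp add: y_def algebra_simps)
      then have "y x \<in> cball 0 1" using that h by (simp add: dist_norm norm_minus_commute)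
      then have zz: "\<bar>z (y x)\<bar> \<le> C1 * C2 / h * ?N" "\<And>i. \<bar>pd i z (y x)\<bar> \<le> C1 * C2 / h * ?N"
        "\<And>i j. \<bar>pd i (pd j z) (y x)\<bar> \<le> C1 * C2 / h * ?N"
        using zb unfolding C2_bounded_def by auto
      have "\<bar>w x\<bar> \<le> h\<^sup>2 * (C1 * C2 / h * ?N)"
        unfolding w_def using mult_left_mono[OF zz(1), of "h\<^sup>2"] by (simp add: abs_mult)
      moreover have "\<bar>pd i w x\<bar> \<le> h * (C1 * C2 / h * ?N)" for i
        unfolding w1 using mult_left_mono[OF zz(2)[of i], of h] h by (simp add: abs_mult)
      ultimately show ?thesis using zz(3) h by (simp add: w2 power2_eq_square mult_ac)
    qed
    ultimately show "\<exists>z. poly_deg_le (n + 2) z \<and> cop A z = q \<and> (\<forall>x\<in>cball u h.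
        \<bar>z x\<bar> \<le> C1 * C2 * h * ?N \<and> (\<forall>i. \<bar>pd i z x\<bar> \<le> C1 * C2 * ?N) \<and> (\<forall>i j. \<bar>pd i (pd j z) x\<bar> \<le> C1 * C2 / h * ?N))"
      by (intro exI[of _ w]) auto
  qed
qed

definition inverse_bound :: "nat \<Rightarrow> real \<Rightarrow> real \<Rightarrow> bool" where
  "inverse_bound n \<rho> C \<longleftrightarrow> (\<forall>(u :: pt) (h :: real) q. h > 0 \<longrightarrow> poly_deg_le n q \<longrightarrow>
     (\<forall>x\<in>cball u h. \<bar>q x\<bar> \<le> C / h * L2_norm_on (ball u (\<rho> * h)) q))"

text \<open>The norm on the small ball controls the coefficients of \<open>q\<close> about the
  centre, and on the unit ball each monomial is at most 1. Thus values on the larger ball are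
  controlled as well.\<close>

lemma inverse_estimate:
  assumes \<rho>: "\<rho> > 0"
  shows "\<exists>C\<ge>0. inverse_bound n \<rho> C"
proof -
  obtain C where C: "C \<ge> 0" "\<And>co. (\<Sum>m\<in>pidx n. \<bar>co m\<bar>) \<le> C * L2_norm_on (ball 0 \<rho>) (\<lambda>x. \<Sum>l\<in>pidx n. co l * mon l x)"
    using coeffs_bound[OF \<rho>, of n] by blast
  have "\<bar>q x\<bar> \<le> C / h * L2_norm_on (ball u (\<rho> * h)) q" if h: "h > 0" and q: "poly_deg_le n q" and x: "x \<in> cball u h" for u :: pt and h q x
  proof -
    obtain co where co: "(\<lambda>y. q (u + h *\<^sub>R y)) = (\<lambda>x. \<Sum>m\<in>pidx n. co m * mon m x)"
      using poly_deg_le_affine[OF q, of u h] by (auto simp: poly_deg_le_iff)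
    define y where "y = (1/h) *\<^sub>R (x - u)"
    have yx: "u + h *\<^sub>R y = x" using h by (simp add: y_def)
    have ny: "norm y \<le> 1" using x h by (simp add: y_def dist_norm norm_minus_commute)
    have m1: "\<bar>mon m y\<bar> \<le> 1" for m
    proof -
      have "\<bar>y $ i\<bar> ^ k \<le> 1" for i k
        using component_le_norm_cart[of y i] ny by (intro power_le_one) auto
      then show ?thesis unfolding mon_def abs_mult power_abs by (intro mult_le_one) auto
    qed
    have "\<bar>q x\<bar> = \<bar>\<Sum>m\<in>pidx n. co m * mon m y\<bar>" using fun_cong[OF co, of y] yx by simp
    also have "\<dots> \<le> (\<Sum>m\<in>pidx n. \<bar>co m * mon m y\<bar>)" by (rule sum_abs)
    also have "\<dots> \<le> (\<Sum>m\<in>pidx n. \<bar>co m\<bar>)"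
      using m1 by (intro sum_mono) (simp add: abs_mult mult_left_le)
    also have "\<dots> \<le> C * L2_norm_on (ball 0 \<rho>) (\<lambda>y. q (u + h *\<^sub>R y))" using C(2)[of co] co by simp
    also have "\<dots> = C / h * L2_norm_on (ball u (\<rho> * h)) q"
      using L2_norm_affine[OF h smooth2_cont[OF smooth2_poly[OF q]], of u \<rho>] h by simp
    finally show ?thesis .
  qed
  then show ?thesis unfolding inverse_bound_def using C(1) by blast
qed

section \<open>Mollification\<close>

lemma lborel_integral_translate:
  fixes f :: "pt \<Rightarrow> real"
  assumes [measurable]: "f \<in> borel_measurable borel"
  shows "(LINT x|lborel. f (c + x)) = integral\<^sup>L lborel f"
proof -
  have "integral\<^sup>L lborel f = integral\<^sup>L (distr lborel borel ((+) c)) f"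
    by (simp add: lborel_distr_plus)
  also have "\<dots> = (LINT x|lborel. f (c + x))"
    by (subst integral_distr) auto
  finally show ?thesis by simp
qed

lemma bounded_support_integrable:
  fixes f :: "pt \<Rightarrow> real"
  assumes [measurable]: "f \<in> borel_measurable borel" and "\<And>x. \<bar>f x\<bar> \<le> K" and "\<And>x. norm x > R \<Longrightarrow> f x = 0"
  shows "integrable lborel f"
proof (rule Bochner_Integration.integrable_bound)
  show "integrable lborel (\<lambda>x. indicat_real (cball 0 R :: pt set) x * \<bar>K\<bar>)"
    using emeasure_bounded_finite[of "cball 0 R :: pt set"] by (auto simp: less_top)
  show "AE x in lborel. norm (f x) \<le> norm (indicat_real (cball 0 R) x * \<bar>K\<bar>)"
  proof (rule AE_I2)
    fix x show "norm (f x) \<le> norm (indicat_real (cball 0 R) x * \<bar>K\<bar>)"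
      using assms(2)[of x] assms(3)[of x] by (cases "norm x \<le> R") (auto simp: indicator_def)
  qed
qed simp

definition supported_in :: "real \<Rightarrow> (pt \<Rightarrow> real) \<Rightarrow> bool" where
  "supported_in r f \<longleftrightarrow> (\<forall>x. norm x \<ge> r \<longrightarrow> f x = 0)"

lemma supported_in_bounded:
  assumes "supported_in r f" "continuous_on UNIV f"
  obtains K where "\<And>x. \<bar>f x\<bar> \<le> K" "K \<ge> 0"
proof -
  obtain K where K: "\<And>x. x \<in> cball 0 r \<Longrightarrow> \<bar>f x\<bar> \<le> K"
    by (rule continuous_bounded_on[OF bounded_cball assms(2)]) blast
  have "\<bar>f x\<bar> \<le> \<bar>K\<bar>" for x
    using K[of x] assms(1) by (cases "norm x \<le> r") (auto simp: supported_in_def)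
  then show ?thesis by (intro that[of "\<bar>K\<bar>"]) auto
qed

text \<open>The margin 1 leaves room to move from a point along the axis without meeting the
  support; later only the boundedness of the support matters.\<close>

lemma supported_in_pd:
  assumes "supported_in r f" shows "supported_in (r + 1) (pd i f)"
  unfolding supported_in_def
proof (intro allI impI)
  fix x :: pt assume x: "r + 1 \<le> norm x"
  have "((\<lambda>t. f (x + t *\<^sub>R axis i 1)) has_real_derivative 0) (at 0)"
  proof (rule has_field_derivative_transform_within_open[of "\<lambda>_. 0" _ _ "{-1<..<1}"])
    fix t :: real assume "t \<in> {-1<..<1}"
    then have "norm (t *\<^sub>R axis i 1 :: pt) \<le> 1" by (auto simp: abs_le_iff)
    then have "norm (x + t *\<^sub>R axis i 1) \<ge> r"
      using x norm_diff_ineq[of x "t *\<^sub>R axis i 1"] by linarith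
    then show "0 = f (x + t *\<^sub>R axis i 1)" using assms by (simp add: supported_in_def)
  qed auto
  then show "pd i f x = 0" by (rule pd_eqI)
qed

text \<open>Convolution of \<open>w\<close> with the reflection of \<open>\<zeta>\<close>. The point
  \<open>x\<close> occurs only in the kernel, so \<open>w\<close> may be merely measurable, and
  derivatives fall on \<open>\<zeta>\<close> with a minus sign.\<close>

definition moll :: "(pt \<Rightarrow> real) \<Rightarrow> (pt \<Rightarrow> real) \<Rightarrow> pt \<Rightarrow> real" where
  "moll w \<zeta> x = (LINT y|lborel. w y * \<zeta> (y - x))"

context
  fixes w :: "pt \<Rightarrow> real" and W R :: real
  assumes wm [measurable]: "w \<in> borel_measurable borel"
    and wb: "\<And>x. \<bar>w x\<bar> \<le> W" and ws: "\<And>x. norm x > R \<Longrightarrow> w x = 0"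
begin

lemma W_nonneg: "W \<ge> 0" using wb[of 0] by linarith

lemma moll_integrable:
  assumes [measurable]: "g \<in> borel_measurable borel" and "\<And>y. \<bar>g y\<bar> \<le> K"
  shows "integrable lborel (\<lambda>y. w y * g y)"
proof (rule bounded_support_integrable)
  show "\<bar>w x * g x\<bar> \<le> W * K" for x
    unfolding abs_mult using wb assms(2) W_nonneg by (intro mult_mono) auto
  show "w x * g x = 0" if "norm x > R" for x using ws[OF that] by simp
qed measurable

lemma moll_dominated:
  assumes "\<And>n. g n \<in> borel_measurable borel" "g' \<in> borel_measurable borel"
    and "\<And>n y. \<bar>g n y\<bar> \<le> K" and lim: "\<And>y. (\<lambda>n. g n y) \<longlonglongrightarrow> g' y"
  shows "(\<lambda>n. LINT y|lborel. w y * g n y) \<longlonglongrightarrow> (LINT y|lborel. w y * g' y)"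
proof (rule integral_dominated_convergence)
  have [measurable]: "g n \<in> borel_measurable borel" "g' \<in> borel_measurable borel" for n
    using assms by auto
  show "(\<lambda>y. w y * g' y) \<in> borel_measurable lborel" "(\<lambda>y. w y * g n y) \<in> borel_measurable lborel" for n
    by measurable
  show "integrable lborel (\<lambda>y. \<bar>w y\<bar> * K)"
  proof -
    have "integrable lborel w" by (rule bounded_support_integrable[OF wm wb ws])
    then show ?thesis by auto
  qed
  show "AE y in lborel. (\<lambda>n. w y * g n y) \<longlonglongrightarrow> w y * g' y"
    by (intro AE_I2 tendsto_mult tendsto_const lim)
  show "AE y in lborel. norm (w y * g n y) \<le> \<bar>w y\<bar> * K" for n
    using assms(3) by (intro AE_I2) (simp add: abs_mult mult_left_mono)
qed

lemma cont_meas: "continuous_on UNIV \<zeta> \<Longrightarrow> (\<lambda>y. \<zeta> (y - x)) \<in> borel_measurable borel" for \<zeta> :: "pt \<Rightarrow> real"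
  by (rule borel_measurable_continuous_onI) (rule continuous_on_compose2, auto intro!: continuous_intros)

text \<open>Differentiation under the integral along arbitrary null sequences: the mean value bound
  dominates the difference quotients of \<open>\<zeta>\<close> by a bound on its partial
  derivative.\<close>

lemma moll_DERIV:
  assumes z: "smooth2 \<zeta>" and sup: "supported_in r \<zeta>"
  shows "((\<lambda>t. moll w \<zeta> (x + t *\<^sub>R axis i 1)) has_real_derivative moll w (\<lambda>y. -1 * pd i \<zeta> y) x) (at 0)"
proof -
  let ?e = "axis i 1 :: pt"
  obtain K where K: "\<And>x. \<bar>pd i \<zeta> x\<bar> \<le> K" "K \<ge> 0"
    by (rule supported_in_bounded[OF supported_in_pd[OF sup, of i] smooth2_cont[OF smooth2_pd[OF z]]]) blast
  obtain K0 where K0: "\<And>x. \<bar>\<zeta> x\<bar> \<le> K0" "K0 \<ge> 0"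
    by (rule supported_in_bounded[OF sup smooth2_cont[OF z]]) blast
  have int: "integrable lborel (\<lambda>y. w y * \<zeta> (y - x))" for x
    by (rule moll_integrable[OF cont_meas[OF smooth2_cont[OF z]]]) (rule K0)
  have "((\<lambda>h. (moll w \<zeta> (x + h *\<^sub>R ?e) - moll w \<zeta> x) / h) \<longlongrightarrow> moll w (\<lambda>y. -1 * pd i \<zeta> y) x) (at 0)"
    unfolding tendsto_at_iff_sequentially
  proof (intro allI impI)
    fix X :: "nat \<Rightarrow> real" assume X: "\<forall>n. X n \<in> UNIV - {0}" "X \<longlonglongrightarrow> 0"
    have "(\<lambda>n. LINT y|lborel. w y * ((\<zeta> (y - (x + X n *\<^sub>R ?e)) - \<zeta> (y - x)) / X n))
        \<longlonglongrightarrow> (LINT y|lborel. w y * (-1 * pd i \<zeta> (y - x)))"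
    proof (rule moll_dominated)
      show "(\<lambda>y. (\<zeta> (y - (x + X n *\<^sub>R ?e)) - \<zeta> (y - x)) / X n) \<in> borel_measurable borel" for n
        using cont_meas[OF smooth2_cont[OF z]] by measurable
      show "(\<lambda>y. - 1 * pd i \<zeta> (y - x)) \<in> borel_measurable borel"
        using cont_meas[OF smooth2_cont[OF smooth2_pd[OF z]]] by measurable
      show "\<bar>(\<zeta> (y - (x + X n *\<^sub>R ?e)) - \<zeta> (y - x)) / X n\<bar> \<le> K" for n y
      proof -
        have "\<bar>\<zeta> ((y - x) + (- X n) *\<^sub>R ?e) - \<zeta> (y - x)\<bar> \<le> K * \<bar>- X n\<bar>"
          by (rule axis_mvt[OF z]) (rule K)
        then show ?thesis using X(1) by (simp add: algebra_simps divide_le_eq)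
      qed
      show "(\<lambda>n. (\<zeta> (y - (x + X n *\<^sub>R ?e)) - \<zeta> (y - x)) / X n) \<longlonglongrightarrow> - 1 * pd i \<zeta> (y - x)" for y
      proof -
        have "((\<lambda>t. \<zeta> ((y - x) + (- t) *\<^sub>R ?e)) has_real_derivative pd i \<zeta> (y - x) * (- 1)) (at 0)"
          by (rule DERIV_chain2[of "\<lambda>t. \<zeta> ((y - x) + t *\<^sub>R ?e)"])
            (auto intro!: derivative_eq_intros smooth2_DERIV0[OF z])
        then have "((\<lambda>h. (\<zeta> (y - (x + h *\<^sub>R ?e)) - \<zeta> (y - x)) / h) \<longlongrightarrow> - 1 * pd i \<zeta> (y - x)) (at 0)"
          by (simp add: DERIV_def algebra_simps)
        then show ?thesis using X unfolding tendsto_at_iff_sequentially by (auto simp: o_def)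
      qed
    qed
    note A = this
    have B: "(LINT y|lborel. w y * ((\<zeta> (y - (x + X n *\<^sub>R ?e)) - \<zeta> (y - x)) / X n))
       = (moll w \<zeta> (x + X n *\<^sub>R ?e) - moll w \<zeta> x) / X n" for n
    proof -
      have "(LINT y|lborel. w y * ((\<zeta> (y - (x + X n *\<^sub>R ?e)) - \<zeta> (y - x)) / X n))
         = (LINT y|lborel. (w y * \<zeta> (y - (x + X n *\<^sub>R ?e)) - w y * \<zeta> (y - x)) / X n)"
        by (simp add: algebra_simps)
      also have "\<dots> = (moll w \<zeta> (x + X n *\<^sub>R ?e) - moll w \<zeta> x) / X n"
        using int by (simp add: moll_def)
      finally show ?thesis .
    qed
    show "((\<lambda>h. (moll w \<zeta> (x + h *\<^sub>R ?e) - moll w \<zeta> x) / h) \<circ> X) \<longlonglongrightarrow> moll w (\<lambda>y. -1 * pd i \<zeta> y) x"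
      using A unfolding B by (simp only: o_def moll_def)
  qed
  then show ?thesis by (simp add: DERIV_def)
qed

lemma moll_continuous:
  assumes z: "smooth2 \<zeta>" and sup: "supported_in r \<zeta>"
  shows "continuous_on UNIV (moll w \<zeta>)"
proof -
  obtain K0 where K0: "\<And>x. \<bar>\<zeta> x\<bar> \<le> K0" "K0 \<ge> 0"
    by (rule supported_in_bounded[OF sup smooth2_cont[OF z]]) blast
  have "(\<lambda>n. moll w \<zeta> (X n)) \<longlonglongrightarrow> moll w \<zeta> x" if X: "X \<longlonglongrightarrow> x" for X x
    unfolding moll_def
  proof (rule moll_dominated[OF cont_meas[OF smooth2_cont[OF z]] cont_meas[OF smooth2_cont[OF z]] K0(1)])
    show "(\<lambda>n. \<zeta> (y - X n)) \<longlonglongrightarrow> \<zeta> (y - x)" for y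
      using smooth2_cont[OF z] X
      by (intro isCont_tendsto_compose[of _ \<zeta>] tendsto_intros) (auto simp: continuous_on_eq_continuous_at)
  qed
  then show ?thesis by (auto simp: continuous_on_eq_continuous_at continuous_at_sequentially o_def)
qed

text \<open>All mollifications of \<open>w\<close> form one class stable under \<open>pd\<close>,
  because a derivative is again a mollification, with another smooth kernel of bounded
  support.\<close>

lemma smooth2_moll:
  assumes "smooth2 \<zeta>" "supported_in r \<zeta>"
  shows "smooth2 (moll w \<zeta>)"
proof (rule smooth2_coinduct[where P = "\<lambda>f. \<exists>\<zeta> r. smooth2 \<zeta> \<and> supported_in r \<zeta> \<and> f = moll w \<zeta>"])
  show "\<exists>\<zeta>' r. smooth2 \<zeta>' \<and> supported_in r \<zeta>' \<and> moll w \<zeta> = moll w \<zeta>'" using assms by blast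
next
  fix f assume "\<exists>\<zeta> r. smooth2 \<zeta> \<and> supported_in r \<zeta> \<and> f = moll w \<zeta>"
  then obtain \<zeta> r where z: "smooth2 \<zeta>" "supported_in r \<zeta>" and f: "f = moll w \<zeta>" by blast
  show "continuous_on UNIV f" unfolding f by (rule moll_continuous[OF z])
  show "(\<lambda>t. f (x + t *\<^sub>R axis i 1)) differentiable at 0" for i x
    unfolding f using moll_DERIV[OF z] real_differentiable_def by blast
  fix i
  have "pd i f = moll w (\<lambda>y. -1 * pd i \<zeta> y)"
    unfolding f by (rule ext, rule pd_eqI, rule moll_DERIV[OF z])
  moreover have "smooth2 (\<lambda>y. -1 * pd i \<zeta> y)" using z(1) by (intro smooth2_mult smooth2_const smooth2_pd)
  moreover have "supported_in (r + 1) (\<lambda>y. -1 * pd i \<zeta> y)"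
    using supported_in_pd[OF z(2), of i] by (simp add: supported_in_def)
  ultimately show "\<exists>\<zeta> r. smooth2 \<zeta> \<and> supported_in r \<zeta> \<and> pd i f = moll w \<zeta>" by blast
qed

lemma moll_alt:
  assumes "continuous_on UNIV \<zeta>"
  shows "moll w \<zeta> x = (LINT y|lborel. w (x + y) * \<zeta> y)"
proof -
  have [measurable]: "(\<lambda>y. \<zeta> (y - x)) \<in> borel_measurable borel" by (rule cont_meas[OF assms])
  have "moll w \<zeta> x = (LINT y|lborel. w (x + y) * \<zeta> (x + y - x))"
    unfolding moll_def by (subst lborel_integral_translate[symmetric, where c = x]) auto
  then show ?thesis by simp
qed

end

lemma exists_unit_bump:
  assumes r: "r > 0"
  obtains \<eta> where "smooth2 \<eta>" "\<And>x. \<eta> x \<ge> 0" "supported_in r \<eta>" "integrable lborel \<eta>" "integral\<^sup>L lborel \<eta> = 1"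
proof -
  obtain b where b: "smooth2 b" "\<And>x. b x \<ge> 0" "\<And>x. norm x \<ge> r \<Longrightarrow> b x = 0" "b 0 > 0"
    using exists_bump[OF r] by blast
  have sb: "supported_in r b" using b(3) by (simp add: supported_in_def)
  have cb: "continuous_on UNIV b" using b(1) by (rule smooth2_cont)
  obtain K where K: "\<And>x. \<bar>b x\<bar> \<le> K" by (rule supported_in_bounded[OF sb cb]) blast
  have ib: "integrable lborel b"
    by (rule bounded_support_integrable[OF borel_measurable_continuous_onI[OF cb] K, of r]) (use b(3) in auto)
  have e: "(\<lambda>x. indicat_real (ball 0 r) x *\<^sub>R b x) = b" using b(3) by (auto simp: indicator_def fun_eq_iff)
  \<comment> \<open>The integral of \<open>b\<close> is the squared norm of its square root, so
    positivity follows from the fact that a continuous function of norm zero vanishes.\<close>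
  have "L2_norm_on (ball 0 r) (\<lambda>x. sqrt (b x)) = sqrt (integral\<^sup>L lborel b)"
    using b(2) e by (simp add: L2_norm_on_def set_lebesgue_integral_def)
  then have "integral\<^sup>L lborel b \<noteq> 0"
    using continuous_L2_zero[of "ball 0 r" "\<lambda>x. sqrt (b x)" 0] b(4) r cb by (auto intro!: continuous_intros)
  moreover have "integral\<^sup>L lborel b \<ge> 0" using b(2) by (simp add: integral_nonneg_AE)
  ultimately have I: "integral\<^sup>L lborel b > 0" by simp
  let ?\<eta> = "\<lambda>x. 1 / integral\<^sup>L lborel b * b x"
  show ?thesis
  proof (rule that[of ?\<eta>])
    show "smooth2 ?\<eta>" using b(1) by (intro smooth2_mult smooth2_const)
    show "0 \<le> ?\<eta> x" for x using b(2)[of x] I by simp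
    show "supported_in r ?\<eta>" using sb by (simp add: supported_in_def)
    show "integrable lborel ?\<eta>" using ib by simp
    show "integral\<^sup>L lborel ?\<eta> = 1" using I by simp
  qed
qed

text \<open>Averaging against a nonnegative kernel of mass one preserves every uniform comparison on
  the ball of radius \<open>r\<close>: with a constant for values, with a linear increment for
  derivatives. All that follows about supports, sup bounds, Lipschitz bounds and convergence is an
  instance of these two properties.\<close>

lemma mollification:
  fixes w :: "pt \<Rightarrow> real" and W R r :: real
  assumes wm [measurable]: "w \<in> borel_measurable borel"
    and wb: "\<And>x. \<bar>w x\<bar> \<le> W" and ws: "\<And>x. norm x > R \<Longrightarrow> w x = 0" and r: "r > 0"
  obtains \<phi> where "smooth2 \<phi>"
    and "\<And>(x :: pt) d \<kappa>. (\<And>y. dist x y < r \<Longrightarrow> \<bar>w y - d\<bar> \<le> \<kappa>) \<Longrightarrow> \<bar>\<phi> x - d\<bar> \<le> \<kappa>"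
    and "\<And>(x :: pt) i d \<kappa> \<delta>. \<delta> > 0 \<Longrightarrow> (\<And>y t. dist x y < r \<Longrightarrow> \<bar>t\<bar> < \<delta> \<Longrightarrow>
        \<bar>w (y + t *\<^sub>R axis i 1) - w y - t * d\<bar> \<le> \<kappa> * \<bar>t\<bar>) \<Longrightarrow> \<bar>pd i \<phi> x - d\<bar> \<le> \<kappa>"
proof -
  obtain \<eta> where \<eta>: "smooth2 \<eta>" "\<And>x. \<eta> x \<ge> 0" "supported_in r \<eta>" "integrable lborel \<eta>" "integral\<^sup>L lborel \<eta> = 1"
    using exists_unit_bump[OF r] by blast
  have ce: "continuous_on UNIV \<eta>" using \<eta>(1) by (rule smooth2_cont)
  have [measurable]: "\<eta> \<in> borel_measurable borel" by (rule borel_measurable_continuous_onI[OF ce])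
  let ?\<phi> = "moll w \<eta>"
  have alt: "?\<phi> x = (LINT y|lborel. w (x + y) * \<eta> y)" for x
    by (rule moll_alt[OF wm wb ws ce])
  have iw: "integrable lborel (\<lambda>y. w (x + y) * \<eta> y)" for x
  proof (rule Bochner_Integration.integrable_bound[of _ "\<lambda>y. W * \<eta> y"])
    show "AE y in lborel. norm (w (x + y) * \<eta> y) \<le> norm (W * \<eta> y)"
      using wb \<eta>(2) abs_ge_self[of W] by (intro AE_I2) (auto simp: abs_mult intro!: mult_right_mono intro: order_trans)
  qed (use \<eta>(4) in auto)
  have key: "\<bar>LINT y|lborel. g y * \<eta> y\<bar> \<le> \<kappa>"
    if g: "integrable lborel (\<lambda>y. g y * \<eta> y)" and gb: "\<And>y. norm y < r \<Longrightarrow> \<bar>g y\<bar> \<le> \<kappa>" for g \<kappa>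
  proof -
    have "\<bar>LINT y|lborel. g y * \<eta> y\<bar> \<le> (LINT y|lborel. \<bar>g y * \<eta> y\<bar>)"
      by (rule integral_abs_bound)
    also have "\<dots> \<le> (LINT y|lborel. \<kappa> * \<eta> y)"
    proof (rule integral_mono)
      fix y show "\<bar>g y * \<eta> y\<bar> \<le> \<kappa> * \<eta> y"
      proof (cases "norm y < r")
        case True
        then show ?thesis using gb[OF True] \<eta>(2)[of y] by (simp add: abs_mult mult_right_mono)
      next
        case False
        then show ?thesis using \<eta>(3) by (simp add: supported_in_def)
      qed
    qed (use g \<eta>(4) in auto)
    finally show ?thesis using \<eta>(5) by simp
  qed
  have sm: "smooth2 ?\<phi>" by (rule smooth2_moll[OF wm wb ws \<eta>(1,3)])
  show ?thesis
  proof (rule that[of ?\<phi>])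
    show "smooth2 ?\<phi>" by (rule sm)
    fix x :: pt and d \<kappa> assume h: "\<And>y. dist x y < r \<Longrightarrow> \<bar>w y - d\<bar> \<le> \<kappa>"
    have i: "integrable lborel (\<lambda>y. (w (x + y) - d) * \<eta> y)"
      using iw[of x] \<eta>(4) by (simp add: left_diff_distrib)
    have "(LINT y|lborel. (w (x + y) - d) * \<eta> y) = ?\<phi> x - d"
      unfolding alt using iw[of x] \<eta>(4,5) by (simp add: left_diff_distrib)
    then show "\<bar>?\<phi> x - d\<bar> \<le> \<kappa>" using key[OF i] h by (auto simp: dist_norm)
  next
    fix x :: pt and i d \<kappa> \<delta>
    assume \<delta>: "(\<delta>::real) > 0" and h: "\<And>y t. dist x y < r \<Longrightarrow> \<bar>t\<bar> < \<delta> \<Longrightarrow>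
        \<bar>w (y + t *\<^sub>R axis i 1) - w y - t * d\<bar> \<le> \<kappa> * \<bar>t\<bar>"
    have b: "\<bar>?\<phi> (x + t *\<^sub>R axis i 1) - ?\<phi> x - t * d\<bar> \<le> \<kappa> * \<bar>t\<bar>" if t: "\<bar>t\<bar> < \<delta>" for t
    proof -
      have i: "integrable lborel (\<lambda>y. (w (x + t *\<^sub>R axis i 1 + y) - w (x + y) - t * d) * \<eta> y)"
        using iw[of x] iw[of "x + t *\<^sub>R axis i 1"] \<eta>(4) by (simp add: left_diff_distrib)
      have "(LINT y|lborel. (w (x + t *\<^sub>R axis i 1 + y) - w (x + y) - t * d) * \<eta> y) = ?\<phi> (x + t *\<^sub>R axis i 1) - ?\<phi> x - t * d"
        unfolding alt using iw[of x] iw[of "x + t *\<^sub>R axis i 1"] \<eta>(4,5) by (simp add: left_diff_distrib)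
      moreover have "\<bar>w (x + t *\<^sub>R axis i 1 + y) - w (x + y) - t * d\<bar> \<le> \<kappa> * \<bar>t\<bar>" if "norm y < r" for y
        using h[of "x + y" t] that t by (simp add: dist_norm add_ac)
      ultimately show ?thesis using key[OF i, where \<kappa> = "\<kappa> * \<bar>t\<bar>"] by simp
    qed
    have lim: "((\<lambda>t. \<bar>(?\<phi> (x + t *\<^sub>R axis i 1) - ?\<phi> x) / t - d\<bar>) \<longlongrightarrow> \<bar>pd i ?\<phi> x - d\<bar>) (at 0)"
      using smooth2_DERIV0[OF sm, of x i] by (intro tendsto_intros) (simp add: DERIV_def)
    show "\<bar>pd i ?\<phi> x - d\<bar> \<le> \<kappa>"
    proof (rule tendsto_upperbound[OF lim])
      show "\<forall>\<^sub>F t in at 0. \<bar>(?\<phi> (x + t *\<^sub>R axis i 1) - ?\<phi> x) / t - d\<bar> \<le> \<kappa>"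
        unfolding eventually_at
      proof (intro exI[of _ \<delta>] conjI ballI impI \<delta>)
        fix t :: real assume "t \<noteq> 0 \<and> dist t 0 < \<delta>"
        then have t: "t \<noteq> 0" "\<bar>t\<bar> < \<delta>" by auto
        have "(?\<phi> (x + t *\<^sub>R axis i 1) - ?\<phi> x) / t - d = (?\<phi> (x + t *\<^sub>R axis i 1) - ?\<phi> x - t * d) / t"
          using t by (simp add: field_simps)
        then show "\<bar>(?\<phi> (x + t *\<^sub>R axis i 1) - ?\<phi> x) / t - d\<bar> \<le> \<kappa>"
          using b[OF t(2)] t(1) by (simp add: divide_le_eq)
      qed
    qed simp
  qed
qed

section \<open>Piecewise smooth functions on a partition\<close>

lemma test_funI:
  assumes "smooth2 \<phi>" "closed K" "K \<subseteq> \<Omega>" "bounded \<Omega>" "\<And>x. \<phi> x \<noteq> 0 \<Longrightarrow> x \<in> K"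
  shows "test_fun \<Omega> \<phi>"
proof -
  have "closure {x. \<phi> x \<noteq> 0} \<subseteq> K" using assms(2,5) by (intro closure_minimal) auto
  moreover then have "bounded (closure {x. \<phi> x \<noteq> 0})"
    using assms(3,4) by (meson bounded_subset)
  ultimately show ?thesis
    unfolding test_fun_def using assms(1,3) by (auto simp: compact_eq_bounded_closed)
qed

lemma closed_negligible_AE:
  assumes "closed S" "negligible S" shows "AE x::pt in lborel. x \<notin> S"
proof -
  have "S \<in> null_sets lborel"
    using assms by (simp add: negligible_iff_null_sets null_sets_completion_iff)
  then show ?thesis by (rule AE_not_in)
qed

text \<open>\<open>G\<close> is cut off near the boundary and then mollified on a shorter scale.
  Continuity enters only pointwise, so one construction serves discontinuous piecewise functions and
  glued Lipschitz functions; the last two clauses address the derivatives in the Lipschitz case and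
  near points where \<open>G\<close> is smooth.\<close>

lemma test_fun_approximation:
  fixes G :: "pt \<Rightarrow> real"
  assumes op: "open \<Omega>" and bd: "bounded \<Omega>" and Gm [measurable]: "G \<in> borel_measurable borel"
    and Gb: "\<And>x. \<bar>G x\<bar> \<le> W" and G0: "\<And>x. x \<notin> \<Omega> \<Longrightarrow> G x = 0"
  obtains \<phi> :: "nat \<Rightarrow> pt \<Rightarrow> real" where "\<And>n. test_fun \<Omega> (\<phi> n)" "\<And>n x. \<bar>\<phi> n x\<bar> \<le> W"
    "\<And>x. x \<in> \<Omega> \<Longrightarrow> isCont G x \<Longrightarrow> (\<lambda>n. \<phi> n x) \<longlonglongrightarrow> G x"
    "\<And>L n i x. L \<ge> 0 \<Longrightarrow> (\<And>x y. \<bar>G x - G y\<bar> \<le> L * dist x y) \<Longrightarrow> \<bar>pd i (\<phi> n) x\<bar> \<le> 4 * L"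
    "\<And>x \<delta> f i. x \<in> \<Omega> \<Longrightarrow> \<delta> > 0 \<Longrightarrow> smooth2 f \<Longrightarrow> (\<And>y. dist x y < \<delta> \<Longrightarrow> G y = f y) \<Longrightarrow>
       (\<lambda>n. pd i (\<phi> n) x) \<longlonglongrightarrow> pd i f x"
proof -
  have ne: "- \<Omega> \<noteq> {}" using bd by (metis Compl_empty_eq double_complement not_bounded_UNIV)
  define d where "d x = infdist x (- \<Omega>)" for x :: pt
  have dnn: "d x \<ge> 0" for x by (simp add: d_def infdist_nonneg)
  have d0: "d x = 0" if "x \<notin> \<Omega>" for x using that by (simp add: d_def)
  have dL: "\<bar>d x - d y\<bar> \<le> dist x y" for x y
    using infdist_triangle[of x "- \<Omega>" y] infdist_triangle[of y "- \<Omega>" x] by (auto simp: d_def dist_commute)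
  have dball: "d x \<ge> \<delta>" if "ball x \<delta> \<subseteq> \<Omega>" for x \<delta>
    unfolding d_def infdist_notempty[OF ne]
    by (rule cINF_greatest[OF ne]) (use that in \<open>auto simp: subset_iff not_less[symmetric]\<close>)
  have cd: "continuous_on UNIV d" unfolding d_def by (intro continuous_intros)
  \<comment> \<open>The cutoff is 0 where \<open>real (Suc n) * d x \<le> 1\<close> and 1 where
    \<open>real (Suc n) * d x \<ge> 2\<close>.\<close>
  define \<theta> where "\<theta> n x = max 0 (min 1 (real (Suc n) * d x - 1))" for n x
  have \<theta>01: "0 \<le> \<theta> n x" "\<theta> n x \<le> 1" for n x by (auto simp: \<theta>_def)
  have \<theta>L: "\<bar>\<theta> n x - \<theta> n y\<bar> \<le> real (Suc n) * dist x y" for n x y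
  proof -
    have "\<bar>\<theta> n x - \<theta> n y\<bar> \<le> \<bar>real (Suc n) * d x - real (Suc n) * d y\<bar>" by (auto simp: \<theta>_def)
    also have "\<dots> = real (Suc n) * \<bar>d x - d y\<bar>" by (simp add: abs_mult right_diff_distrib[symmetric])
    also have "\<dots> \<le> real (Suc n) * dist x y" using dL by (intro mult_left_mono) auto
    finally show ?thesis .
  qed
  have \<theta>1: "\<theta> n x = 1" if "real (Suc n) * d x \<ge> 2" for n x using that by (auto simp: \<theta>_def)
  have \<theta>m: "\<theta> n \<in> borel_measurable borel" for n
    by (rule borel_measurable_continuous_onI) (auto simp: \<theta>_def[abs_def] intro!: continuous_intros cd)
  define w where "w n x = G x * \<theta> n x" for n x
  have wm: "w n \<in> borel_measurable borel" for n unfolding w_def[abs_def] using \<theta>m by measurable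
  have W0: "W \<ge> 0" using Gb[of 0] by linarith
  have wb: "\<bar>w n x\<bar> \<le> W" for n x
  proof -
    have "\<bar>G x\<bar> * \<bar>\<theta> n x\<bar> \<le> W * 1" using Gb \<theta>01 W0 by (intro mult_mono) auto
    then show ?thesis by (simp add: w_def abs_mult)
  qed
  obtain R where R: "\<And>x. x \<in> \<Omega> \<Longrightarrow> norm x \<le> R" using bd unfolding bounded_iff by blast
  have ws: "w n x = 0" if "norm x > R" for n x using R[of x] G0[of x] that by (auto simp: w_def)
  \<comment> \<open>Half the width of the layer on which the cutoff vanishes, so that mollification
    does not reach the complement of \<open>\<Omega>\<close>.\<close>
  define r where "r n = 1 / (2 * real (Suc n))" for n
  have r: "r n > 0" for n by (simp add: r_def)
  define P where "P n \<phi> \<longleftrightarrow> smooth2 \<phi> \<and> (\<forall>x d \<kappa>. (\<forall>y. dist x y < r n \<longrightarrow> \<bar>w n y - d\<bar> \<le> \<kappa>) \<longrightarrow> \<bar>\<phi> x - d\<bar> \<le> \<kappa>) \<and>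
    (\<forall>x i d \<kappa> \<delta>. \<delta> > 0 \<longrightarrow> (\<forall>y t. dist x y < r n \<longrightarrow> \<bar>t\<bar> < \<delta> \<longrightarrow>
        \<bar>w n (y + t *\<^sub>R axis i 1) - w n y - t * d\<bar> \<le> \<kappa> * \<bar>t\<bar>) \<longrightarrow> \<bar>pd i \<phi> x - d\<bar> \<le> \<kappa>)" for n \<phi>
  have "\<forall>n. \<exists>\<phi>. P n \<phi>"
  proof
    fix n
    show "\<exists>\<phi>. P n \<phi>"
    proof (rule mollification[OF wm[of n] wb[of n] ws[of _ n] r[of n]])
      fix \<phi>
      assume a: "smooth2 \<phi>"
        and b: "\<And>x d \<kappa>. (\<And>y. dist x y < r n \<Longrightarrow> \<bar>w n y - d\<bar> \<le> \<kappa>) \<Longrightarrow> \<bar>\<phi> x - d\<bar> \<le> \<kappa>"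
        and c: "\<And>x i d \<kappa> \<delta>. \<delta> > 0 \<Longrightarrow> (\<And>y t. dist x y < r n \<Longrightarrow> \<bar>t\<bar> < \<delta> \<Longrightarrow>
        \<bar>w n (y + t *\<^sub>R axis i 1) - w n y - t * d\<bar> \<le> \<kappa> * \<bar>t\<bar>) \<Longrightarrow> \<bar>pd i \<phi> x - d\<bar> \<le> \<kappa>"
      have "P n \<phi>"
        unfolding P_def
      proof (intro conjI allI impI a)
        fix x d \<kappa> assume "\<forall>y. dist x y < r n \<longrightarrow> \<bar>w n y - d\<bar> \<le> \<kappa>"
        then show "\<bar>\<phi> x - d\<bar> \<le> \<kappa>" by (intro b) simp
      next
        fix x i d \<kappa> \<delta> assume "(\<delta>::real) > 0" "\<forall>y t. dist x y < r n \<longrightarrow> \<bar>t\<bar> < \<delta> \<longrightarrow>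
          \<bar>w n (y + t *\<^sub>R axis i 1) - w n y - t * d\<bar> \<le> \<kappa> * \<bar>t\<bar>"
        then show "\<bar>pd i \<phi> x - d\<bar> \<le> \<kappa>" by (intro c) auto
      qed
      then show "\<exists>\<phi>. P n \<phi>" by blast
    qed
  qed
  then obtain \<phi> where P: "\<And>n. P n (\<phi> n)" by metis
  have sm: "smooth2 (\<phi> n)" for n by (rule conjunct1[OF P[unfolded P_def]])
  have val: "\<bar>\<phi> n x - e\<bar> \<le> \<kappa>" if "\<And>y. dist x y < r n \<Longrightarrow> \<bar>w n y - e\<bar> \<le> \<kappa>" for n x e \<kappa>
    using P[of n] that unfolding P_def by simp
  have der: "\<bar>pd i (\<phi> n) x - e\<bar> \<le> \<kappa>" if "\<delta> > 0" "\<And>y t. dist x y < r n \<Longrightarrow> \<bar>t\<bar> < \<delta> \<Longrightarrow>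
        \<bar>w n (y + t *\<^sub>R axis i 1) - w n y - t * e\<bar> \<le> \<kappa> * \<bar>t\<bar>" for n x i e \<kappa> \<delta>
    using P[of n, unfolded P_def, THEN conjunct2, THEN conjunct2, THEN spec[of _ x], THEN spec[of _ i],
      THEN spec[of _ e], THEN spec[of _ \<kappa>], THEN spec[of _ \<delta>], THEN mp, THEN mp, OF that(1)] that(2)
    by blast
  have rlim: "\<forall>\<^sub>F n in sequentially. 4 * r n \<le> \<delta> \<and> real (Suc n) * \<delta> \<ge> 4" if "\<delta> > 0" for \<delta>
  proof -
    obtain N :: nat where N: "real N > 4 / \<delta>" using reals_Archimedean2 by blast
    have "4 * r n \<le> \<delta> \<and> real (Suc n) * \<delta> \<ge> 4" if "n \<ge> N" for n
    proof -
      have "real (Suc n) > 4 / \<delta>" using N that by linarith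
      then have "real (Suc n) * \<delta> > 4" using \<open>\<delta> > 0\<close> by (simp add: divide_less_eq)
      moreover have "4 * r n = 2 / real (Suc n)" unfolding r_def by (simp add: field_simps)
      moreover have "2 / real (Suc n) \<le> \<delta> \<longleftrightarrow> 2 \<le> \<delta> * real (Suc n)"
        by (rule pos_divide_le_eq) simp
      ultimately show ?thesis by (simp only: mult.commute) linarith
    qed
    then show ?thesis by (auto simp: eventually_sequentially)
  qed
  have near: "\<forall>\<^sub>F n in sequentially. 4 * r n \<le> \<delta> \<and> (\<forall>y. dist x y < 2 * r n \<longrightarrow> dist x y < \<delta> \<and> w n y = G y)"
    if x: "x \<in> \<Omega>" and \<delta>: "\<delta> > 0" for x \<delta>
  proof -
    obtain \<delta>' where \<delta>': "\<delta>' > 0" "ball x \<delta>' \<subseteq> \<Omega>" using op x open_contains_ball by blast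
    define \<epsilon> where "\<epsilon> = min \<delta> \<delta>'"
    have \<epsilon>: "\<epsilon> > 0" "\<epsilon> \<le> \<delta>" "ball x \<epsilon> \<subseteq> \<Omega>" using \<delta> \<delta>' by (auto simp: \<epsilon>_def)
    from rlim[OF \<epsilon>(1)] show ?thesis
    proof eventually_elim
      case (elim n)
      have "dist x y < \<delta> \<and> w n y = G y" if y: "dist x y < 2 * r n" for y
      proof -
        have dx: "d x \<ge> \<epsilon>" by (rule dball[OF \<epsilon>(3)])
        have "d y \<ge> \<epsilon> / 2" using dL[of x y] dx y elim by linarith
        then have "real (Suc n) * d y \<ge> real (Suc n) * (\<epsilon> / 2)" by (intro mult_left_mono) auto
        then have "\<theta> n y = 1" using elim by (intro \<theta>1) linarith
        then show ?thesis using y elim \<epsilon> r[of n] by (auto simp: w_def)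
      qed
      moreover have "4 * r n \<le> \<delta>" using elim \<epsilon> by linarith
      ultimately show ?case by blast
    qed
  qed
  show ?thesis
  proof (rule that[of \<phi>])
    show "test_fun \<Omega> (\<phi> n)" for n
    proof (rule test_funI[OF sm _ _ bd])
      show "closed {x. r n \<le> d x}" using cd by (intro closed_Collect_le) (auto intro: continuous_intros)
      show "{x. r n \<le> d x} \<subseteq> \<Omega>" using d0 r[of n] by (auto simp: not_le[symmetric]) (metis not_le)
      show "x \<in> {x. r n \<le> d x}" if "\<phi> n x \<noteq> 0" for x
      proof (rule ccontr)
        assume "x \<notin> {x. r n \<le> d x}"
        then have dx: "d x < r n" by simp
        have "\<bar>\<phi> n x - 0\<bar> \<le> 0"
        proof (rule val)
          fix y assume "dist x y < r n"
          then have "d y < 2 * r n" using dL[of x y] dx by linarith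
          then have "real (Suc n) * d y < 1" by (simp add: r_def field_simps)
          then show "\<bar>w n y - 0\<bar> \<le> 0" by (simp add: w_def \<theta>_def)
        qed
        then show False using that by simp
      qed
    qed
    show "\<bar>\<phi> n x\<bar> \<le> W" for n x using val[of x n 0 W] wb by simp
    show "(\<lambda>n. \<phi> n x) \<longlonglongrightarrow> G x" if x: "x \<in> \<Omega>" and c: "isCont G x" for x
    proof (rule tendstoI)
      fix \<epsilon> :: real assume \<epsilon>: "\<epsilon> > 0"
      obtain \<delta> where \<delta>: "\<delta> > 0" "\<And>y. dist y x < \<delta> \<Longrightarrow> dist (G y) (G x) < \<epsilon> / 2"
        using c \<epsilon> unfolding continuous_at_eps_delta by (metis half_gt_zero)
      from near[OF x \<delta>(1)] show "\<forall>\<^sub>F n in sequentially. dist (\<phi> n x) (G x) < \<epsilon>"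
      proof eventually_elim
        case (elim n)
        have "\<bar>\<phi> n x - G x\<bar> \<le> \<epsilon> / 2"
        proof (rule val)
          fix y assume "dist x y < r n"
          then have "dist x y < \<delta>" "w n y = G y" using elim r[of n] by auto
          then show "\<bar>w n y - G x\<bar> \<le> \<epsilon> / 2" using \<delta>(2)[of y] by (simp add: dist_commute dist_real_def abs_minus_commute)
        qed
        then show ?case using \<epsilon> by (simp add: dist_real_def)
      qed
    qed
    show "\<bar>pd i (\<phi> n) x\<bar> \<le> 4 * L" if L: "L \<ge> 0" "\<And>x y. \<bar>G x - G y\<bar> \<le> L * dist x y" for L n i x
    proof -
      \<comment> \<open>A Lipschitz function vanishing off \<open>\<Omega>\<close> is at most
        \<open>L\<close> times the distance to the complement; this compensates for the steepness of
        the cutoff.\<close>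
      have Gd: "\<bar>G x\<bar> \<le> L * d x" for x
      proof (rule field_le_epsilon)
        fix e :: real assume e: "e > 0"
        define e' where "e' = e / (L + 1)"
        have e': "e' > 0" "L * e' \<le> e" using e L by (auto simp: e'_def field_simps)
        have "(INF y\<in>- \<Omega>. dist x y) < d x + e'" unfolding d_def infdist_notempty[OF ne] using e' by simp
        obtain y where y: "y \<notin> \<Omega>" "dist x y < d x + e'"
        proof -
          have "bdd_below (dist x ` (- \<Omega>))" unfolding bdd_below_def by (intro exI[of _ 0]) auto
          then show thesis
            using that cINF_less_iff[OF ne, of "dist x" "d x + e'"] \<open>(INF y\<in>- \<Omega>. dist x y) < d x + e'\<close> by auto
        qed
        have "\<bar>G x\<bar> \<le> L * dist x y" using L(2)[of x y] G0[OF y(1)] by simp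
        also have "\<dots> \<le> L * (d x + e')" using y L by (intro mult_left_mono) auto
        also have "\<dots> \<le> L * d x + e" using e' by (simp add: algebra_simps)
        finally show "\<bar>G x\<bar> \<le> L * d x + e" .
      qed
      \<comment> \<open>In this layer the increment of \<open>G\<close> contributes \<open>L\<close>
        and that of the cutoff at most \<open>3 * L\<close>, which explains the factor 4. If both
        points lie beyond the layer, the cutoff equals 1 at both.\<close>
      have bnd: "\<bar>w n x - w n y\<bar> \<le> 4 * L * dist x y" if "real (Suc n) * d x \<le> 3" for x y
      proof -
        have "w n x - w n y = (G x - G y) * \<theta> n y + G x * (\<theta> n x - \<theta> n y)"
          by (simp add: w_def algebra_simps)
        then have "\<bar>w n x - w n y\<bar> \<le> \<bar>G x - G y\<bar> * \<bar>\<theta> n y\<bar> + \<bar>G x\<bar> * \<bar>\<theta> n x - \<theta> n y\<bar>"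
          using abs_triangle_ineq[of "(G x - G y) * \<theta> n y" "G x * (\<theta> n x - \<theta> n y)"] by (simp add: abs_mult)
        also have "\<dots> \<le> (L * dist x y) * 1 + (L * d x) * (real (Suc n) * dist x y)"
          using L \<theta>01 Gd \<theta>L dnn by (intro add_mono mult_mono) auto
        also have "\<dots> = L * dist x y * (1 + real (Suc n) * d x)" by (simp add: algebra_simps)
        also have "\<dots> \<le> L * dist x y * 4" using that L by (intro mult_left_mono) auto
        finally show ?thesis by (simp add: mult_ac)
      qed
      have wL: "\<bar>w n x - w n y\<bar> \<le> 4 * L * dist x y" for x y
      proof -
        consider "real (Suc n) * d x \<le> 3" | "real (Suc n) * d y \<le> 3" | "real (Suc n) * d x > 3" "real (Suc n) * d y > 3" by linarith
        then show ?thesis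
        proof cases
          case 1 then show ?thesis by (rule bnd)
        next
          case 2 then show ?thesis using bnd[of y x] by (simp add: dist_commute abs_minus_commute)
        next
          case 3
          then have "w n x - w n y = G x - G y" using \<theta>1[of n x] \<theta>1[of n y] by (simp add: w_def)
          moreover have "L * dist x y \<ge> 0" using L by simp
          ultimately show ?thesis using L(2)[of x y] by simp
        qed
      qed
      have "\<bar>pd i (\<phi> n) x - 0\<bar> \<le> 4 * L"
      proof (rule der[of 1])
        fix y t show "\<bar>w n (y + t *\<^sub>R axis i 1) - w n y - t * 0\<bar> \<le> 4 * L * \<bar>t\<bar>"
          using wL[of "y + t *\<^sub>R axis i 1" y] by (simp add: dist_norm)
      qed simp
      then show ?thesis by simp
    qed
    show "(\<lambda>n. pd i (\<phi> n) x) \<longlonglongrightarrow> pd i f x"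
      if x: "x \<in> \<Omega>" and \<delta>: "\<delta> > 0" and f: "smooth2 f" and Gf: "\<And>y. dist x y < \<delta> \<Longrightarrow> G y = f y" for x \<delta> f i
    proof (rule tendstoI)
      fix \<epsilon> :: real assume \<epsilon>: "\<epsilon> > 0"
      have "isCont (pd i f) x" using smooth2_cont[OF smooth2_pd[OF f]] by (simp add: continuous_on_eq_continuous_at)
      then obtain \<delta>1 where \<delta>1: "\<delta>1 > 0" "\<And>y. dist y x < \<delta>1 \<Longrightarrow> dist (pd i f y) (pd i f x) < \<epsilon> / 2"
        using \<epsilon> unfolding continuous_at_eps_delta by (metis half_gt_zero)
      define \<delta>2 where "\<delta>2 = min \<delta> \<delta>1"
      have \<delta>2: "\<delta>2 > 0" "\<delta>2 \<le> \<delta>" "\<delta>2 \<le> \<delta>1" using \<delta> \<delta>1 by (auto simp: \<delta>2_def)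
      from near[OF x \<delta>2(1)] show "\<forall>\<^sub>F n in sequentially. dist (pd i (\<phi> n) x) (pd i f x) < \<epsilon>"
      proof eventually_elim
        case (elim n)
        \<comment> \<open>Subtracting the linear part of slope \<open>pd i f x\<close> reduces the
          claim to a small increment of \<open>g\<close>, whose partial derivative is close to 0
          near \<open>x\<close>.\<close>
        define g where "g = (\<lambda>z. f z - pd i f x * z $ i)"
        have sg: "smooth2 g" unfolding g_def by (intro smooth2_diff f smooth2_mult smooth2_const smooth2_coord)
        have pg: "pd i g = (\<lambda>z. pd i f z - pd i f x)"
        proof -
          have "smooth2 (\<lambda>z. pd i f x * z $ i)" by (intro smooth2_mult smooth2_const smooth2_coord)
          then have "pd i g = (\<lambda>z. pd i f z - pd i (\<lambda>z. pd i f x * z $ i) z)"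
            unfolding g_def by (rule pd_diff[OF f])
          then show ?thesis by (simp add: pd_cmult[OF smooth2_coord] pd_coord)
        qed
        have "\<bar>pd i (\<phi> n) x - pd i f x\<bar> \<le> \<epsilon> / 2"
        proof (rule der[OF r])
          fix y t assume y: "dist x y < r n" and t: "\<bar>t\<bar> < r n"
          have far: "dist x (y + s *\<^sub>R axis i 1) < 2 * r n" if "\<bar>s\<bar> \<le> \<bar>t\<bar>" for s
          proof -
            have "dist x (y + s *\<^sub>R axis i 1) \<le> dist x y + dist y (y + s *\<^sub>R axis i 1)" by (rule dist_triangle)
            also have "dist y (y + s *\<^sub>R axis i 1) = \<bar>s\<bar>" by (simp add: dist_norm)
            finally show ?thesis using that t y by linarith
          qed
          have "\<bar>g (y + t *\<^sub>R axis i 1) - g y\<bar> \<le> \<epsilon> / 2 * \<bar>t\<bar>"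
          proof (rule axis_mvt[OF sg])
            fix s :: real assume "\<bar>s\<bar> \<le> \<bar>t\<bar>"
            then have "dist x (y + s *\<^sub>R axis i 1) < \<delta>1" using far elim \<delta>2 by fastforce
            then show "\<bar>pd i g (y + s *\<^sub>R axis i 1)\<bar> \<le> \<epsilon> / 2"
              using \<delta>1(2)[of "y + s *\<^sub>R axis i 1"] unfolding pg by (simp add: dist_commute[of _ x] dist_real_def)
          qed
          moreover have wf: "w n z = f z" if "dist x z < 2 * r n" for z
            using elim that Gf[of z] \<delta>2 by fastforce
          then have "w n (y + t *\<^sub>R axis i 1) = f (y + t *\<^sub>R axis i 1)" "w n y = f y"
            using far[of t] y r[of n] by auto
          ultimately show "\<bar>w n (y + t *\<^sub>R axis i 1) - w n y - t * pd i f x\<bar> \<le> \<epsilon> / 2 * \<bar>t\<bar>"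
            by (simp add: g_def nth_plus_axis algebra_simps)
        qed
        then show ?case using \<epsilon> by (simp add: dist_real_def)
      qed
    qed
  qed
qed

lemma L2_on_bounded_mult:
  fixes f g :: "pt \<Rightarrow> real"
  assumes f: "set_borel_measurable lborel S f" "\<And>x. x \<in> S \<Longrightarrow> \<bar>f x\<bar> \<le> K" and g: "L2_on S g"
  shows "L2_on S (\<lambda>x. f x * g x)"
proof -
  have gm: "set_borel_measurable lborel S g" and gi: "set_integrable lborel S (\<lambda>x. (g x)\<^sup>2)"
    using g by (auto simp: L2_on_def)
  have m: "set_borel_measurable lborel S (\<lambda>x. f x * g x)"
  proof -
    have "(\<lambda>x. (indicat_real S x *\<^sub>R f x) * (indicat_real S x *\<^sub>R g x)) \<in> borel_measurable lborel"
      using f(1) gm by (auto simp: set_borel_measurable_def intro!: borel_measurable_times)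
    then show ?thesis unfolding set_borel_measurable_def
      by (rule back_subst[where P = "\<lambda>f. f \<in> borel_measurable lborel"]) (auto simp: indicator_def)
  qed
  have "integrable lborel (\<lambda>x. K\<^sup>2 * (indicat_real S x *\<^sub>R (g x)\<^sup>2))"
    using gi by (simp add: set_integrable_def)
  then have "integrable lborel (\<lambda>x. indicat_real S x *\<^sub>R (f x * g x)\<^sup>2)"
  proof (rule Bochner_Integration.integrable_bound)
    show "(\<lambda>x. indicat_real S x *\<^sub>R (f x * g x)\<^sup>2) \<in> borel_measurable lborel"
      using set_borel_measurable_power2[OF m] by (simp add: set_borel_measurable_def)
    show "AE x in lborel. norm (indicat_real S x *\<^sub>R (f x * g x)\<^sup>2) \<le> norm (K\<^sup>2 * (indicat_real S x *\<^sub>R (g x)\<^sup>2))"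
    proof (rule AE_I2)
      fix x
      have "x \<in> S \<Longrightarrow> (f x)\<^sup>2 \<le> K\<^sup>2" using f(2)[of x] by (metis abs_ge_zero power2_abs power_mono)
      then show "norm (indicat_real S x *\<^sub>R (f x * g x)\<^sup>2) \<le> norm (K\<^sup>2 * (indicat_real S x *\<^sub>R (g x)\<^sup>2))"
        by (cases "x \<in> S") (auto simp: power_mult_distrib mult_right_mono)
    qed
  qed
  then show ?thesis using m by (simp add: L2_on_def set_integrable_def)
qed

lemma L2_on_set_integrable:
  assumes "S \<in> sets borel" "bounded S" "L2_on S f"
  shows "set_integrable lborel S f"
  using L2_on_mult_integrable[OF assms(3), of "\<lambda>_. 1"] continuous_L2_on[OF assms(1,2), of "\<lambda>_. 1"] by simp

text \<open>What integration and gluing use of a mesh: finitely many disjoint open cells with null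
  frontiers whose closures cover the domain. Edges come in only when agreement on common closures is
  derived from jumps.\<close>

locale cells =
  fixes \<Omega> :: "pt set" and \<T> :: "pt set set"
  assumes opO: "open \<Omega>" and bdO: "bounded \<Omega>" and fin: "finite \<T>"
    and opT: "\<And>T. T \<in> \<T> \<Longrightarrow> open T" and subT: "\<And>T. T \<in> \<T> \<Longrightarrow> T \<subseteq> \<Omega>"
    and disj: "\<And>T T'. T \<in> \<T> \<Longrightarrow> T' \<in> \<T> \<Longrightarrow> T \<noteq> T' \<Longrightarrow> T \<inter> T' = {}"
    and neglT: "\<And>T. T \<in> \<T> \<Longrightarrow> negligible (frontier T)"
    and cover: "\<Omega> \<subseteq> \<Union>(closure ` \<T>)"
begin

lemma borelO: "\<Omega> \<in> sets borel" using opO by simp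
lemma borelT: "T \<in> \<T> \<Longrightarrow> T \<in> sets borel" using opT by simp
lemma bdT: "T \<in> \<T> \<Longrightarrow> bounded T" using subT bdO bounded_subset by blast

lemma closure_cover: "closure \<Omega> \<subseteq> \<Union>(closure ` \<T>)"
  using fin cover by (intro closure_minimal closed_UN) auto

text \<open>Points outside \<open>closure \<Omega>\<close> are listed separately because the
  difference quotients of glued functions are integrated over the whole plane. The exceptional set
  consists of the frontiers of the cells, including their parts on the frontier of
  \<open>\<Omega>\<close>.\<close>

lemma AE_cells: "AE x in lborel. (\<exists>T\<in>\<T>. x \<in> T) \<or> x \<notin> closure \<Omega>"
proof -
  have "negligible (\<Union>(frontier ` \<T>))" using fin neglT by (intro negligible_Union) auto
  moreover have "closed (\<Union>(frontier ` \<T>))" using fin by (intro closed_UN) auto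
  ultimately have "AE x in lborel. x \<notin> \<Union>(frontier ` \<T>)" by (intro closed_negligible_AE)
  then show ?thesis
  proof eventually_elim
    case (elim x)
    show ?case
    proof (rule ccontr)
      assume "\<not> ((\<exists>T\<in>\<T>. x \<in> T) \<or> x \<notin> closure \<Omega>)"
      then obtain T where T: "T \<in> \<T>" "x \<in> closure T" "x \<notin> T" using closure_cover by blast
      then have "x \<in> frontier T" using opT[OF T(1)] by (simp add: frontier_def interior_open)
      then show False using elim T(1) by blast
    qed
  qed
qed

lemma AE_cells_in: "AE x in lborel. x \<in> \<Omega> \<longrightarrow> (\<exists>T\<in>\<T>. x \<in> T)"
  using AE_cells by eventually_elim (use closure_subset in blast)

text \<open>A single function on the plane represents elementwise data, with value 0 on the skeleton
  and off \<open>\<Omega>\<close>, so that measurability and norms refer to one integrand.\<close>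

definition pwf :: "(pt set \<Rightarrow> pt \<Rightarrow> real) \<Rightarrow> pt \<Rightarrow> real" where
  "pwf g x = (\<Sum>T\<in>\<T>. indicat_real T x * g T x)"

lemma pwf_in:
  assumes "T \<in> \<T>" "x \<in> T" shows "pwf g x = g T x"
proof -
  have "(\<Sum>T'\<in>\<T> - {T}. indicat_real T' x * g T' x) = 0"
    using disj assms by (intro sum.neutral) (auto simp: indicator_def)
  then show ?thesis using assms by (simp add: pwf_def sum.remove[OF fin assms(1)])
qed

lemma pwf_out: "x \<notin> \<Omega> \<Longrightarrow> pwf g x = 0"
  unfolding pwf_def using subT by (intro sum.neutral) (auto simp: indicator_def)

lemma pwf_measurable:
  assumes "\<And>T. T \<in> \<T> \<Longrightarrow> continuous_on UNIV (g T)"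
  shows "pwf g \<in> borel_measurable borel"
  unfolding pwf_def[abs_def]
proof (rule borel_measurable_sum)
  fix T assume T: "T \<in> \<T>"
  have [measurable]: "T \<in> sets borel" "g T \<in> borel_measurable borel"
    using borelT[OF T] borel_measurable_continuous_onI[OF assms[OF T]] by auto
  show "(\<lambda>x. indicat_real T x * g T x) \<in> borel_measurable borel" by measurable
qed

lemma pwf_bounded:
  assumes "\<And>T. T \<in> \<T> \<Longrightarrow> continuous_on UNIV (g T)"
  shows "\<exists>K\<ge>0. \<forall>x. \<bar>pwf g x\<bar> \<le> K"
proof -
  have "\<forall>T\<in>\<T>. \<exists>K. \<forall>x\<in>T. \<bar>g T x\<bar> \<le> K"
  proof
    fix T assume T: "T \<in> \<T>"
    show "\<exists>K. \<forall>x\<in>T. \<bar>g T x\<bar> \<le> K"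
      by (rule continuous_bounded_on[OF bdT[OF T] assms[OF T]]) blast
  qed
  from bchoice[OF this] obtain K where K: "\<And>T x. T \<in> \<T> \<Longrightarrow> x \<in> T \<Longrightarrow> \<bar>g T x\<bar> \<le> K T" by blast
  have "\<bar>pwf g x\<bar> \<le> (\<Sum>T\<in>\<T>. \<bar>K T\<bar>)" for x
    unfolding pwf_def
  proof (rule order_trans[OF sum_abs], rule sum_mono)
    fix T assume "T \<in> \<T>"
    then show "\<bar>indicat_real T x * g T x\<bar> \<le> \<bar>K T\<bar>" using K[of T x] by (cases "x \<in> T") auto
  qed
  then show ?thesis by (intro exI[of _ "\<Sum>T\<in>\<T>. \<bar>K T\<bar>"]) (auto intro: sum_nonneg)
qed

lemma pwf_L2:
  assumes "\<And>T. T \<in> \<T> \<Longrightarrow> continuous_on UNIV (g T)"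
  shows "L2_on \<Omega> (pwf g)"
proof -
  obtain K where K: "\<And>x. \<bar>pwf g x\<bar> \<le> K" using pwf_bounded[of g, OF assms] by blast
  have "set_borel_measurable lborel \<Omega> (pwf g)"
    using pwf_measurable[OF assms] borelO by (auto simp: set_borel_measurable_def)
  then show ?thesis using K borelO bdO by (intro bounded_measurable_L2_on) auto
qed

lemma set_integral_cells:
  fixes F :: "pt \<Rightarrow> real"
  assumes "set_integrable lborel \<Omega> F"
  shows "(LINT x:\<Omega>|lborel. F x) = (\<Sum>T\<in>\<T>. LINT x:T|lborel. F x)"
proof -
  have i: "integrable lborel (\<lambda>x. indicat_real T x *\<^sub>R F x)" if "T \<in> \<T>" for T
    using set_integrable_subset[OF assms, of T] that subT borelT by (auto simp: set_integrable_def)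
  have "(LINT x:\<Omega>|lborel. F x) = (LINT x|lborel. (\<Sum>T\<in>\<T>. indicat_real T x *\<^sub>R F x))"
    unfolding set_lebesgue_integral_def
  proof (rule integral_cong_AE)
    show "AE x in lborel. indicat_real \<Omega> x *\<^sub>R F x = (\<Sum>T\<in>\<T>. indicat_real T x *\<^sub>R F x)"
      using AE_cells_in
    proof eventually_elim
      case (elim x)
      show ?case
      proof (cases "x \<in> \<Omega>")
        case True
        then obtain T where "T \<in> \<T>" "x \<in> T" using elim by auto
        then show ?thesis using pwf_in[of T x "\<lambda>_. F"] True by (simp add: pwf_def)
      next
        case False
        then show ?thesis using pwf_out[of x "\<lambda>_. F"] by (simp add: pwf_def)
      qed
    qed
  qed (use assms i in \<open>auto simp: set_integrable_def\<close>)
  also have "\<dots> = (\<Sum>T\<in>\<T>. LINT x:T|lborel. F x)"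
    unfolding set_lebesgue_integral_def using i by (rule Bochner_Integration.integral_sum)
  finally show ?thesis .
qed

lemma set_integral_cong_cells:
  fixes F G :: "pt \<Rightarrow> real"
  assumes "set_integrable lborel \<Omega> F" "set_integrable lborel \<Omega> G" "\<And>T x. T \<in> \<T> \<Longrightarrow> x \<in> T \<Longrightarrow> F x = G x"
  shows "(LINT x:\<Omega>|lborel. F x) = (LINT x:\<Omega>|lborel. G x)"
  unfolding set_integral_cells[OF assms(1)] set_integral_cells[OF assms(2)]
proof (intro sum.cong refl)
  fix T assume T: "T \<in> \<T>"
  then show "(LINT x:T|lborel. F x) = (LINT x:T|lborel. G x)"
    using assms(3) borelT by (intro set_lebesgue_integral_cong) auto
qed

text \<open>The continuous counterpart of \<open>pwf\<close>: it lives on the closed cells. The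
  choice is immaterial once the data agree on overlaps, and then the two functions agree inside the
  cells.\<close>

definition glued :: "(pt set \<Rightarrow> pt \<Rightarrow> real) \<Rightarrow> pt \<Rightarrow> real" where
  "glued f x = (if \<exists>T\<in>\<T>. x \<in> closure T then f (SOME T. T \<in> \<T> \<and> x \<in> closure T) x else 0)"

context
  fixes f :: "pt set \<Rightarrow> pt \<Rightarrow> real"
  assumes sm: "\<And>T. T \<in> \<T> \<Longrightarrow> smooth2 (f T)"
    and agree: "\<And>T T' x. T \<in> \<T> \<Longrightarrow> T' \<in> \<T> \<Longrightarrow> x \<in> closure T \<Longrightarrow> x \<in> closure T' \<Longrightarrow> f T x = f T' x"
    and bdry: "\<And>T x. T \<in> \<T> \<Longrightarrow> x \<in> closure T \<Longrightarrow> x \<notin> \<Omega> \<Longrightarrow> f T x = 0"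
begin

lemma glued_in: "T \<in> \<T> \<Longrightarrow> x \<in> closure T \<Longrightarrow> glued f x = f T x"
proof -
  assume T: "T \<in> \<T>" "x \<in> closure T"
  then have S: "(SOME T. T \<in> \<T> \<and> x \<in> closure T) \<in> \<T> \<and> x \<in> closure (SOME T. T \<in> \<T> \<and> x \<in> closure T)"
    by (intro someI[of "\<lambda>T. T \<in> \<T> \<and> x \<in> closure T"]) auto
  have "glued f x = f (SOME T. T \<in> \<T> \<and> x \<in> closure T) x" using T by (auto simp: glued_def)
  also have "\<dots> = f T x" by (rule agree[OF conjunct1[OF S] T(1) conjunct2[OF S] T(2)])
  finally show ?thesis .
qed

lemma glued_out: "x \<notin> \<Omega> \<Longrightarrow> glued f x = 0"
proof (cases "\<exists>T\<in>\<T>. x \<in> closure T")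
  case True
  assume x: "x \<notin> \<Omega>"
  obtain T where T: "T \<in> \<T>" "x \<in> closure T" using True by blast
  show ?thesis unfolding glued_in[OF T] by (rule bdry[OF T x])
qed (simp add: glued_def)

text \<open>\<open>\<Omega>\<close> need not be convex, so the estimate is made along the segment
  from \<open>x\<close> to \<open>y\<close> in the plane. Its parameter interval is covered by
  finitely many closed sets, one for each closed cell and one for the complement of
  \<open>\<Omega>\<close>, and on each of them the function is Lipschitz with the same
  constant.\<close>

lemma glued_Lipschitz: "\<exists>L\<ge>0. \<forall>x y. \<bar>glued f x - glued f y\<bar> \<le> L * dist x y"
proof -
  obtain R where R: "\<And>x. x \<in> closure \<Omega> \<Longrightarrow> norm x \<le> R"
    using bounded_closure[OF bdO] unfolding bounded_iff by blast
  have "\<forall>T\<in>\<T>. \<exists>L\<ge>0. L-lipschitz_on (cball 0 R) (f T)" using smooth2_Lipschitz[OF sm] by blast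
  from bchoice[OF this] obtain L where L: "\<And>T. T \<in> \<T> \<Longrightarrow> L T \<ge> 0" "\<And>T. T \<in> \<T> \<Longrightarrow> (L T)-lipschitz_on (cball 0 R) (f T)" by blast
  define K where "K = sum L \<T>"
  have K0: "K \<ge> 0" unfolding K_def using L by (intro sum_nonneg) auto
  have LK: "L T \<le> K" if "T \<in> \<T>" for T unfolding K_def using that L fin by (intro member_le_sum) auto
  have "\<bar>glued f x - glued f y\<bar> \<le> K * dist x y" for x y
  proof -
    let ?p = "\<lambda>t::real. x + t *\<^sub>R (y - x)"
    let ?I = "insert None (Some ` \<T>)"
    define U where "U i = {0..1} \<inter> ?p -` (case i of None \<Rightarrow> - \<Omega> | Some T \<Rightarrow> closure T)" for i
    have cp: "continuous_on UNIV ?p" by (intro continuous_intros)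
    have "(K * dist x y)-lipschitz_on {0..1} (\<lambda>t. glued f (?p t))"
    proof (rule lipschitz_on_closed_Union[where I = ?I and U = U])
      fix i assume i: "i \<in> ?I"
      show "closed (U i)"
        unfolding U_def using opO by (intro closed_Int closed_vimage cp) (auto split: option.split)
      show "(K * dist x y)-lipschitz_on (U i) (\<lambda>t. glued f (?p t))"
      proof (cases i)
        case None
        then show ?thesis using K0 by (intro lipschitz_onI) (auto simp: U_def glued_out)
      next
        case (Some T)
        then have T: "T \<in> \<T>" using i by auto
        show ?thesis
        proof (rule lipschitz_onI)
          fix s t assume "s \<in> U i" "t \<in> U i"
          then have st: "?p s \<in> closure T" "?p t \<in> closure T" using Some by (auto simp: U_def)
          then have "?p s \<in> cball 0 R" "?p t \<in> cball 0 R"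
            using R closure_mono[OF subT[OF T]] by auto
          then have "dist (f T (?p s)) (f T (?p t)) \<le> L T * dist (?p s) (?p t)"
            by (rule lipschitz_onD[OF L(2)[OF T]])
          also have "\<dots> \<le> K * dist (?p s) (?p t)" using LK[OF T] by (intro mult_right_mono) auto
          also have "dist (?p s) (?p t) = dist x y * dist s t"
            by (simp add: dist_norm scaleR_left_diff_distrib[symmetric] norm_minus_commute dist_real_def)
          finally show "dist (glued f (?p s)) (glued f (?p t)) \<le> K * dist x y * dist s t"
            using st T by (simp add: glued_in mult.assoc)
        qed (use K0 in auto)
      qed
    next
      show "{0..1} \<subseteq> \<Union> (U ` ?I)"
      proof
        fix t :: real assume t: "t \<in> {0..1}"
        show "t \<in> \<Union> (U ` ?I)"
        proof (cases "?p t \<in> \<Omega>")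
          case True
          then obtain T where "T \<in> \<T>" "?p t \<in> closure T" using cover by blast
          then have "t \<in> U (Some T)" "Some T \<in> ?I" using t by (auto simp: U_def)
          then show ?thesis by blast
        next
          case False
          then have "t \<in> U None" using t by (auto simp: U_def)
          then show ?thesis by blast
        qed
      qed
    qed (use fin K0 in auto)
    from lipschitz_onD[OF this, of 0 1]
    have "dist (glued f (?p 0)) (glued f (?p 1)) \<le> K * dist x y * dist 0 (1::real)" by simp
    then show ?thesis by (simp add: dist_real_def)
  qed
  then show ?thesis using K0 by blast
qed

lemma glued_measurable: "glued f \<in> borel_measurable borel"
proof -
  obtain L where L: "L \<ge> 0" "\<And>x y. \<bar>glued f x - glued f y\<bar> \<le> L * dist x y" using glued_Lipschitz by blast
  then have "L-lipschitz_on UNIV (glued f)" by (auto simp: lipschitz_on_def dist_real_def)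
  then show ?thesis by (intro borel_measurable_continuous_onI lipschitz_on_continuous_on)
qed

lemma glued_bounded: "\<exists>K\<ge>0. \<forall>x. \<bar>glued f x\<bar> \<le> K"
proof -
  obtain L where L: "L \<ge> 0" "\<And>x y. \<bar>glued f x - glued f y\<bar> \<le> L * dist x y" using glued_Lipschitz by blast
  obtain R where R: "\<And>x. x \<in> \<Omega> \<Longrightarrow> norm x \<le> R" using bdO unfolding bounded_iff by blast
  have "\<bar>glued f x\<bar> \<le> L * \<bar>R\<bar> + \<bar>glued f 0\<bar>" for x
  proof (cases "x \<in> \<Omega>")
    case True
    then have "norm x \<le> \<bar>R\<bar>" using R[of x] by linarith
    then have "L * dist x 0 \<le> L * \<bar>R\<bar>" using L(1) by (intro mult_left_mono) auto
    then show ?thesis using L(2)[of x 0] by linarith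
  qed (use L in \<open>auto simp: glued_out\<close>)
  moreover have "L * \<bar>R\<bar> + \<bar>glued f 0\<bar> \<ge> 0" using L by simp
  ultimately show ?thesis by blast
qed

text \<open>The integrals of the difference quotients vanish by translation invariance and converge to
  the integral of the derivative; this avoids slicing the domain into lines.\<close>

lemma integral_pd_glued_zero: "(LINT x:\<Omega>|lborel. pwf (\<lambda>T. pd i (f T)) x) = 0"
proof -
  let ?e = "axis i 1 :: pt" and ?F = "glued f"
  obtain L where L: "L \<ge> 0" "\<And>x y. \<bar>?F x - ?F y\<bar> \<le> L * dist x y" using glued_Lipschitz by blast
  obtain K where K: "\<And>x. \<bar>?F x\<bar> \<le> K" using glued_bounded by blast
  obtain R where R: "\<And>x. x \<in> \<Omega> \<Longrightarrow> norm x \<le> R" using bdO unfolding bounded_iff by blast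
  note [measurable] = glued_measurable
  have c: "continuous_on UNIV (pd i (f T))" if "T \<in> \<T>" for T by (rule smooth2_cont[OF smooth2_pd[OF sm[OF that]]])
  define h where "h n = 1 / real (Suc n)" for n
  have h: "0 < h n" "h n \<le> 1" for n by (auto simp: h_def)
  have hlim: "h \<longlonglongrightarrow> 0" unfolding h_def using LIMSEQ_inverse_real_of_nat by (simp add: inverse_eq_divide)
  define s where "s n x = (?F (h n *\<^sub>R ?e + x) - ?F x) / h n" for n x
  have iF: "integrable lborel ?F"
    by (rule bounded_support_integrable[OF glued_measurable K, of R]) (use R glued_out in force)
  have A: "integral\<^sup>L lborel (s n) = 0" for n
  proof -
    have "integrable lborel (\<lambda>x. ?F (h n *\<^sub>R ?e + x))"
    proof (rule bounded_support_integrable[OF _ K, of _ "R + 1"])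
      fix x :: pt assume "norm x > R + 1"
      moreover have "norm x \<le> norm (h n *\<^sub>R ?e + x) + norm (h n *\<^sub>R ?e)"
        using norm_triangle_ineq4[of "h n *\<^sub>R ?e + x" "h n *\<^sub>R ?e"] by simp
      moreover have "norm (h n *\<^sub>R ?e) \<le> 1" using h[of n] by simp
      ultimately show "?F (h n *\<^sub>R ?e + x) = 0" using R[of "h n *\<^sub>R ?e + x"] glued_out by force
    qed measurable
    then have "integral\<^sup>L lborel (s n) = ((LINT x|lborel. ?F (h n *\<^sub>R ?e + x)) - integral\<^sup>L lborel ?F) / h n"
      unfolding s_def[abs_def] using iF by simp
    then show ?thesis by (simp add: lborel_integral_translate[OF glued_measurable])
  qed
  have B: "(\<lambda>n. integral\<^sup>L lborel (s n)) \<longlonglongrightarrow> (LINT x|lborel. pwf (\<lambda>T. pd i (f T)) x)"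
  proof (rule integral_dominated_convergence)
    show "pwf (\<lambda>T. pd i (f T)) \<in> borel_measurable lborel" using pwf_measurable[OF c] by simp
    show "s n \<in> borel_measurable lborel" for n unfolding s_def[abs_def] by measurable
    show "integrable lborel (\<lambda>x. L * indicat_real (cball 0 (R + 1)) (x::pt))"
      using emeasure_bounded_finite[of "cball 0 (R + 1) :: pt set"] by (auto simp: less_top)
    show "AE x in lborel. norm (s n x) \<le> L * indicat_real (cball 0 (R + 1)) x" for n
    proof (rule AE_I2)
      fix x :: pt
      have t: "norm (h n *\<^sub>R ?e) \<le> 1" using h[of n] by simp
      show "norm (s n x) \<le> L * indicat_real (cball 0 (R + 1)) x"
      proof (cases "norm x \<le> R + 1")
        case True
        have "\<bar>?F (h n *\<^sub>R ?e + x) - ?F x\<bar> \<le> L * h n"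
          using L(2)[of "h n *\<^sub>R ?e + x" x] h[of n] by (simp add: dist_norm)
        then show ?thesis using True h[of n] by (simp add: s_def divide_le_eq)
      next
        case False
        have "norm x \<le> norm (h n *\<^sub>R ?e + x) + norm (h n *\<^sub>R ?e)"
          using norm_triangle_ineq4[of "h n *\<^sub>R ?e + x" "h n *\<^sub>R ?e"] by simp
        then have "h n *\<^sub>R ?e + x \<notin> \<Omega>" "x \<notin> \<Omega>" using R[of "h n *\<^sub>R ?e + x"] R[of x] t False by auto
        then show ?thesis using L by (simp add: s_def glued_out)
      qed
    qed
    show "AE x in lborel. (\<lambda>n. s n x) \<longlonglongrightarrow> pwf (\<lambda>T. pd i (f T)) x"
      \<comment> \<open>Inside a cell the shifted point eventually stays in the same cell and the
        limit is the partial derivative; outside \<open>closure \<Omega>\<close> the quotients are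
        eventually 0.\<close>
      using AE_cells
    proof eventually_elim
      case (elim x)
      have ev: "\<forall>\<^sub>F n in sequentially. h n *\<^sub>R ?e + x \<in> B" if "open B" "x \<in> B" for B
      proof -
        have "(\<lambda>n. h n *\<^sub>R ?e + x) \<longlonglongrightarrow> 0 *\<^sub>R ?e + x" by (intro tendsto_intros hlim)
        then show ?thesis using that topological_tendstoD by fastforce
      qed
      show ?case
      proof (cases "\<exists>T\<in>\<T>. x \<in> T")
        case True
        then obtain T where T: "T \<in> \<T>" "x \<in> T" by blast
        have "((\<lambda>t. (f T (x + t *\<^sub>R ?e) - f T x) / t) \<longlongrightarrow> pd i (f T) x) (at 0)"
          using smooth2_DERIV0[OF sm[OF T(1)], of x i] by (simp add: DERIV_def)
        moreover have "filterlim h (at 0) sequentially"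
          unfolding filterlim_at using hlim h(1) by (auto intro!: always_eventually simp: h_def)
        ultimately have "(\<lambda>n. (f T (x + h n *\<^sub>R ?e) - f T x) / h n) \<longlonglongrightarrow> pd i (f T) x"
          by (rule filterlim_compose)
        moreover have "\<forall>\<^sub>F n in sequentially. (f T (x + h n *\<^sub>R ?e) - f T x) / h n = s n x"
          using ev[OF opT[OF T(1)] T(2)]
        proof eventually_elim
          case (elim n)
          then have "glued f (h n *\<^sub>R ?e + x) = f T (h n *\<^sub>R ?e + x)" "glued f x = f T x"
            using T closure_subset by (auto intro!: glued_in)
          then show ?case by (simp add: s_def add.commute)
        qed
        ultimately show ?thesis using T by (simp add: pwf_in Lim_transform_eventually)
      next
        case False
        then have xc: "x \<in> - closure \<Omega>" using elim by auto
        have "\<forall>\<^sub>F n in sequentially. 0 = s n x"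
          using ev[OF _ xc]
        proof (rule eventually_mono)
          fix n assume "h n *\<^sub>R ?e + x \<in> - closure \<Omega>"
          then have "h n *\<^sub>R ?e + x \<notin> \<Omega>" "x \<notin> \<Omega>" using xc closure_subset by auto
          then show "0 = s n x" by (simp add: s_def glued_out)
        qed (simp add: open_Compl)
        then have "(\<lambda>n. s n x) \<longlonglongrightarrow> 0" by (rule Lim_transform_eventually[OF tendsto_const])
        moreover have "x \<notin> \<Omega>" using xc closure_subset by auto
        ultimately show ?thesis by (simp add: pwf_out)
      qed
    qed
  qed
  have "(LINT x|lborel. pwf (\<lambda>T. pd i (f T)) x) = 0" using B unfolding A by (simp add: LIMSEQ_const_iff)
  moreover have "(\<lambda>x. indicat_real \<Omega> x *\<^sub>R pwf (\<lambda>T. pd i (f T)) x) = pwf (\<lambda>T. pd i (f T))"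
    by (auto simp: fun_eq_iff indicator_def pwf_out)
  ultimately show ?thesis by (simp add: set_lebesgue_integral_def)
qed

text \<open>The Lipschitz bound of \<open>glued f\<close> dominates the derivatives of the
  approximating test functions, and near any point inside a cell \<open>glued f\<close> coincides
  with a smooth function. Dominated convergence gives the limits of values and derivatives.\<close>

lemma H10_glued: "H10_with \<Omega> (pwf f) (\<lambda>i. pwf (\<lambda>T. pd i (f T)))"
proof -
  obtain L where L: "L \<ge> 0" "\<And>x y. \<bar>glued f x - glued f y\<bar> \<le> L * dist x y" using glued_Lipschitz by blast
  obtain K where K: "\<And>x. \<bar>glued f x\<bar> \<le> K" "K \<ge> 0" using glued_bounded by blast
  have gO: "\<And>x. x \<notin> \<Omega> \<Longrightarrow> glued f x = 0" by (rule glued_out)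
  have loc: "\<exists>\<delta>>0. \<forall>y. dist x y < \<delta> \<longrightarrow> glued f y = f T y" if T: "T \<in> \<T>" "x \<in> T" for T x
  proof -
    obtain \<delta> where "\<delta> > 0" "ball x \<delta> \<subseteq> T" using opT[OF T(1)] T(2) open_contains_ball by blast
    note d = this
    have "glued f y = f T y" if "dist x y < \<delta>" for y
    proof (rule glued_in[OF T(1)])
      have "y \<in> T" using that d(2) by auto
      then show "y \<in> closure T" using closure_subset by blast
    qed
    then show ?thesis using d(1) by blast
  qed
  have dct: "(\<lambda>n. LINT x:\<Omega>|lborel. (s n x - pwf g x)\<^sup>2) \<longlonglongrightarrow> 0"
    if sc: "\<And>n. continuous_on UNIV (s n)" and sb: "\<And>n x. \<bar>s n x\<bar> \<le> B" and gc: "\<And>T. T \<in> \<T> \<Longrightarrow> continuous_on UNIV (g T)"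
      and lim: "\<And>T x. T \<in> \<T> \<Longrightarrow> x \<in> T \<Longrightarrow> (\<lambda>n. s n x) \<longlonglongrightarrow> g T x" for s B g
  proof -
    obtain D where D: "\<And>x. \<bar>pwf g x\<bar> \<le> D" "D \<ge> 0" using pwf_bounded[of g, OF gc] by blast
    have [measurable]: "pwf g \<in> borel_measurable borel" "\<And>n. s n \<in> borel_measurable borel" "\<Omega> \<in> sets borel"
      using pwf_measurable[OF gc] borel_measurable_continuous_onI[OF sc] borelO by auto
    have "(\<lambda>n. LINT x|lborel. indicat_real \<Omega> x *\<^sub>R (s n x - pwf g x)\<^sup>2) \<longlonglongrightarrow> (LINT x|(lborel :: pt measure). (0::real))"
    proof (rule integral_dominated_convergence)
      show "integrable lborel (\<lambda>x. (B + D)\<^sup>2 * indicat_real \<Omega> x)"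
        using emeasure_bounded_finite[OF bdO] by (auto simp: less_top)
      show "AE x in lborel. norm (indicat_real \<Omega> x *\<^sub>R (s n x - pwf g x)\<^sup>2) \<le> (B + D)\<^sup>2 * indicat_real \<Omega> x" for n
      proof (rule AE_I2)
        fix x
        have "\<bar>s n x - pwf g x\<bar> \<le> B + D" using sb[of n x] D(1)[of x] by linarith
        then have "(s n x - pwf g x)\<^sup>2 \<le> (B + D)\<^sup>2" by (metis abs_ge_zero power2_abs power_mono)
        then show "norm (indicat_real \<Omega> x *\<^sub>R (s n x - pwf g x)\<^sup>2) \<le> (B + D)\<^sup>2 * indicat_real \<Omega> x"
          by (simp add: indicator_def)
      qed
      show "AE x in lborel. (\<lambda>n. indicat_real \<Omega> x *\<^sub>R (s n x - pwf g x)\<^sup>2) \<longlonglongrightarrow> 0"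
        using AE_cells_in
      proof eventually_elim
        case (elim x)
        show ?case
        proof (cases "x \<in> \<Omega>")
          case True
          then obtain T where T: "T \<in> \<T>" "x \<in> T" using elim by blast
          have "(\<lambda>n. (s n x - g T x)\<^sup>2) \<longlonglongrightarrow> (g T x - g T x)\<^sup>2" by (intro tendsto_intros lim[OF T])
          then show ?thesis using True T by (simp add: pwf_in)
        qed simp
      qed
    qed measurable
    then show ?thesis by (simp add: set_lebesgue_integral_def)
  qed
  show ?thesis
  proof (rule test_fun_approximation[OF opO bdO glued_measurable K(1) gO])
    fix \<phi>
    assume \<phi>: "\<And>n. test_fun \<Omega> (\<phi> n)" "\<And>n x. \<bar>\<phi> n x\<bar> \<le> K"
    "\<And>x. x \<in> \<Omega> \<Longrightarrow> isCont (glued f) x \<Longrightarrow> (\<lambda>n. \<phi> n x) \<longlonglongrightarrow> glued f x"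
    "\<And>L n i x. L \<ge> 0 \<Longrightarrow> (\<And>x y. \<bar>glued f x - glued f y\<bar> \<le> L * dist x y) \<Longrightarrow> \<bar>pd i (\<phi> n) x\<bar> \<le> 4 * L"
    "\<And>x \<delta> g i. x \<in> \<Omega> \<Longrightarrow> \<delta> > 0 \<Longrightarrow> smooth2 g \<Longrightarrow> (\<And>y. dist x y < \<delta> \<Longrightarrow> glued f y = g y) \<Longrightarrow>
       (\<lambda>n. pd i (\<phi> n) x) \<longlonglongrightarrow> pd i g x"
    have sphi: "smooth2 (\<phi> n)" for n using \<phi>(1) by (simp add: test_fun_def)
    show "H10_with \<Omega> (pwf f) (\<lambda>i. pwf (\<lambda>T. pd i (f T)))" unfolding H10_with_def
  proof (intro exI[of _ \<phi>] conjI allI)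
    show "test_fun \<Omega> (\<phi> n)" for n by (rule \<phi>(1))
    show "(\<lambda>n. LINT x:\<Omega>|lborel. (\<phi> n x - pwf f x)\<^sup>2) \<longlonglongrightarrow> 0"
    proof (rule dct[OF smooth2_cont[OF sphi] \<phi>(2) smooth2_cont[OF sm]])
      fix T x assume T: "T \<in> \<T>" "x \<in> T"
      have "L-lipschitz_on UNIV (glued f)" using L by (auto simp: lipschitz_on_def dist_real_def)
      then have "isCont (glued f) x" using lipschitz_on_continuous_on continuous_on_eq_continuous_at by blast
      moreover have "glued f x = f T x" using T closure_subset by (intro glued_in) auto
      ultimately show "(\<lambda>n. \<phi> n x) \<longlonglongrightarrow> f T x" using \<phi>(3)[of x] T subT by auto
    qed
    show "(\<lambda>n. LINT x:\<Omega>|lborel. (pd i (\<phi> n) x - pwf (\<lambda>T. pd i (f T)) x)\<^sup>2) \<longlonglongrightarrow> 0" for i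
    proof (rule dct[OF smooth2_cont[OF smooth2_pd[OF sphi]] \<phi>(4)[OF L] smooth2_cont[OF smooth2_pd[OF sm]]])
      fix T x assume T: "T \<in> \<T>" "x \<in> T"
      obtain \<delta> where \<delta>: "\<delta> > 0" "\<forall>y. dist x y < \<delta> \<longrightarrow> glued f y = f T y" using loc[OF T] by blast
      show "(\<lambda>n. pd i (\<phi> n) x) \<longlonglongrightarrow> pd i (f T) x"
        by (rule \<phi>(5)[OF _ \<delta>(1) sm[OF T(1)]]) (use T subT \<delta>(2) in auto)
    qed
  qed
  qed
qed

end

section \<open>Weak derivatives and the use of the regularity estimate\<close>

lemma test_fun_outside: "test_fun \<Omega> \<phi> \<Longrightarrow> x \<notin> \<Omega> \<Longrightarrow> \<phi> x = 0"
  unfolding test_fun_def using closure_subset[of "{x. \<phi> x \<noteq> 0}"] by auto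

lemma test_fun_pd:
  assumes "test_fun \<Omega> \<phi>" shows "test_fun \<Omega> (pd i \<phi>)"
proof (rule test_funI)
  show "smooth2 (pd i \<phi>)" using assms by (auto simp: test_fun_def intro: smooth2_pd)
  show "x \<in> closure {x. \<phi> x \<noteq> 0}" if "pd i \<phi> x \<noteq> 0" for x
  proof (rule ccontr)
    assume "x \<notin> closure {x. \<phi> x \<noteq> 0}"
    then obtain e where e: "e > 0" "\<And>y. dist y x < e \<Longrightarrow> \<phi> y = 0"
      unfolding closure_approachable by auto
    have "((\<lambda>t. \<phi> (x + t *\<^sub>R axis i 1)) has_real_derivative 0) (at 0)"
      by (rule has_field_derivative_transform_within_open[of "\<lambda>_. 0" _ _ "{-e<..<e}"])
        (use e in \<open>auto simp: dist_norm\<close>)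
    then show False using that pd_eqI by blast
  qed
qed (use assms bdO in \<open>auto simp: test_fun_def\<close>)

text \<open>The products \<open>f T x * \<phi> x\<close> satisfy the gluing conditions, at the
  boundary because \<open>\<phi>\<close> vanishes there, so their derivatives integrate to zero;
  this is integration by parts. Agreement is required inside \<open>\<Omega>\<close> only, which is
  exactly what gradient jumps on interior edges provide.\<close>

lemma weak_pd_pwf:
  assumes sm: "\<And>T. T \<in> \<T> \<Longrightarrow> smooth2 (f T)"
    and agree: "\<And>T T' x. T \<in> \<T> \<Longrightarrow> T' \<in> \<T> \<Longrightarrow> x \<in> closure T \<Longrightarrow> x \<in> closure T' \<Longrightarrow> x \<in> \<Omega> \<Longrightarrow> f T x = f T' x"
  shows "weak_pd \<Omega> i (pwf f) (pwf (\<lambda>T. pd i (f T)))"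
  unfolding weak_pd_def
proof (intro allI impI)
  fix \<phi> assume \<phi>: "test_fun \<Omega> \<phi>"
  have s\<phi>: "smooth2 \<phi>" using \<phi> by (simp add: test_fun_def)
  have "(LINT x:\<Omega>|lborel. pwf (\<lambda>T. pd i (\<lambda>x. f T x * \<phi> x)) x) = 0"
  proof (rule integral_pd_glued_zero)
    fix T T' x assume T: "T \<in> \<T>" "T' \<in> \<T>" "x \<in> closure T" "x \<in> closure T'"
    then show "f T x * \<phi> x = f T' x * \<phi> x"
      using agree[OF T] test_fun_outside[OF \<phi>, of x] by (cases "x \<in> \<Omega>") auto
  qed (use sm s\<phi> test_fun_outside[OF \<phi>] in auto)
  also have "(LINT x:\<Omega>|lborel. pwf (\<lambda>T. pd i (\<lambda>x. f T x * \<phi> x)) x)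
      = (LINT x:\<Omega>|lborel. pwf (\<lambda>T. pd i (f T)) x * \<phi> x + pwf f x * pd i \<phi> x)"
  proof (rule set_integral_cong_cells)
    have "L2_on \<Omega> (pwf (\<lambda>T. pd i (\<lambda>x. f T x * \<phi> x)))"
      by (intro pwf_L2 smooth2_cont smooth2_pd smooth2_mult sm s\<phi>)
    then show "set_integrable lborel \<Omega> (pwf (\<lambda>T. pd i (\<lambda>x. f T x * \<phi> x)))"
      using L2_on_set_integrable borelO bdO by blast
    show "set_integrable lborel \<Omega> (\<lambda>x. pwf (\<lambda>T. pd i (f T)) x * \<phi> x + pwf f x * pd i \<phi> x)"
      by (intro set_integral_add L2_on_mult_integrable pwf_L2 continuous_L2_on borelO bdO smooth2_cont smooth2_pd sm s\<phi>)
    show "pwf (\<lambda>T. pd i (\<lambda>x. f T x * \<phi> x)) x = pwf (\<lambda>T. pd i (f T)) x * \<phi> x + pwf f x * pd i \<phi> x"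
      if "T \<in> \<T>" "x \<in> T" for T x
      using that by (simp add: pwf_in pd_mult[OF sm s\<phi>])
  qed
  also have "\<dots> = (LINT x:\<Omega>|lborel. pwf (\<lambda>T. pd i (f T)) x * \<phi> x) + (LINT x:\<Omega>|lborel. pwf f x * pd i \<phi> x)"
    by (intro set_integral_add L2_on_mult_integrable pwf_L2 continuous_L2_on borelO bdO smooth2_cont smooth2_pd sm s\<phi>)
  finally show "(LINT x:\<Omega>|lborel. pwf f x * pd i \<phi> x) = - (LINT x:\<Omega>|lborel. pwf (\<lambda>T. pd i (f T)) x * \<phi> x)"
    by simp
qed

text \<open>Transfers a norm bound from a weak derivative \<open>D\<close> to a piecewise one.
  Equality against test functions extends to the bounded function \<open>pwf g\<close> itself by
  approximation; Cauchy-Schwarz and cancellation of one factor finish the argument.\<close>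

lemma pwf_norm_le:
  assumes gc: "\<And>T. T \<in> \<T> \<Longrightarrow> continuous_on UNIV (g T)" and D: "L2_on \<Omega> D"
    and eq: "\<And>\<phi>. test_fun \<Omega> \<phi> \<Longrightarrow> (LINT x:\<Omega>|lborel. pwf g x * \<phi> x) = (LINT x:\<Omega>|lborel. D x * \<phi> x)"
  shows "L2_norm_on \<Omega> (pwf g) \<le> L2_norm_on \<Omega> D"
proof -
  obtain K where K: "\<And>x. \<bar>pwf g x\<bar> \<le> K" "K \<ge> 0" using pwf_bounded[of g, OF gc] by blast
  have gO: "\<And>x. x \<notin> \<Omega> \<Longrightarrow> pwf g x = 0" by (rule pwf_out)
  have gL: "L2_on \<Omega> (pwf g)" by (rule pwf_L2[OF gc])
  obtain \<phi> where \<phi>: "\<And>n. test_fun \<Omega> (\<phi> n)" "\<And>n x. \<bar>\<phi> n x\<bar> \<le> K"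
    "\<And>x. x \<in> \<Omega> \<Longrightarrow> isCont (pwf g) x \<Longrightarrow> (\<lambda>n. \<phi> n x) \<longlonglongrightarrow> pwf g x"
  proof (rule test_fun_approximation[OF opO bdO pwf_measurable[OF gc] K(1) gO])
    fix \<phi>
    assume a: "\<And>n. test_fun \<Omega> (\<phi> n)" and b: "\<And>n x. \<bar>\<phi> n x\<bar> \<le> K"
      and c: "\<And>x. x \<in> \<Omega> \<Longrightarrow> isCont (pwf g) x \<Longrightarrow> (\<lambda>n. \<phi> n x) \<longlonglongrightarrow> pwf g x"
    show thesis by (rule that[of \<phi>]) (rule a, rule b, rule c, assumption+)
  qed
  have cphi: "continuous_on UNIV (\<phi> n)" for n using \<phi>(1) by (auto simp: test_fun_def intro: smooth2_cont)
  have lim: "(\<lambda>n. LINT x:\<Omega>|lborel. E x * \<phi> n x) \<longlonglongrightarrow> (LINT x:\<Omega>|lborel. E x * pwf g x)" if E: "L2_on \<Omega> E" for E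
    unfolding set_lebesgue_integral_def
  proof (rule integral_dominated_convergence)
    have "L2_on \<Omega> (\<phi> n)" for n by (rule continuous_L2_on[OF borelO bdO cphi])
    from L2_on_mult_integrable[OF E this]
    show "(\<lambda>x. indicat_real \<Omega> x *\<^sub>R (E x * \<phi> n x)) \<in> borel_measurable lborel" for n
      by (auto simp: set_integrable_def)
    show "(\<lambda>x. indicat_real \<Omega> x *\<^sub>R (E x * pwf g x)) \<in> borel_measurable lborel"
      using L2_on_mult_integrable[OF E gL] by (auto simp: set_integrable_def)
    have "set_integrable lborel \<Omega> E" by (rule L2_on_set_integrable[OF borelO bdO E])
    then have "integrable lborel (\<lambda>x. K * \<bar>indicat_real \<Omega> x *\<^sub>R E x\<bar>)"
      unfolding set_integrable_def by (intro integrable_mult_right integrable_abs)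
    then show "integrable lborel (\<lambda>x. K * \<bar>indicat_real \<Omega> x *\<^sub>R E x\<bar>)" .
    show "AE x in lborel. norm (indicat_real \<Omega> x *\<^sub>R (E x * \<phi> n x)) \<le> K * \<bar>indicat_real \<Omega> x *\<^sub>R E x\<bar>" for n
    proof (rule AE_I2)
      fix x
      have "\<bar>E x\<bar> * \<bar>\<phi> n x\<bar> \<le> \<bar>E x\<bar> * K" using \<phi>(2) by (intro mult_left_mono) auto
      then show "norm (indicat_real \<Omega> x *\<^sub>R (E x * \<phi> n x)) \<le> K * \<bar>indicat_real \<Omega> x *\<^sub>R E x\<bar>"
        by (simp add: indicator_def abs_mult mult.commute)
    qed
    show "AE x in lborel. (\<lambda>n. indicat_real \<Omega> x *\<^sub>R (E x * \<phi> n x)) \<longlonglongrightarrow> indicat_real \<Omega> x *\<^sub>R (E x * pwf g x)"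
      using AE_cells_in
    proof eventually_elim
      case (elim x)
      show ?case
      proof (cases "x \<in> \<Omega>")
        case True
        then obtain T where T: "T \<in> \<T>" "x \<in> T" using elim by blast
        have "isCont (g T) x" using gc[OF T(1)] by (simp add: continuous_on_eq_continuous_at)
        moreover have "\<forall>\<^sub>F y in nhds x. pwf g y = g T y"
          using eventually_nhds_in_open[OF opT[OF T(1)] T(2)] by eventually_elim (simp add: pwf_in T)
        ultimately have "isCont (pwf g) x" using isCont_cong by blast
        then have "(\<lambda>n. \<phi> n x) \<longlonglongrightarrow> pwf g x" by (rule \<phi>(3)[OF True])
        then show ?thesis by (intro tendsto_intros)
      qed simp
    qed
  qed
  have "(LINT x:\<Omega>|lborel. pwf g x * pwf g x) = (LINT x:\<Omega>|lborel. D x * pwf g x)"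
    by (rule LIMSEQ_unique[OF lim[OF gL]]) (unfold eq[OF \<phi>(1)], rule lim[OF D])
  then have "(L2_norm_on \<Omega> (pwf g))\<^sup>2 = (LINT x:\<Omega>|lborel. D x * pwf g x)"
    unfolding L2_norm_sq unfolding power2_eq_square .
  also have "\<dots> \<le> L2_norm_on \<Omega> D * L2_norm_on \<Omega> (pwf g)"
    using L2_Cauchy_Schwarz[OF D gL] by linarith
  finally have q: "L2_norm_on \<Omega> (pwf g) * L2_norm_on \<Omega> (pwf g) \<le> L2_norm_on \<Omega> D * L2_norm_on \<Omega> (pwf g)"
    by (simp add: power2_eq_square)
  show ?thesis
  proof (cases "L2_norm_on \<Omega> (pwf g) = 0")
    case False
    then have "L2_norm_on \<Omega> (pwf g) > 0" using L2_norm_nonneg[of \<Omega> "pwf g"] by linarith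
    then show ?thesis using q by simp
  qed simp
qed

text \<open>A function without jumps is itself a strong solution, with right-hand side
  \<open>g\<close>; uniqueness identifies it with the solution whose norm is bounded. The piecewise
  derivatives are then compared with the weak ones of that solution by testing.\<close>

lemma regularity_bound:
  assumes reg: "\<And>g. L2_on \<Omega> g \<Longrightarrow>
      (\<exists>u D1 D2. strong_sol \<Omega> a c g u D1 D2 \<and> H2_norm \<Omega> u D1 D2 \<le> C * L2_norm_on \<Omega> g) \<and>
      (\<forall>u D1 D2 v E1 E2. strong_sol \<Omega> a c g u D1 D2 \<longrightarrow> strong_sol \<Omega> a c g v E1 E2 \<longrightarrow>
          (AE x in lborel. x \<in> \<Omega> \<longrightarrow> u x = v x))"
    and sm: "\<And>T. T \<in> \<T> \<Longrightarrow> smooth2 (v T)"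
    and agree: "\<And>T T' x. T \<in> \<T> \<Longrightarrow> T' \<in> \<T> \<Longrightarrow> x \<in> closure T \<Longrightarrow> x \<in> closure T' \<Longrightarrow> v T x = v T' x"
    and bdry: "\<And>T x. T \<in> \<T> \<Longrightarrow> x \<in> closure T \<Longrightarrow> x \<notin> \<Omega> \<Longrightarrow> v T x = 0"
    and agree1: "\<And>T T' x i. T \<in> \<T> \<Longrightarrow> T' \<in> \<T> \<Longrightarrow> x \<in> closure T \<Longrightarrow> x \<in> closure T' \<Longrightarrow> x \<in> \<Omega> \<Longrightarrow> pd i (v T) x = pd i (v T') x"
    and am: "\<And>i j. set_borel_measurable lborel \<Omega> (\<lambda>x. a x $ i $ j)" and ab: "\<And>i j x. x \<in> \<Omega> \<Longrightarrow> \<bar>a x $ i $ j\<bar> \<le> B"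
    and cm: "set_borel_measurable lborel \<Omega> c" and cb: "\<And>x. x \<in> \<Omega> \<Longrightarrow> \<bar>c x\<bar> \<le> B"
  defines "g \<equiv> \<lambda>x. (\<Sum>i\<in>UNIV. \<Sum>j\<in>UNIV. a x $ i $ j * pwf (\<lambda>T. pd i (pd j (v T))) x) + c x * pwf v x"
  shows "L2_on \<Omega> g" "L2_norm_on \<Omega> (pwf v) \<le> C * L2_norm_on \<Omega> g"
    "L2_norm_on \<Omega> (pwf (\<lambda>T. pd i (v T))) \<le> C * L2_norm_on \<Omega> g"
    "L2_norm_on \<Omega> (pwf (\<lambda>T. pd i (pd j (v T)))) \<le> C * L2_norm_on \<Omega> g"
proof -
  let ?D1 = "\<lambda>i. pwf (\<lambda>T. pd i (v T))" and ?D2 = "\<lambda>i j. pwf (\<lambda>T. pd i (pd j (v T)))"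
  have c0: "\<And>T. T \<in> \<T> \<Longrightarrow> continuous_on UNIV (v T)" and c1: "\<And>i T. T \<in> \<T> \<Longrightarrow> continuous_on UNIV (pd i (v T))"
    and c2: "\<And>i j T. T \<in> \<T> \<Longrightarrow> continuous_on UNIV (pd i (pd j (v T)))"
    by (rule smooth2_cont[OF sm], assumption, rule smooth2_cont[OF smooth2_pd[OF sm]], assumption,
        rule smooth2_cont[OF smooth2_pd[OF smooth2_pd[OF sm]]], assumption)
  note L0 = pwf_L2[OF c0] and L1 = pwf_L2[OF c1] and L2 = pwf_L2[OF c2]
  show Lg: "L2_on \<Omega> g"
    unfolding g_def
    by (intro L2_on_add L2_on_sum L2_on_bounded_mult[OF am ab] L2_on_bounded_mult[OF cm cb] L0 L2) auto
  have w1: "weak_pd \<Omega> i (pwf v) (?D1 i)" for i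
    by (rule weak_pd_pwf[OF sm agree]) auto
  have w2: "weak_pd \<Omega> i (?D1 j) (?D2 i j)" for i j
    by (rule weak_pd_pwf[OF smooth2_pd[OF sm] agree1]) auto
  have "strong_sol \<Omega> a c g (pwf v) ?D1 ?D2"
    unfolding strong_sol_def H2_with_def using L0 L1 L2 w1 w2 H10_glued[OF sm agree bdry] by (auto simp: g_def)
  moreover obtain u D1 D2 where u: "strong_sol \<Omega> a c g u D1 D2" "H2_norm \<Omega> u D1 D2 \<le> C * L2_norm_on \<Omega> g"
    using reg[OF Lg] by blast
  ultimately have ae: "AE x in lborel. x \<in> \<Omega> \<longrightarrow> pwf v x = u x" using reg[OF Lg] by blast
  have H: "L2_on \<Omega> u" "\<And>i. L2_on \<Omega> (D1 i)" "\<And>i. weak_pd \<Omega> i u (D1 i)" "\<And>i j. L2_on \<Omega> (D2 i j)" "\<And>i j. weak_pd \<Omega> i (D1 j) (D2 i j)"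
    using u(1) by (auto simp: strong_sol_def H2_with_def)
  have e0: "(LINT x:\<Omega>|lborel. pwf v x * \<phi> x) = (LINT x:\<Omega>|lborel. u x * \<phi> x)" if \<phi>: "test_fun \<Omega> \<phi>" for \<phi>
    unfolding set_lebesgue_integral_def
  proof (rule integral_cong_AE)
    have "L2_on \<Omega> \<phi>" using \<phi> by (intro continuous_L2_on[OF borelO bdO]) (auto simp: test_fun_def intro: smooth2_cont)
    then show "(\<lambda>x. indicat_real \<Omega> x *\<^sub>R (pwf v x * \<phi> x)) \<in> borel_measurable lborel"
      "(\<lambda>x. indicat_real \<Omega> x *\<^sub>R (u x * \<phi> x)) \<in> borel_measurable lborel"
      using L2_on_mult_integrable[OF L0] L2_on_mult_integrable[OF H(1)] by (auto simp: set_integrable_def)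
    show "AE x in lborel. indicat_real \<Omega> x *\<^sub>R (pwf v x * \<phi> x) = indicat_real \<Omega> x *\<^sub>R (u x * \<phi> x)"
      using ae by eventually_elim (auto simp: indicator_def)
  qed
  \<comment> \<open>Using \<open>e0\<close> with \<open>pd i \<phi>\<close> as test function moves
    the derivative onto the test function; \<open>e2\<close> repeats this, starting from
    \<open>e1\<close>.\<close>
  have e1: "(LINT x:\<Omega>|lborel. ?D1 i x * \<phi> x) = (LINT x:\<Omega>|lborel. D1 i x * \<phi> x)" if \<phi>: "test_fun \<Omega> \<phi>" for \<phi> i
    using w1[of i] H(3)[of i] e0[OF test_fun_pd[OF \<phi>, of i]] \<phi> by (simp add: weak_pd_def)
  have e2: "(LINT x:\<Omega>|lborel. ?D2 i j x * \<phi> x) = (LINT x:\<Omega>|lborel. D2 i j x * \<phi> x)" if \<phi>: "test_fun \<Omega> \<phi>" for \<phi> i j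
    using w2[of i j] H(5)[of i j] e1[OF test_fun_pd[OF \<phi>, of i], of j] \<phi> by (simp add: weak_pd_def)
  have nn: "0 \<le> (L2_norm_on \<Omega> u)\<^sup>2" "0 \<le> (\<Sum>i\<in>UNIV. (L2_norm_on \<Omega> (D1 i))\<^sup>2)" "0 \<le> (\<Sum>i\<in>UNIV. \<Sum>j\<in>UNIV. (L2_norm_on \<Omega> (D2 i j))\<^sup>2)"
    by (auto intro!: sum_nonneg)
  have Hn: "H2_norm \<Omega> u D1 D2 = sqrt ((L2_norm_on \<Omega> u)\<^sup>2 + (\<Sum>i\<in>UNIV. (L2_norm_on \<Omega> (D1 i))\<^sup>2)
      + (\<Sum>i\<in>UNIV. \<Sum>j\<in>UNIV. (L2_norm_on \<Omega> (D2 i j))\<^sup>2))"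
    by (simp add: H2_norm_def L2_norm_sq)
  have b0: "L2_norm_on \<Omega> u \<le> H2_norm \<Omega> u D1 D2"
    unfolding Hn using nn by (intro real_le_rsqrt) linarith
  have b1: "L2_norm_on \<Omega> (D1 i) \<le> H2_norm \<Omega> u D1 D2" for i
  proof -
    have "(L2_norm_on \<Omega> (D1 i))\<^sup>2 \<le> (\<Sum>i\<in>UNIV. (L2_norm_on \<Omega> (D1 i))\<^sup>2)"
      by (rule member_le_sum) auto
    then show ?thesis unfolding Hn using nn by (intro real_le_rsqrt) linarith
  qed
  have b2: "L2_norm_on \<Omega> (D2 i j) \<le> H2_norm \<Omega> u D1 D2" for i j
  proof -
    have "(L2_norm_on \<Omega> (D2 i j))\<^sup>2 \<le> (\<Sum>j\<in>UNIV. (L2_norm_on \<Omega> (D2 i j))\<^sup>2)"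
      by (rule member_le_sum) auto
    also have "\<dots> \<le> (\<Sum>i\<in>UNIV. \<Sum>j\<in>UNIV. (L2_norm_on \<Omega> (D2 i j))\<^sup>2)"
      by (rule member_le_sum[of i UNIV "\<lambda>i. \<Sum>j\<in>UNIV. (L2_norm_on \<Omega> (D2 i j))\<^sup>2"]) (auto intro: sum_nonneg)
    finally show ?thesis unfolding Hn using nn by (intro real_le_rsqrt) linarith
  qed
  show "L2_norm_on \<Omega> (pwf v) \<le> C * L2_norm_on \<Omega> g"
    using pwf_norm_le[OF c0 H(1) e0] b0 u(2) by linarith
  show "L2_norm_on \<Omega> (?D1 i) \<le> C * L2_norm_on \<Omega> g"
    using pwf_norm_le[OF c1 H(2) e1] b1[of i] u(2) by (meson order_trans)
  show "L2_norm_on \<Omega> (?D2 i j) \<le> C * L2_norm_on \<Omega> g"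
    using pwf_norm_le[OF c2 H(4) e2] b2[of i j] u(2) by (meson order_trans)
qed

end

section \<open>Polygonal meshes\<close>

lemma negligible_segment: "negligible (closed_segment a b :: pt set)"
proof (cases "a = b")
  case False
  define d where "d = b - a"
  have d: "d \<noteq> 0" using False by (simp add: d_def)
  \<comment> \<open>A normal to the segment, which therefore lies on a line, that is, on a null
    hyperplane of the plane.\<close>
  define n :: pt where "n = vector [- d $ 2, d $ 1]"
  have n: "n \<bullet> d = 0" by (simp add: n_def inner_vec_def sum_2)
  have n0: "n \<noteq> 0" using d by (auto simp: n_def vec_eq_iff forall_2)
  have "closed_segment a b \<subseteq> {x. n \<bullet> x = n \<bullet> a}"
  proof
    fix x assume "x \<in> closed_segment a b"
    then obtain u where "x = (1 - u) *\<^sub>R a + u *\<^sub>R b" by (auto simp: closed_segment_def)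
    then have "x = a + u *\<^sub>R d" by (simp add: d_def algebra_simps)
    then show "x \<in> {x. n \<bullet> x = n \<bullet> a}" using n by (simp add: inner_add_right)
  qed
  moreover have "negligible {x. n \<bullet> x = n \<bullet> a}" using n0 by (intro negligible_hyperplane) simp
  ultimately show ?thesis using negligible_subset by blast
qed simp

text \<open>Cells that meet at a vertex without sharing an edge are compared by going around it.
  Close to \<open>p\<close> only edges through \<open>p\<close> occur, so two cells meeting
  elsewhere in a small punctured ball agree along a set that contains \<open>p\<close>. Grouping the
  cells by their value at \<open>p\<close> splits the punctured ball into two closed parts that
  cannot meet, and connectedness leaves one group only.\<close>

lemma glue_at_vertices:
  fixes K :: "'i \<Rightarrow> pt set" and f :: "'i \<Rightarrow> pt \<Rightarrow> real"
  assumes U: "open U" and I: "finite I" and K: "\<And>i. i \<in> I \<Longrightarrow> closed (K i)" and cov: "U \<subseteq> (\<Union>i\<in>I. K i)"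
    and V: "finite V" and E: "finite E" "\<And>S. S \<in> E \<Longrightarrow> closed S"
    and edge: "\<And>x i j. x \<in> U \<Longrightarrow> x \<notin> V \<Longrightarrow> i \<in> I \<Longrightarrow> j \<in> I \<Longrightarrow> i \<noteq> j \<Longrightarrow> x \<in> K i \<Longrightarrow> x \<in> K j \<Longrightarrow>
       \<exists>S\<in>E. x \<in> S \<and> (\<forall>y\<in>S. f i y = f j y)"
    and noiso: "\<And>p i. p \<in> V \<Longrightarrow> p \<in> U \<Longrightarrow> i \<in> I \<Longrightarrow> p \<in> K i \<Longrightarrow> p islimpt K i"
    and p: "p \<in> U" "i \<in> I" "j \<in> I" "p \<in> K i" "p \<in> K j"
  shows "f i p = f j p"
proof (cases "p \<in> V")
  case False
  then show ?thesis using edge[OF p(1) False p(2,3) _ p(4,5)] by (cases "i = j") auto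
next
  case True
  show ?thesis
  proof (rule ccontr)
    assume ne: "f i p \<noteq> f j p"
    \<comment> \<open>All that has to stay away from \<open>p\<close>: the other vertices and the
      edges that do not contain \<open>p\<close>.\<close>
    let ?Z = "(V - {p}) \<union> \<Union>{S \<in> E. p \<notin> S}"
    have "closed ?Z" using V E by (intro closed_Un finite_imp_closed closed_Union) auto
    then have "open (U - ?Z)" using U by (intro open_Diff)
    moreover have "p \<in> U - ?Z" using p(1) by auto
    ultimately obtain r where r: "r > 0" "ball p r \<subseteq> U - ?Z" using open_contains_ball by blast
    let ?D = "ball p r - {p}"
    have "connected ?D" by (intro connected_punctured_ball) simp
    let ?A = "\<Union>(K ` {k \<in> I. f k p = f i p})" and ?B = "\<Union>(K ` {k \<in> I. f k p \<noteq> f i p})"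
    have cl: "closed ?A" "closed ?B" using I K by (auto intro!: closed_UN)
    have co: "?D \<subseteq> ?A \<union> ?B"
    proof
      fix y assume "y \<in> ?D"
      then obtain k where "k \<in> I" "y \<in> K k" using r(2) cov by blast
      then show "y \<in> ?A \<union> ?B" by (cases "f k p = f i p") auto
    qed
    have di: "?A \<inter> ?B \<inter> ?D = {}"
    proof (rule ccontr)
      assume "?A \<inter> ?B \<inter> ?D \<noteq> {}"
      then obtain y k l where y: "y \<in> ?D" "k \<in> I" "f k p = f i p" "y \<in> K k" "l \<in> I" "f l p \<noteq> f i p" "y \<in> K l" by blast
      then have "y \<in> U" "y \<notin> V" "k \<noteq> l" using r(2) by auto
      then obtain S where S: "S \<in> E" "y \<in> S" "\<forall>y\<in>S. f k y = f l y" using edge y by blast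
      then have "p \<in> S" using r(2) y(1) by blast
      then show False using S(3) y(3,6) by auto
    qed
    \<comment> \<open>Each cell through \<open>p\<close> reaches into the punctured ball, so both
      groups would be nonempty there.\<close>
    have nonempty: "K k \<inter> ?D \<noteq> {}" if "k \<in> I" "p \<in> K k" for k
    proof -
      have "p islimpt K k" by (rule noiso[OF True p(1) that])
      then obtain y where "y \<in> K k" "y \<noteq> p" "dist y p < r" using r(1) unfolding islimpt_approachable by blast
      then show ?thesis by (auto simp: dist_commute)
    qed
    have "?A \<inter> ?D \<noteq> {}" using nonempty[OF p(2,4)] p(2) by blast
    moreover have "?B \<inter> ?D \<noteq> {}" using nonempty[OF p(3,5)] p(3) ne[symmetric] by blast
    ultimately show False using connected_closedD[OF \<open>connected ?D\<close> di co cl] by blast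
  qed
qed

text \<open>In the gluing argument the complement of \<open>\<Omega>\<close> acts as a further cell
  carrying the value 0, so it must have no isolated points, in contrast to the complement of a
  punctured disc. At a frontier point the local graph has complement points straight above
  it.\<close>

lemma lipschitz_domain_complement_islimpt:
  assumes dom: "lipschitz_domain \<Omega>" and p: "p \<notin> \<Omega>"
  shows "p islimpt - \<Omega>"
proof (cases "p \<in> frontier \<Omega>")
  case False
  then have "p \<in> - closure \<Omega>" using p interior_subset by (auto simp: frontier_def)
  then have "p \<in> interior (- \<Omega>)" by (simp add: closure_interior)
  then show ?thesis by (rule interior_limit_point)
next
  case True
  obtain r and Q :: "pt \<Rightarrow> pt" and g :: "real \<Rightarrow> real" where r: "r > 0" and Q: "orthogonal_transformation Q"
    and eq: "\<Omega> \<inter> ball p r = {x \<in> ball p r. Q (x - p) $ 2 < g (Q (x - p) $ 1)}"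
    using dom True unfolding lipschitz_domain_def by blast
  have lQ: "linear Q" using Q by (simp add: orthogonal_transformation_def)
  obtain u where u: "Q u = axis 2 1" using orthogonal_transformation_surj[OF Q] by (metis surjD)
  have nu: "norm u = 1" using orthogonal_transformation_norm[OF Q, of u] u by simp
  have "p \<notin> \<Omega> \<inter> ball p r" using p by simp
  then have "g 0 \<le> 0" unfolding eq using r linear_0[OF lQ] by simp
  show ?thesis unfolding islimpt_approachable
  proof (intro allI impI)
    fix e :: real assume e: "e > 0"
    define t where "t = min e r / 2"
    have t: "t > 0" "t < e" "t < r" using e r by (auto simp: t_def)
    let ?x = "p + t *\<^sub>R u"
    have "Q (?x - p) = t *\<^sub>R axis 2 1" using linear_scale[OF lQ, of t u] u by simp
    then have "Q (?x - p) $ 2 = t" "Q (?x - p) $ 1 = 0" by (auto simp: axis_def)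
    moreover have "?x \<in> ball p r" using t nu by (simp add: dist_norm)
    ultimately have "?x \<notin> \<Omega>" using eq \<open>g 0 \<le> 0\<close> t by force
    moreover have "?x \<noteq> p" "dist ?x p < e" using t nu by (auto simp: dist_norm)
    ultimately show "\<exists>x'\<in>- \<Omega>. x' \<noteq> p \<and> dist x' p < e" by blast
  qed
qed

section \<open>Elements, edges and vertices of a mesh\<close>

locale mesh =
  fixes \<Omega> :: "pt set" and M :: mesh
  assumes dom: "lipschitz_domain \<Omega>" and pm: "poly_mesh \<Omega> M"
begin

lemma dom_open: "open \<Omega>" and dom_bounded: "bounded \<Omega>" using dom by (auto simp: lipschitz_domain_def)

lemmas mesh_parts = pm[unfolded poly_mesh_def]

lemma fin_elts: "finite (fst M)"
  by (rule mesh_parts[THEN conjunct1])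

lemma fin_edges: "finite (snd M)"
  by (rule mesh_parts[THEN conjunct2, THEN conjunct1])

lemmas elt_parts = mesh_parts[THEN conjunct2, THEN conjunct2, THEN conjunct2, THEN conjunct1, THEN bspec]

lemma elt_open: "T \<in> fst M \<Longrightarrow> open T"
  by (rule elt_parts[THEN conjunct1])

lemma elt_bounded: "T \<in> fst M \<Longrightarrow> bounded T"
  by (rule elt_parts[THEN conjunct2, THEN conjunct1])

lemma elt_ne: "T \<in> fst M \<Longrightarrow> T \<noteq> {}"
  by (rule elt_parts[THEN conjunct2, THEN conjunct2, THEN conjunct1])

lemma elt_sub: "T \<in> fst M \<Longrightarrow> T \<subseteq> \<Omega>"
  by (rule elt_parts[THEN conjunct2, THEN conjunct2, THEN conjunct2, THEN conjunct1])

lemma elt_frontier: "T \<in> fst M \<Longrightarrow> frontier T = \<Union>{eseg e | e. e \<in> snd M \<and> eseg e \<subseteq> frontier T}"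
  by (rule elt_parts[THEN conjunct2, THEN conjunct2, THEN conjunct2, THEN conjunct2])

lemmas mesh_parts' = mesh_parts[THEN conjunct2, THEN conjunct2, THEN conjunct2, THEN conjunct2]

lemma elt_disj: "T1 \<in> fst M \<Longrightarrow> T2 \<in> fst M \<Longrightarrow> T1 \<noteq> T2 \<Longrightarrow> T1 \<inter> T2 = {}"
  by (rule mesh_parts'[THEN conjunct1, THEN bspec, THEN bspec, THEN mp])

lemma elt_cover: "\<Omega> \<subseteq> \<Union>(closure ` fst M)"
  by (rule mesh_parts'[THEN conjunct2, THEN conjunct1])

lemmas edge_parts = mesh_parts'[THEN conjunct2, THEN conjunct2, THEN conjunct1, THEN bspec]

lemma edge_ne: "e \<in> snd M \<Longrightarrow> fst e \<noteq> snd e"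
  by (rule edge_parts[THEN conjunct1])

lemma edge_cases: "e \<in> snd M \<Longrightarrow> (bdry_edge \<Omega> e \<and> card (adj M e) = 1) \<or>
         (open_segment (fst e) (snd e) \<subseteq> \<Omega> \<and> card (adj M e) = 2)"
  by (rule edge_parts[THEN conjunct2])

lemma edge_Int: "e1 \<in> snd M \<Longrightarrow> e2 \<in> snd M \<Longrightarrow> e1 \<noteq> e2 \<Longrightarrow> eseg e1 \<inter> eseg e2 \<subseteq> {fst e1, snd e1}"
  by (rule mesh_parts'[THEN conjunct2, THEN conjunct2, THEN conjunct2, THEN bspec, THEN bspec, THEN mp])

sublocale cells \<Omega> "fst M"
proof
  fix T assume T: "T \<in> fst M"
  have "frontier T \<subseteq> \<Union>(eseg ` snd M)" using elt_frontier[OF T] by blast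
  moreover have "negligible (\<Union>(eseg ` snd M))"
    using fin_edges by (intro negligible_Union) (auto simp: eseg_def negligible_segment)
  ultimately show "negligible (frontier T)" using negligible_subset by blast
qed (use dom_open dom_bounded fin_elts elt_open elt_sub elt_disj elt_cover in auto)

definition verts :: "pt set" where "verts = fst ` snd M \<union> snd ` snd M"

lemma finite_verts: "finite verts" using fin_edges by (simp add: verts_def)

lemma on_edge:
  assumes "T \<in> fst M" "x \<in> closure T" "x \<notin> T"
  shows "\<exists>e\<in>snd M. x \<in> eseg e \<and> T \<in> adj M e"
proof -
  have "x \<in> frontier T" using assms elt_open[OF assms(1)] by (simp add: frontier_def interior_open)
  then obtain e where "e \<in> snd M" "eseg e \<subseteq> frontier T" "x \<in> eseg e"
    using elt_frontier[OF assms(1)] by blast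
  then show ?thesis using assms(1) by (auto simp: adj_def)
qed

lemma edge_unique:
  assumes "e1 \<in> snd M" "e2 \<in> snd M" "x \<in> eseg e1" "x \<in> eseg e2" "x \<notin> verts"
  shows "e1 = e2"
  using edge_Int[of e1 e2] assms by (force simp: verts_def)

lemma finite_adj: "finite (adj M e)" using fin_elts by (simp add: adj_def)

lemma adj_elt: "T \<in> adj M e \<Longrightarrow> T \<in> fst M" and adj_frontier: "T \<in> adj M e \<Longrightarrow> eseg e \<subseteq> frontier T"
  by (auto simp: adj_def)

lemma adj_ne: "e \<in> snd M \<Longrightarrow> adj M e \<noteq> {}"
  using edge_cases[of e] by auto

lemma elt1_adj: "e \<in> snd M \<Longrightarrow> elt1 M e \<in> adj M e"
proof -
  assume "e \<in> snd M"
  then obtain T where "T \<in> adj M e" using adj_ne[of e] by auto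
  then show ?thesis unfolding elt1_def by (rule someI)
qed

lemma open_edge_not_bdry: "e \<in> snd M \<Longrightarrow> open_segment (fst e) (snd e) \<subseteq> \<Omega> \<Longrightarrow> \<not> bdry_edge \<Omega> e"
proof
  assume e: "e \<in> snd M" "open_segment (fst e) (snd e) \<subseteq> \<Omega>" "bdry_edge \<Omega> e"
  have "open_segment (fst e) (snd e) \<noteq> {}" using edge_ne[OF e(1)] by simp
  then obtain x where x: "x \<in> open_segment (fst e) (snd e)" by blast
  then have "x \<in> frontier \<Omega>" using e(3) by (auto simp: bdry_edge_def eseg_def open_segment_def)
  then show False using x e(2) dom_open by (auto simp: frontier_def interior_open)
qed

lemma interior_edge_adj:
  assumes "e \<in> snd M" "\<not> bdry_edge \<Omega> e"
  shows "adj M e = {elt1 M e, elt2 M e}" "elt2 M e \<in> adj M e"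
proof -
  have c: "card (adj M e) = 2" using edge_cases[OF assms(1)] assms(2) by auto
  then have "card (adj M e - {elt1 M e}) = 1" using elt1_adj[OF assms(1)] finite_adj by simp
  then obtain T where T: "adj M e - {elt1 M e} = {T}" using card_1_singletonE by blast
  then have e2: "elt2 M e = T" unfolding elt2_def by (intro some_equality) auto
  then show "adj M e = {elt1 M e, elt2 M e}" using T elt1_adj[OF assms(1)] by blast
  then show "elt2 M e \<in> adj M e" by blast
qed

text \<open>Off the vertices a point lies on at most one edge. Two elements touching there are
  therefore adjacent to the same edge, which then has two neighbours and cannot be a boundary
  edge.\<close>

lemma elts_at_point:
  assumes T: "T1 \<in> fst M" "T2 \<in> fst M" "T1 \<noteq> T2" "x \<in> closure T1" "x \<in> closure T2" and x: "x \<notin> verts"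
  shows "\<exists>e\<in>snd M. x \<in> eseg e \<and> \<not> bdry_edge \<Omega> e \<and> {T1, T2} = {elt1 M e, elt2 M e}"
proof -
  have "x \<notin> T1" using elt_disj[OF T(1-3)] elt_open[OF T(1)] T(5) by (metis disjoint_iff open_Int_closure_eq_empty)
  moreover have "x \<notin> T2" using elt_disj[OF T(1-3)] elt_open[OF T(2)] T(4) by (metis disjoint_iff open_Int_closure_eq_empty Int_commute)
  ultimately obtain e1 e2 where e: "e1 \<in> snd M" "x \<in> eseg e1" "T1 \<in> adj M e1" "e2 \<in> snd M" "x \<in> eseg e2" "T2 \<in> adj M e2"
    using on_edge T by meson
  then have "e1 = e2" using edge_unique x by blast
  then have a: "T1 \<in> adj M e1" "T2 \<in> adj M e1" using e by auto
  have "card {T1, T2} \<le> card (adj M e1)" using a finite_adj by (intro card_mono) auto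
  then have "card (adj M e1) \<noteq> 1" using T(3) by simp
  then have "\<not> bdry_edge \<Omega> e1" using edge_cases[OF e(1)] open_edge_not_bdry[OF e(1)] by auto
  moreover from this have "adj M e1 = {elt1 M e1, elt2 M e1}" by (rule interior_edge_adj(1)[OF e(1)])
  ultimately show ?thesis using a T(3) e(1,2) by (intro bexI[of _ e1]) auto
qed

lemma elt_at_bdry:
  assumes T: "T \<in> fst M" "x \<in> closure T" "x \<notin> \<Omega>" and x: "x \<notin> verts"
  shows "\<exists>e\<in>snd M. x \<in> eseg e \<and> bdry_edge \<Omega> e \<and> elt1 M e = T"
proof -
  have "x \<notin> T" using elt_sub T by blast
  then obtain e where e: "e \<in> snd M" "x \<in> eseg e" "T \<in> adj M e" using on_edge[OF T(1,2)] by blast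
  have "x \<in> open_segment (fst e) (snd e)" using e x by (auto simp: eseg_def verts_def open_segment_def)
  then have "bdry_edge \<Omega> e" "card (adj M e) = 1" using edge_cases[OF e(1)] T(3) by auto
  moreover from this(2) have "elt1 M e = T" using e(3) elt1_adj[OF e(1)] by (metis card_1_singletonE singletonD)
  ultimately show ?thesis using e by blast
qed

lemma closed_eseg: "closed (eseg e)" by (simp add: eseg_def)

lemma closure_islimpt: "T \<in> fst M \<Longrightarrow> p \<in> closure T \<Longrightarrow> p islimpt closure T"
proof -
  assume T: "T \<in> fst M" "p \<in> closure T"
  have "p islimpt T"
  proof (cases "p \<in> T")
    case True
    then show ?thesis using elt_open[OF T(1)] by (intro interior_limit_point) (simp add: interior_open)
  next
    case False
    then show ?thesis using T(2) by (simp add: closure_def)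
  qed
  then show ?thesis using islimpt_subset closure_subset by blast
qed

text \<open>The index \<open>None\<close> stands for the complement of \<open>\<Omega>\<close> with
  the zero function. The boundary condition becomes one more continuity condition, and boundary
  vertices are treated like interior ones.\<close>

lemma glue_values:
  assumes z: "\<And>e x. e \<in> snd M \<Longrightarrow> x \<in> eseg e \<Longrightarrow> jump \<Omega> M v e x = 0"
  shows "T1 \<in> fst M \<Longrightarrow> T2 \<in> fst M \<Longrightarrow> x \<in> closure T1 \<Longrightarrow> x \<in> closure T2 \<Longrightarrow> v T1 x = v T2 x"
    and "T \<in> fst M \<Longrightarrow> x \<in> closure T \<Longrightarrow> x \<notin> \<Omega> \<Longrightarrow> v T x = 0"
proof -
  let ?I = "insert None (Some ` fst M)"
  let ?K = "\<lambda>i. case i of None \<Rightarrow> - \<Omega> | Some T \<Rightarrow> closure T"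
  let ?f = "\<lambda>i x. case i of None \<Rightarrow> 0 | Some T \<Rightarrow> v T x"
  have ag: "\<exists>S\<in>eseg ` snd M. x \<in> S \<and> (\<forall>y\<in>S. v T1 y = v T2 y)"
    if a: "x \<notin> verts" "T1 \<in> fst M" "T2 \<in> fst M" "T1 \<noteq> T2" "x \<in> closure T1" "x \<in> closure T2" for x T1 T2
  proof -
    obtain e where e: "e \<in> snd M" "x \<in> eseg e" "\<not> bdry_edge \<Omega> e" "{T1, T2} = {elt1 M e, elt2 M e}"
      using elts_at_point[OF a(2-6,1)] by blast
    have "v (elt1 M e) y = v (elt2 M e) y" if "y \<in> eseg e" for y
      using z[OF e(1) that] e(3) by (simp add: jump_def)
    then show ?thesis using e by (auto simp: doubleton_eq_iff)
  qed
  have ab: "\<exists>S\<in>eseg ` snd M. x \<in> S \<and> (\<forall>y\<in>S. v T y = 0)"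
    if a: "x \<notin> verts" "T \<in> fst M" "x \<in> closure T" "x \<notin> \<Omega>" for x T
  proof -
    obtain e where e: "e \<in> snd M" "x \<in> eseg e" "bdry_edge \<Omega> e" "elt1 M e = T"
      using elt_at_bdry[OF a(2-4,1)] by blast
    have "v T y = 0" if "y \<in> eseg e" for y using z[OF e(1) that] e(3,4) by (simp add: jump_def)
    then show ?thesis using e by auto
  qed
  have main: "?f i p = ?f j p" if "i \<in> ?I" "j \<in> ?I" "p \<in> ?K i" "p \<in> ?K j" for i j p
  proof (rule glue_at_vertices[where U = UNIV and I = ?I and V = verts and E = "eseg ` snd M" and K = ?K and f = ?f])
    show "UNIV \<subseteq> \<Union> (?K ` ?I)" using elt_cover by auto
    fix x i j assume ij: "x \<notin> verts" "i \<in> ?I" "j \<in> ?I" "i \<noteq> j" "x \<in> ?K i" "x \<in> ?K j"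
    show "\<exists>S\<in>eseg ` snd M. x \<in> S \<and> (\<forall>y\<in>S. ?f i y = ?f j y)"
    proof (cases i)
      case None
      then obtain T where "j = Some T" "T \<in> fst M" using ij by auto
      then show ?thesis using None ij ab[of x T] by auto
    next
      case (Some T)
      then have T: "T \<in> fst M" using ij by auto
      show ?thesis
      proof (cases j)
        case None
        then show ?thesis using Some T ij ab[of x T] by auto
      next
        case (Some T')
        then have "T' \<in> fst M" using ij by auto
        then show ?thesis using Some \<open>i = Some T\<close> T ij ag[of x T T'] by auto
      qed
    qed
  next
    fix p i assume "i \<in> ?I" "p \<in> ?K i"
    then show "p islimpt ?K i"
      using lipschitz_domain_complement_islimpt[OF dom, of p] closure_islimpt[of _ p] by auto
  qed (use that fin_elts fin_edges finite_verts closed_eseg dom_open in \<open>auto split: option.splits\<close>)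
  show "T1 \<in> fst M \<Longrightarrow> T2 \<in> fst M \<Longrightarrow> x \<in> closure T1 \<Longrightarrow> x \<in> closure T2 \<Longrightarrow> v T1 x = v T2 x"
    using main[of "Some T1" "Some T2" x] by simp
  show "T \<in> fst M \<Longrightarrow> x \<in> closure T \<Longrightarrow> x \<notin> \<Omega> \<Longrightarrow> v T x = 0"
    using main[of "Some T" None x] by simp
qed

text \<open>Gradient jumps are penalized on interior edges only, so the vertex argument is run
  inside the open set \<open>\<Omega>\<close>, which the closed elements alone cover.\<close>

lemma glue_gradients:
  assumes z: "\<And>e x. e \<in> int_edges \<Omega> M \<Longrightarrow> x \<in> eseg e \<Longrightarrow> jump \<Omega> M w e x = 0"
    and T: "T1 \<in> fst M" "T2 \<in> fst M" "x \<in> closure T1" "x \<in> closure T2" "x \<in> \<Omega>"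
  shows "w T1 x = w T2 x"
proof (rule glue_at_vertices[where U = \<Omega> and I = "fst M" and V = verts and E = "eseg ` snd M" and K = closure and f = w])
  fix x T1 T2 assume "x \<notin> verts" "T1 \<in> fst M" "T2 \<in> fst M" "T1 \<noteq> T2" "x \<in> closure T1" "x \<in> closure T2"
  then obtain e where e: "e \<in> snd M" "x \<in> eseg e" "\<not> bdry_edge \<Omega> e" "{T1, T2} = {elt1 M e, elt2 M e}"
    using elts_at_point by blast
  have "w (elt1 M e) y = w (elt2 M e) y" if "y \<in> eseg e" for y
    using z[OF _ that] e by (simp add: jump_def int_edges_def)
  then show "\<exists>S\<in>eseg ` snd M. x \<in> S \<and> (\<forall>y\<in>S. w T1 y = w T2 y)" using e by (auto simp: doubleton_eq_iff)
next
  fix p T assume "T \<in> fst M" "p \<in> closure T"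
  then show "p islimpt closure T" by (rule closure_islimpt)
qed (use T fin_elts fin_edges finite_verts closed_eseg dom_open elt_cover in auto)

lemma diameter_pos: "T \<in> fst M \<Longrightarrow> diameter T > 0"
proof -
  assume T: "T \<in> fst M"
  obtain x where x: "x \<in> T" using elt_ne[OF T] by blast
  then obtain r where r: "r > 0" "ball x r \<subseteq> T" using elt_open[OF T] open_contains_ball by blast
  have "x + (r/2) *\<^sub>R axis 1 1 \<in> ball x r" using r by (simp add: dist_norm)
  then have "dist x (x + (r/2) *\<^sub>R axis 1 1) \<le> diameter T"
    using diameter_bounded_bound[OF elt_bounded[OF T] x] r by blast
  then show ?thesis using r by (simp add: dist_norm)
qed

lemma h_edge_ge: "T \<in> adj M e \<Longrightarrow> diameter T \<le> h_edge M e"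
  unfolding h_edge_def using finite_adj by (intro Max_ge) auto

lemma h_edge_pos: "e \<in> snd M \<Longrightarrow> h_edge M e > 0"
  using adj_ne[of e] h_edge_ge diameter_pos adj_elt by (metis all_not_in_conv less_le_trans)

lemma edge_length_le:
  assumes "e \<in> snd M" shows "dist (fst e) (snd e) \<le> h_edge M e"
proof -
  obtain T where T: "T \<in> adj M e" using adj_ne[OF assms] by blast
  then have "{fst e, snd e} \<subseteq> closure T"
    using adj_frontier[OF T] by (auto simp: eseg_def frontier_def)
  then have "dist (fst e) (snd e) \<le> diameter (closure T)"
    using elt_bounded[OF adj_elt[OF T]] by (intro diameter_bounded_bound) auto
  then show ?thesis using h_edge_ge[OF T] elt_bounded[OF adj_elt[OF T]] by (simp add: diameter_closure)
qed

end

section \<open>Star-shaped cells and the number of their edges\<close>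

lemma triangle_cross:
  fixes x p q :: pt
  assumes "p \<noteq> q" and far: "\<And>s. dist x (p + s *\<^sub>R (q - p)) \<ge> r" and r: "r \<ge> 0"
  shows "\<bar>(q $ 1 - x $ 1) * (p $ 2 - x $ 2) - (p $ 1 - x $ 1) * (q $ 2 - x $ 2)\<bar> \<ge> r * dist p q"
proof -
  define d where "d = q - p"
  define w where "w = x - p"
  \<comment> \<open>Parameter of the foot of the perpendicular from \<open>x\<close> to the line.
    The cross product is then base times height, by the Lagrange identity.\<close>
  define s where "s = (w \<bullet> d) / (d \<bullet> d)"
  have d: "d \<bullet> d > 0" using assms(1) by (simp add: d_def)
  have "dist x (p + s *\<^sub>R d) = norm (w - s *\<^sub>R d)" by (simp add: dist_norm w_def algebra_simps)
  then have "r \<le> norm (w - s *\<^sub>R d)" using far[of s] by (simp add: d_def)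
  then have "(r * norm d)\<^sup>2 \<le> (norm (w - s *\<^sub>R d) * norm d)\<^sup>2" using r by (intro power_mono mult_right_mono) auto
  also have "\<dots> = ((w - s *\<^sub>R d) \<bullet> (w - s *\<^sub>R d)) * (d \<bullet> d)"
    by (simp add: power_mult_distrib power2_norm_eq_inner)
  also have "\<dots> = (w \<bullet> w) * (d \<bullet> d) - (w \<bullet> d)\<^sup>2"
  proof -
    have "(w - s *\<^sub>R d) \<bullet> (w - s *\<^sub>R d) = w \<bullet> w - 2 * s * (w \<bullet> d) + s * s * (d \<bullet> d)"
      by (simp add: inner_diff_left inner_diff_right inner_commute algebra_simps)
    also have "s * s * (d \<bullet> d) = s * (w \<bullet> d)" using d by (simp add: s_def)
    finally have A: "(w - s *\<^sub>R d) \<bullet> (w - s *\<^sub>R d) = w \<bullet> w - s * (w \<bullet> d)" by simp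
    have "((w - s *\<^sub>R d) \<bullet> (w - s *\<^sub>R d)) * (d \<bullet> d) = (w \<bullet> w) * (d \<bullet> d) - s * (d \<bullet> d) * (w \<bullet> d)"
      unfolding A by (simp add: algebra_simps)
    also have "s * (d \<bullet> d) = w \<bullet> d" using d by (simp add: s_def)
    finally show ?thesis by (simp add: power2_eq_square)
  qed
  also have "\<dots> = (w $ 1 * d $ 2 - w $ 2 * d $ 1)\<^sup>2"
    by (simp add: inner_vec_def sum_2 power2_eq_square algebra_simps)
  also have "w $ 1 * d $ 2 - w $ 2 * d $ 1 = (q $ 1 - x $ 1) * (p $ 2 - x $ 2) - (p $ 1 - x $ 1) * (q $ 2 - x $ 2)"
    by (simp add: w_def d_def algebra_simps)
  finally have "(r * norm d)\<^sup>2 \<le> ((q $ 1 - x $ 1) * (p $ 2 - x $ 2) - (p $ 1 - x $ 1) * (q $ 2 - x $ 2))\<^sup>2" .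
  then have "\<bar>r * norm d\<bar> \<le> \<bar>(q $ 1 - x $ 1) * (p $ 2 - x $ 2) - (p $ 1 - x $ 1) * (q $ 2 - x $ 2)\<bar>"
    by (simp only: abs_le_square_iff)
  then show ?thesis using r by (simp add: d_def dist_norm norm_minus_commute abs_mult)
qed

locale star_cell =
  fixes T :: "pt set" and x0 :: pt and r :: real
  assumes opn: "open T" and bnd: "bounded T" and r0: "r > 0" and ballT: "ball x0 r \<subseteq> T"
    and star: "\<And>y z. y \<in> ball x0 r \<Longrightarrow> z \<in> T \<Longrightarrow> closed_segment y z \<subseteq> T"
begin

text \<open>\<open>z\<close> is replaced by a nearby point \<open>z'\<close> of \<open>T\<close>,
  and the starting point is shifted within the ball in such a way that the intermediate point stays
  the same.\<close>

lemma star_closure: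
  assumes y: "y \<in> ball x0 r" and z: "z \<in> closure T" and \<tau>: "0 \<le> \<tau>" "\<tau> < 1"
  shows "y + \<tau> *\<^sub>R (z - y) \<in> T"
proof -
  obtain \<delta> where \<delta>: "\<delta> > 0" "ball y \<delta> \<subseteq> ball x0 r" using openE[OF open_ball y] by blast
  define \<epsilon> where "\<epsilon> = \<delta> * (1 - \<tau>)"
  have "\<epsilon> > 0" using \<delta> \<tau> by (simp add: \<epsilon>_def)
  then obtain z' where z': "z' \<in> T" "dist z' z < \<epsilon>" using z unfolding closure_approachable by blast
  define y' where "y' = y + (\<tau> / (1 - \<tau>)) *\<^sub>R (z - z')"
  have "dist y y' = \<tau> / (1 - \<tau>) * dist z' z" using \<tau> by (simp add: y'_def dist_norm norm_minus_commute)
  also have "\<dots> \<le> 1 / (1 - \<tau>) * dist z' z" using \<tau> by (intro mult_right_mono divide_right_mono) auto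
  also have "\<dots> < \<delta>" using z' \<tau> by (simp add: \<epsilon>_def divide_less_eq)
  finally have "y' \<in> ball x0 r" using \<delta> by auto
  moreover have "(1 - \<tau>) *\<^sub>R y' + \<tau> *\<^sub>R z' \<in> closed_segment y' z'" using \<tau> by (auto simp: closed_segment_def)
  ultimately have "(1 - \<tau>) *\<^sub>R y' + \<tau> *\<^sub>R z' \<in> T" using star[OF _ z'(1)] by blast
  moreover have e: "(1 - \<tau>) *\<^sub>R y' = (1 - \<tau>) *\<^sub>R y + \<tau> *\<^sub>R (z - z')" using \<tau> by (simp add: y'_def scaleR_add_right)
  have "(1 - \<tau>) *\<^sub>R y' + \<tau> *\<^sub>R z' = y + \<tau> *\<^sub>R (z - y)" unfolding e by (simp add: algebra_simps)
  ultimately show ?thesis by simp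
qed

lemma frontier_notin: "x \<in> frontier T \<Longrightarrow> x \<notin> T" using opn by (simp add: frontier_def interior_open)
lemma frontier_closure: "x \<in> frontier T \<Longrightarrow> x \<in> closure T" by (simp add: frontier_def)

text \<open>Even the prolongation of a frontier segment avoids the ball. A point of the ball on the
  line would either lie on the segment or see one endpoint strictly in front of the other, which
  would place a frontier point inside the open cell.\<close>

lemma line_far:
  assumes pq: "closed_segment p q \<subseteq> frontier T"
  shows "dist x0 (p + s *\<^sub>R (q - p)) \<ge> r"
proof (rule ccontr)
  let ?y = "p + s *\<^sub>R (q - p)"
  assume "\<not> r \<le> dist x0 ?y"
  then have y: "?y \<in> ball x0 r" by simp
  have fr: "p \<in> frontier T" "q \<in> frontier T" using pq by auto
  consider "0 \<le> s" "s \<le> 1" | "s < 0" | "s > 1" by linarith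
  then show False
  proof cases
    case 1
    then have "?y \<in> closed_segment p q" by (auto simp: closed_segment_def algebra_simps intro!: exI[of _ s])
    then show False using pq y ballT frontier_notin by blast
  next
    case 2
    define \<tau> where "\<tau> = - s / (1 - s)"
    have t: "0 \<le> \<tau>" unfolding \<tau>_def using 2 by (intro divide_nonneg_nonneg) simp_all
    have "\<tau> < 1" unfolding \<tau>_def using 2 by (subst pos_divide_less_eq) simp_all
    note t = t this
    have "\<tau> * (1 - s) = - s" using 2 by (simp add: \<tau>_def)
    then have "s + \<tau> * (1 - s) = 0" by simp
    moreover have "?y + \<tau> *\<^sub>R (q - ?y) = p + (s + \<tau> * (1 - s)) *\<^sub>R (q - p)" by (simp add: algebra_simps)
    ultimately have "?y + \<tau> *\<^sub>R (q - ?y) = p" by simp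
    then have "p \<in> T" using star_closure[OF y frontier_closure[OF fr(2)] t] by (simp only:)
    then show False using frontier_notin[OF fr(1)] by blast
  next
    case 3
    define \<tau> where "\<tau> = (s - 1) / s"
    have t: "0 \<le> \<tau>" "\<tau> < 1" using 3 by (auto simp: \<tau>_def divide_less_eq)
    have "\<tau> * s = s - 1" using 3 by (simp add: \<tau>_def)
    then have "s - \<tau> * s = 1" by simp
    moreover have "?y + \<tau> *\<^sub>R (p - ?y) = p + (s - \<tau> * s) *\<^sub>R (q - p)" by (simp add: algebra_simps)
    ultimately have "?y + \<tau> *\<^sub>R (p - ?y) = q" by simp
    then have "q \<in> T" using star_closure[OF y frontier_closure[OF fr(1)] t] by (simp only:)
    then show False using frontier_notin[OF fr(2)] by blast
  qed
qed

lemma triangle_point: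
  assumes "y \<in> convex hull {x0, p, q}"
  obtains s z where "0 \<le> s" "s \<le> 1" "z \<in> closed_segment p q" "y = x0 + s *\<^sub>R (z - x0)"
proof -
  obtain u v b where b: "u \<ge> 0" "v \<ge> 0" "u + v = 1" "b \<in> convex hull {p, q}" "y = u *\<^sub>R x0 + v *\<^sub>R b"
    using assms convex_hull_insert[of "{p, q}" x0] by auto
  have u: "u = 1 - v" using b by simp
  show ?thesis
  proof (rule that[of v b])
    show "b \<in> closed_segment p q" using b by (simp add: segment_convex_hull)
    show "y = x0 + v *\<^sub>R (b - x0)" unfolding b(5) u by (simp add: algebra_simps)
  qed (use b in auto)
qed

text \<open>A ray from \<open>x0\<close> meets the frontier at most once, so a point common to two
  triangles, other than \<open>x0\<close>, comes from a point common to their bases, that is, from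
  an endpoint.\<close>

lemma triangles_Int:
  assumes e1: "closed_segment p q \<subseteq> frontier T" and e2: "closed_segment p' q' \<subseteq> frontier T"
    and Int: "closed_segment p q \<inter> closed_segment p' q' \<subseteq> {p, q}"
  shows "convex hull {x0, p, q} \<inter> convex hull {x0, p', q'} \<subseteq> closed_segment x0 p \<union> closed_segment x0 q"
proof
  fix y assume y: "y \<in> convex hull {x0, p, q} \<inter> convex hull {x0, p', q'}"
  obtain s z where s: "0 \<le> s" "s \<le> 1" "z \<in> closed_segment p q" "y = x0 + s *\<^sub>R (z - x0)"
    using y triangle_point[of y p q] by blast
  obtain t w where t: "0 \<le> t" "t \<le> 1" "w \<in> closed_segment p' q'" "y = x0 + t *\<^sub>R (w - x0)"
    using y triangle_point[of y p' q'] by blast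
  have x0: "x0 \<in> ball x0 r" using r0 by simp
  have zf: "z \<in> frontier T" and wf: "w \<in> frontier T" using s t e1 e2 by auto
  have key: "b \<le> a" if "0 < b" "0 \<le> a" "a *\<^sub>R (u - x0) = b *\<^sub>R (u' - x0)" "u \<in> frontier T" "u' \<in> frontier T" for a b u u'
  proof (rule ccontr)
    assume "\<not> b \<le> a"
    then have ab: "0 \<le> a / b" "a / b < 1" using that by auto
    have "u' - x0 = (a / b) *\<^sub>R (u - x0)"
    proof -
      have "(1 / b) *\<^sub>R (b *\<^sub>R (u' - x0)) = (1 / b) *\<^sub>R (a *\<^sub>R (u - x0))" using that(3) by simp
      then show ?thesis using that(1) by simp
    qed
    then have "u' = x0 + (a / b) *\<^sub>R (u - x0)" by (simp add: algebra_simps)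
    then show False using star_closure[OF x0 frontier_closure[OF that(4)] ab] frontier_notin[OF that(5)] by simp
  qed
  have eq: "s *\<^sub>R (z - x0) = t *\<^sub>R (w - x0)" using s(4) t(4) by simp
  show "y \<in> closed_segment x0 p \<union> closed_segment x0 q"
  proof (cases "s = 0 \<or> t = 0")
    case True
    then have "y = x0" using s(4) t(4) by auto
    then show ?thesis by simp
  next
    case False
    then have pos: "0 < s" "0 < t" using s t by auto
    have "s = t"
      using key[OF pos(2) s(1) eq zf wf] key[OF pos(1) t(1) eq[symmetric] wf zf] by simp
    then have "z = w" using eq pos by simp
    then have "z = p \<or> z = q" using s(3) t(3) Int by blast
    then show ?thesis using s by (auto simp: closed_segment_def algebra_simps intro!: exI[of _ s])
  qed
qed

end

context mesh begin

lemma star_cellI: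
  assumes "shape_regular \<rho> M" "\<rho> > 0" "T \<in> fst M"
  obtains x0 where "star_cell T x0 (\<rho> * diameter T)"
proof -
  obtain x0 where "ball x0 (\<rho> * diameter T) \<subseteq> T" "\<forall>y\<in>ball x0 (\<rho> * diameter T). \<forall>z\<in>T. closed_segment y z \<subseteq> T"
    using assms unfolding shape_regular_def by blast
  then have "star_cell T x0 (\<rho> * diameter T)"
    using mult_pos_pos[OF assms(2) diameter_pos[OF assms(3)]] elt_open[OF assms(3)] elt_bounded[OF assms(3)]
    by unfold_locales blast+
  then show ?thesis by (rule that)
qed

lemma closure_cball:
  assumes "T \<in> fst M" "x0 \<in> T" shows "closure T \<subseteq> cball x0 (diameter T)"
proof (rule closure_minimal)
  show "T \<subseteq> cball x0 (diameter T)"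
    using diameter_bounded_bound[OF elt_bounded[OF assms(1)] assms(2)] by auto
qed simp

text \<open>Triangles from the centre over the edges overlap in null sets only, have height and base
  at least \<open>\<rho> * diameter T\<close>, and lie in a disc of radius
  \<open>diameter T\<close>. Comparing areas bounds their number independently of the mesh.\<close>

lemma card_edges_bound:
  assumes sr: "shape_regular \<rho> M" and \<rho>: "\<rho> > 0" and T: "T \<in> fst M"
  shows "real (card {e \<in> snd M. T \<in> adj M e}) \<le> 2 * unit_ball_vol 2 / \<rho>\<^sup>2"
proof -
  let ?h = "diameter T" and ?E = "{e \<in> snd M. T \<in> adj M e}"
  have h: "?h > 0" by (rule diameter_pos[OF T])
  obtain x0 where "star_cell T x0 (\<rho> * ?h)" using star_cellI[OF sr \<rho> T] by blast
  then interpret star_cell T x0 "\<rho> * ?h" .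
  have x0: "x0 \<in> T" using ballT r0 by (meson centre_in_ball subsetD)
  define tri where "tri e = convex hull {x0, fst e, snd e}" for e
  have fr: "closed_segment (fst e) (snd e) \<subseteq> frontier T" if "e \<in> ?E" for e
    using that adj_frontier by (auto simp: eseg_def)
  have area: "measure lebesgue (tri e) \<ge> \<rho>\<^sup>2 * ?h\<^sup>2 / 2" if e: "e \<in> ?E" for e
  proof -
    have ne: "fst e \<noteq> snd e" using e edge_ne by auto
    have "tri e \<in> sets borel" unfolding tri_def by (intro borel_compact compact_convex_hull) simp
    then have "measure lebesgue (tri e) = measure lborel (tri e)" by (intro measure_completion) simp
    then have "measure lebesgue (tri e) = \<bar>(snd e $ 1 - x0 $ 1) * (fst e $ 2 - x0 $ 2) - (fst e $ 1 - x0 $ 1) * (snd e $ 2 - x0 $ 2)\<bar> / 2"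
      unfolding tri_def content_triangle .
    moreover have "\<rho> * ?h * dist (fst e) (snd e) \<le> \<bar>(snd e $ 1 - x0 $ 1) * (fst e $ 2 - x0 $ 2) - (fst e $ 1 - x0 $ 1) * (snd e $ 2 - x0 $ 2)\<bar>"
      by (rule triangle_cross[OF ne line_far[OF fr[OF e]]]) (use \<rho> h in auto)
    moreover have "\<rho> * ?h \<le> dist (fst e) (snd e)"
      using sr T e adj_frontier unfolding shape_regular_def by auto
    then have "\<rho> * ?h * (\<rho> * ?h) \<le> \<rho> * ?h * dist (fst e) (snd e)" using \<rho> h by (intro mult_left_mono) auto
    ultimately show ?thesis by (simp add: power2_eq_square algebra_simps)
  qed
  have lm: "tri e \<in> lmeasurable" for e
    unfolding tri_def by (intro lmeasurable_compact compact_convex_hull) simp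
  have "real (card ?E) * (\<rho>\<^sup>2 * ?h\<^sup>2 / 2) = (\<Sum>e\<in>?E. \<rho>\<^sup>2 * ?h\<^sup>2 / 2)" by simp
  also have "\<dots> \<le> (\<Sum>e\<in>?E. measure lebesgue (tri e))" by (intro sum_mono area)
  also have "\<dots> = measure lebesgue (\<Union>(tri ` ?E))"
  proof (rule measure_negligible_finite_Union_image[symmetric])
    show "pairwise (\<lambda>e e'. negligible (tri e \<inter> tri e')) ?E"
    proof (rule pairwiseI)
      fix e e' assume e: "e \<in> ?E" "e' \<in> ?E" "e \<noteq> e'"
      have "tri e \<inter> tri e' \<subseteq> closed_segment x0 (fst e) \<union> closed_segment x0 (snd e)"
        unfolding tri_def using edge_Int[of e e'] e by (intro triangles_Int fr) (auto simp: eseg_def)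
      then show "negligible (tri e \<inter> tri e')"
        using negligible_subset negligible_Un negligible_segment by metis
    qed
  qed (use fin_edges lm in auto)
  also have "\<dots> \<le> measure lebesgue (cball x0 ?h)"
  proof (rule measure_mono_fmeasurable)
    have "tri e \<subseteq> cball x0 ?h" if "e \<in> ?E" for e
    proof -
      have "fst e \<in> closure T" "snd e \<in> closure T" using fr[OF that] frontier_closure by auto
      then have "{x0, fst e, snd e} \<subseteq> cball x0 ?h" using closure_cball[OF T x0] h by auto
      then show ?thesis unfolding tri_def by (intro hull_minimal) auto
    qed
    then show "\<Union>(tri ` ?E) \<subseteq> cball x0 ?h" by blast
    show "\<Union>(tri ` ?E) \<in> sets lebesgue" using fin_edges lm fmeasurableD by (intro sets.finite_UN) auto
  qed auto
  also have "\<dots> = unit_ball_vol 2 * ?h\<^sup>2"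
    using h by (subst measure_completion) (auto simp: content_cball)
  finally have "(real (card ?E) * \<rho>\<^sup>2 / 2) * ?h\<^sup>2 \<le> unit_ball_vol 2 * ?h\<^sup>2" by (simp add: mult_ac)
  then have "real (card ?E) * \<rho>\<^sup>2 / 2 \<le> unit_ball_vol 2" using h by simp
  then show ?thesis using \<rho> by (simp add: field_simps)
qed

end

section \<open>Finite-dimensional variational problems\<close>

lemma linear_functional_expand:
  fixes G :: "('j \<Rightarrow> real) \<Rightarrow> real"
  assumes add: "\<And>x z b. G (\<lambda>j. x j + b * z j) = G x + b * G z" and fin: "finite S"
  shows "G (\<lambda>j. if j \<in> S then x j else 0) = (\<Sum>j\<in>S. x j * G (\<lambda>i. if i = j then 1 else 0))"
  using fin
proof (induction S rule: finite_induct)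
  case empty
  show ?case using add[of "\<lambda>_. 0" 1 "\<lambda>_. 0"] by simp
next
  case (insert s S)
  have "(\<lambda>j. if j \<in> insert s S then x j else 0)
      = (\<lambda>j. (if j \<in> S then x j else 0) + x s * (if j = s then 1 else 0))"
    using insert.hyps by auto
  then have "G (\<lambda>j. if j \<in> insert s S then x j else 0)
      = G (\<lambda>j. if j \<in> S then x j else 0) + x s * G (\<lambda>j. if j = s then 1 else 0)"
    by (simp only: add)
  then show ?case using insert by simp
qed

text \<open>The unknowns are functions on the whole index type of which only the values on
  \<open>J\<close> count, as the congruence assumptions express. Mesh functions can thus be
  parametrized by coefficients; nondegeneracy makes the coefficient matrix injective.\<close>

lemma bilinear_solvable:
  fixes F :: "('j \<Rightarrow> real) \<Rightarrow> ('j \<Rightarrow> real) \<Rightarrow> real" and l :: "('j \<Rightarrow> real) \<Rightarrow> real"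
  assumes J: "finite J"
    and add1: "\<And>x z b y. F (\<lambda>j. x j + b * z j) y = F x y + b * F z y"
    and add2: "\<And>x y z b. F x (\<lambda>j. y j + b * z j) = F x y + b * F x z"
    and addl: "\<And>y z b. l (\<lambda>j. y j + b * z j) = l y + b * l z"
    and cong1: "\<And>x x' y. (\<And>j. j \<in> J \<Longrightarrow> x j = x' j) \<Longrightarrow> F x y = F x' y"
    and cong2: "\<And>x y y'. (\<And>j. j \<in> J \<Longrightarrow> y j = y' j) \<Longrightarrow> F x y = F x y'"
    and congl: "\<And>y y'. (\<And>j. j \<in> J \<Longrightarrow> y j = y' j) \<Longrightarrow> l y = l y'"
    and nondeg: "\<And>x. (\<And>y. F x y = 0) \<Longrightarrow> \<forall>j\<in>J. x j = 0"
  shows "\<exists>x. \<forall>y. F x y = l y"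
proof -
  let ?\<delta> = "\<lambda>j i. if i = j then 1 else (0::real)"
  let ?A = "\<lambda>i j. F (?\<delta> j) (?\<delta> i)"
  have e1: "F x y = (\<Sum>j\<in>J. x j * F (?\<delta> j) y)" for x y
    using linear_functional_expand[of "\<lambda>x. F x y" J x, OF add1 J] cong1[of x "\<lambda>j. if j \<in> J then x j else 0" y] by simp
  have e2: "F x y = (\<Sum>j\<in>J. y j * F x (?\<delta> j))" for x y
    using linear_functional_expand[of "\<lambda>y. F x y" J y, OF add2 J] cong2[of y "\<lambda>j. if j \<in> J then y j else 0" x] by simp
  have el: "l y = (\<Sum>j\<in>J. y j * l (?\<delta> j))" for y
    using linear_functional_expand[of l J y, OF addl J] congl[of y "\<lambda>j. if j \<in> J then y j else 0"] by simp
  have eA: "F x (?\<delta> i) = (\<Sum>j\<in>J. ?A i j * x j)" for x i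
    using e1[of x "?\<delta> i"] by (simp add: mult.commute)
  have "\<exists>x. \<forall>i\<in>J. (\<Sum>j\<in>J. ?A i j * x j) = l (?\<delta> i)"
  proof (rule square_system_solvable[OF J])
    fix x assume "\<forall>i\<in>J. (\<Sum>j\<in>J. ?A i j * x j) = 0"
    then have "F x (?\<delta> i) = 0" if "i \<in> J" for i using eA[of x i] that by simp
    then have "F x y = 0" for y unfolding e2[of x y] by simp
    then show "\<forall>j\<in>J. x j = 0" by (rule nondeg)
  qed
  then obtain x where x: "\<forall>i\<in>J. (\<Sum>j\<in>J. ?A i j * x j) = l (?\<delta> i)" by blast
  have "F x (?\<delta> i) = l (?\<delta> i)" if "i \<in> J" for i using eA[of x i] x that by simp
  then have "F x y = l y" for y unfolding e2[of x y] el[of y] by simp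
  then show ?thesis by blast
qed

definition pev :: "nat \<Rightarrow> (nat \<times> nat \<Rightarrow> real) \<Rightarrow> pt \<Rightarrow> real" where
  "pev m co x = (\<Sum>l\<in>pidx m. co l * mon l x)"

lemma poly_deg_le_pev: "poly_deg_le m (pev m co)"
  unfolding poly_deg_le_iff pev_def[abs_def] by blast

lemma pev_surj: "poly_deg_le m p \<Longrightarrow> \<exists>co. p = pev m co"
  unfolding poly_deg_le_iff pev_def[abs_def] by blast

lemma pev_add: "pev m (\<lambda>j. x j + b * z j) y = pev m x y + b * pev m z y"
  by (simp add: pev_def algebra_simps sum.distrib sum_distrib_left)

lemma pev_cong: "(\<And>j. j \<in> pidx m \<Longrightarrow> x j = x' j) \<Longrightarrow> pev m x = pev m x'"
  by (auto simp: pev_def fun_eq_iff)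

lemma pev_zero: "(\<And>y. pev m x y = 0) \<Longrightarrow> j \<in> pidx m \<Longrightarrow> x j = 0"
  using poly_coeffs_zero[where s = 1 and k = m and co = x and m = j] by (simp add: pev_def)

lemma pev_cont: "continuous_on UNIV (pev m x)"
  by (rule smooth2_cont[OF smooth2_poly[OF poly_deg_le_pev]])

lemma set_integral_linear:
  fixes f g :: "pt \<Rightarrow> real"
  assumes "set_integrable lborel S f" "set_integrable lborel S g"
  shows "(LINT x:S|lborel. f x + b * g x) = (LINT x:S|lborel. f x) + b * (LINT x:S|lborel. g x)"
proof -
  have "set_integrable lborel S (\<lambda>x. b * g x)" using assms(2) by simp
  from set_integral_add(2)[OF assms(1) this] show ?thesis by simp
qed

text \<open>The normal equations are a square system for the coefficients. A polynomial orthogonal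
  to all polynomials of its degree is orthogonal to itself and vanishes.\<close>

lemma L2_projection:
  assumes S: "open S" "bounded S" "S \<noteq> {}" and w: "L2_on S w"
  shows "\<exists>q. poly_deg_le m q \<and> (\<forall>p. poly_deg_le m p \<longrightarrow> (LINT x:S|lborel. (w x - q x) * p x) = 0)"
proof -
  have bS: "S \<in> sets borel" using S by simp
  have LP: "L2_on S (pev m y)" for y by (rule continuous_L2_on[OF bS S(2) pev_cont])
  have iPP: "set_integrable lborel S (\<lambda>t. pev m x t * pev m y t)" for x y by (rule L2_on_mult_integrable[OF LP LP])
  have iwP: "set_integrable lborel S (\<lambda>t. w t * pev m y t)" for y by (rule L2_on_mult_integrable[OF w LP])
  have "\<exists>x. \<forall>y. (LINT t:S|lborel. pev m x t * pev m y t) = (LINT t:S|lborel. w t * pev m y t)"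
  proof (rule bilinear_solvable[OF finite_pidx[of m]])
    fix x z y :: "nat \<times> nat \<Rightarrow> real" and b
    show "(LINT t:S|lborel. pev m (\<lambda>j. x j + b * z j) t * pev m y t)
       = (LINT t:S|lborel. pev m x t * pev m y t) + b * (LINT t:S|lborel. pev m z t * pev m y t)"
      using set_integral_linear[OF iPP[of x y] iPP[of z y], of b] by (simp add: pev_add algebra_simps)
    show "(LINT t:S|lborel. pev m x t * pev m (\<lambda>j. y j + b * z j) t)
       = (LINT t:S|lborel. pev m x t * pev m y t) + b * (LINT t:S|lborel. pev m x t * pev m z t)"
      using set_integral_linear[OF iPP[of x y] iPP[of x z], of b] by (simp add: pev_add algebra_simps)
    show "(LINT t:S|lborel. w t * pev m (\<lambda>j. y j + b * z j) t)
       = (LINT t:S|lborel. w t * pev m y t) + b * (LINT t:S|lborel. w t * pev m z t)"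
      using set_integral_linear[OF iwP[of y] iwP[of z], of b] by (simp add: pev_add algebra_simps)
  next
    fix x :: "nat \<times> nat \<Rightarrow> real" assume "\<And>y. (LINT t:S|lborel. pev m x t * pev m y t) = 0"
    from this[of x] have "(L2_norm_on S (pev m x))\<^sup>2 = 0" unfolding L2_norm_sq by (simp add: power2_eq_square)
    then have "pev m x = (\<lambda>_. 0)" using poly_zero_if_L2_zero[OF S poly_deg_le_pev] by simp
    then show "\<forall>j\<in>pidx m. x j = 0" using pev_zero[where m = m and x = x] by simp
  next
    fix x x' y :: "nat \<times> nat \<Rightarrow> real" assume "\<And>j. j \<in> pidx m \<Longrightarrow> x j = x' j"
    then have e: "pev m x = pev m x'" by (rule pev_cong)
    show "(LINT t:S|lborel. pev m x t * pev m y t) = (LINT t:S|lborel. pev m x' t * pev m y t)"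
      "(LINT t:S|lborel. pev m y t * pev m x t) = (LINT t:S|lborel. pev m y t * pev m x' t)"
      "(LINT t:S|lborel. w t * pev m x t) = (LINT t:S|lborel. w t * pev m x' t)" unfolding e by rule+
  qed
  then obtain x where x: "\<And>y. (LINT t:S|lborel. pev m x t * pev m y t) = (LINT t:S|lborel. w t * pev m y t)" by blast
  have "(LINT t:S|lborel. (w t - pev m x t) * p t) = 0" if pm: "poly_deg_le m p" for p
  proof -
    obtain y where p: "p = pev m y" using pev_surj[OF pm] by blast
    show ?thesis using set_integral_linear[OF iwP[of y] iPP[of x y], of "-1"] x[of y] unfolding p by (simp add: algebra_simps)
  qed
  then show ?thesis using poly_deg_le_pev by blast
qed

lemma L2_on_subset:
  assumes f: "L2_on S f" and T: "T \<in> sets borel" "T \<subseteq> S"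
  shows "L2_on T f"
proof -
  have sm: "set_borel_measurable lborel S f" and si: "set_integrable lborel S (\<lambda>x. (f x)\<^sup>2)"
    using f by (auto simp: L2_on_def)
  have [measurable]: "T \<in> sets borel" "(\<lambda>x. indicat_real S x *\<^sub>R f x) \<in> borel_measurable borel"
    using T sm by (auto simp: set_borel_measurable_def)
  have "(\<lambda>x. indicat_real T x * (indicat_real S x *\<^sub>R f x)) \<in> borel_measurable borel" by measurable
  moreover have "(\<lambda>x. indicat_real T x * (indicat_real S x *\<^sub>R f x)) = (\<lambda>x. indicat_real T x *\<^sub>R f x)"
    using T(2) by (auto simp: fun_eq_iff indicator_def)
  ultimately have "set_borel_measurable lborel T f" by (simp add: set_borel_measurable_def)
  moreover have "set_integrable lborel T (\<lambda>x. (f x)\<^sup>2)"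
    using T by (intro set_integrable_subset[OF si]) auto
  ultimately show ?thesis by (simp add: L2_on_def)
qed

section \<open>The discrete forms\<close>

lemma edge_int_linear:
  assumes "continuous_on UNIV f" "continuous_on UNIV g"
  shows "edge_int e (\<lambda>x. f x + b * g x) = edge_int e f + b * edge_int e g"
proof -
  have i: "(\<lambda>t. h (fst e + t *\<^sub>R (snd e - fst e))) integrable_on {0..1}" if "continuous_on UNIV h" for h :: "pt \<Rightarrow> real"
    by (intro integrable_continuous_real continuous_on_compose2[OF that] continuous_intros) auto
  have c: "continuous_on UNIV (\<lambda>x. b * g x)" using assms(2) by (intro continuous_intros)
  have "integral {0..1} (\<lambda>t. f (fst e + t *\<^sub>R (snd e - fst e)) + b * g (fst e + t *\<^sub>R (snd e - fst e)))
     = integral {0..1} (\<lambda>t. f (fst e + t *\<^sub>R (snd e - fst e))) + integral {0..1} (\<lambda>t. b * g (fst e + t *\<^sub>R (snd e - fst e)))"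
    using Henstock_Kurzweil_Integration.integral_add[OF i[OF assms(1)] i[OF c]] .
  then show ?thesis unfolding edge_int_def by (simp add: algebra_simps)
qed

lemma edge_point: "t \<in> {0..1} \<Longrightarrow> fst e + t *\<^sub>R (snd e - fst e) \<in> eseg e"
  unfolding eseg_def closed_segment_def by (auto simp: algebra_simps intro!: exI[of _ t])

lemma edge_int_le:
  assumes g: "continuous_on UNIV g" and "\<And>x. x \<in> eseg e \<Longrightarrow> g x \<le> K"
  shows "edge_int e g \<le> dist (fst e) (snd e) * K"
proof -
  have "(\<lambda>t. g (fst e + t *\<^sub>R (snd e - fst e))) integrable_on {0..1}"
    by (intro integrable_continuous_real continuous_on_compose2[OF g] continuous_intros) auto
  then have "integral {0..1} (\<lambda>t. g (fst e + t *\<^sub>R (snd e - fst e))) \<le> integral {0..1} (\<lambda>t::real. K)"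
    using assms(2) edge_point by (intro integral_le) auto
  then show ?thesis unfolding edge_int_def by (intro mult_left_mono) auto
qed

lemma edge_int_nonneg:
  assumes g: "continuous_on UNIV g" and "\<And>x. x \<in> eseg e \<Longrightarrow> g x \<ge> 0"
  shows "edge_int e g \<ge> 0"
proof -
  have "(\<lambda>t. g (fst e + t *\<^sub>R (snd e - fst e))) integrable_on {0..1}"
    by (intro integrable_continuous_real continuous_on_compose2[OF g] continuous_intros) auto
  then show ?thesis unfolding edge_int_def using assms(2) edge_point by (intro mult_nonneg_nonneg integral_nonneg) auto
qed

lemma edge_int_zero:
  assumes g: "continuous_on UNIV g" and nn: "\<And>x. x \<in> eseg e \<Longrightarrow> g x \<ge> 0" and z: "edge_int e g = 0"
    and ne: "fst e \<noteq> snd e" and x: "x \<in> eseg e"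
  shows "g x = 0"
proof -
  let ?G = "\<lambda>t. g (fst e + t *\<^sub>R (snd e - fst e))"
  have "integral {0..1} ?G = 0" using z ne by (simp add: edge_int_def)
  moreover have "continuous_on {0..1} ?G"
    by (intro continuous_on_compose2[OF g] continuous_intros) auto
  ultimately have "\<forall>t\<in>{0..1}. ?G t = 0"
    using integral_eq_0_iff[of 0 1 ?G] nn edge_point by auto
  moreover obtain t where "t \<in> {0..1}" "x = fst e + t *\<^sub>R (snd e - fst e)"
    using x unfolding eseg_def closed_segment_def by (auto simp: algebra_simps)
  ultimately show ?thesis by auto
qed

lemma pd_linear: "smooth2 f \<Longrightarrow> smooth2 g \<Longrightarrow> pd i (\<lambda>x. f x + b * g x) = (\<lambda>x. pd i f x + b * pd i g x)"
  using pd_add[of f "\<lambda>x. b * g x" i] smooth2_mult[OF smooth2_const[of b], of g] by (simp add: pd_cmult)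

lemma jump_linear: "jump \<Omega> M (\<lambda>T x. u T x + b * w T x) e x = jump \<Omega> M u e x + b * jump \<Omega> M w e x"
  by (simp add: jump_def algebra_simps)

lemma jump_cont: "(\<And>T. continuous_on UNIV (u T)) \<Longrightarrow> continuous_on UNIV (jump \<Omega> M u e)"
  unfolding jump_def[abs_def] by (cases "bdry_edge \<Omega> e") (auto intro!: continuous_intros)

lemma jump_sq_cont:
  assumes "\<And>T. smooth2 (u T)"
  shows "continuous_on UNIV (\<lambda>x. jump \<Omega> M u e x * jump \<Omega> M u e x)"
  using jump_cont[of u \<Omega> M e] smooth2_cont[OF assms] by (intro continuous_on_mult) auto

lemma jump_sq_int_nonneg:
  assumes "\<And>T. smooth2 (u T)"
  shows "0 \<le> edge_int e (\<lambda>x. jump \<Omega> M u e x * jump \<Omega> M u e x)"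
  by (rule edge_int_nonneg[OF jump_sq_cont[OF assms]]) simp

lemma jump_sq_int_zero:
  assumes "\<And>T. smooth2 (u T)" "edge_int e (\<lambda>x. jump \<Omega> M u e x * jump \<Omega> M u e x) = 0" "fst e \<noteq> snd e" "x \<in> eseg e"
  shows "jump \<Omega> M u e x = 0"
  using edge_int_zero[OF jump_sq_cont[OF assms(1)] _ assms(2-4)] by simp

lemma sh_commute: "sh \<Omega> M u v = sh \<Omega> M v u"
  by (simp add: sh_def mult.commute)

lemma pw_poly_deg: "v \<in> pw_poly M m \<Longrightarrow> poly_deg_le m (v T)"
  by (cases "T \<in> fst M") (auto simp: pw_poly_def)

lemma pw_poly_smooth: "v \<in> pw_poly M m \<Longrightarrow> smooth2 (v T)"
  using pw_poly_deg smooth2_poly by blast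

lemma pw_poly_linear: "u \<in> pw_poly M m \<Longrightarrow> v \<in> pw_poly M m \<Longrightarrow> (\<lambda>T x. u T x + b * v T x) \<in> pw_poly M m"
  by (auto simp: pw_poly_def intro!: poly_deg_le_add poly_deg_le_cmult)

lemma pw_poly_zero: "(\<lambda>T x. 0) \<in> pw_poly M m"
  by (auto simp: pw_poly_def)

lemma sh_linear:
  assumes "u \<in> pw_poly M k" "w \<in> pw_poly M k" "v \<in> pw_poly M k"
  shows "sh \<Omega> M (\<lambda>T x. u T x + b * w T x) v = sh \<Omega> M u v + b * sh \<Omega> M w v"
proof -
  note sm = pw_poly_smooth[OF assms(1)] pw_poly_smooth[OF assms(2)] pw_poly_smooth[OF assms(3)]
  have c: "continuous_on UNIV (jump \<Omega> M u e)" "continuous_on UNIV (jump \<Omega> M w e)" "continuous_on UNIV (jump \<Omega> M v e)" for e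
    by (rule jump_cont, rule smooth2_cont, rule sm)+
  have c1: "continuous_on UNIV (jump \<Omega> M (\<lambda>T. pd i (u T)) e)" "continuous_on UNIV (jump \<Omega> M (\<lambda>T. pd i (w T)) e)"
    "continuous_on UNIV (jump \<Omega> M (\<lambda>T. pd i (v T)) e)" for e i
    by (rule jump_cont, rule smooth2_cont, rule smooth2_pd, rule sm)+
  have A: "edge_int e (\<lambda>x. jump \<Omega> M (\<lambda>T x. u T x + b * w T x) e x * jump \<Omega> M v e x)
     = edge_int e (\<lambda>x. jump \<Omega> M u e x * jump \<Omega> M v e x) + b * edge_int e (\<lambda>x. jump \<Omega> M w e x * jump \<Omega> M v e x)" for e
    unfolding jump_linear using edge_int_linear[of "\<lambda>x. jump \<Omega> M u e x * jump \<Omega> M v e x" "\<lambda>x. jump \<Omega> M w e x * jump \<Omega> M v e x" e b] c[of e]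
    by (simp add: continuous_on_mult algebra_simps)
  have B: "edge_int e (\<lambda>x. jump \<Omega> M (\<lambda>T. pd i (\<lambda>x. u T x + b * w T x)) e x * jump \<Omega> M (\<lambda>T. pd i (v T)) e x)
     = edge_int e (\<lambda>x. jump \<Omega> M (\<lambda>T. pd i (u T)) e x * jump \<Omega> M (\<lambda>T. pd i (v T)) e x)
       + b * edge_int e (\<lambda>x. jump \<Omega> M (\<lambda>T. pd i (w T)) e x * jump \<Omega> M (\<lambda>T. pd i (v T)) e x)" for e i
    unfolding pd_linear[OF sm(1,2)] jump_linear
    using edge_int_linear[of "\<lambda>x. jump \<Omega> M (\<lambda>T. pd i (u T)) e x * jump \<Omega> M (\<lambda>T. pd i (v T)) e x"
        "\<lambda>x. jump \<Omega> M (\<lambda>T. pd i (w T)) e x * jump \<Omega> M (\<lambda>T. pd i (v T)) e x" e b] c1[of i e]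
    by (simp add: continuous_on_mult algebra_simps)
  show ?thesis
    unfolding sh_def A B by (simp add: algebra_simps sum.distrib sum_distrib_left)
qed

section \<open>Stabilizer and projection on a mesh\<close>

context mesh begin

lemma sh_terms_nonneg:
  assumes "v \<in> pw_poly M k"
  shows "e \<in> snd M \<Longrightarrow> 0 \<le> (1 / h_edge M e ^ 3) * edge_int e (\<lambda>x. jump \<Omega> M v e x * jump \<Omega> M v e x)"
    and "0 \<le> edge_int e (\<lambda>x. jump \<Omega> M (\<lambda>T. pd i (v T)) e x * jump \<Omega> M (\<lambda>T. pd i (v T)) e x)"
proof -
  note sm = pw_poly_smooth[OF assms]
  show "0 \<le> (1 / h_edge M e ^ 3) * edge_int e (\<lambda>x. jump \<Omega> M v e x * jump \<Omega> M v e x)" if "e \<in> snd M"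
    using h_edge_pos[OF that] by (intro mult_nonneg_nonneg jump_sq_int_nonneg sm) simp
  show "0 \<le> edge_int e (\<lambda>x. jump \<Omega> M (\<lambda>T. pd i (v T)) e x * jump \<Omega> M (\<lambda>T. pd i (v T)) e x)"
    by (intro jump_sq_int_nonneg smooth2_pd sm)
qed

lemma sh_nonneg:
  assumes v: "v \<in> pw_poly M k" shows "sh \<Omega> M v v \<ge> 0"
  unfolding sh_def
proof (intro add_nonneg_nonneg sum_nonneg)
  fix e assume e: "e \<in> int_edges \<Omega> M"
  then have "h_edge M e > 0" using h_edge_pos by (simp add: int_edges_def)
  then show "0 \<le> 1 / h_edge M e * (\<Sum>i\<in>UNIV. edge_int e (\<lambda>x. jump \<Omega> M (\<lambda>T. pd i (v T)) e x * jump \<Omega> M (\<lambda>T. pd i (v T)) e x))"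
    by (intro mult_nonneg_nonneg sum_nonneg sh_terms_nonneg(2)[OF v]) simp
qed (rule sh_terms_nonneg(1)[OF v])

lemma sh_zero_jumps:
  assumes v: "v \<in> pw_poly M k" and z: "sh \<Omega> M v v = 0"
  shows "e \<in> snd M \<Longrightarrow> x \<in> eseg e \<Longrightarrow> jump \<Omega> M v e x = 0"
    and "e \<in> int_edges \<Omega> M \<Longrightarrow> x \<in> eseg e \<Longrightarrow> jump \<Omega> M (\<lambda>T. pd i (v T)) e x = 0"
proof -
  note sm = pw_poly_smooth[OF v]
  have fi: "finite (int_edges \<Omega> M)" "int_edges \<Omega> M \<subseteq> snd M" using fin_edges by (auto simp: int_edges_def)
  let ?s1 = "\<lambda>e. (1 / h_edge M e ^ 3) * edge_int e (\<lambda>x. jump \<Omega> M v e x * jump \<Omega> M v e x)"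
  let ?t = "\<lambda>e i. edge_int e (\<lambda>x. jump \<Omega> M (\<lambda>T. pd i (v T)) e x * jump \<Omega> M (\<lambda>T. pd i (v T)) e x)"
  let ?s2 = "\<lambda>e. (1 / h_edge M e) * (\<Sum>i\<in>UNIV. ?t e i)"
  have n1: "0 \<le> ?s1 e" if "e \<in> snd M" for e using sh_terms_nonneg(1)[OF v that] .
  have nt: "0 \<le> ?t e i" if "e \<in> int_edges \<Omega> M" for e i by (rule sh_terms_nonneg(2)[OF v])
  have n2: "0 \<le> ?s2 e" if "e \<in> int_edges \<Omega> M" for e
    using nt[OF that] h_edge_pos[of e] that fi by (intro mult_nonneg_nonneg sum_nonneg) auto
  have "sum ?s1 (snd M) + sum ?s2 (int_edges \<Omega> M) = 0" using z by (simp only: sh_def)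
  moreover have "sum ?s1 (snd M) \<ge> 0" "sum ?s2 (int_edges \<Omega> M) \<ge> 0" using n1 n2 by (auto intro!: sum_nonneg)
  ultimately have s: "sum ?s1 (snd M) = 0" "sum ?s2 (int_edges \<Omega> M) = 0" by linarith+
  show "jump \<Omega> M v e x = 0" if e: "e \<in> snd M" and x: "x \<in> eseg e"
  proof -
    have "?s1 e = 0" using s(1) n1 fin_edges e by (simp only: sum_nonneg_eq_0_iff)
    then have "edge_int e (\<lambda>x. jump \<Omega> M v e x * jump \<Omega> M v e x) = 0" using h_edge_pos[OF e] by simp
    then show ?thesis by (rule jump_sq_int_zero[OF sm _ edge_ne[OF e] x])
  qed
  show "jump \<Omega> M (\<lambda>T. pd i (v T)) e x = 0" if e: "e \<in> int_edges \<Omega> M" and x: "x \<in> eseg e"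
  proof -
    have eM: "e \<in> snd M" using e fi by blast
    have "?s2 e = 0" using s(2) n2 fi(1) e by (simp only: sum_nonneg_eq_0_iff)
    then have "(\<Sum>i\<in>UNIV. ?t e i) = 0" using h_edge_pos[OF eM] by simp
    then have "?t e i = 0" using nt[OF e] by (simp add: sum_nonneg_eq_0_iff)
    then show ?thesis by (rule jump_sq_int_zero[OF smooth2_pd[OF sm] _ edge_ne[OF eM] x])
  qed
qed

text \<open>\<open>sh\<close> is only positive semidefinite, so the case \<open>?c = 0\<close> is
  separate: there the quadratic in \<open>t\<close> is affine and bounded below, and its slope must
  vanish.\<close>

lemma sh_Cauchy_Schwarz:
  assumes u: "u \<in> pw_poly M k" and v: "v \<in> pw_poly M k"
  shows "\<bar>sh \<Omega> M u v\<bar> \<le> sqrt (sh \<Omega> M u u) * sqrt (sh \<Omega> M v v)"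
proof -
  let ?a = "sh \<Omega> M u u" and ?b = "sh \<Omega> M u v" and ?c = "sh \<Omega> M v v"
  have q: "0 \<le> ?a + 2 * t * ?b + t * t * ?c" for t
  proof -
    let ?w = "\<lambda>T x. u T x + t * v T x"
    have w: "?w \<in> pw_poly M k" by (rule pw_poly_linear[OF u v])
    have "sh \<Omega> M ?w ?w = sh \<Omega> M u ?w + t * sh \<Omega> M v ?w" by (rule sh_linear[OF u v w])
    also have "sh \<Omega> M u ?w = ?a + t * ?b" using sh_linear[OF u v u, of \<Omega> t] sh_commute[of \<Omega> M u ?w] sh_commute[of \<Omega> M v u] by simp
    also have "sh \<Omega> M v ?w = ?b + t * ?c"
      using sh_linear[OF u v v, of \<Omega> t] sh_commute[of \<Omega> M v ?w] by simp
    finally have "sh \<Omega> M ?w ?w = ?a + 2 * t * ?b + t * t * ?c" by (simp add: algebra_simps)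
    then show ?thesis using sh_nonneg[OF w] by simp
  qed
  have a0: "?a \<ge> 0" and c0: "?c \<ge> 0" using sh_nonneg u v by auto
  have "?b\<^sup>2 \<le> ?a * ?c"
  proof (cases "?c = 0")
    case True
    have "?b = 0"
    proof (rule ccontr)
      assume b: "?b \<noteq> 0"
      define t where "t = - (?a + 1) / (2 * ?b)"
      have "2 * t * ?b = - (?a + 1)" using b by (simp add: t_def)
      then show False using q[of t] True by simp
    qed
    then show ?thesis using True by simp
  next
    case False
    then have "?c > 0" using c0 by simp
    then show ?thesis using q[of "- ?b / ?c"] by (simp add: power2_eq_square field_simps)
  qed
  then have "sqrt (?b\<^sup>2) \<le> sqrt (?a * ?c)" by (rule real_sqrt_le_mono)
  then show ?thesis by (simp add: real_sqrt_mult)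
qed

text \<open>Trades sums over elements for integrals over \<open>\<Omega>\<close> of arbitrary global
  representatives, after which linearity and Cauchy-Schwarz on \<open>\<Omega>\<close>
  apply.\<close>

lemma pw_inner_eq:
  assumes "L2_on \<Omega> F" "L2_on \<Omega> G" "\<And>T x. T \<in> fst M \<Longrightarrow> x \<in> T \<Longrightarrow> F x = w T x" "\<And>T x. T \<in> fst M \<Longrightarrow> x \<in> T \<Longrightarrow> G x = q T x"
  shows "pw_inner M w q = (LINT x:\<Omega>|lborel. F x * G x)"
  unfolding pw_inner_def set_integral_cells[OF L2_on_mult_integrable[OF assms(1,2)]]
  using assms(3,4) borelT by (intro sum.cong refl set_lebesgue_integral_cong) auto

lemma pw_L2_norm_eq:
  assumes "L2_on \<Omega> G" "\<And>T x. T \<in> fst M \<Longrightarrow> x \<in> T \<Longrightarrow> G x = q T x"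
  shows "pw_L2_norm M q = L2_norm_on \<Omega> G"
  using pw_inner_eq[OF assms(1,1,2,2)]
  by (simp add: pw_L2_norm_def L2_norm_on_def pw_inner_def power2_eq_square)

lemma pwf_poly_L2: "q \<in> pw_poly M m \<Longrightarrow> L2_on \<Omega> (pwf q)"
  using pw_poly_smooth smooth2_cont by (intro pwf_L2) blast

lemma pw_L2_norm_poly: "q \<in> pw_poly M m \<Longrightarrow> pw_L2_norm M q = L2_norm_on \<Omega> (pwf q)"
  using pwf_poly_L2 pwf_in by (intro pw_L2_norm_eq) auto

lemma pw_L2_norm_sq: "(pw_L2_norm M q)\<^sup>2 = (\<Sum>T\<in>fst M. (L2_norm_on T (q T))\<^sup>2)"
  unfolding pw_L2_norm_def L2_norm_sq by (intro real_sqrt_pow2 sum_nonneg) (auto simp: L2_norm_sq[symmetric])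

lemma pw_poly_zero_iff:
  assumes q: "q \<in> pw_poly M m" and z: "pw_L2_norm M q = 0"
  shows "q = (\<lambda>T x. 0)"
proof (intro ext)
  fix T x
  show "q T x = 0"
  proof (cases "T \<in> fst M")
    case True
    have "(\<Sum>T\<in>fst M. (L2_norm_on T (q T))\<^sup>2) = 0" using z pw_L2_norm_sq[of q] by simp
    then have "L2_norm_on T (q T) = 0" using True fin_elts by (simp add: sum_nonneg_eq_0_iff)
    then have "q T = (\<lambda>_. 0)"
      using poly_zero_if_L2_zero[OF elt_open elt_bounded elt_ne pw_poly_deg[OF q]] True by blast
    then show ?thesis by simp
  qed (use q in \<open>auto simp: pw_poly_def\<close>)
qed

text \<open>Justifies the definite description in \<open>l2proj\<close>: existence by projecting on
  each element, uniqueness because the difference of two candidates is orthogonal to itself.\<close>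

lemma l2proj_props:
  assumes F: "L2_on \<Omega> F" "\<And>T x. T \<in> fst M \<Longrightarrow> x \<in> T \<Longrightarrow> F x = w T x"
  shows "l2proj M m w \<in> pw_poly M m" "p \<in> pw_poly M m \<Longrightarrow> pw_inner M (l2proj M m w) p = pw_inner M w p"
proof -
  let ?P = "\<lambda>q. q \<in> pw_poly M m \<and> (\<forall>p\<in>pw_poly M m. pw_inner M (\<lambda>T x. w T x - q T x) p = 0)"
  have key: "pw_inner M (\<lambda>T x. w T x - q T x) p = pw_inner M w p - pw_inner M q p"
    if "q \<in> pw_poly M m" "p \<in> pw_poly M m" for q p
  proof -
    note L = pwf_poly_L2[OF that(1)] pwf_poly_L2[OF that(2)]
    have "pw_inner M (\<lambda>T x. w T x - q T x) p = (LINT x:\<Omega>|lborel. (F x - pwf q x) * pwf p x)"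
      by (rule pw_inner_eq) (use F L pwf_in in auto)
    also have "\<dots> = (LINT x:\<Omega>|lborel. F x * pwf p x) - (LINT x:\<Omega>|lborel. pwf q x * pwf p x)"
      using set_integral_linear[OF L2_on_mult_integrable[OF F(1) L(2)] L2_on_mult_integrable[OF L], of "-1"]
      by (simp add: algebra_simps)
    also have "\<dots> = pw_inner M w p - pw_inner M q p"
      using pw_inner_eq[OF F(1) L(2) F(2), where q = p] pw_inner_eq[OF L, where w = q and q = p] pwf_in by simp
    finally show ?thesis .
  qed
  have "\<forall>T\<in>fst M. \<exists>q. poly_deg_le m q \<and> (\<forall>p. poly_deg_le m p \<longrightarrow> (LINT x:T|lborel. (w T x - q x) * p x) = 0)"
  proof
    fix T assume T: "T \<in> fst M"
    have "L2_on T F" by (rule L2_on_subset[OF F(1) borelT[OF T] subT[OF T]])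
    then obtain q where q: "poly_deg_le m q" "\<And>p. poly_deg_le m p \<Longrightarrow> (LINT x:T|lborel. (F x - q x) * p x) = 0"
      using L2_projection[OF elt_open[OF T] elt_bounded[OF T] elt_ne[OF T]] by blast
    have "(LINT x:T|lborel. (w T x - q x) * p x) = (LINT x:T|lborel. (F x - q x) * p x)" for p
      using F(2)[OF T] borelT[OF T] by (intro set_lebesgue_integral_cong) auto
    then show "\<exists>q. poly_deg_le m q \<and> (\<forall>p. poly_deg_le m p \<longrightarrow> (LINT x:T|lborel. (w T x - q x) * p x) = 0)"
      using q by (intro exI[of _ q]) simp
  qed
  from bchoice[OF this] obtain Q where Q: "\<And>T. T \<in> fst M \<Longrightarrow> poly_deg_le m (Q T)"
    "\<And>T p. T \<in> fst M \<Longrightarrow> poly_deg_le m p \<Longrightarrow> (LINT x:T|lborel. (w T x - Q T x) * p x) = 0" by blast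
  \<comment> \<open>Zero off the mesh, as membership in \<open>pw_poly\<close> demands; this
    normalization is what makes the projection unique as a function on all sets.\<close>
  define Q' where "Q' T = (if T \<in> fst M then Q T else (\<lambda>_. 0))" for T
  have "?P Q'"
  proof
    show "Q' \<in> pw_poly M m" using Q(1) by (auto simp: pw_poly_def Q'_def)
    show "\<forall>p\<in>pw_poly M m. pw_inner M (\<lambda>T x. w T x - Q' T x) p = 0"
    proof
      fix p assume "p \<in> pw_poly M m"
      then show "pw_inner M (\<lambda>T x. w T x - Q' T x) p = 0"
        unfolding pw_inner_def using Q(2) pw_poly_deg by (intro sum.neutral) (auto simp: Q'_def)
    qed
  qed
  moreover have "q = Q'" if q: "?P q" for q
  proof -
    let ?d = "\<lambda>T x. q T x + (-1) * Q' T x"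
    have qP: "q \<in> pw_poly M m" "Q' \<in> pw_poly M m" using q \<open>?P Q'\<close> by auto
    have d: "?d \<in> pw_poly M m" by (rule pw_poly_linear[OF qP])
    note L = pwf_poly_L2[OF d] pwf_poly_L2[OF qP(1)] pwf_poly_L2[OF qP(2)]
    have "pw_inner M q ?d = pw_inner M Q' ?d" using key[OF qP(1) d] key[OF qP(2) d] q \<open>?P Q'\<close> d by simp
    moreover have "pw_inner M ?d ?d = pw_inner M q ?d + (-1) * pw_inner M Q' ?d"
    proof -
      have "pw_inner M ?d ?d = (LINT x:\<Omega>|lborel. (pwf q x + (-1) * pwf Q' x) * pwf ?d x)"
        by (rule pw_inner_eq[OF L2_on_add[OF L(2) L2_on_cmult[OF L(3)]] L(1)]) (auto simp: pwf_in)
      then show ?thesis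
        using set_integral_linear[OF L2_on_mult_integrable[OF L(2) L(1)] L2_on_mult_integrable[OF L(3) L(1)], of "-1"]
          pw_inner_eq[OF L(2) L(1), where w = q and q = ?d] pw_inner_eq[OF L(3) L(1), where w = Q' and q = ?d] by (simp add: pwf_in algebra_simps)
    qed
    ultimately have "pw_inner M ?d ?d = 0" by simp
    then have "pw_L2_norm M ?d = 0" by (simp add: pw_L2_norm_def pw_inner_def power2_eq_square)
    then have z: "?d = (\<lambda>T x. 0)" by (rule pw_poly_zero_iff[OF d])
    have "q T x = Q' T x" for T x using fun_cong[OF fun_cong[OF z, of T], of x] by simp
    then show ?thesis by blast
  qed
  ultimately have P: "?P (l2proj M m w)"
    unfolding l2proj_def by (rule theI)
  then show 1: "l2proj M m w \<in> pw_poly M m" by blast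
  show "p \<in> pw_poly M m \<Longrightarrow> pw_inner M (l2proj M m w) p = pw_inner M w p"
    using key[OF 1] P by simp
qed

end

section \<open>The bilinear form for bounded measurable coefficients\<close>

locale mesh_problem = mesh +
  fixes a :: "pt \<Rightarrow> real^2^2" and c :: "pt \<Rightarrow> real" and B :: real and k :: nat
  assumes a_meas: "\<And>i j. set_borel_measurable lborel \<Omega> (\<lambda>x. a x $ i $ j)"
    and a_bdd: "\<And>i j x. x \<in> \<Omega> \<Longrightarrow> \<bar>a x $ i $ j\<bar> \<le> B"
    and c_meas: "set_borel_measurable lborel \<Omega> c"
    and c_bdd: "\<And>x. x \<in> \<Omega> \<Longrightarrow> \<bar>c x\<bar> \<le> B"
begin

definition Lpw :: "(pt set \<Rightarrow> pt \<Rightarrow> real) \<Rightarrow> pt \<Rightarrow> real" where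
  "Lpw v x = (\<Sum>i\<in>UNIV. \<Sum>j\<in>UNIV. a x $ i $ j * pwf (\<lambda>T. pd i (pd j (v T))) x) + c x * pwf v x"

lemma Lpw_in: "T \<in> fst M \<Longrightarrow> x \<in> T \<Longrightarrow> Lpw v x = Lop a c (v T) x"
  by (simp add: Lpw_def Lop_def pwf_in)

lemma Lpw_L2:
  assumes "\<And>T. smooth2 (v T)" shows "L2_on \<Omega> (Lpw v)"
  unfolding Lpw_def[abs_def]
proof (intro L2_on_add L2_on_sum)
  fix i j
  show "L2_on \<Omega> (\<lambda>x. a x $ i $ j * pwf (\<lambda>T. pd i (pd j (v T))) x)"
    by (intro L2_on_bounded_mult[OF a_meas a_bdd] pwf_L2 smooth2_cont smooth2_pd assms)
  show "L2_on \<Omega> (\<lambda>x. c x * pwf v x)"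
    by (intro L2_on_bounded_mult[OF c_meas c_bdd] pwf_L2 smooth2_cont assms)
qed

lemma Lpw_poly_L2: "v \<in> pw_poly M l \<Longrightarrow> L2_on \<Omega> (Lpw v)"
  by (rule Lpw_L2) (rule pw_poly_smooth)

lemma bh_eq:
  assumes "v \<in> pw_poly M l" "q \<in> pw_poly M m"
  shows "bh M a c v q = (LINT x:\<Omega>|lborel. Lpw v x * pwf q x)"
  unfolding bh_def
  by (rule pw_inner_eq[OF Lpw_poly_L2[OF assms(1)] pwf_poly_L2[OF assms(2)]]) (simp_all add: Lpw_in pwf_in)

lemma Lop_linear:
  assumes "smooth2 u" "smooth2 w"
  shows "Lop a c (\<lambda>x. u x + b * w x) x = Lop a c u x + b * Lop a c w x"
  unfolding Lop_def pd_linear[OF assms] pd_linear[OF smooth2_pd[OF assms(1)] smooth2_pd[OF assms(2)]]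
  by (simp add: algebra_simps sum.distrib sum_distrib_left)

lemma bh_linear1:
  assumes u: "u \<in> pw_poly M l" and w: "w \<in> pw_poly M l" and q: "q \<in> pw_poly M m"
  shows "bh M a c (\<lambda>T x. u T x + b * w T x) q = bh M a c u q + b * bh M a c w q"
proof -
  note L = Lpw_poly_L2[OF u] Lpw_poly_L2[OF w] pwf_poly_L2[OF q]
  have "bh M a c (\<lambda>T x. u T x + b * w T x) q = (LINT x:\<Omega>|lborel. (Lpw u x + b * Lpw w x) * pwf q x)"
    unfolding bh_def
    by (rule pw_inner_eq[OF L2_on_add[OF L(1) L2_on_cmult[OF L(2)]] L(3)])
      (simp_all add: Lpw_in pwf_in Lop_linear[OF pw_poly_smooth[OF u] pw_poly_smooth[OF w]])
  then show ?thesis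
    using set_integral_linear[OF L2_on_mult_integrable[OF L(1,3)] L2_on_mult_integrable[OF L(2,3)], where b = b]
    by (simp add: bh_eq[OF u q] bh_eq[OF w q] algebra_simps)
qed

lemma pw_inner_linear2:
  assumes F: "L2_on \<Omega> F" "\<And>T x. T \<in> fst M \<Longrightarrow> x \<in> T \<Longrightarrow> F x = w T x"
    and p: "p \<in> pw_poly M m" and q: "q \<in> pw_poly M m"
  shows "pw_inner M w (\<lambda>T x. p T x + b * q T x) = pw_inner M w p + b * pw_inner M w q"
proof -
  note L = pwf_poly_L2[OF p] pwf_poly_L2[OF q]
  have "pw_inner M w (\<lambda>T x. p T x + b * q T x) = (LINT x:\<Omega>|lborel. F x * (pwf p x + b * pwf q x))"
    by (rule pw_inner_eq[OF F(1) L2_on_add[OF L(1) L2_on_cmult[OF L(2)]]]) (simp_all add: F(2) pwf_in)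
  also have "\<dots> = (LINT x:\<Omega>|lborel. F x * pwf p x) + b * (LINT x:\<Omega>|lborel. F x * pwf q x)"
    using set_integral_linear[OF L2_on_mult_integrable[OF F(1) L(1)] L2_on_mult_integrable[OF F(1) L(2)], of b]
    by (simp add: algebra_simps)
  also have "(LINT x:\<Omega>|lborel. F x * pwf p x) = pw_inner M w p"
    by (rule pw_inner_eq[symmetric, OF F(1) L(1)]) (simp_all add: F(2) pwf_in)
  also have "(LINT x:\<Omega>|lborel. F x * pwf q x) = pw_inner M w q"
    by (rule pw_inner_eq[symmetric, OF F(1) L(2)]) (simp_all add: F(2) pwf_in)
  finally show ?thesis .
qed

lemma bh_linear2:
  assumes v: "v \<in> pw_poly M l" and p: "p \<in> pw_poly M m" and q: "q \<in> pw_poly M m"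
  shows "bh M a c v (\<lambda>T x. p T x + b * q T x) = bh M a c v p + b * bh M a c v q"
  unfolding bh_def
  by (rule pw_inner_linear2[OF Lpw_poly_L2[OF v] _ p q]) (simp add: Lpw_in)

lemma pw_inner_le:
  assumes F: "L2_on \<Omega> F" "\<And>T x. T \<in> fst M \<Longrightarrow> x \<in> T \<Longrightarrow> F x = w T x" and q: "q \<in> pw_poly M m"
  shows "\<bar>pw_inner M w q\<bar> \<le> L2_norm_on \<Omega> F * pw_L2_norm M q"
proof -
  have "pw_inner M w q = (LINT x:\<Omega>|lborel. F x * pwf q x)"
    by (rule pw_inner_eq[OF F(1) pwf_poly_L2[OF q]]) (simp_all add: F(2) pwf_in)
  then show ?thesis
    using L2_Cauchy_Schwarz[OF F(1) pwf_poly_L2[OF q]] by (simp add: pw_L2_norm_poly[OF q])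
qed

text \<open>By \<open>eq\<close>, the projection of the operator value is also the projection of
  \<open>F\<close>. Testing it with itself and cancelling one factor shows that projection does not
  increase the norm.\<close>

lemma l2proj_norm:
  assumes v: "v \<in> pw_poly M l" and F: "L2_on \<Omega> F"
    and eq: "\<And>q. q \<in> pw_poly M m \<Longrightarrow> bh M a c v q = pw_inner M (\<lambda>T. F) q"
  shows "pw_L2_norm M (l2proj M m (\<lambda>T. Lop a c (v T))) \<le> L2_norm_on \<Omega> F"
proof -
  let ?w = "\<lambda>T. Lop a c (v T)" and ?p = "l2proj M m (\<lambda>T. Lop a c (v T))"
  note L = Lpw_poly_L2[OF v]
  have pr: "?p \<in> pw_poly M m" "\<And>p. p \<in> pw_poly M m \<Longrightarrow> pw_inner M ?p p = pw_inner M ?w p"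
    using l2proj_props[OF L, where w = ?w and m = m] Lpw_in by auto
  have "(pw_L2_norm M ?p)\<^sup>2 = pw_inner M ?p ?p"
    unfolding pw_L2_norm_sq L2_norm_sq pw_inner_def unfolding power2_eq_square by (rule refl)
  also have "\<dots> = bh M a c v ?p" using pr by (simp add: bh_def)
  also have "\<dots> = pw_inner M (\<lambda>T. F) ?p" using eq[OF pr(1)] .
  also have "\<dots> \<le> L2_norm_on \<Omega> F * pw_L2_norm M ?p" using pw_inner_le[OF F _ pr(1), where w = "\<lambda>T. F"] by simp
  finally have q: "pw_L2_norm M ?p * pw_L2_norm M ?p \<le> L2_norm_on \<Omega> F * pw_L2_norm M ?p"
    by (simp add: power2_eq_square)
  show ?thesis
  proof (cases "pw_L2_norm M ?p = 0")
    case False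
    have "pw_L2_norm M ?p \<ge> 0" using pw_L2_norm_poly[OF pr(1)] by simp
    then have "pw_L2_norm M ?p > 0" using False by linarith
    then show ?thesis using q by simp
  qed simp
qed

end

section \<open>The saddle point problem\<close>

definition pw_eval :: "mesh \<Rightarrow> nat \<Rightarrow> (pt set \<times> nat \<times> nat \<Rightarrow> real) \<Rightarrow> pt set \<Rightarrow> pt \<Rightarrow> real" where
  "pw_eval M m x T = (if T \<in> fst M then pev m (\<lambda>l. x (T, l)) else (\<lambda>_. 0))"

lemma pw_eval_poly: "pw_eval M m x \<in> pw_poly M m"
  by (auto simp: pw_poly_def pw_eval_def poly_deg_le_pev)

lemma pw_eval_linear: "pw_eval M m (\<lambda>p. x p + b * z p) = (\<lambda>T t. pw_eval M m x T t + b * pw_eval M m z T t)"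
  by (auto simp: pw_eval_def fun_eq_iff pev_add)

lemma pw_eval_surj:
  assumes "v \<in> pw_poly M m" shows "\<exists>x. pw_eval M m x = v"
proof -
  have "\<forall>T. \<exists>co. v T = pev m co" using pev_surj[OF pw_poly_deg[OF assms]] by blast
  then obtain co where co: "\<And>T. v T = pev m (co T)" by metis
  have "pw_eval M m (\<lambda>p. co (fst p) (snd p)) T = v T" for T
    using co[of T] assms by (cases "T \<in> fst M") (auto simp: pw_eval_def pw_poly_def)
  then show ?thesis by blast
qed

lemma pw_eval_cong: "(\<And>p. p \<in> fst M \<times> pidx m \<Longrightarrow> x p = x' p) \<Longrightarrow> pw_eval M m x = pw_eval M m x'"
  by (auto simp: pw_eval_def fun_eq_iff intro!: fun_cong[OF pev_cong])

lemma pw_eval_zero: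
  assumes "pw_eval M m x = (\<lambda>T t. 0)" "T \<in> fst M" "l \<in> pidx m" shows "x (T, l) = 0"
proof -
  have "pev m (\<lambda>l. x (T, l)) y = 0" for y
    using fun_cong[OF fun_cong[OF assms(1), of T], of y] assms(2) by (simp add: pw_eval_def)
  then show ?thesis using pev_zero[where m = m and x = "\<lambda>l. x (T, l)"] assms(3) by blast
qed

text \<open>Separates the algebra of the saddle point problem from its analysis: inf-sup stability
  with control of the stabilizer, and injectivity on the functions without jumps. \<open>Cs\<close>
  is the only constant that reaches the final estimate.\<close>

locale stable_problem = mesh_problem +
  fixes Cs :: real
  assumes Cs: "Cs \<ge> 0"
    and infsup: "\<And>q. q \<in> Mh M k \<Longrightarrow> \<exists>v\<in>Xh M k. (pw_L2_norm M q)\<^sup>2 / 2 \<le> bh M a c v q \<and> sh \<Omega> M v v \<le> Cs * (pw_L2_norm M q)\<^sup>2"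
    and kernel: "\<And>v. v \<in> Xh M k \<Longrightarrow> sh \<Omega> M v v = 0 \<Longrightarrow> (\<And>q. q \<in> Mh M k \<Longrightarrow> bh M a c v q = 0) \<Longrightarrow> v = (\<lambda>T x. 0)"
begin

lemma pw_L2_norm_nonneg: "q \<in> pw_poly M m \<Longrightarrow> pw_L2_norm M q \<ge> 0"
  by (simp add: pw_L2_norm_poly)

text \<open>Testing with \<open>u\<close> bounds \<open>sh \<Omega> M u u\<close> by
  \<open>N\<close> times the norm of the multiplier; testing with the inf-sup function bounds that
  norm by a multiple of the root of \<open>sh \<Omega> M u u\<close>. The two estimates close up.
  \<open>N\<close> is a parameter because the lemma serves the homogeneous problem, with
  \<open>N = 0\<close>, as well as the data norm.\<close>

lemma a_priori:
  assumes u: "u \<in> Xh M k" and lam: "lam \<in> Mh M k"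
    and e1: "\<And>v. v \<in> Xh M k \<Longrightarrow> sh \<Omega> M u v + bh M a c v lam = 0"
    and N: "\<bar>bh M a c u lam\<bar> \<le> N * pw_L2_norm M lam" "N \<ge> 0"
  shows "pw_L2_norm M lam \<le> 4 * Cs * N" "sh \<Omega> M u u \<le> 4 * Cs * N\<^sup>2"
proof -
  let ?n = "pw_L2_norm M lam" and ?s = "sh \<Omega> M u u"
  have n0: "?n \<ge> 0" by (rule pw_L2_norm_nonneg[OF lam])
  have s0: "?s \<ge> 0" by (rule sh_nonneg[OF u])
  obtain v where v: "v \<in> Xh M k" "?n\<^sup>2 / 2 \<le> bh M a c v lam" "sh \<Omega> M v v \<le> Cs * ?n\<^sup>2"
    using infsup[OF lam] by blast
  have su: "?s \<le> N * ?n" using e1[OF u] N(1) by linarith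
  have "?n\<^sup>2 / 2 \<le> \<bar>sh \<Omega> M u v\<bar>" using v(2) e1[OF v(1)] by linarith
  also have "\<dots> \<le> sqrt ?s * sqrt (sh \<Omega> M v v)" by (rule sh_Cauchy_Schwarz[OF u v(1)])
  also have "\<dots> \<le> sqrt ?s * sqrt (Cs * ?n\<^sup>2)" using v(3) s0 by (intro mult_left_mono) auto
  also have "\<dots> = sqrt ?s * sqrt Cs * ?n" using n0 by (simp add: real_sqrt_mult)
  finally have q: "?n * ?n \<le> (2 * sqrt ?s * sqrt Cs) * ?n" by (simp add: power2_eq_square)
  have nb: "?n \<le> 2 * sqrt ?s * sqrt Cs"
  proof (cases "?n = 0")
    case True
    then show ?thesis using s0 Cs by simp
  next
    case False
    then show ?thesis using q n0 by simp
  qed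
  then have "?n\<^sup>2 \<le> (2 * sqrt ?s * sqrt Cs)\<^sup>2" using n0 by (rule power_mono)
  also have "\<dots> = 4 * Cs * ?s" using s0 Cs by (simp add: power_mult_distrib)
  also have "\<dots> \<le> 4 * Cs * (N * ?n)" using su Cs by (intro mult_left_mono) auto
  finally have q2: "?n * ?n \<le> (4 * Cs * N) * ?n" by (simp add: power2_eq_square mult_ac)
  show r: "?n \<le> 4 * Cs * N"
  proof (cases "?n = 0")
    case True
    then show ?thesis using N Cs by simp
  next
    case False
    then show ?thesis using q2 n0 by simp
  qed
  have "?s \<le> N * (4 * Cs * N)" using su mult_left_mono[OF r N(2)] by linarith
  then show "?s \<le> 4 * Cs * N\<^sup>2" by (simp add: power2_eq_square mult_ac)
qed

lemma homogeneous_zero: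
  assumes u: "u \<in> Xh M k" and lam: "lam \<in> Mh M k"
    and e1: "\<And>v. v \<in> Xh M k \<Longrightarrow> sh \<Omega> M u v + bh M a c v lam = 0"
    and e2: "\<And>q. q \<in> Mh M k \<Longrightarrow> bh M a c u q = 0"
  shows "u = (\<lambda>T x. 0)" "lam = (\<lambda>T x. 0)"
proof -
  have ap: "pw_L2_norm M lam \<le> 4 * Cs * 0" "sh \<Omega> M u u \<le> 4 * Cs * 0\<^sup>2"
    using a_priori[OF u lam e1, of 0] e2[OF lam] by auto
  have "pw_L2_norm M lam = 0" using ap(1) pw_L2_norm_nonneg[OF lam] by simp
  then show "lam = (\<lambda>T x. 0)" by (rule pw_poly_zero_iff[OF lam])
  have "sh \<Omega> M u u = 0" using ap(2) sh_nonneg[OF u] by simp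
  then show "u = (\<lambda>T x. 0)" by (rule kernel[OF u _ e2])
qed

lemma star_norm_eq:
  "star_norm \<Omega> M k a c v = sqrt ((pw_L2_norm M (l2proj M (k - 2) (\<lambda>T. Lop a c (v T))))\<^sup>2 + sh \<Omega> M v v)"
  unfolding star_norm_def pw_L2_norm_sq L2_norm_sq ..

lemma solution_bound:
  assumes f: "L2_on \<Omega> f" and sol: "pd_dg_solution \<Omega> M k a c f u lam"
  shows "star_norm \<Omega> M k a c u + pw_L2_norm M lam \<le> (1 + 8 * Cs) * L2_norm_on \<Omega> f"
proof -
  let ?N = "L2_norm_on \<Omega> f"
  have u: "u \<in> Xh M k" and lam: "lam \<in> Mh M k"
    and e1: "\<And>v. v \<in> Xh M k \<Longrightarrow> sh \<Omega> M u v + bh M a c v lam = 0"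
    and e2: "\<And>q. q \<in> Mh M k \<Longrightarrow> bh M a c u q = pw_inner M (\<lambda>T. f) q"
    using sol by (auto simp: pd_dg_solution_def)
  have "\<bar>bh M a c u lam\<bar> \<le> ?N * pw_L2_norm M lam"
    unfolding e2[OF lam] by (rule pw_inner_le[OF f _ lam]) simp
  note ap = a_priori[OF u lam e1 this L2_norm_nonneg]
  have p: "pw_L2_norm M (l2proj M (k - 2) (\<lambda>T. Lop a c (u T))) \<le> ?N"
    by (rule l2proj_norm[OF u f e2])
  have p0: "0 \<le> pw_L2_norm M (l2proj M (k - 2) (\<lambda>T. Lop a c (u T)))"
    by (simp add: pw_L2_norm_def sum_nonneg L2_norm_sq[symmetric])
  \<comment> \<open>\<open>1 + 4 * Cs\<close> replaces its own square root, which is smaller; adding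
    the multiplier bound gives \<open>1 + 8 * Cs\<close>.\<close>
  have "star_norm \<Omega> M k a c u \<le> sqrt (((1 + 4 * Cs) * ?N)\<^sup>2)"
    unfolding star_norm_eq
  proof (rule real_sqrt_le_mono)
    have "(pw_L2_norm M (l2proj M (k - 2) (\<lambda>T. Lop a c (u T))))\<^sup>2 + sh \<Omega> M u u \<le> ?N\<^sup>2 + 4 * Cs * ?N\<^sup>2"
      using power_mono[OF p p0, of 2] ap(2) by linarith
    also have "\<dots> = (1 + 4 * Cs) * ?N\<^sup>2" by (simp add: algebra_simps)
    also have "\<dots> \<le> (1 + 4 * Cs)\<^sup>2 * ?N\<^sup>2"
      using Cs by (intro mult_right_mono) (auto simp: power2_eq_square algebra_simps)
    finally show "(pw_L2_norm M (l2proj M (k - 2) (\<lambda>T. Lop a c (u T))))\<^sup>2 + sh \<Omega> M u u \<le> ((1 + 4 * Cs) * ?N)\<^sup>2"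
      by (simp add: power_mult_distrib)
  qed
  also have "\<dots> = (1 + 4 * Cs) * ?N" using Cs by simp
  finally show ?thesis using ap(1) by (simp add: algebra_simps)
qed

lemma solution_unique:
  assumes f: "L2_on \<Omega> f" and s1: "pd_dg_solution \<Omega> M k a c f u lam" and s2: "pd_dg_solution \<Omega> M k a c f u' lam'"
  shows "u = u' \<and> lam = lam'"
proof -
  have u: "u \<in> Xh M k" "lam \<in> Mh M k" "u' \<in> Xh M k" "lam' \<in> Mh M k" using s1 s2 by (auto simp: pd_dg_solution_def)
  let ?d = "\<lambda>T x. u T x + (-1) * u' T x" and ?e = "\<lambda>T x. lam T x + (-1) * lam' T x"
  have d: "?d \<in> Xh M k" "?e \<in> Mh M k"
    by (rule pw_poly_linear[OF u(1,3)], rule pw_poly_linear[OF u(2,4)])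
  have e1: "sh \<Omega> M ?d v + bh M a c v ?e = 0" if v: "v \<in> Xh M k" for v
  proof -
    have "sh \<Omega> M u v + bh M a c v lam = 0" "sh \<Omega> M u' v + bh M a c v lam' = 0"
      using s1 s2 v by (simp_all add: pd_dg_solution_def)
    then show ?thesis
      using sh_linear[OF u(1,3) v, where \<Omega> = \<Omega> and b = "-1"] bh_linear2[OF v u(2,4), where b = "-1"] by linarith
  qed
  have e2: "bh M a c ?d q = 0" if q: "q \<in> Mh M k" for q
  proof -
    have "bh M a c u q = pw_inner M (\<lambda>T. f) q" "bh M a c u' q = pw_inner M (\<lambda>T. f) q"
      using s1 s2 q by (simp_all add: pd_dg_solution_def)
    then show ?thesis using bh_linear1[OF u(1,3) q, where b = "-1"] by linarith
  qed
  have z: "?d = (\<lambda>T x. 0)" "?e = (\<lambda>T x. 0)" using homogeneous_zero[OF d e1 e2] by auto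
  have "u T x = u' T x" "lam T x = lam' T x" for T x
    using fun_cong[OF fun_cong[OF z(1), of T], of x] fun_cong[OF fun_cong[OF z(2), of T], of x] by auto
  then show ?thesis by blast
qed

text \<open>Both equations are added into one bilinear form in the coefficients of the pair, indexed
  by a disjoint sum. Triviality of the homogeneous solution is the nondegeneracy that a square
  system needs.\<close>

lemma solution_exists:
  assumes f: "L2_on \<Omega> f" shows "\<exists>u lam. pd_dg_solution \<Omega> M k a c f u lam"
proof -
  let ?J = "(fst M \<times> pidx k) <+> (fst M \<times> pidx (k - 2))"
  define U where "U x = pw_eval M k (\<lambda>p. x (Inl p))" for x :: "(pt set \<times> nat \<times> nat) + (pt set \<times> nat \<times> nat) \<Rightarrow> real"
  define V where "V x = pw_eval M (k - 2) (\<lambda>p. x (Inr p))" for x :: "(pt set \<times> nat \<times> nat) + (pt set \<times> nat \<times> nat) \<Rightarrow> real"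
  have UX: "U x \<in> Xh M k" and VM: "V x \<in> Mh M k" for x unfolding U_def V_def by (rule pw_eval_poly)+
  have Ul: "U (\<lambda>j. x j + b * z j) = (\<lambda>T t. U x T t + b * U z T t)"
    and Vl: "V (\<lambda>j. x j + b * z j) = (\<lambda>T t. V x T t + b * V z T t)" for x z b
    unfolding U_def V_def by (rule pw_eval_linear)+
  have Uc: "U x = U x'" and Vc: "V x = V x'" if "\<And>j. j \<in> ?J \<Longrightarrow> x j = x' j" for x x'
    unfolding U_def V_def using that by (auto intro!: pw_eval_cong)
  have UVs: "\<exists>x. U x = v \<and> V x = q" if vq: "v \<in> Xh M k" "q \<in> Mh M k" for v q
  proof -
    obtain x y where "pw_eval M k x = v" "pw_eval M (k - 2) y = q" using pw_eval_surj vq by blast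
    then show ?thesis by (intro exI[of _ "case_sum x y"]) (simp add: U_def V_def)
  qed
  have sl: "sh \<Omega> M (\<lambda>T t. U x T t + b * U z T t) (U y) = sh \<Omega> M (U x) (U y) + b * sh \<Omega> M (U z) (U y)" for x z y b
    by (rule sh_linear[OF UX UX UX])
  have sl2: "sh \<Omega> M (U y) (\<lambda>T t. U x T t + b * U z T t) = sh \<Omega> M (U y) (U x) + b * sh \<Omega> M (U y) (U z)" for x z y b
    using sl[where x = x and b = b and z = z and y = y] by (simp add: sh_commute[of \<Omega> M "U y"])
  have bl: "bh M a c (\<lambda>T t. U x T t + b * U z T t) (V y) = bh M a c (U x) (V y) + b * bh M a c (U z) (V y)"
    and bl2: "bh M a c (U y) (\<lambda>T t. V x T t + b * V z T t) = bh M a c (U y) (V x) + b * bh M a c (U y) (V z)" for x z y b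
    by (rule bh_linear1[OF UX UX VM], rule bh_linear2[OF UX VM VM])
  have fl: "pw_inner M (\<lambda>T. f) (\<lambda>T t. V x T t + b * V z T t) = pw_inner M (\<lambda>T. f) (V x) + b * pw_inner M (\<lambda>T. f) (V z)" for x z b
    by (rule pw_inner_linear2[OF f _ VM VM]) simp
  define F where "F x y = sh \<Omega> M (U x) (U y) + bh M a c (U y) (V x) + bh M a c (U x) (V y)" for x y
  define l where "l y = pw_inner M (\<lambda>T. f) (V y)" for y
  have "\<exists>x. \<forall>y. F x y = l y"
  proof (rule bilinear_solvable[of ?J])
    show "finite ?J" using fin_elts by simp
    show "F (\<lambda>j. x j + b * z j) y = F x y + b * F z y" for x z b y
      unfolding F_def Ul Vl sl bl bl2 by (simp add: algebra_simps)
    show "F x (\<lambda>j. y j + b * z j) = F x y + b * F x z" for x z b y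
      unfolding F_def Ul Vl sl2 bl bl2 by (simp add: algebra_simps)
    show "l (\<lambda>j. y j + b * z j) = l y + b * l z" for y z b unfolding l_def Vl fl ..
    show "F x y = F x' y" if "\<And>j. j \<in> ?J \<Longrightarrow> x j = x' j" for x x' y
    proof -
      have "U x = U x'" "V x = V x'" by (rule Uc, erule that, rule Vc, erule that)
      then show ?thesis by (simp add: F_def)
    qed
    show "F x y = F x y'" if "\<And>j. j \<in> ?J \<Longrightarrow> y j = y' j" for x y y'
    proof -
      have "U y = U y'" "V y = V y'" by (rule Uc, erule that, rule Vc, erule that)
      then show ?thesis by (simp add: F_def)
    qed
    show "l y = l y'" if "\<And>j. j \<in> ?J \<Longrightarrow> y j = y' j" for y y'
    proof -
      have "V y = V y'" by (rule Vc, erule that)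
      then show ?thesis by (simp add: l_def)
    qed
    show "\<forall>j\<in>?J. x j = 0" if z: "\<And>y. F x y = 0" for x
    proof -
      have e: "sh \<Omega> M (U x) v + bh M a c v (V x) + bh M a c (U x) q = 0" if vq: "v \<in> Xh M k" "q \<in> Mh M k" for v q
      proof -
        obtain y where "U y = v" "V y = q" using UVs[OF vq] by blast
        then show ?thesis using z[of y] by (simp add: F_def)
      qed
      have q0: "bh M a c v (\<lambda>T x. 0) = 0" for v by (simp add: bh_def pw_inner_def)
      \<comment> \<open>Taking \<open>q = 0\<close> recovers the first equation from the sum;
        subtracting it, with \<open>v = U x\<close>, leaves the second.\<close>
      have e1: "sh \<Omega> M (U x) v + bh M a c v (V x) = 0" if "v \<in> Xh M k" for v
        using e[OF that pw_poly_zero] q0 by simp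
      have e2: "bh M a c (U x) q = 0" if "q \<in> Mh M k" for q
        using e[OF UX[of x] that] e1[OF UX[of x]] by simp
      have "U x = (\<lambda>T x. 0)" "V x = (\<lambda>T x. 0)" using homogeneous_zero[OF UX VM e1 e2] by auto
      then show ?thesis using pw_eval_zero unfolding U_def V_def by fastforce
    qed
  qed
  then obtain x where x: "\<And>y. F x y = l y" by blast
  have e: "sh \<Omega> M (U x) v + bh M a c v (V x) + bh M a c (U x) q = pw_inner M (\<lambda>T. f) q" if vq: "v \<in> Xh M k" "q \<in> Mh M k" for v q
  proof -
    obtain y where "U y = v" "V y = q" using UVs[OF vq] by blast
    then show ?thesis using x[of y] by (simp add: F_def l_def)
  qed
  have q0: "bh M a c v (\<lambda>T x. 0) = 0" "pw_inner M w (\<lambda>T x. 0) = 0" for v w by (simp_all add: bh_def pw_inner_def)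
  have e1: "sh \<Omega> M (U x) v + bh M a c v (V x) = 0" if "v \<in> Xh M k" for v
    using e[OF that pw_poly_zero] q0 by simp
  have e2: "bh M a c (U x) q = pw_inner M (\<lambda>T. f) q" if "q \<in> Mh M k" for q
    using e[OF UX[of x] that] e1[OF UX[of x]] by simp
  show ?thesis unfolding pd_dg_solution_def using UX VM e1 e2 by blast
qed

lemma well_posed:
  assumes f: "L2_on \<Omega> f"
  shows "(\<exists>!(uh, lh). pd_dg_solution \<Omega> M k a c f uh lh) \<and>
     (\<forall>uh lh. pd_dg_solution \<Omega> M k a c f uh lh \<longrightarrow>
        star_norm \<Omega> M k a c uh + pw_L2_norm M lh \<le> (1 + 8 * Cs) * L2_norm_on \<Omega> f)"
proof
  obtain u lam where ul: "pd_dg_solution \<Omega> M k a c f u lam" using solution_exists[OF f] by blast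
  show "\<exists>!(uh, lh). pd_dg_solution \<Omega> M k a c f uh lh"
  proof (rule ex1I[of _ "(u, lam)"])
    show "case (u, lam) of (uh, lh) \<Rightarrow> pd_dg_solution \<Omega> M k a c f uh lh" using ul by simp
    fix p assume "case p of (uh, lh) \<Rightarrow> pd_dg_solution \<Omega> M k a c f uh lh"
    then show "p = (u, lam)" using solution_unique[OF f _ ul] by (cases p) auto
  qed
qed (use solution_bound[OF f] in blast)

end

section \<open>Consequences of the regularity hypothesis\<close>

text \<open>Each differentiation produces a factor \<open>r\<close>, so the class that is stable
  under \<open>pd\<close> has to admit a scalar multiple \<open>b\<close>.\<close>

lemma smooth2_affine:
  assumes "smooth2 f" shows "smooth2 (\<lambda>x. f (u + r *\<^sub>R x))"
proof (rule smooth2_coinduct[where P = "\<lambda>g. \<exists>f b. smooth2 f \<and> g = (\<lambda>x. b * f (u + r *\<^sub>R x))"])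
  show "\<exists>f' b. smooth2 f' \<and> (\<lambda>x. f (u + r *\<^sub>R x)) = (\<lambda>x. b * f' (u + r *\<^sub>R x))"
    using assms by (intro exI[of _ f] exI[of _ 1]) simp
next
  fix g assume "\<exists>f b. smooth2 f \<and> g = (\<lambda>x. b * f (u + r *\<^sub>R x))"
  then obtain f b where f: "smooth2 f" and g: "g = (\<lambda>x. b * f (u + r *\<^sub>R x))" by blast
  have D: "((\<lambda>t. g (x + t *\<^sub>R axis i 1)) has_real_derivative (b * r) * pd i f (u + r *\<^sub>R x)) (at 0)" for x i
  proof -
    have "((\<lambda>t. f ((u + r *\<^sub>R x) + (r * t) *\<^sub>R axis i 1)) has_real_derivative pd i f (u + r *\<^sub>R x) * r) (at 0)"
      by (rule DERIV_chain2[of "\<lambda>t. f ((u + r *\<^sub>R x) + t *\<^sub>R axis i 1)"])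
        (auto intro!: derivative_eq_intros smooth2_DERIV0[OF f])
    from DERIV_cmult[OF this, of b] show ?thesis unfolding g by (simp add: algebra_simps)
  qed
  show "continuous_on UNIV g"
    unfolding g by (intro continuous_on_mult continuous_on_const continuous_on_compose2[OF smooth2_cont[OF f]] continuous_intros) auto
  show "(\<lambda>t. g (x + t *\<^sub>R axis i 1)) differentiable at 0" for i x using D real_differentiable_def by blast
  show "\<exists>f b. smooth2 f \<and> pd i g = (\<lambda>x. b * f (u + r *\<^sub>R x))" for i
  proof (intro exI conjI)
    show "pd i g = (\<lambda>x. (b * r) * pd i f (u + r *\<^sub>R x))" by (rule ext, rule pd_eqI, rule D)
  qed (rule smooth2_pd[OF f])
qed

lemma pd_zero_on_open:
  assumes "open U" "x \<in> U" "\<And>y. y \<in> U \<Longrightarrow> f y = 0" shows "pd i f x = 0"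
proof (rule pd_eqI)
  obtain e where e: "e > 0" "ball x e \<subseteq> U" using assms(1,2) open_contains_ball by blast
  show "((\<lambda>t. f (x + t *\<^sub>R axis i 1)) has_real_derivative 0) (at 0)"
  proof (rule has_field_derivative_transform_within_open[of "\<lambda>_. 0" _ _ "{-e<..<e}"])
    fix t assume "t \<in> {-e<..<e}"
    then have "x + t *\<^sub>R axis i 1 \<in> ball x e" by (auto simp: dist_norm)
    then show "0 = f (x + t *\<^sub>R axis i 1)" using e assms(3) by auto
  qed (use e in auto)
qed

text \<open>If this second derivative vanished on the ball, \<open>\<phi>\<close> would be affine
  along the first axis with value 0 at both \<open>r\<close> and \<open>-r\<close>, hence 0 at the
  centre. One such bump, rescaled to an element, probes the coefficients there.\<close>

lemma bump_second_derivative: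
  assumes r: "r > 0"
  obtains \<phi> S where "smooth2 \<phi>" "\<And>x. norm x \<ge> r \<Longrightarrow> \<phi> x = 0" "S > 0" "\<And>x. \<bar>\<phi> x\<bar> \<le> S"
    "\<And>i j x. \<bar>pd i (pd j \<phi>) x\<bar> \<le> S" "L2_norm_on (ball 0 r) (pd 1 (pd 1 \<phi>)) > 0"
proof -
  obtain \<phi> where "smooth2 \<phi>" "\<And>x. \<phi> x \<ge> 0" "\<And>x. norm x \<ge> r \<Longrightarrow> \<phi> x = 0" "\<phi> 0 > 0"
    using exists_bump[OF r] by blast
  note \<phi> = this(1,3,4)
  have sup: "supported_in r \<phi>" using \<phi>(2) by (simp add: supported_in_def)
  obtain K where K: "\<And>x. \<bar>\<phi> x\<bar> \<le> K" "K \<ge> 0" by (rule supported_in_bounded[OF sup smooth2_cont[OF \<phi>(1)]]) blast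
  have "\<exists>K. \<forall>x. \<bar>pd (fst p) (pd (snd p) \<phi>) x\<bar> \<le> K" for p
    by (rule supported_in_bounded[OF supported_in_pd[OF supported_in_pd[OF sup, of "snd p"], of "fst p"]
        smooth2_cont[OF smooth2_pd[OF smooth2_pd[OF \<phi>(1)]]]]) blast
  then have "\<forall>p. \<exists>K. \<forall>x. \<bar>pd (fst p) (pd (snd p) \<phi>) x\<bar> \<le> K" by blast
  from choice[OF this] obtain K2 where K2: "\<And>p x. \<bar>pd (fst p) (pd (snd p) \<phi>) x\<bar> \<le> K2 p" by blast
  define S where "S = 1 + K + (\<Sum>p\<in>(UNIV :: (2 \<times> 2) set). \<bar>K2 p\<bar>)"
  have nn: "0 \<le> (\<Sum>p\<in>(UNIV :: (2 \<times> 2) set). \<bar>K2 p\<bar>)" by (intro sum_nonneg) simp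
  have S2: "\<bar>pd i (pd j \<phi>) x\<bar> \<le> S" for i j x
  proof -
    have "\<bar>K2 (i, j)\<bar> \<le> (\<Sum>p\<in>(UNIV :: (2 \<times> 2) set). \<bar>K2 p\<bar>)" by (rule member_le_sum) auto
    then show ?thesis using K2[of "(i, j)" x] K(2) unfolding S_def by simp
  qed
  have "L2_norm_on (ball 0 r) (pd 1 (pd 1 \<phi>)) \<noteq> 0"
  proof
    assume 0: "L2_norm_on (ball 0 r) (pd 1 (pd 1 \<phi>)) = 0"
    have c: "continuous_on UNIV (pd 1 (pd 1 \<phi>))" by (rule smooth2_cont[OF smooth2_pd[OF smooth2_pd[OF \<phi>(1)]]])
    have z: "pd 1 (pd 1 \<phi>) x = 0" if "norm x < r" for x
      using continuous_L2_zero[OF open_ball bounded_ball c 0, of x] that by simp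
    let ?g = "\<lambda>t. \<phi> (t *\<^sub>R axis 1 1)" and ?d = "\<lambda>t. pd 1 \<phi> (t *\<^sub>R axis 1 1)"
    have D1: "(?g has_real_derivative ?d t) (at t)" for t
      using smooth2_DERIV[OF \<phi>(1), of 0 1 t] by simp
    have D2: "(?d has_real_derivative pd 1 (pd 1 \<phi>) (t *\<^sub>R axis 1 1)) (at t)" for t
      using smooth2_DERIV[OF smooth2_pd[OF \<phi>(1), of 1], where x = 0 and i = 1 and s = t] by simp
    have "\<exists>q. \<forall>x\<in>{-r<..<r}. ?d x = q"
    proof (rule has_field_derivative_zero_constant)
      fix x assume "x \<in> {-r<..<r}"
      then have "pd 1 (pd 1 \<phi>) (x *\<^sub>R axis 1 1) = 0" by (intro z) auto
      then show "(?d has_real_derivative 0) (at x within {-r<..<r})"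
        using D2[of x] by (auto intro: has_field_derivative_at_within)
    qed simp
    then obtain q where q: "\<And>x. x \<in> {-r<..<r} \<Longrightarrow> ?d x = q" by blast
    have d0: "?d t = ?d 0" if "-r < t" "t < r" for t using q[of t] q[of 0] that r by simp
    let ?f = "\<lambda>s. ?g s - s * ?d 0"
    have "?f x = ?f (-r)" if "-r \<le> x" "x \<le> r" for x
    proof (rule DERIV_isconst2[OF _ _ _ that])
      show "continuous_on {-r..r} ?f"
        using D1 by (intro continuous_intros) (auto intro!: continuous_at_imp_continuous_on DERIV_isCont)
      fix x assume "-r < x" "x < r"
      moreover have "(?f has_real_derivative ?d x - 1 * ?d 0) (at x)"
        by (intro DERIV_diff D1 DERIV_cmult_right DERIV_ident)
      ultimately show "(?f has_real_derivative 0) (at x)" using d0[of x] by simp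
    qed (use r in simp)
    note c = this[of r] this[of 0]
    have "?g r = 0" "?g (- r) = 0" using \<phi>(2) r by auto
    then show False using c \<phi>(3) r by simp
  qed
  then have "L2_norm_on (ball 0 r) (pd 1 (pd 1 \<phi>)) > 0" using L2_norm_nonneg[of "ball 0 r" "pd 1 (pd 1 \<phi>)"] by linarith
  note pos = this
  show ?thesis
  proof (rule that[of \<phi> S])
    show "S > 0" unfolding S_def using K nn by linarith
    show "\<bar>\<phi> x\<bar> \<le> S" for x unfolding S_def using K(1)[of x] nn by linarith
  qed (use \<phi> S2 pos in auto)
qed

lemma L2_norm_le_indicator:
  assumes F: "L2_on \<Omega> F" and T: "T \<in> sets borel" "bounded T" and K: "K \<ge> 0"
    and ae: "AE x in lborel. x \<in> \<Omega> \<longrightarrow> \<bar>F x\<bar> \<le> K * indicat_real T x"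
  shows "L2_norm_on \<Omega> F \<le> K * sqrt (measure lborel T)"
proof -
  have "(LINT x:\<Omega>|lborel. (F x)\<^sup>2) \<le> (LINT x|lborel. K\<^sup>2 * indicat_real T x)"
    unfolding set_lebesgue_integral_def
  proof (rule integral_mono_AE)
    show "integrable lborel (\<lambda>x. indicat_real \<Omega> x *\<^sub>R (F x)\<^sup>2)" using F by (simp add: L2_on_def set_integrable_def)
    show "integrable lborel (\<lambda>x. K\<^sup>2 * indicat_real T x)"
      using T emeasure_bounded_finite[OF T(2)] by (auto simp: less_top)
    show "AE x in lborel. indicat_real \<Omega> x *\<^sub>R (F x)\<^sup>2 \<le> K\<^sup>2 * indicat_real T x"
      using ae
    proof eventually_elim
      case (elim x)
      show ?case
      proof (cases "x \<in> \<Omega>")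
        case True
        then have "(F x)\<^sup>2 \<le> (K * indicat_real T x)\<^sup>2" using elim by (metis abs_ge_zero power2_abs power_mono)
        then show ?thesis using True by (cases "x \<in> T") auto
      qed simp
    qed
  qed
  also have "\<dots> = K\<^sup>2 * measure lborel T" using T by simp
  finally show ?thesis using K unfolding L2_norm_on_def
    by (metis real_sqrt_le_mono real_sqrt_mult real_sqrt_abs abs_of_nonneg)
qed

lemma L2_norm_le_AE:
  assumes F: "L2_on S F" and G: "L2_on S G" and ae: "AE x in lborel. x \<in> S \<longrightarrow> \<bar>F x\<bar> \<le> G x"
  shows "L2_norm_on S F \<le> L2_norm_on S G"
  unfolding L2_norm_on_def set_lebesgue_integral_def
proof (intro real_sqrt_le_mono integral_mono_AE)
  show "integrable lborel (\<lambda>x. indicat_real S x *\<^sub>R (F x)\<^sup>2)" "integrable lborel (\<lambda>x. indicat_real S x *\<^sub>R (G x)\<^sup>2)"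
    using F G by (auto simp: L2_on_def set_integrable_def)
  show "AE x in lborel. indicat_real S x *\<^sub>R (F x)\<^sup>2 \<le> indicat_real S x *\<^sub>R (G x)\<^sup>2"
    using ae
  proof eventually_elim
    case (elim x)
    then have "x \<in> S \<Longrightarrow> (F x)\<^sup>2 \<le> (G x)\<^sup>2" by (metis abs_ge_zero power2_abs power_mono)
    then show ?case by (simp add: indicator_def)
  qed
qed

lemma L2_on_abs: "L2_on S f \<Longrightarrow> L2_on S (\<lambda>x. \<bar>f x\<bar>)"
proof -
  assume f: "L2_on S f"
  then have "(\<lambda>x. \<bar>indicat_real S x *\<^sub>R f x\<bar>) \<in> borel_measurable lborel" by (auto simp: L2_on_def set_borel_measurable_def)
  then have "set_borel_measurable lborel S (\<lambda>x. \<bar>f x\<bar>)"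
    unfolding set_borel_measurable_def by (rule back_subst[where P = "\<lambda>f. f \<in> borel_measurable lborel"]) (auto simp: indicator_def)
  then show ?thesis using f by (simp add: L2_on_def)
qed

lemma L2_norm_abs: "L2_norm_on S (\<lambda>x. \<bar>f x\<bar>) = L2_norm_on S f"
  by (simp add: L2_norm_on_def)

lemma L2_norm_sum_le:
  assumes "finite I" "\<And>i. i \<in> I \<Longrightarrow> L2_on S (f i)"
  shows "L2_norm_on S (\<lambda>x. \<Sum>i\<in>I. f i x) \<le> (\<Sum>i\<in>I. L2_norm_on S (f i))"
  using assms
proof (induction I rule: finite_induct)
  case (insert i I)
  have "L2_norm_on S (\<lambda>x. f i x + (\<Sum>i\<in>I. f i x)) \<le> L2_norm_on S (f i) + L2_norm_on S (\<lambda>x. \<Sum>i\<in>I. f i x)"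
    using insert.prems by (intro L2_norm_triangle L2_on_sum) auto
  then show ?case using insert by simp
qed (simp add: L2_norm_on_def)

section \<open>Averaged coefficients on a fine mesh\<close>

abbreviation disc_area :: real where "disc_area \<equiv> unit_ball_vol 2"

text \<open>What a fine mesh provides: oscillation at most \<open>\<epsilon>\<close>, diameters at
  most \<open>h\<close>, and the regularity estimate with a named constant. The numbers are
  parameters, so that the final theorem can fix them before any mesh is given.\<close>

locale small_mesh = mesh_problem +
  fixes \<rho> \<epsilon> h C0 :: real
  assumes sr: "shape_regular \<rho> M" and rho: "\<rho> > 0" and eps0: "\<epsilon> \<ge> 0" and B0: "B \<ge> 0" and C00: "C0 \<ge> 0"
    and diam: "\<And>T. T \<in> fst M \<Longrightarrow> diameter T \<le> h"
    and a_eps: "\<And>i j. AE x in lborel. x \<in> \<Omega> \<longrightarrow> \<bar>a x $ i $ j - pw_avg M (\<lambda>x. a x $ i $ j) x\<bar> \<le> \<epsilon>"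
    and c_eps: "AE x in lborel. x \<in> \<Omega> \<longrightarrow> \<bar>c x - pw_avg M c x\<bar> \<le> \<epsilon>"
    and reg: "\<And>g. L2_on \<Omega> g \<Longrightarrow>
      (\<exists>u D1 D2. strong_sol \<Omega> a c g u D1 D2 \<and> H2_norm \<Omega> u D1 D2 \<le> C0 * L2_norm_on \<Omega> g) \<and>
      (\<forall>u D1 D2 v E1 E2. strong_sol \<Omega> a c g u D1 D2 \<longrightarrow> strong_sol \<Omega> a c g v E1 E2 \<longrightarrow>
          (AE x in lborel. x \<in> \<Omega> \<longrightarrow> u x = v x))"
begin

definition aavg :: "pt set \<Rightarrow> real^2^2" where
  "aavg T = (\<chi> i j. (LINT y:T|lborel. a y $ i $ j) / measure lborel T)"

definition cavg :: "pt set \<Rightarrow> real" where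
  "cavg T = (LINT y:T|lborel. c y) / measure lborel T"

lemma elts_ne: "fst M \<noteq> {}"
  by (rule mesh_parts[THEN conjunct2, THEN conjunct2, THEN conjunct1])

lemma h_pos: "h > 0"
  using diam diameter_pos elts_ne by (metis all_not_in_conv less_le_trans)

lemma avg_close:
  "AE x in lborel. \<forall>T\<in>fst M. x \<in> T \<longrightarrow> (\<forall>i j. \<bar>a x $ i $ j - aavg T $ i $ j\<bar> \<le> \<epsilon>) \<and> \<bar>c x - cavg T\<bar> \<le> \<epsilon>"
proof -
  have av: "pw_avg M g x = (LINT y:T|lborel. g y) / measure lborel T" if "T \<in> fst M" "x \<in> T" for g T x
    using pwf_in[OF that, of "\<lambda>T _. (LINT y:T|lborel. g y) / measure lborel T"] by (simp add: pw_avg_def pwf_def)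
  have "AE x in lborel. \<forall>i\<in>UNIV. \<forall>j\<in>UNIV. x \<in> \<Omega> \<longrightarrow> \<bar>a x $ i $ j - pw_avg M (\<lambda>x. a x $ i $ j) x\<bar> \<le> \<epsilon>"
    by (intro AE_finite_allI finite a_eps)
  then show ?thesis using c_eps
  proof eventually_elim
    case (elim x)
    show ?case
    proof (intro ballI impI conjI allI)
      fix T assume T: "T \<in> fst M" "x \<in> T"
      then have x: "x \<in> \<Omega>" using elt_sub by blast
      show "\<bar>a x $ i $ j - aavg T $ i $ j\<bar> \<le> \<epsilon>" for i j
        using elim(1) x av[OF T] by (simp add: aavg_def)
      show "\<bar>c x - cavg T\<bar> \<le> \<epsilon>" using elim(2) x av[OF T] by (simp add: cavg_def)
    qed
  qed
qed

lemma measure_elt: "T \<in> fst M \<Longrightarrow> measure lborel T \<le> disc_area * (diameter T)\<^sup>2"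
proof -
  assume T: "T \<in> fst M"
  obtain x where x: "x \<in> T" using elt_ne[OF T] by blast
  have "measure lborel T \<le> measure lborel (cball x (diameter T))"
  proof (rule measure_mono_fmeasurable)
    show "T \<subseteq> cball x (diameter T)" using closure_cball[OF T x] closure_subset by blast
    show "T \<in> sets lborel" using elt_open[OF T] by simp
    show "cball x (diameter T) \<in> fmeasurable lborel"
      using emeasure_bounded_finite[OF bounded_cball, of x "diameter T"] by (simp add: fmeasurable_def)
  qed
  then show ?thesis using diameter_pos[OF T] by (simp add: content_cball)
qed

lemma measure_elt_pos: "T \<in> fst M \<Longrightarrow> measure lborel T > 0"
proof -
  assume T: "T \<in> fst M"
  have "L2_norm_on T (\<lambda>_. 1) \<noteq> 0"
    using continuous_L2_zero[OF elt_open[OF T] elt_bounded[OF T], of "\<lambda>_. 1"] elt_ne[OF T] by force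
  moreover have "L2_norm_on T (\<lambda>_. 1) \<le> 1 * sqrt (measure lborel T)"
    using elt_open[OF T] elt_bounded[OF T] by (intro L2_norm_le_sup continuous_set_borel_measurable) auto
  ultimately have "0 < sqrt (measure lborel T)" using L2_norm_nonneg[of T "\<lambda>_. 1"] by linarith
  then show ?thesis by simp
qed

lemma avg_bound:
  assumes T: "T \<in> fst M" and g: "set_borel_measurable lborel \<Omega> g" "\<And>x. x \<in> \<Omega> \<Longrightarrow> \<bar>g x\<bar> \<le> B"
  shows "\<bar>(LINT y:T|lborel. g y) / measure lborel T\<bar> \<le> B"
proof -
  have "L2_on \<Omega> g" by (rule bounded_measurable_L2_on[OF borelO bdO g])
  then have L: "L2_on T g" by (rule L2_on_subset[OF _ borelT[OF T] subT[OF T]])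
  have L1: "L2_on T (\<lambda>_. 1)" using borelT[OF T] bdT[OF T] by (intro continuous_L2_on) auto
  have "\<bar>LINT y:T|lborel. g y * 1\<bar> \<le> L2_norm_on T g * L2_norm_on T (\<lambda>_. 1)" by (rule L2_Cauchy_Schwarz[OF L L1])
  also have "\<dots> \<le> (B * sqrt (measure lborel T)) * (1 * sqrt (measure lborel T))"
    using L L1 g(2) subT[OF T] B0 borelT[OF T] bdT[OF T]
    by (intro mult_mono L2_norm_le_sup mult_nonneg_nonneg) (auto simp: L2_on_def)
  also have "\<dots> = B * measure lborel T" by simp
  finally show ?thesis using measure_elt_pos[OF T] by (simp add: abs_divide divide_le_eq)
qed

lemma aavg_bound: "T \<in> fst M \<Longrightarrow> \<bar>aavg T $ i $ j\<bar> \<le> B"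
  using avg_bound[OF _ a_meas a_bdd] by (simp add: aavg_def)

lemma cavg_bound: "T \<in> fst M \<Longrightarrow> \<bar>cavg T\<bar> \<le> B"
  using avg_bound[OF _ c_meas c_bdd] by (simp add: cavg_def)

text \<open>A degenerate coefficient on one element would make a bump function concentrated on that
  element violate the regularity estimate.\<close>

lemma average_nondegenerate:
  assumes sym: "\<And>x i j. x \<in> \<Omega> \<Longrightarrow> a x $ i $ j = a x $ j $ i"
    and pdef: "\<And>x \<xi>. x \<in> \<Omega> \<Longrightarrow> \<xi> \<noteq> 0 \<Longrightarrow> \<xi> \<bullet> (a x *v \<xi>) > 0"
    and \<phi>: "smooth2 \<phi>" "\<And>x. norm x \<ge> \<rho> \<Longrightarrow> \<phi> x = 0" "\<And>x. \<bar>\<phi> x\<bar> \<le> S" "\<And>i j x. \<bar>pd i (pd j \<phi>) x\<bar> \<le> S"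
    and T: "T \<in> fst M" and deg: "\<And>i. \<bar>aavg T $ i $ i\<bar> < \<eta>"
  shows "L2_norm_on (ball 0 \<rho>) (pd 1 (pd 1 \<phi>)) \<le> C0 * sqrt disc_area * S * (4 * (\<eta> + \<epsilon>) + B * h\<^sup>2)"
proof -
  define t where "t = diameter T"
  have t: "t > 0" "t \<le> h" using diameter_pos[OF T] diam[OF T] by (auto simp: t_def)
  have S0: "S \<ge> 0" using \<phi>(3)[of 0] by linarith
  have \<eta>0: "\<eta> \<ge> 0" using deg[of 1] by linarith
  obtain x0 where "star_cell T x0 (\<rho> * t)" using star_cellI[OF sr rho T] unfolding t_def by blast
  then interpret sc: star_cell T x0 "\<rho> * t" .
  \<comment> \<open>Maps the inscribed ball about \<open>x0\<close> to the ball of radius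
    \<open>\<rho>\<close> about 0, so \<open>\<psi>\<close> is a bump inside \<open>T\<close> whose
    second derivatives carry the factor \<open>(1/t)\<^sup>2\<close>.\<close>
  define y where "y x = (- (1/t)) *\<^sub>R x0 + (1/t) *\<^sub>R x" for x :: pt
  define \<psi> where "\<psi> x = \<phi> (y x)" for x
  have s\<psi>: "smooth2 \<psi>" unfolding \<psi>_def[abs_def] y_def by (rule smooth2_affine[OF \<phi>(1)])
  have p1: "pd i \<psi> = (\<lambda>x. (1/t) * pd i \<phi> (y x))" for i
    unfolding \<psi>_def[abs_def] y_def by (rule pd_affine[OF \<phi>(1)])
  have p2: "pd i (pd j \<psi>) = (\<lambda>x. (1/t)\<^sup>2 * pd i (pd j \<phi>) (y x))" for i j
  proof -
    have "smooth2 (\<lambda>x. pd j \<phi> (y x))" unfolding y_def by (rule smooth2_affine[OF smooth2_pd[OF \<phi>(1)]])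
    then have "pd i (pd j \<psi>) = (\<lambda>x. (1/t) * pd i (\<lambda>x. pd j \<phi> (y x)) x)" unfolding p1 by (rule pd_cmult)
    also have "pd i (\<lambda>x. pd j \<phi> (y x)) = (\<lambda>x. (1/t) * pd i (pd j \<phi>) (y x))"
      unfolding y_def by (rule pd_affine[OF smooth2_pd[OF \<phi>(1)]])
    finally show ?thesis by (simp add: power2_eq_square mult.assoc)
  qed
  have \<psi>0: "\<psi> x = 0" if "x \<notin> ball x0 (\<rho> * t)" for x
  proof -
    have "y x = (1/t) *\<^sub>R (x - x0)" by (simp add: y_def algebra_simps)
    then have "norm (y x) = dist x0 x / t" using t by (simp add: dist_norm norm_minus_commute)
    moreover have "dist x0 x \<ge> \<rho> * t" using that by simp
    ultimately have "norm (y x) \<ge> \<rho>" using t by (simp add: le_divide_eq)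
    then show ?thesis by (simp add: \<psi>_def \<phi>(2))
  qed
  have \<psi>T: "\<psi> x = 0" if "x \<notin> T" for x using \<psi>0 that sc.ballT by blast
  \<comment> \<open>The same smooth function on every element has no jumps, and it vanishes off
    \<open>T\<close>, hence off \<open>\<Omega>\<close>; so the regularity estimate applies.\<close>
  let ?v = "\<lambda>_::pt set. \<psi>"
  have rb: "L2_norm_on \<Omega> (pwf (\<lambda>T. pd 1 (pd 1 (?v T)))) \<le> C0 * L2_norm_on \<Omega> (Lpw ?v)"
    unfolding Lpw_def[abs_def]
    by (rule regularity_bound(4)[where v = ?v and B = B, OF reg])
      (use s\<psi> \<psi>T elt_sub[OF T] a_meas a_bdd c_meas c_bdd in auto)
  have low: "L2_norm_on (ball 0 \<rho>) (pd 1 (pd 1 \<phi>)) / t \<le> L2_norm_on \<Omega> (pwf (\<lambda>T. pd 1 (pd 1 (?v T))))"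
  proof -
    have cont: "continuous_on UNIV (pd 1 (pd 1 \<psi>))" by (rule smooth2_cont[OF smooth2_pd[OF smooth2_pd[OF s\<psi>]]])
    have "y (x0 + t *\<^sub>R z) = z" for z using t by (simp add: y_def algebra_simps)
    then have "L2_norm_on (ball x0 (\<rho> * t)) (pd 1 (pd 1 \<psi>)) = t * L2_norm_on (ball 0 \<rho>) (\<lambda>z. (1/t)\<^sup>2 * pd 1 (pd 1 \<phi>) z)"
      using L2_norm_affine[OF t(1) cont, of x0 \<rho>] by (simp add: p2)
    also have "\<dots> = L2_norm_on (ball 0 \<rho>) (pd 1 (pd 1 \<phi>)) / t"
      unfolding L2_norm_cmult using t by (simp add: power2_eq_square)
    finally have "L2_norm_on (ball 0 \<rho>) (pd 1 (pd 1 \<phi>)) / t = L2_norm_on (ball x0 (\<rho> * t)) (pd 1 (pd 1 \<psi>))" by simp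
    also have "\<dots> = L2_norm_on (ball x0 (\<rho> * t)) (pwf (\<lambda>T. pd 1 (pd 1 (?v T))))"
      unfolding L2_norm_on_def
      by (intro arg_cong[of _ _ sqrt] set_lebesgue_integral_cong) (use pwf_in[OF T] sc.ballT in auto)
    also have "\<dots> \<le> L2_norm_on \<Omega> (pwf (\<lambda>T. pd 1 (pd 1 (?v T))))"
      using sc.ballT subT[OF T] cont by (intro L2_norm_mono pwf_L2) auto
    finally show ?thesis .
  qed
  \<comment> \<open>Four second-order terms, each with a coefficient of size at most
    \<open>\<eta> + \<epsilon>\<close>, and one term from \<open>c\<close>.\<close>
  let ?K = "4 * ((\<eta> + \<epsilon>) * ((1/t)\<^sup>2 * S)) + B * S"
  have K0: "?K \<ge> 0" using S0 \<eta>0 eps0 B0 by simp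
  have up: "L2_norm_on \<Omega> (Lpw ?v) \<le> ?K * sqrt (measure lborel T)"
  proof (rule L2_norm_le_indicator[OF Lpw_L2[OF s\<psi>] borelT[OF T] bdT[OF T] K0])
    show "AE x in lborel. x \<in> \<Omega> \<longrightarrow> \<bar>Lpw ?v x\<bar> \<le> ?K * indicat_real T x"
      using AE_cells_in avg_close
    proof eventually_elim
      case (elim x)
      show ?case
      proof
        assume x: "x \<in> \<Omega>"
        then obtain T' where T': "T' \<in> fst M" "x \<in> T'" using elim(1) by blast
        show "\<bar>Lpw ?v x\<bar> \<le> ?K * indicat_real T x"
        proof (cases "x \<in> T")
          case False
          then have "T' \<noteq> T" using T' by blast
          then have z: "\<psi> y = 0" if "y \<in> T'" for y using \<psi>T elt_disj[OF T'(1) T] that by blast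
          have z1: "pd j \<psi> y = 0" if "y \<in> T'" for y j by (rule pd_zero_on_open[OF elt_open[OF T'(1)] that z])
          have "pd i (pd j \<psi>) x = 0" for i j by (rule pd_zero_on_open[OF elt_open[OF T'(1)] T'(2) z1])
          then have "Lpw ?v x = 0" using z[OF T'(2)] by (simp add: Lpw_in[OF T'] Lop_def)
          then show ?thesis using False by simp
        next
          case True
          have dg: "\<bar>a x $ i $ i\<bar> \<le> \<eta> + \<epsilon>" for i
          proof -
            have "\<bar>a x $ i $ i - aavg T $ i $ i\<bar> \<le> \<epsilon>" using elim(2) T True by blast
            then show ?thesis using deg[of i] by linarith
          qed
          \<comment> \<open>Positive definiteness tested with \<open>(1, 1)\<close> and
            \<open>(1, -1)\<close> bounds the off-diagonal entry by the mean of the diagonal ones,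
            so small diagonal entries make the whole matrix small.\<close>
          have od: "2 * \<bar>a x $ 1 $ 2\<bar> \<le> a x $ 1 $ 1 + a x $ 2 $ 2"
          proof -
            have q: "s * s = 1 \<Longrightarrow> a x $ 1 $ 1 + 2 * s * (a x $ 1 $ 2) + a x $ 2 $ 2 > 0" for s :: real
            proof -
              assume s: "s * s = 1"
              let ?\<xi> = "vector [1, s] :: real^2"
              have "?\<xi> \<noteq> 0" by (simp add: vec_eq_iff forall_2)
              then have "?\<xi> \<bullet> (a x *v ?\<xi>) > 0" by (rule pdef[OF x])
              then have "a x $ 1 $ 1 + s * (a x $ 1 $ 2) + s * (a x $ 2 $ 1) + (s * s) * a x $ 2 $ 2 > 0"
                by (simp add: inner_vec_def matrix_vector_mult_def sum_2 algebra_simps)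
              then show ?thesis using s sym[OF x, of 2 1] by simp
            qed
            show ?thesis using q[of 1] q[of "-1"] by (simp add: abs_if)
          qed
          have ab: "\<bar>a x $ i $ j\<bar> \<le> \<eta> + \<epsilon>" for i j
          proof -
            have "\<bar>a x $ 1 $ 2\<bar> \<le> \<eta> + \<epsilon>" using od dg[of 1] dg[of 2] by linarith
            moreover have "a x $ 2 $ 1 = a x $ 1 $ 2" by (rule sym[OF x])
            ultimately show ?thesis using dg[of 1] dg[of 2] exhaust_2[of i] exhaust_2[of j] by auto
          qed
          have tm: "\<bar>a x $ i $ j * pd i (pd j \<psi>) x\<bar> \<le> (\<eta> + \<epsilon>) * ((1/t)\<^sup>2 * S)" for i j
          proof -
            have "\<bar>pd i (pd j \<psi>) x\<bar> \<le> (1/t)\<^sup>2 * S"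
              unfolding p2 using mult_left_mono[OF \<phi>(4), of "(1/t)\<^sup>2"] by (simp add: abs_mult)
            then show ?thesis unfolding abs_mult using ab \<eta>0 eps0 by (intro mult_mono) auto
          qed
          have cm: "\<bar>c x * \<psi> x\<bar> \<le> B * S"
            unfolding abs_mult \<psi>_def using c_bdd[OF x] \<phi>(3) B0 by (intro mult_mono) auto
          have "Lpw ?v x = a x $ 1 $ 1 * pd 1 (pd 1 \<psi>) x + a x $ 1 $ 2 * pd 1 (pd 2 \<psi>) x
             + (a x $ 2 $ 1 * pd 2 (pd 1 \<psi>) x + a x $ 2 $ 2 * pd 2 (pd 2 \<psi>) x) + c x * \<psi> x"
            by (simp add: Lpw_in[OF T True] Lop_def sum_2)
          then have "\<bar>Lpw ?v x\<bar> \<le> ?K" using tm[of 1 1] tm[of 1 2] tm[of 2 1] tm[of 2 2] cm by linarith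
          then show ?thesis using True by simp
        qed
      qed
    qed
  qed
  have "sqrt (measure lborel T) \<le> sqrt (disc_area * t\<^sup>2)" using measure_elt[OF T] unfolding t_def by (rule real_sqrt_le_mono)
  also have "\<dots> = sqrt disc_area * t" using t by (simp add: real_sqrt_mult)
  finally have mT: "sqrt (measure lborel T) \<le> sqrt disc_area * t" .
  have "L2_norm_on (ball 0 \<rho>) (pd 1 (pd 1 \<phi>)) / t \<le> C0 * (?K * (sqrt disc_area * t))"
    using low rb up mult_left_mono[OF mT K0] mult_left_mono[OF _ C00] by (meson order_trans)
  then have "L2_norm_on (ball 0 \<rho>) (pd 1 (pd 1 \<phi>)) \<le> C0 * (?K * (sqrt disc_area * t)) * t" using t by (simp add: divide_le_eq)
  \<comment> \<open>The factor \<open>t\<close> from the area of \<open>T\<close> and the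
    \<open>t\<close> moved over from the scaled norm cancel the \<open>(1/t)\<^sup>2\<close> of the
    second derivatives, so the principal term does not depend on the size of the element.\<close>
  also have "\<dots> = C0 * sqrt disc_area * S * (4 * (\<eta> + \<epsilon>) + B * t\<^sup>2)"
    using t by (simp add: power2_eq_square field_simps)
  also have "\<dots> \<le> C0 * sqrt disc_area * S * (4 * (\<eta> + \<epsilon>) + B * h\<^sup>2)"
    using t S0 C00 B0 by (intro mult_left_mono add_left_mono power_mono mult_nonneg_nonneg) auto
  finally show ?thesis .
qed

end

section \<open>The inf-sup condition\<close>

lemma abs_six_le:
  fixes d :: real
  assumes "d = x1 + x2 + (x3 + x4) + (y + w)" "\<bar>x1\<bar> \<le> k1" "\<bar>x2\<bar> \<le> k2" "\<bar>x3\<bar> \<le> k3" "\<bar>x4\<bar> \<le> k4"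
    "\<bar>y\<bar> \<le> l" "\<bar>w\<bar> \<le> m"
  shows "\<bar>d\<bar> \<le> k1 + k2 + (k3 + k4) + (l + m)"
  using assms by linarith

context small_mesh begin

definition ctr :: "pt set \<Rightarrow> pt" where
  "ctr T = (SOME x. star_cell T x (\<rho> * diameter T))"

lemma star_ctr: "T \<in> fst M \<Longrightarrow> star_cell T (ctr T) (\<rho> * diameter T)"
proof -
  assume "T \<in> fst M"
  then obtain x where "star_cell T x (\<rho> * diameter T)" using star_cellI[OF sr rho] by blast
  then show ?thesis unfolding ctr_def by (rule someI)
qed

lemma ctr_ball: "T \<in> fst M \<Longrightarrow> ball (ctr T) (\<rho> * diameter T) \<subseteq> T"
  by (rule star_cell.ballT[OF star_ctr])

lemma ctr_in: "T \<in> fst M \<Longrightarrow> ctr T \<in> T"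
  using ctr_ball mult_pos_pos[OF rho diameter_pos] by (meson centre_in_ball subsetD)

lemma closure_ctr: "T \<in> fst M \<Longrightarrow> closure T \<subseteq> cball (ctr T) (diameter T)"
  by (rule closure_cball[OF _ ctr_in])

lemma smooth_L2_elt: "T \<in> fst M \<Longrightarrow> smooth2 f \<Longrightarrow> L2_on T f"
  by (rule continuous_L2_on[OF borelT bdT smooth2_cont])

lemma ball_norm_le:
  assumes "T \<in> fst M" "smooth2 f"
  shows "L2_norm_on (ball (ctr T) (\<rho> * diameter T)) f \<le> L2_norm_on T f"
  using L2_norm_mono[OF smooth_L2_elt[OF assms] ctr_ball[OF assms(1)]] by simp

text \<open>Each element is counted once per edge. With the bound on the number of edges, sums over
  edges turn into sums over elements.\<close>

lemma edge_sum_swap: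
  "(\<Sum>e\<in>snd M. \<Sum>T\<in>adj M e. n T) = (\<Sum>T\<in>fst M. real (card {e \<in> snd M. T \<in> adj M e}) * n T)"
proof -
  have "(\<Sum>e\<in>snd M. \<Sum>T\<in>adj M e. n T) = (\<Sum>e\<in>snd M. \<Sum>T\<in>fst M. if T \<in> adj M e then n T else 0)"
  proof (rule sum.cong[OF refl])
    fix e
    have "adj M e = {T \<in> fst M. T \<in> adj M e}" using adj_elt by blast
    then show "sum n (adj M e) = (\<Sum>T\<in>fst M. if T \<in> adj M e then n T else 0)"
      using sum.inter_filter[OF fin_elts, of n "\<lambda>T. T \<in> adj M e"] by simp
  qed
  also have "\<dots> = (\<Sum>T\<in>fst M. \<Sum>e\<in>snd M. if T \<in> adj M e then n T else 0)" by (rule sum.swap)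
  also have "\<dots> = (\<Sum>T\<in>fst M. real (card {e \<in> snd M. T \<in> adj M e}) * n T)"
  proof (rule sum.cong[OF refl])
    fix T
    show "(\<Sum>e\<in>snd M. if T \<in> adj M e then n T else 0) = real (card {e \<in> snd M. T \<in> adj M e}) * n T"
      using sum.inter_filter[OF fin_edges, of "\<lambda>_. n T" "\<lambda>e. T \<in> adj M e"] by simp
  qed
  finally show ?thesis .
qed

lemma jump_le:
  assumes e: "e \<in> snd M" and nn: "\<And>T. T \<in> adj M e \<Longrightarrow> n T \<ge> 0"
    and le: "\<And>T. T \<in> adj M e \<Longrightarrow> \<bar>w T x\<bar> \<le> n T"
  shows "jump \<Omega> M w e x * jump \<Omega> M w e x \<le> 2 * (\<Sum>T\<in>adj M e. (n T)\<^sup>2)"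
proof (cases "bdry_edge \<Omega> e")
  case True
  let ?T = "elt1 M e"
  have T: "?T \<in> adj M e" by (rule elt1_adj[OF e])
  have "(w ?T x)\<^sup>2 \<le> (n ?T)\<^sup>2" using le[OF T] by (metis abs_ge_zero power2_abs power_mono)
  also have "\<dots> \<le> (\<Sum>T\<in>adj M e. (n T)\<^sup>2)" using T finite_adj by (intro member_le_sum) auto
  finally have "(w ?T x)\<^sup>2 \<le> (\<Sum>T\<in>adj M e. (n T)\<^sup>2)" .
  moreover have "0 \<le> (\<Sum>T\<in>adj M e. (n T)\<^sup>2)" by (intro sum_nonneg) simp
  ultimately show ?thesis using True by (simp add: jump_def power2_eq_square)
next
  case False
  let ?T1 = "elt1 M e" and ?T2 = "elt2 M e"
  have adj: "adj M e = {?T1, ?T2}" "?T2 \<in> adj M e" using interior_edge_adj[OF e False] by auto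
  have T1: "?T1 \<in> adj M e" by (rule elt1_adj[OF e])
  have "card (adj M e) = 2" using edge_cases[OF e] False by auto
  then have ne: "?T1 \<noteq> ?T2" using adj(1) by auto
  have "(w ?T1 x)\<^sup>2 \<le> (n ?T1)\<^sup>2" "(w ?T2 x)\<^sup>2 \<le> (n ?T2)\<^sup>2"
    using le[OF T1] le[OF adj(2)] by (metis abs_ge_zero power2_abs power_mono)+
  moreover have "(\<Sum>T\<in>adj M e. (n T)\<^sup>2) = (n ?T1)\<^sup>2 + (n ?T2)\<^sup>2" unfolding adj(1) using ne by simp
  moreover have "(w ?T1 x - w ?T2 x) * (w ?T1 x - w ?T2 x) \<le> 2 * ((w ?T1 x)\<^sup>2 + (w ?T2 x)\<^sup>2)"
    using zero_le_power2[of "w ?T1 x + w ?T2 x"] by (simp add: power2_eq_square algebra_simps)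
  ultimately show ?thesis using False by (simp add: jump_def)
qed

text \<open>No cancellation across edges is needed: the lift is pointwise of size \<open>h\<^sup>2\<close> times the datum,
  which already compensates the weights in the stabilizer.\<close>

lemma stabilizer_bound:
  assumes z: "z \<in> pw_poly M l" and C: "C \<ge> 0" and n: "\<And>T. T \<in> fst M \<Longrightarrow> n T \<ge> 0"
    and z0: "\<And>T x. T \<in> fst M \<Longrightarrow> x \<in> closure T \<Longrightarrow> \<bar>z T x\<bar> \<le> C * diameter T * n T"
    and z1: "\<And>T x i. T \<in> fst M \<Longrightarrow> x \<in> closure T \<Longrightarrow> \<bar>pd i (z T) x\<bar> \<le> C * n T"
  shows "sh \<Omega> M z z \<le> 6 * C\<^sup>2 * (2 * disc_area / \<rho>\<^sup>2) * (\<Sum>T\<in>fst M. (n T)\<^sup>2)"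
proof -
  note sm = pw_poly_smooth[OF z]
  let ?s = "\<lambda>e. \<Sum>T\<in>adj M e. (n T)\<^sup>2"
  have s0: "?s e \<ge> 0" for e by (intro sum_nonneg) simp
  have cl: "x \<in> closure T" if "x \<in> eseg e" "T \<in> adj M e" for x e T
    using adj_frontier[OF that(2)] that(1) by (auto simp: frontier_def)
  have A: "1 / h_edge M e ^ 3 * edge_int e (\<lambda>x. jump \<Omega> M z e x * jump \<Omega> M z e x) \<le> 2 * C\<^sup>2 * ?s e" if e: "e \<in> snd M" for e
  proof -
    let ?h = "h_edge M e"
    have h: "?h > 0" by (rule h_edge_pos[OF e])
    \<comment> \<open>Replacing the diameters of both neighbours by \<open>?h\<close> gives
      \<open>?h\<^sup>2\<close> from the values and one more \<open>?h\<close> from the length of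
      the edge, which together cancel the weight \<open>?h ^ 3\<close>.\<close>
    have "edge_int e (\<lambda>x. jump \<Omega> M z e x * jump \<Omega> M z e x) \<le> dist (fst e) (snd e) * (2 * (\<Sum>T\<in>adj M e. (C * ?h * n T)\<^sup>2))"
    proof (rule edge_int_le[OF jump_sq_cont[OF sm]])
      fix x assume x: "x \<in> eseg e"
      show "jump \<Omega> M z e x * jump \<Omega> M z e x \<le> 2 * (\<Sum>T\<in>adj M e. (C * ?h * n T)\<^sup>2)"
      proof (rule jump_le[OF e])
        fix T assume T: "T \<in> adj M e"
        note TM = adj_elt[OF T]
        show "0 \<le> C * ?h * n T" using C h n[OF TM] by simp
        have "C * diameter T * n T \<le> C * ?h * n T"
          using h_edge_ge[OF T] C n[OF TM] by (intro mult_right_mono mult_left_mono) auto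
        then show "\<bar>z T x\<bar> \<le> C * ?h * n T" using z0[OF TM cl[OF x T]] by linarith
      qed
    qed
    also have "\<dots> \<le> ?h * (2 * (\<Sum>T\<in>adj M e. (C * ?h * n T)\<^sup>2))"
      using edge_length_le[OF e] by (intro mult_right_mono) (auto intro: sum_nonneg)
    also have "(\<Sum>T\<in>adj M e. (C * ?h * n T)\<^sup>2) = C\<^sup>2 * ?h\<^sup>2 * ?s e"
      by (simp add: power_mult_distrib sum_distrib_left)
    also have "?h * (2 * (C\<^sup>2 * ?h\<^sup>2 * ?s e)) = ?h ^ 3 * (2 * C\<^sup>2 * ?s e)"
      by (simp add: power2_eq_square power3_eq_cube)
    finally show ?thesis using h by (simp add: divide_le_eq mult.commute)
  qed
  have Bd: "1 / h_edge M e * (\<Sum>i\<in>UNIV. edge_int e (\<lambda>x. jump \<Omega> M (\<lambda>T. pd i (z T)) e x * jump \<Omega> M (\<lambda>T. pd i (z T)) e x)) \<le> 4 * C\<^sup>2 * ?s e"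
    if e: "e \<in> snd M" for e
  proof -
    let ?h = "h_edge M e"
    have h: "?h > 0" by (rule h_edge_pos[OF e])
    have "edge_int e (\<lambda>x. jump \<Omega> M (\<lambda>T. pd i (z T)) e x * jump \<Omega> M (\<lambda>T. pd i (z T)) e x) \<le> ?h * (2 * C\<^sup>2 * ?s e)" for i
    proof -
      have "edge_int e (\<lambda>x. jump \<Omega> M (\<lambda>T. pd i (z T)) e x * jump \<Omega> M (\<lambda>T. pd i (z T)) e x) \<le> dist (fst e) (snd e) * (2 * (\<Sum>T\<in>adj M e. (C * n T)\<^sup>2))"
      proof (rule edge_int_le[OF jump_sq_cont[OF smooth2_pd[OF sm]]])
        fix x assume x: "x \<in> eseg e"
        show "jump \<Omega> M (\<lambda>T. pd i (z T)) e x * jump \<Omega> M (\<lambda>T. pd i (z T)) e x \<le> 2 * (\<Sum>T\<in>adj M e. (C * n T)\<^sup>2)"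
          using C n adj_elt z1 cl[OF x] by (intro jump_le[OF e]) auto
      qed
      also have "\<dots> \<le> ?h * (2 * (\<Sum>T\<in>adj M e. (C * n T)\<^sup>2))"
        using edge_length_le[OF e] by (intro mult_right_mono) (auto intro: sum_nonneg)
      also have "(\<Sum>T\<in>adj M e. (C * n T)\<^sup>2) = C\<^sup>2 * ?s e"
        by (simp add: power_mult_distrib sum_distrib_left)
      finally show ?thesis by simp
    qed
    then have "(\<Sum>i\<in>UNIV. edge_int e (\<lambda>x. jump \<Omega> M (\<lambda>T. pd i (z T)) e x * jump \<Omega> M (\<lambda>T. pd i (z T)) e x)) \<le> (\<Sum>i\<in>(UNIV :: 2 set). ?h * (2 * C\<^sup>2 * ?s e))"
      by (rule sum_mono)
    also have "\<dots> = ?h * (4 * C\<^sup>2 * ?s e)" by (simp add: sum_2)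
    finally show ?thesis using h by (simp add: divide_le_eq mult.commute)
  qed
  \<comment> \<open>The factor 6 is 2 from the jumps of values plus twice 2 from the two components
    of the gradient.\<close>
  have "sh \<Omega> M z z \<le> (\<Sum>e\<in>snd M. 2 * C\<^sup>2 * ?s e) + (\<Sum>e\<in>int_edges \<Omega> M. 4 * C\<^sup>2 * ?s e)"
    unfolding sh_def using A Bd by (intro add_mono sum_mono) (auto simp: int_edges_def)
  also have "(\<Sum>e\<in>int_edges \<Omega> M. 4 * C\<^sup>2 * ?s e) \<le> (\<Sum>e\<in>snd M. 4 * C\<^sup>2 * ?s e)"
    using fin_edges s0 by (intro sum_mono2) (auto simp: int_edges_def)
  also have "(\<Sum>e\<in>snd M. 2 * C\<^sup>2 * ?s e) + (\<Sum>e\<in>snd M. 4 * C\<^sup>2 * ?s e) = 6 * C\<^sup>2 * (\<Sum>e\<in>snd M. ?s e)"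
    by (simp add: sum_distrib_left[symmetric])
  finally have "sh \<Omega> M z z \<le> 6 * C\<^sup>2 * (\<Sum>e\<in>snd M. ?s e)" by simp
  also have "\<dots> \<le> 6 * C\<^sup>2 * (\<Sum>T\<in>fst M. 2 * disc_area / \<rho>\<^sup>2 * (n T)\<^sup>2)"
    unfolding edge_sum_swap
    by (intro mult_left_mono sum_mono mult_right_mono card_edges_bound[OF sr rho]) auto
  finally show ?thesis by (simp add: sum_distrib_left mult.assoc)
qed

text \<open>The test function is the elementwise lift of \<open>q\<close> for the averaged
  coefficients. The true operator maps it to \<open>q\<close> up to the oscillation of
  \<open>a\<close> and the zero-order term; by \<open>small\<close> this residual has at most half
  the norm of \<open>q\<close> on each element, so half of the squared norm survives.\<close>

lemma inf_sup:
  assumes k2: "k \<ge> 2" and C: "C \<ge> 0"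
    and nondeg: "\<And>T. T \<in> fst M \<Longrightarrow> \<exists>i. \<bar>aavg T $ i $ i\<bar> \<ge> \<eta>"
    and lift: "lift_bound (k - 2) \<eta> B \<rho> C"
    and small: "(4 * \<epsilon> * C + B * C * h\<^sup>2) * sqrt disc_area \<le> 1 / 2"
    and q: "q \<in> Mh M k"
  shows "\<exists>v\<in>Xh M k. (pw_L2_norm M q)\<^sup>2 / 2 \<le> bh M a c v q \<and>
     sh \<Omega> M v v \<le> 6 * C\<^sup>2 * (2 * disc_area / \<rho>\<^sup>2) * (pw_L2_norm M q)\<^sup>2"
proof -
  define n where "n T = L2_norm_on T (q T)" for T
  have n0: "n T \<ge> 0" for T by (simp add: n_def)
  have qs: "smooth2 (q T)" for T by (rule pw_poly_smooth[OF q])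
  define Q where "Q T z \<longleftrightarrow> poly_deg_le k z \<and> cop (aavg T) z = q T \<and> (\<forall>x\<in>cball (ctr T) (diameter T).
      \<bar>z x\<bar> \<le> C * diameter T * n T \<and> (\<forall>i. \<bar>pd i z x\<bar> \<le> C * n T) \<and> (\<forall>i j. \<bar>pd i (pd j z) x\<bar> \<le> C / diameter T * n T))" for T z
  have "\<forall>T\<in>fst M. \<exists>z. Q T z"
  proof
    fix T assume T: "T \<in> fst M"
    let ?t = "diameter T" and ?b = "L2_norm_on (ball (ctr T) (\<rho> * diameter T)) (q T)"
    have t: "?t > 0" by (rule diameter_pos[OF T])
    obtain i where i: "\<bar>aavg T $ i $ i\<bar> \<ge> \<eta>" using nondeg[OF T] by blast
    have ab: "\<forall>i j. \<bar>aavg T $ i $ j\<bar> \<le> B" using aavg_bound[OF T] by blast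
    obtain z where z: "poly_deg_le (k - 2 + 2) z" "cop (aavg T) z = q T"
      "\<And>x. x \<in> cball (ctr T) ?t \<Longrightarrow> \<bar>z x\<bar> \<le> C * ?t * ?b \<and> (\<forall>i. \<bar>pd i z x\<bar> \<le> C * ?b) \<and> (\<forall>i j. \<bar>pd i (pd j z) x\<bar> \<le> C / ?t * ?b)"
      using lift[unfolded lift_bound_def, THEN spec, THEN spec, THEN spec, THEN spec, THEN spec, THEN mp, THEN mp, THEN mp, THEN mp, OF ab i t pw_poly_deg[OF q, of T], of "ctr T"] by metis
    have bn: "?b \<le> n T" unfolding n_def by (rule ball_norm_le[OF T qs])
    have m: "C * ?t * ?b \<le> C * ?t * n T" "C * ?b \<le> C * n T" "C / ?t * ?b \<le> C / ?t * n T"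
      by (rule mult_left_mono[OF bn]; use C t in simp)+
    have "Q T z"
      unfolding Q_def
    proof (intro conjI ballI allI)
      show "poly_deg_le k z" using z(1) le_add_diff_inverse2[OF k2] by metis
      show "cop (aavg T) z = q T" by (rule z(2))
      fix x assume x: "x \<in> cball (ctr T) ?t"
      show "\<bar>z x\<bar> \<le> C * ?t * n T" using z(3)[OF x] m(1) by linarith
      show "\<bar>pd i z x\<bar> \<le> C * n T" for i using z(3)[OF x] m(2) by (meson order_trans)
      show "\<bar>pd i (pd j z) x\<bar> \<le> C / ?t * n T" for i j using z(3)[OF x] m(3) by (meson order_trans)
    qed
    then show "\<exists>z. Q T z" by blast
  qed
  from bchoice[OF this] obtain Z where Z: "\<And>T. T \<in> fst M \<Longrightarrow> Q T (Z T)" by blast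
  define v where "v T = (if T \<in> fst M then Z T else (\<lambda>_. 0))" for T
  have vT: "v T = Z T" if "T \<in> fst M" for T using that by (simp add: v_def)
  have vX: "v \<in> Xh M k" using Z by (auto simp: pw_poly_def v_def Q_def)
  have vs: "smooth2 (v T)" for T by (rule pw_poly_smooth[OF vX])
  have vc: "cop (aavg T) (v T) = q T" if "T \<in> fst M" for T using Z[OF that] by (simp add: vT[OF that] Q_def)
  have vb: "\<bar>v T x\<bar> \<le> C * diameter T * n T" "\<bar>pd i (v T) x\<bar> \<le> C * n T" "\<bar>pd i (pd j (v T)) x\<bar> \<le> C / diameter T * n T"
    if T: "T \<in> fst M" and x: "x \<in> closure T" for T x i j
  proof -
    have "x \<in> cball (ctr T) (diameter T)" using closure_ctr[OF T] x by blast
    then show "\<bar>v T x\<bar> \<le> C * diameter T * n T" "\<bar>pd i (v T) x\<bar> \<le> C * n T" "\<bar>pd i (pd j (v T)) x\<bar> \<le> C / diameter T * n T"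
      using Z[OF T] unfolding vT[OF T] Q_def by blast+
  qed
  have sq: "(pw_L2_norm M q)\<^sup>2 = (\<Sum>T\<in>fst M. (n T)\<^sup>2)" unfolding n_def by (rule pw_L2_norm_sq)
  have "sh \<Omega> M v v \<le> 6 * C\<^sup>2 * (2 * disc_area / \<rho>\<^sup>2) * (pw_L2_norm M q)\<^sup>2"
    unfolding sq using vb n0 by (intro stabilizer_bound[OF vX C]) auto
  moreover have "(pw_L2_norm M q)\<^sup>2 / 2 \<le> bh M a c v q"
  proof -
    have loc: "(n T)\<^sup>2 / 2 \<le> (LINT x:T|lborel. Lop a c (v T) x * q T x)" if T: "T \<in> fst M" for T
    proof -
      let ?t = "diameter T"
      have t: "?t > 0" "?t \<le> h" using diameter_pos[OF T] diam[OF T] by auto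
      have LL: "L2_on T (Lpw v)" by (rule L2_on_subset[OF Lpw_L2[OF vs] borelT[OF T] subT[OF T]])
      have Lq: "L2_on T (q T)" by (rule smooth_L2_elt[OF T qs])
      let ?d = "\<lambda>x. Lpw v x - q T x"
      have Ld: "L2_on T ?d" by (rule L2_on_diff[OF LL Lq])
      \<comment> \<open>Second derivatives of the lift have size \<open>C / ?t\<close> and its
        values size \<open>C * ?t\<close>. After the factor \<open>?t\<close> from the area, the
        oscillation part is small through \<open>\<epsilon>\<close> and the zero-order part through
        \<open>h\<^sup>2\<close>.\<close>
      let ?K = "4 * (\<epsilon> * (C / ?t * n T)) + B * (C * ?t * n T)"
      have K0: "?K \<ge> 0" using eps0 C t n0 B0 by (intro add_nonneg_nonneg mult_nonneg_nonneg divide_nonneg_pos) auto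
      have "L2_norm_on T ?d \<le> ?K * sqrt (measure lborel T)"
      proof (rule L2_norm_le_indicator[OF Ld borelT[OF T] bdT[OF T] K0])
        show "AE x in lborel. x \<in> T \<longrightarrow> \<bar>?d x\<bar> \<le> ?K * indicat_real T x"
          using avg_close
        proof eventually_elim
          case (elim x)
          show ?case
          proof
            assume x: "x \<in> T"
            then have xc: "x \<in> closure T" and xO: "x \<in> \<Omega>" using closure_subset elt_sub[OF T] by auto
            have tm: "\<bar>(a x $ i $ j - aavg T $ i $ j) * pd i (pd j (v T)) x\<bar> \<le> \<epsilon> * (C / ?t * n T)" for i j
              unfolding abs_mult using elim T x vb(3)[OF T xc] eps0 by (intro mult_mono) auto
            have cm: "\<bar>c x * v T x\<bar> \<le> B * (C * ?t * n T)"
              unfolding abs_mult using c_bdd[OF xO] vb(1)[OF T xc] B0 by (intro mult_mono) auto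
            have "q T x = cop (aavg T) (v T) x" using vc[OF T] by simp
            then have "?d x = ((a x $ 1 $ 1 - aavg T $ 1 $ 1) * pd 1 (pd 1 (v T)) x + (a x $ 1 $ 2 - aavg T $ 1 $ 2) * pd 1 (pd 2 (v T)) x)
               + ((a x $ 2 $ 1 - aavg T $ 2 $ 1) * pd 2 (pd 1 (v T)) x + (a x $ 2 $ 2 - aavg T $ 2 $ 2) * pd 2 (pd 2 (v T)) x) + (c x * v T x + 0)"
              by (simp add: Lpw_in[OF T x] Lop_def cop_def sum_2 algebra_simps)
            moreover have "K + K + (K + K) + (l + 0) = 4 * K + l" for K l :: real by simp
            ultimately have "\<bar>?d x\<bar> \<le> ?K" using abs_six_le[OF _ tm tm tm tm cm abs_zero[THEN eq_refl]] by metis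
            then show "\<bar>?d x\<bar> \<le> ?K * indicat_real T x" using x by simp
          qed
        qed
      qed
      also have "\<dots> \<le> ?K * (sqrt disc_area * ?t)"
      proof (rule mult_left_mono[OF _ K0])
        have "sqrt (measure lborel T) \<le> sqrt (disc_area * ?t\<^sup>2)" using measure_elt[OF T] by (rule real_sqrt_le_mono)
        then show "sqrt (measure lborel T) \<le> sqrt disc_area * ?t" using t by (simp add: real_sqrt_mult)
      qed
      also have "\<dots> = ((4 * \<epsilon> * C + B * C * ?t\<^sup>2) * sqrt disc_area) * n T"
        using t by (simp add: power2_eq_square field_simps)
      also have "\<dots> \<le> ((4 * \<epsilon> * C + B * C * h\<^sup>2) * sqrt disc_area) * n T"
        using t B0 C n0[of T] by (intro mult_right_mono add_left_mono mult_left_mono power_mono mult_nonneg_nonneg) auto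
      also have "\<dots> \<le> 1 / 2 * n T" by (rule mult_right_mono[OF small n0])
      finally have dn: "L2_norm_on T ?d \<le> 1 / 2 * n T" .
      have "\<bar>LINT x:T|lborel. ?d x * q T x\<bar> \<le> L2_norm_on T ?d * n T"
        unfolding n_def by (rule L2_Cauchy_Schwarz[OF Ld Lq])
      also have "\<dots> \<le> 1 / 2 * n T * n T" by (rule mult_right_mono[OF dn n0])
      finally have db: "\<bar>LINT x:T|lborel. ?d x * q T x\<bar> \<le> (n T)\<^sup>2 / 2" by (simp add: power2_eq_square)
      have "(LINT x:T|lborel. Lop a c (v T) x * q T x) = (LINT x:T|lborel. q T x * q T x + 1 * (?d x * q T x))"
        using borelT[OF T] by (intro set_lebesgue_integral_cong) (auto simp: Lpw_in[OF T] algebra_simps)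
      also have "\<dots> = (LINT x:T|lborel. q T x * q T x) + 1 * (LINT x:T|lborel. ?d x * q T x)"
        by (rule set_integral_linear[OF L2_on_mult_integrable[OF Lq Lq] L2_on_mult_integrable[OF Ld Lq]])
      also have "(LINT x:T|lborel. q T x * q T x) = (n T)\<^sup>2" by (simp add: n_def L2_norm_sq power2_eq_square[symmetric])
      finally show ?thesis using db by linarith
    qed
    have "(pw_L2_norm M q)\<^sup>2 / 2 = (\<Sum>T\<in>fst M. (n T)\<^sup>2 / 2)" unfolding sq by (rule sum_divide_distrib)
    also have "\<dots> \<le> bh M a c v q" unfolding bh_def pw_inner_def by (rule sum_mono) (rule loc)
    finally show ?thesis .
  qed
  ultimately show ?thesis using vX by blast
qed

end

section \<open>Discrete functions without jumps\<close>

context small_mesh begin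

lemma pwf_norm_sq:
  assumes "\<And>T. T \<in> fst M \<Longrightarrow> continuous_on UNIV (g T)"
  shows "(L2_norm_on \<Omega> (pwf g))\<^sup>2 = (\<Sum>T\<in>fst M. (L2_norm_on T (g T))\<^sup>2)"
proof -
  have "pw_L2_norm M g = L2_norm_on \<Omega> (pwf g)"
    by (rule pw_L2_norm_eq[OF pwf_L2[OF assms]]) (simp_all add: pwf_in)
  then show ?thesis using pw_L2_norm_sq by metis
qed

text \<open>The inverse estimate bounds each partial derivative by \<open>C / diameter T\<close>
  times its norm, and each leg of the path from the centre is no longer than
  \<open>diameter T\<close>. The path may leave \<open>T\<close>, but \<open>p\<close> is a
  polynomial on the plane and the inverse estimate holds on the whole ball.\<close>

lemma deviation_from_ctr:
  assumes T: "T \<in> fst M" and p: "poly_deg_le k p" and C: "C \<ge> 0"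
    and inv: "inverse_bound k \<rho> C"
    and x: "x \<in> T"
  shows "\<bar>p x - p (ctr T)\<bar> \<le> C * (L2_norm_on T (pd 1 p) + L2_norm_on T (pd 2 p))"
proof -
  let ?t = "diameter T" and ?u = "ctr T"
  define K where "K i = C / ?t * L2_norm_on T (pd i p)" for i
  have t: "?t > 0" by (rule diameter_pos[OF T])
  have sp: "smooth2 p" by (rule smooth2_poly[OF p])
  have K0: "K i \<ge> 0" for i unfolding K_def using C t by (intro mult_nonneg_nonneg) auto
  have K: "\<bar>pd i p y\<bar> \<le> K i" if y: "y \<in> cball ?u ?t" for i y
  proof -
    have "poly_deg_le k (pd i p)" by (rule poly_deg_le_mono[OF poly_deg_le_pd[OF p]]) simp
    then have "\<bar>pd i p y\<bar> \<le> C / ?t * L2_norm_on (ball ?u (\<rho> * ?t)) (pd i p)" using inv t y unfolding inverse_bound_def by blast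
    also have "\<dots> \<le> K i" unfolding K_def
      using ball_norm_le[OF T smooth2_pd[OF sp]] C t by (intro mult_left_mono) auto
    finally show ?thesis .
  qed
  have xt: "norm (x - ?u) \<le> ?t"
    using subsetD[OF closure_ctr[OF T] subsetD[OF closure_subset x]] by (simp add: dist_norm norm_minus_commute)
  have comp: "\<bar>(x - ?u) $ i\<bar> \<le> ?t" for i using component_le_norm_cart[of "x - ?u" i] xt by linarith
  \<comment> \<open>Points no farther from the centre than \<open>x\<close> in either coordinate
    stay in the ball; this covers both legs.\<close>
  have inb: "y \<in> cball ?u ?t" if "\<And>i. \<bar>(y - ?u) $ i\<bar> \<le> \<bar>(x - ?u) $ i\<bar>" for y
  proof -
    have "norm (y - ?u) \<le> norm (x - ?u)" using that by (intro norm_le_componentwise_cart) simp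
    then show ?thesis using xt by (simp add: dist_norm norm_minus_commute)
  qed
  define z where "z = ?u + (x - ?u) $ 1 *\<^sub>R axis 1 1"
  have "\<bar>p z - p ?u\<bar> \<le> K 1 * \<bar>(x - ?u) $ 1\<bar>"
    unfolding z_def
  proof (rule axis_mvt[OF sp])
    fix s assume "\<bar>s\<bar> \<le> \<bar>(x - ?u) $ 1\<bar>"
    then show "\<bar>pd 1 p (?u + s *\<^sub>R axis 1 1)\<bar> \<le> K 1"
      by (intro K inb) (auto simp: axis_def)
  qed
  also have "\<dots> \<le> K 1 * ?t" using comp K0 by (intro mult_left_mono) auto
  finally have 1: "\<bar>p z - p ?u\<bar> \<le> K 1 * ?t" .
  have xz: "x = z + (x - ?u) $ 2 *\<^sub>R axis 2 1"
    unfolding z_def vec_eq_iff forall_2 by (simp add: axis_def)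
  have "\<bar>p (z + (x - ?u) $ 2 *\<^sub>R axis 2 1) - p z\<bar> \<le> K 2 * \<bar>(x - ?u) $ 2\<bar>"
  proof (rule axis_mvt[OF sp])
    fix s assume s: "\<bar>s\<bar> \<le> \<bar>(x - ?u) $ 2\<bar>"
    show "\<bar>pd 2 p (z + s *\<^sub>R axis 2 1)\<bar> \<le> K 2"
    proof (intro K inb)
      fix i :: 2
      show "\<bar>(z + s *\<^sub>R axis 2 1 - ?u) $ i\<bar> \<le> \<bar>(x - ?u) $ i\<bar>"
        using exhaust_2[of i] s by (auto simp: z_def axis_def)
    qed
  qed
  also have "\<dots> \<le> K 2 * ?t" using comp K0 by (intro mult_left_mono) auto
  finally have 2: "\<bar>p x - p z\<bar> \<le> K 2 * ?t" unfolding xz[symmetric] .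
  have "K i * ?t = C * L2_norm_on T (pd i p)" for i using t by (simp add: K_def)
  then show ?thesis using 1 2 by (simp add: distrib_left)
qed

text \<open>A Poincare-type inequality with the value at the centre in place of the mean. Passing
  from the uniform bound to the norm costs the square root of the area of the element, which
  supplies the factor \<open>h\<close>.\<close>

lemma deviation_norm_le:
  assumes v: "v \<in> pw_poly M k" and C: "C \<ge> 0"
    and inv: "inverse_bound k \<rho> C"
    and N: "\<And>i. L2_norm_on \<Omega> (pwf (\<lambda>T. pd i (v T))) \<le> N" "N \<ge> 0"
  shows "L2_norm_on \<Omega> (pwf (\<lambda>T x. v T x - v T (ctr T))) \<le> 2 * C * sqrt disc_area * h * N"
proof (rule power2_le_imp_le)
  have vs: "smooth2 (v T)" for T by (rule pw_poly_smooth[OF v])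
  have c1: "continuous_on UNIV (pd i (v T))" for i T by (rule smooth2_cont[OF smooth2_pd[OF vs]])
  have cW: "continuous_on UNIV (\<lambda>x. v T x - v T (ctr T))" for T
    by (intro continuous_intros smooth2_cont[OF vs])
  let ?W = "\<lambda>T x. v T x - v T (ctr T)" and ?n = "\<lambda>i T. L2_norm_on T (pd i (v T))"
  let ?D = "2 * C\<^sup>2 * disc_area * h\<^sup>2"
  have loc: "(L2_norm_on T (?W T))\<^sup>2 \<le> ?D * ((?n 1 T)\<^sup>2 + (?n 2 T)\<^sup>2)" if T: "T \<in> fst M" for T
  proof -
    let ?s = "C * (?n 1 T + ?n 2 T)"
    have s0: "?s \<ge> 0" using C by simp
    have "L2_norm_on T (?W T) \<le> ?s * sqrt (measure lborel T)"
      using deviation_from_ctr[OF T pw_poly_deg[OF v] C inv]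
      by (intro L2_norm_le_sup[OF borelT[OF T] bdT[OF T]] s0 continuous_set_borel_measurable[OF borelT[OF T] cW]) auto
    then have "(L2_norm_on T (?W T))\<^sup>2 \<le> (?s * sqrt (measure lborel T))\<^sup>2" by (rule power_mono) simp
    also have "\<dots> = ?s\<^sup>2 * measure lborel T" by (simp add: power_mult_distrib)
    also have "\<dots> \<le> ?s\<^sup>2 * (disc_area * h\<^sup>2)"
    proof (rule mult_left_mono)
      have "disc_area * (diameter T)\<^sup>2 \<le> disc_area * h\<^sup>2"
        using diam[OF T] diameter_pos[OF T] by (intro mult_left_mono power_mono) auto
      then show "measure lborel T \<le> disc_area * h\<^sup>2" using measure_elt[OF T] by linarith
    qed simp
    also have "\<dots> \<le> 2 * C\<^sup>2 * ((?n 1 T)\<^sup>2 + (?n 2 T)\<^sup>2) * (disc_area * h\<^sup>2)"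
    proof (rule mult_right_mono)
      have "(?n 1 T + ?n 2 T)\<^sup>2 \<le> 2 * ((?n 1 T)\<^sup>2 + (?n 2 T)\<^sup>2)"
        using zero_le_power2[of "?n 1 T - ?n 2 T"] by (simp add: power2_eq_square algebra_simps)
      then have "C\<^sup>2 * (?n 1 T + ?n 2 T)\<^sup>2 \<le> C\<^sup>2 * (2 * ((?n 1 T)\<^sup>2 + (?n 2 T)\<^sup>2))" by (rule mult_left_mono) simp
      then show "?s\<^sup>2 \<le> 2 * C\<^sup>2 * ((?n 1 T)\<^sup>2 + (?n 2 T)\<^sup>2)" by (simp only: power_mult_distrib mult_ac)
    qed simp
    finally show ?thesis by (simp only: mult_ac)
  qed
  have "(L2_norm_on \<Omega> (pwf ?W))\<^sup>2 = (\<Sum>T\<in>fst M. (L2_norm_on T (?W T))\<^sup>2)" by (rule pwf_norm_sq[OF cW])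
  also have "\<dots> \<le> (\<Sum>T\<in>fst M. ?D * ((?n 1 T)\<^sup>2 + (?n 2 T)\<^sup>2))" by (rule sum_mono) (rule loc)
  also have "\<dots> = ?D * ((\<Sum>T\<in>fst M. (?n 1 T)\<^sup>2) + (\<Sum>T\<in>fst M. (?n 2 T)\<^sup>2))"
    by (simp only: sum_distrib_left[symmetric] sum.distrib)
  also have "\<dots> = ?D * ((L2_norm_on \<Omega> (pwf (\<lambda>T. pd 1 (v T))))\<^sup>2 + (L2_norm_on \<Omega> (pwf (\<lambda>T. pd 2 (v T))))\<^sup>2)"
    by (simp only: pwf_norm_sq[OF c1])
  also have "\<dots> \<le> ?D * (N\<^sup>2 + N\<^sup>2)"
    using N by (intro mult_left_mono add_mono power_mono) auto
  also have "\<dots> = (2 * C * sqrt disc_area * h * N)\<^sup>2" by (simp add: power_mult_distrib)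
  finally show "(L2_norm_on \<Omega> (pwf ?W))\<^sup>2 \<le> (2 * C * sqrt disc_area * h * N)\<^sup>2" .
  show "0 \<le> 2 * C * sqrt disc_area * h * N" using C N h_pos by simp
qed

text \<open>Without jumps, \<open>v\<close> obeys the regularity estimate, so its values and
  derivatives are bounded by \<open>C0 * G\<close>, where \<open>G\<close> is the norm of
  \<open>Lpw v\<close>. Some \<open>q\<close> in \<open>Mh M k\<close> approximates
  \<open>Lpw v\<close> up to a fraction of \<open>G\<close> below 1, and orthogonality to
  \<open>q\<close> forces \<open>G = 0\<close>, hence \<open>v = 0\<close>.\<close>

lemma kernel_trivial:
  assumes C: "C \<ge> 0"
    and inv: "inverse_bound k \<rho> C"
    and small: "5 * \<epsilon> * C0 + 2 * B * C * sqrt disc_area * h * C0 < 1"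
    and v: "v \<in> Xh M k" and s0: "sh \<Omega> M v v = 0" and b0: "\<And>q. q \<in> Mh M k \<Longrightarrow> bh M a c v q = 0"
  shows "v = (\<lambda>T x. 0)"
proof -
  have vs: "smooth2 (v T)" for T by (rule pw_poly_smooth[OF v])
  have c0: "continuous_on UNIV (v T)" for T by (rule smooth2_cont[OF vs])
  have c2: "continuous_on UNIV (pd i (pd j (v T)))" for i j T
    by (rule smooth2_cont[OF smooth2_pd[OF smooth2_pd[OF vs]]])
  define G where "G = L2_norm_on \<Omega> (Lpw v)"
  have G0: "G \<ge> 0" by (simp add: G_def)
  note j0 = sh_zero_jumps(1)[OF v s0] and j1 = sh_zero_jumps(2)[OF v s0]
  note gv = glue_values[where v = v, OF j0]
  have gg: "pd i (v T) x = pd i (v T') x" if "T \<in> fst M" "T' \<in> fst M" "x \<in> closure T" "x \<in> closure T'" "x \<in> \<Omega>" for T T' x i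
    using glue_gradients[where w = "\<lambda>T. pd i (v T)", OF j1 that] .
  note rb = regularity_bound[where a = a and c = c and v = v and C = C0 and B = B, OF reg vs gv gg a_meas a_bdd c_meas c_bdd]
  have n0: "L2_norm_on \<Omega> (pwf v) \<le> C0 * G" unfolding G_def Lpw_def[abs_def] by (rule rb(2))
  have n1: "L2_norm_on \<Omega> (pwf (\<lambda>T. pd i (v T))) \<le> C0 * G" for i unfolding G_def Lpw_def[abs_def] by (rule rb(3))
  have n2: "L2_norm_on \<Omega> (pwf (\<lambda>T. pd i (pd j (v T)))) \<le> C0 * G" for i j unfolding G_def Lpw_def[abs_def] by (rule rb(4))
  let ?W = "\<lambda>T x. v T x - v T (ctr T)"
  have cW: "continuous_on UNIV (?W T)" for T by (intro continuous_intros c0)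
  have nW: "L2_norm_on \<Omega> (pwf ?W) \<le> 2 * C * sqrt disc_area * h * (C0 * G)"
    using C00 G0 by (intro deviation_norm_le[OF v C inv n1]) simp
  \<comment> \<open>The averaged principal part already has degree \<open>k - 2\<close>, whereas
    \<open>cavg T * v T\<close> may have degree \<open>k\<close>; freezing \<open>v\<close> at the
    centre turns it into a constant.\<close>
  define q where "q T = (if T \<in> fst M then \<lambda>x. cop (aavg T) (v T) x + cavg T * v T (ctr T) else (\<lambda>_. 0))" for T
  have "poly_deg_le (k - 2) (q T)" for T
  proof -
    have "poly_deg_le (k - 2) (pd i (pd j (v T)))" for i j :: 2
      using poly_deg_le_pd[OF poly_deg_le_pd[OF pw_poly_deg[OF v]]] by (simp add: numeral_2_eq_2)
    then have "poly_deg_le (k - 2) (cop (aavg T) (v T))"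
      unfolding cop_def[abs_def] by (intro poly_deg_le_sum poly_deg_le_cmult) assumption
    then show ?thesis by (auto simp: q_def)
  qed
  then have qM: "q \<in> Mh M k" by (simp add: pw_poly_def) (simp add: q_def)
  have LL: "L2_on \<Omega> (Lpw v)" by (rule Lpw_poly_L2[OF v])
  have Lq: "L2_on \<Omega> (pwf q)" by (rule pwf_poly_L2[OF qM])
  let ?d = "\<lambda>x. Lpw v x - pwf q x"
  have Ld: "L2_on \<Omega> ?d" by (rule L2_on_diff[OF LL Lq])
  \<comment> \<open>Pointwise majorants of the error: the oscillation of \<open>a\<close>, the
    oscillation of \<open>c\<close>, and, with weight \<open>B\<close>, the freezing of
    \<open>v\<close> at the centre.\<close>
  let ?D = "\<lambda>i j x. \<epsilon> * \<bar>pwf (\<lambda>T. pd i (pd j (v T))) x\<bar>"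
  let ?R2 = "\<lambda>x. \<Sum>i\<in>UNIV. \<Sum>j\<in>UNIV. ?D i j x" and ?R0 = "\<lambda>x. \<epsilon> * \<bar>pwf v x\<bar>" and ?RW = "\<lambda>x. B * \<bar>pwf ?W x\<bar>"
  have LD: "L2_on \<Omega> (?D i j)" for i j by (intro L2_on_cmult L2_on_abs pwf_L2 c2)
  have LR2: "L2_on \<Omega> ?R2" by (intro L2_on_sum LD)
  have LR0: "L2_on \<Omega> ?R0" by (intro L2_on_cmult L2_on_abs pwf_L2 c0)
  have LRW: "L2_on \<Omega> ?RW" by (intro L2_on_cmult L2_on_abs pwf_L2 cW)
  have "L2_norm_on \<Omega> ?d \<le> L2_norm_on \<Omega> (\<lambda>x. ?R2 x + (?R0 x + ?RW x))"
  proof (rule L2_norm_le_AE[OF Ld L2_on_add[OF LR2 L2_on_add[OF LR0 LRW]]])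
    show "AE x in lborel. x \<in> \<Omega> \<longrightarrow> \<bar>?d x\<bar> \<le> ?R2 x + (?R0 x + ?RW x)"
      using avg_close AE_cells_in
    proof eventually_elim
      case (elim x)
      show ?case
      proof
        assume "x \<in> \<Omega>"
        then obtain T where T: "T \<in> fst M" "x \<in> T" using elim(2) by blast
        have A: "\<bar>a x $ i $ j - aavg T $ i $ j\<bar> \<le> \<epsilon>" "\<bar>c x - cavg T\<bar> \<le> \<epsilon>" for i j using elim(1) T by blast+
        have 1: "\<bar>(a x $ i $ j - aavg T $ i $ j) * pd i (pd j (v T)) x\<bar> \<le> ?D i j x" for i j
          unfolding abs_mult pwf_in[OF T] by (rule mult_right_mono[OF A(1)]) simp
        have 2: "\<bar>(c x - cavg T) * v T x\<bar> \<le> ?R0 x"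
          unfolding abs_mult pwf_in[OF T] by (rule mult_right_mono[OF A(2)]) simp
        have 3: "\<bar>cavg T * ?W T x\<bar> \<le> ?RW x"
          unfolding abs_mult pwf_in[OF T] by (rule mult_right_mono[OF cavg_bound[OF T(1)]]) simp
        have d: "?d x = (a x $ 1 $ 1 - aavg T $ 1 $ 1) * pd 1 (pd 1 (v T)) x + (a x $ 1 $ 2 - aavg T $ 1 $ 2) * pd 1 (pd 2 (v T)) x
           + ((a x $ 2 $ 1 - aavg T $ 2 $ 1) * pd 2 (pd 1 (v T)) x + (a x $ 2 $ 2 - aavg T $ 2 $ 2) * pd 2 (pd 2 (v T)) x)
           + ((c x - cavg T) * v T x + cavg T * ?W T x)"
          unfolding Lpw_in[OF T] pwf_in[OF T] q_def if_P[OF T(1)] Lop_def cop_def sum_2 by algebra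
        have "\<bar>?d x\<bar> \<le> ?D 1 1 x + ?D 1 2 x + (?D 2 1 x + ?D 2 2 x) + (?R0 x + ?RW x)"
          by (rule abs_six_le[OF d 1[of 1 1] 1[of 1 2] 1[of 2 1] 1[of 2 2] 2 3])
        then show "\<bar>?d x\<bar> \<le> ?R2 x + (?R0 x + ?RW x)" unfolding sum_2 .
      qed
    qed
  qed
  also have "\<dots> \<le> L2_norm_on \<Omega> ?R2 + L2_norm_on \<Omega> (\<lambda>x. ?R0 x + ?RW x)"
    by (rule L2_norm_triangle[OF LR2 L2_on_add[OF LR0 LRW]])
  also have "\<dots> \<le> 4 * (\<epsilon> * (C0 * G)) + (\<epsilon> * (C0 * G) + B * (2 * C * sqrt disc_area * h * (C0 * G)))"
  proof (rule add_mono)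
    have "L2_norm_on \<Omega> ?R2 \<le> (\<Sum>i\<in>(UNIV :: 2 set). L2_norm_on \<Omega> (\<lambda>x. \<Sum>j\<in>UNIV. ?D i j x))"
      by (intro L2_norm_sum_le L2_on_sum LD) simp
    also have "\<dots> \<le> (\<Sum>i\<in>(UNIV :: 2 set). \<Sum>j\<in>(UNIV :: 2 set). L2_norm_on \<Omega> (?D i j))"
      by (intro sum_mono L2_norm_sum_le LD) simp
    also have "\<dots> \<le> (\<Sum>i\<in>(UNIV :: 2 set). \<Sum>j\<in>(UNIV :: 2 set). \<epsilon> * (C0 * G))"
      unfolding L2_norm_cmult L2_norm_abs using n2 eps0 by (intro sum_mono mult_mono) auto
    finally show "L2_norm_on \<Omega> ?R2 \<le> 4 * (\<epsilon> * (C0 * G))" by simp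
    have "L2_norm_on \<Omega> (\<lambda>x. ?R0 x + ?RW x) \<le> L2_norm_on \<Omega> ?R0 + L2_norm_on \<Omega> ?RW"
      by (rule L2_norm_triangle[OF LR0 LRW])
    also have "\<dots> \<le> \<epsilon> * (C0 * G) + B * (2 * C * sqrt disc_area * h * (C0 * G))"
      unfolding L2_norm_cmult L2_norm_abs using n0 nW eps0 B0 by (intro add_mono mult_mono) auto
    finally show "L2_norm_on \<Omega> (\<lambda>x. ?R0 x + ?RW x) \<le> \<epsilon> * (C0 * G) + B * (2 * C * sqrt disc_area * h * (C0 * G))" .
  qed
  also have "\<dots> = (5 * \<epsilon> * C0 + 2 * B * C * sqrt disc_area * h * C0) * G" by (simp add: algebra_simps)
  finally have dG: "L2_norm_on \<Omega> ?d \<le> (5 * \<epsilon> * C0 + 2 * B * C * sqrt disc_area * h * C0) * G" .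
  \<comment> \<open>Since \<open>bh M a c v q = 0\<close>, only the error \<open>?d\<close>
    contributes to the squared norm.\<close>
  have "G * G = (LINT x:\<Omega>|lborel. Lpw v x * Lpw v x)"
    using L2_norm_sq[of \<Omega> "Lpw v"] by (simp add: G_def power2_eq_square)
  also have "\<dots> = (LINT x:\<Omega>|lborel. Lpw v x * pwf q x + 1 * (Lpw v x * ?d x))"
    by (simp add: algebra_simps)
  also have "\<dots> = (LINT x:\<Omega>|lborel. Lpw v x * pwf q x) + 1 * (LINT x:\<Omega>|lborel. Lpw v x * ?d x)"
    by (rule set_integral_linear[OF L2_on_mult_integrable[OF LL Lq] L2_on_mult_integrable[OF LL Ld]])
  also have "(LINT x:\<Omega>|lborel. Lpw v x * pwf q x) = 0" using b0[OF qM] bh_eq[OF v qM] by simp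
  finally have "G * G \<le> G * L2_norm_on \<Omega> ?d" using L2_Cauchy_Schwarz[OF LL Ld] by (simp add: G_def)
  also have "\<dots> \<le> G * ((5 * \<epsilon> * C0 + 2 * B * C * sqrt disc_area * h * C0) * G)" by (rule mult_left_mono[OF dG G0])
  finally have "(1 - (5 * \<epsilon> * C0 + 2 * B * C * sqrt disc_area * h * C0)) * (G * G) \<le> 0" by (simp add: algebra_simps)
  then have "G * G \<le> 0" using small by (simp add: mult_le_0_iff)
  then have "G = 0" using G0 by (auto simp: mult_le_0_iff)
  then have "L2_norm_on \<Omega> (pwf v) = 0" using n0 by (simp add: order_antisym)
  then show ?thesis using pw_L2_norm_poly[OF v] pw_poly_zero_iff[OF v] by simp
qed

end

section \<open>Choice of the constants\<close>

lemma exists_small_factor: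
  fixes K \<delta> :: real
  assumes "K \<ge> 0" "\<delta> > 0"
  shows "\<exists>e>0. e \<le> \<delta> \<and> K * e \<le> 1 / 4"
proof (intro exI conjI)
  let ?e = "min \<delta> (1 / (4 * (K + 1)))"
  show "?e > 0" "?e \<le> \<delta>" using assms by auto
  have "K * ?e \<le> K * (1 / (4 * (K + 1)))" using assms by (intro mult_left_mono) auto
  also have "\<dots> \<le> 1 / 4" using assms by (simp add: field_simps)
  finally show "K * ?e \<le> 1 / 4" .
qed

theorem theorem3p6:
  fixes \<Omega> :: "pt set" and a :: "pt \<Rightarrow> real^2^2" and c :: "pt \<Rightarrow> real"
    and k :: nat and \<rho> :: real and \<M> :: "mesh set"
  assumes dom: "lipschitz_domain \<Omega>"
    and a_meas: "\<forall>i j. set_borel_measurable lborel \<Omega> (\<lambda>x. a x $ i $ j)"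
    and a_sym: "\<forall>x\<in>\<Omega>. \<forall>i j. a x $ i $ j = a x $ j $ i"
    and a_pd: "\<forall>x\<in>\<Omega>. \<forall>\<xi>::real^2. \<xi> \<noteq> 0 \<longrightarrow> \<xi> \<bullet> (a x *v \<xi>) > 0"
    and a_bdd: "\<exists>B. \<forall>x\<in>\<Omega>. \<forall>i j. \<bar>a x $ i $ j\<bar> \<le> B"
    and c_meas: "set_borel_measurable lborel \<Omega> c"
    and c_nonpos: "\<forall>x\<in>\<Omega>. c x \<le> 0"
    and c_bdd: "\<exists>B. \<forall>x\<in>\<Omega>. \<bar>c x\<bar> \<le> B"
    and k: "k \<ge> 2"
    and meshes: "\<forall>M\<in>\<M>. poly_mesh \<Omega> M"
    and rho: "\<rho> > 0" and shape: "\<forall>M\<in>\<M>. shape_regular \<rho> M"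
    and reg: "H2_regularity \<Omega> a c"
    and a_cont: "\<forall>i j. unif_pw_continuous \<Omega> \<M> (\<lambda>x. a x $ i $ j)"
    and c_cont: "unif_pw_continuous \<Omega> \<M> c"
  shows "\<exists>h0>0. \<exists>C. \<forall>M\<in>\<M>. meshsize M < h0 \<longrightarrow>
           (\<forall>f. L2_on \<Omega> f \<longrightarrow>
              (\<exists>!(uh, lh). pd_dg_solution \<Omega> M k a c f uh lh) \<and>
              (\<forall>uh lh. pd_dg_solution \<Omega> M k a c f uh lh \<longrightarrow>
                 star_norm \<Omega> M k a c uh + pw_L2_norm M lh \<le> C * L2_norm_on \<Omega> f))"
proof -
  obtain Ba Bc where "\<forall>x\<in>\<Omega>. \<forall>i j. \<bar>a x $ i $ j\<bar> \<le> Ba" "\<forall>x\<in>\<Omega>. \<bar>c x\<bar> \<le> Bc"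
    using a_bdd c_bdd by blast
  then obtain B where B: "B \<ge> 0" "\<And>x i j. x \<in> \<Omega> \<Longrightarrow> \<bar>a x $ i $ j\<bar> \<le> B" "\<And>x. x \<in> \<Omega> \<Longrightarrow> \<bar>c x\<bar> \<le> B"
    by (intro that[of "max 0 (max Ba Bc)"]) (auto simp: le_max_iff_disj)
  obtain Cr where Cr: "\<And>g. L2_on \<Omega> g \<Longrightarrow>
      (\<exists>u D1 D2. strong_sol \<Omega> a c g u D1 D2 \<and> H2_norm \<Omega> u D1 D2 \<le> Cr * L2_norm_on \<Omega> g) \<and>
      (\<forall>u D1 D2 v E1 E2. strong_sol \<Omega> a c g u D1 D2 \<longrightarrow> strong_sol \<Omega> a c g v E1 E2 \<longrightarrow>
          (AE x in lborel. x \<in> \<Omega> \<longrightarrow> u x = v x))"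
    using reg unfolding H2_regularity_def by blast
  \<comment> \<open>The sign of the constant in \<open>H2_regularity\<close> is unspecified, while
    the estimates multiply inequalities by it.\<close>
  define C0 where "C0 = max 0 Cr"
  have C00: "C0 \<ge> 0" by (simp add: C0_def)
  have Cr_le: "Cr * L2_norm_on \<Omega> g \<le> C0 * L2_norm_on \<Omega> g" for g
    by (intro mult_right_mono) (auto simp: C0_def)
  have C0: "(\<exists>u D1 D2. strong_sol \<Omega> a c g u D1 D2 \<and> H2_norm \<Omega> u D1 D2 \<le> C0 * L2_norm_on \<Omega> g) \<and>
      (\<forall>u D1 D2 v E1 E2. strong_sol \<Omega> a c g u D1 D2 \<longrightarrow> strong_sol \<Omega> a c g v E1 E2 \<longrightarrow>
          (AE x in lborel. x \<in> \<Omega> \<longrightarrow> u x = v x))" if "L2_on \<Omega> g" for g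
    using Cr[OF that] order_trans[OF _ Cr_le] by meson
  obtain \<phi> S where \<phi>: "smooth2 \<phi>" "\<And>x. norm x \<ge> \<rho> \<Longrightarrow> \<phi> x = 0" "S > 0" "\<And>x. \<bar>\<phi> x\<bar> \<le> S"
    "\<And>i j x. \<bar>pd i (pd j \<phi>) x\<bar> \<le> S" "L2_norm_on (ball 0 \<rho>) (pd 1 (pd 1 \<phi>)) > 0"
    using bump_second_derivative[OF rho] by blast
  \<comment> \<open>\<open>Q\<close> is the factor in the nondegeneracy estimate. Dividing by
    \<open>Q + 1\<close> keeps \<open>\<tau>\<close> defined for \<open>Q = 0\<close> and makes the
    later contradiction strict.\<close>
  define Q where "Q = C0 * sqrt disc_area * S"
  define \<tau> where "\<tau> = L2_norm_on (ball 0 \<rho>) (pd 1 (pd 1 \<phi>)) / (Q + 1)"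
  have Q: "Q \<ge> 0" unfolding Q_def using C00 \<phi>(3) by simp
  have \<tau>: "\<tau> > 0" unfolding \<tau>_def using Q \<phi>(6) by simp
  have N\<tau>: "L2_norm_on (ball 0 \<rho>) (pd 1 (pd 1 \<phi>)) = (Q + 1) * \<tau>" unfolding \<tau>_def using Q by simp
  \<comment> \<open>The threshold \<open>\<tau> / 16\<close> leaves room:
    \<open>4 * (\<tau> / 16 + \<epsilon>)\<close> will be at most \<open>\<tau> / 2\<close> and
    \<open>B * h\<^sup>2\<close> at most \<open>\<tau> / 4\<close>, in sum less than
    \<open>\<tau>\<close>.\<close>
  obtain C where C: "C \<ge> 0" and lift: "lift_bound (k - 2) (\<tau> / 16) B \<rho> C"
    using local_lift[OF divide_pos_pos[OF \<tau>, of 16] B(1) rho, of "k - 2"] by auto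
  obtain Ci where Ci: "Ci \<ge> 0" and inv: "inverse_bound k \<rho> Ci"
    using inverse_estimate[OF rho] by auto
  let ?s = "sqrt disc_area"
  \<comment> \<open>\<open>K1\<close> and \<open>K2\<close> collect the factors of
    \<open>\<epsilon>\<close> and of \<open>h\<close> in all smallness conditions: inf-sup,
    triviality of the kernel and, through \<open>B / \<tau>\<close>, nondegeneracy. One
    \<open>\<epsilon>\<close> and one \<open>h\<close> then satisfy them together.\<close>
  define K1 where "K1 = 4 * C * ?s + 5 * C0"
  have K1: "K1 \<ge> 0" unfolding K1_def using C C00 by simp
  obtain \<epsilon> where \<epsilon>: "\<epsilon> > 0" "\<epsilon> \<le> \<tau> / 16" "K1 * \<epsilon> \<le> 1 / 4"
    using exists_small_factor[OF K1, of "\<tau> / 16"] \<tau> by auto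
  define K2 where "K2 = B / \<tau> + B * C * ?s + 2 * B * Ci * ?s * C0"
  have K2p: "B / \<tau> \<ge> 0" "B * C * ?s \<ge> 0" "2 * B * Ci * ?s * C0 \<ge> 0" using B(1) \<tau> C Ci C00 by simp_all
  then have K2: "K2 \<ge> 0" unfolding K2_def by simp
  obtain h where h: "h > 0" "h \<le> 1" "K2 * h \<le> 1 / 4" using exists_small_factor[OF K2, of 1] by auto
  have h2: "h\<^sup>2 \<le> h" using h by (simp add: power2_eq_square mult_left_le)
  have "4 * C * ?s * \<epsilon> \<ge> 0" "5 * C0 * \<epsilon> \<ge> 0" using C C00 \<epsilon>(1) by simp_all
  then have e1: "4 * C * ?s * \<epsilon> \<le> 1 / 4" "5 * C0 * \<epsilon> \<le> 1 / 4"
    using \<epsilon>(3) unfolding K1_def distrib_right by linarith+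
  have "B / \<tau> * h \<ge> 0" "B * C * ?s * h \<ge> 0" "2 * B * Ci * ?s * C0 * h \<ge> 0"
    using K2p h(1) by (simp_all only: mult_nonneg_nonneg less_imp_le)
  then have e2: "B / \<tau> * h \<le> 1 / 4" "B * C * ?s * h \<le> 1 / 4" "2 * B * Ci * ?s * C0 * h \<le> 1 / 4"
    using h(3) unfolding K2_def distrib_right by linarith+
  have Bh: "B * h\<^sup>2 \<le> \<tau> / 4"
  proof -
    have "B * h\<^sup>2 \<le> B * h" by (rule mult_left_mono[OF h2 B(1)])
    also have "\<dots> \<le> \<tau> / 4" using e2(1) \<tau> by (simp add: field_simps)
    finally show ?thesis .
  qed
  have BCh: "B * C * ?s * h\<^sup>2 \<le> 1 / 4" using mult_left_mono[OF h2 K2p(2)] e2(2) by linarith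
  have small: "(4 * \<epsilon> * C + B * C * h\<^sup>2) * ?s \<le> 1 / 2"
    using e1(1) BCh by (simp add: algebra_simps)
  have contr: "5 * \<epsilon> * C0 + 2 * B * Ci * ?s * h * C0 < 1"
    using e1(2) e2(3) by (simp add: algebra_simps)
  have "\<forall>i j. \<exists>H>0. \<forall>M\<in>\<M>. meshsize M \<le> H \<longrightarrow>
      (AE x in lborel. x \<in> \<Omega> \<longrightarrow> \<bar>a x $ i $ j - pw_avg M (\<lambda>x. a x $ i $ j) x\<bar> \<le> \<epsilon>)"
    using a_cont \<epsilon>(1) unfolding unif_pw_continuous_def by blast
  then obtain H where H: "\<And>i j. H i j > 0" "\<And>i j M. M \<in> \<M> \<Longrightarrow> meshsize M \<le> H i j \<Longrightarrow>
      (AE x in lborel. x \<in> \<Omega> \<longrightarrow> \<bar>a x $ i $ j - pw_avg M (\<lambda>x. a x $ i $ j) x\<bar> \<le> \<epsilon>)"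
    unfolding choice_iff by blast
  obtain Hc where Hc: "Hc > 0" "\<And>M. M \<in> \<M> \<Longrightarrow> meshsize M \<le> Hc \<Longrightarrow>
      (AE x in lborel. x \<in> \<Omega> \<longrightarrow> \<bar>c x - pw_avg M c x\<bar> \<le> \<epsilon>)"
    using c_cont \<epsilon>(1) unfolding unif_pw_continuous_def by blast
  define Ha where "Ha = Min (range (\<lambda>(i, j). H i j))"
  have Ha: "Ha > 0" "Ha \<le> H i j" for i j
    unfolding Ha_def using H(1) Min_le[OF finite_imageI[OF finite] rangeI, of "\<lambda>(i, j). H i j" "(i, j)"] by auto
  define Cs where "Cs = 6 * C\<^sup>2 * (2 * disc_area / \<rho>\<^sup>2)"
  show ?thesis
  proof (rule exI[of _ "min h (min Ha Hc)"], rule conjI)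
    show "0 < min h (min Ha Hc)" using h(1) Ha(1) Hc(1) by simp
    have wp: "\<forall>f. L2_on \<Omega> f \<longrightarrow> (\<exists>!(uh, lh). pd_dg_solution \<Omega> M k a c f uh lh) \<and>
              (\<forall>uh lh. pd_dg_solution \<Omega> M k a c f uh lh \<longrightarrow>
                 star_norm \<Omega> M k a c uh + pw_L2_norm M lh \<le> (1 + 8 * Cs) * L2_norm_on \<Omega> f)"
      if M: "M \<in> \<M>" and ms: "meshsize M < min h (min Ha Hc)" for M
    proof -
      interpret mesh \<Omega> M
        by unfold_locales (use dom meshes M in auto)
      have diam: "diameter T \<le> h" if "T \<in> fst M" for T
      proof -
        have "diameter T \<le> meshsize M" unfolding meshsize_def using fin_elts that by (intro Max_ge) auto
        then show ?thesis using ms by simp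
      qed
      have le: "meshsize M \<le> H i j" "meshsize M \<le> Hc" for i j using ms Ha(2)[of i j] by auto
      interpret small_mesh \<Omega> M a c B k \<rho> \<epsilon> h C0
      proof unfold_locales
        show "AE x in lborel. x \<in> \<Omega> \<longrightarrow> \<bar>a x $ i $ j - pw_avg M (\<lambda>x. a x $ i $ j) x\<bar> \<le> \<epsilon>" for i j
          by (rule H(2)[OF M le(1)])
        show "AE x in lborel. x \<in> \<Omega> \<longrightarrow> \<bar>c x - pw_avg M c x\<bar> \<le> \<epsilon>" by (rule Hc(2)[OF M le(2)])
      qed (use a_meas c_meas B shape M rho \<epsilon>(1) C00 diam C0 in auto)
      have nondeg: "\<exists>i. \<bar>aavg T $ i $ i\<bar> \<ge> \<tau> / 16" if T: "T \<in> fst M" for T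
      proof (rule ccontr)
        assume "\<not> ?thesis"
        then have d: "\<And>i. \<bar>aavg T $ i $ i\<bar> < \<tau> / 16" by (auto simp: not_le)
        have sym: "\<And>x i j. x \<in> \<Omega> \<Longrightarrow> a x $ i $ j = a x $ j $ i"
          and pdf: "\<And>x \<xi>. x \<in> \<Omega> \<Longrightarrow> \<xi> \<noteq> 0 \<Longrightarrow> \<xi> \<bullet> (a x *v \<xi>) > 0"
          using a_sym a_pd by blast+
        \<comment> \<open>If both averaged diagonal entries were below the threshold, the rescaled
          bump would contradict the regularity estimate: the bracket is less than
          \<open>\<tau>\<close>.\<close>
        have "(Q + 1) * \<tau> \<le> Q * (4 * (\<tau> / 16 + \<epsilon>) + B * h\<^sup>2)"
          using average_nondegenerate[OF sym pdf \<phi>(1,2,4,5) T d] unfolding N\<tau> Q_def .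
        also have "\<dots> \<le> Q * \<tau>" using \<epsilon>(2) Bh \<tau> by (intro mult_left_mono[OF _ Q]) simp
        finally show False using \<tau> by (simp add: algebra_simps)
      qed
      interpret stable_problem \<Omega> M a c B k Cs
      proof unfold_locales
        show "Cs \<ge> 0" by (simp add: Cs_def)
        show "\<exists>v\<in>Xh M k. (pw_L2_norm M q)\<^sup>2 / 2 \<le> bh M a c v q \<and> sh \<Omega> M v v \<le> Cs * (pw_L2_norm M q)\<^sup>2"
          if "q \<in> Mh M k" for q
          unfolding Cs_def by (rule inf_sup[OF k C nondeg lift small that])
        show "v = (\<lambda>T x. 0)" if "v \<in> Xh M k" "sh \<Omega> M v v = 0" "\<And>q. q \<in> Mh M k \<Longrightarrow> bh M a c v q = 0" for v
          by (rule kernel_trivial[OF Ci inv contr that])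
      qed
      show ?thesis using well_posed by blast
    qed
    show "\<exists>C. \<forall>M\<in>\<M>. meshsize M < min h (min Ha Hc) \<longrightarrow>
           (\<forall>f. L2_on \<Omega> f \<longrightarrow>
              (\<exists>!(uh, lh). pd_dg_solution \<Omega> M k a c f uh lh) \<and>
              (\<forall>uh lh. pd_dg_solution \<Omega> M k a c f uh lh \<longrightarrow>
                 star_norm \<Omega> M k a c uh + pw_L2_norm M lh \<le> C * L2_norm_on \<Omega> f))"
      by (intro exI[of _ "1 + 8 * Cs"] ballI impI wp)
  qed
qed

end
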